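(* Let $M$ be a real $d\times d$ dilation matrix, $d<p\le\infty$, $p\ge2$, $1/p+1/q=1$, $N\in\mathbb{Z}_+$. Let $h$ be a positive function on $(0,\infty)$ and $w$ a probability density on $(0,\infty)$ such that $$\int_0^\infty w(u)\left(1+h^{N+1}(u)\right)du<\infty.$$ Let $L$ be the differential operator $$Lf=\sum_{[\beta]<N+1}a_\beta D^\beta f,\qquad a_\beta=\int_0^\infty\frac{w(u)}{\beta!\,V_{h(u)}}\left(\int_{B_{h(u)}}t^\beta\,dt\right)du,$$ and let $\widetilde\varphi$ be the distribution associated with $L$. Suppose that either (i) $\varphi\in\mathcal{L}_p$ and there exists $B_\varphi>0$ such that $\sum_{k\in\mathbb{Z}^d}|\widehat\varphi(\xi+k)|^q<B_\varphi$ for all $\xi\in\mathbb{R}^d$, or (ii) $\varphi\in\mathcal{B}$ and $p\ne\infty$. Suppose also that $\widetilde\varphi$ and $\varphi$ are strictly compatible, and that $f\in L_p$, $\widehat f\in L_q$, $\widehat f(\xi)=O\left(|\xi|^{-N-1-\frac dq-\varepsilon}\right)$ as $|\xi|\to\infty$, where $\varepsilon>0$. Then for every positive number $\vartheta$ which is smaller than the modulus of every eigenvalue of $M$ there is a constant $C$, not depending on $j$, such that for all $j\in\mathbb{Z}_+$ $$\left\|f-m^{-j/2}\sum_{k\in\mathbb{Z}^d}E(f,-M^{-j}k)\,\varphi_{jk}\right\|_p\le C\,\vartheta^{-j(N+1)}.$$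
   Context: A dilation matrix is a real $d\times d$ matrix all of whose eigenvalues are bigger than $1$ in modulus; $m=|\det M|$. $L_p=L_p(\mathbb{R}^d)$, $\mathbb{T}^d=[-\frac12,\frac12]^d$, $[\beta]=\beta_1+\dots+\beta_d$ for $\beta\in\mathbb{Z}_+^d$, $\widehat f(\xi)=\int_{\mathbb{R}^d}f(x)e^{-2\pi i(x,\xi)}\,dx$, $\varphi_{jk}(x)=m^{j/2}\varphi(M^jx+k)$. $B_r=\{x\in\mathbb{R}^d:|x|\le r\}$ and $V_r$ is the volume of $B_r$. For $y\in\mathbb{R}^d$ of the form $M^{-j}k$, $k\in\mathbb{Z}^d$, $$E(f,y)=\int_0^\infty w(u)\,\frac{m^j}{V_{h(u)}}\left(\int_{M^{-j}B_{h(u)}}f(y+t)\,dt\right)du$$ (this quantity depends on the level $j$ through the averaging set $M^{-j}B_{h(u)}$). $\mathcal{L}_p$ is the set of $\varphi\in L_p$ with $\|\varphi\|_{\mathcal{L}_p}:=\left\|\sum_{k\in\mathbb{Z}^d}|\varphi(\cdot+k)|\right\|_{L_p(\mathbb{T}^d)}<\infty$. $\mathcal{B}=\mathcal{B}(\mathbb{R}^d)$ is the class of functions $\varphi(x)=\int_{\mathbb{R}^d}\theta(\xi)e^{2\pi i(x,\xi)}\,d\xi$, where $\theta$ is supported on a parallelepiped $S=[a_1,b_1]\times\dots\times[a_d,b_d]$ and $\theta|_S\in C^d(S)$ (so $\widehat\varphi=\theta$). The distribution associated with $L=\sum_{[\beta]\le N}a_\beta D^\beta$ is $\widetilde\varphi=\sum_{[\beta]\le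 N}\overline{a_\beta}(-1)^{[\beta]}D^\beta\delta$ ($\delta$ the Dirac delta); thus $\widehat{\widetilde\varphi}(\xi)=\sum_{[\beta]\le N}\overline{a_\beta}(-2\pi i\xi)^\beta$. A tempered distribution $\widetilde\varphi$ and a function $\varphi$ are strictly compatible if there is $\delta\in(0,1/2)$ such that $\overline{\widehat\varphi(\xi)}\,\widehat{\widetilde\varphi}(\xi)=1$ for a.e. $\xi$ with $|\xi|<\delta$, and $\widehat\varphi(\xi)=0$ for a.e. $\xi$ with $|l-\xi|<\delta$, for all $l\in\mathbb{Z}^d\setminus\{0\}$. *)

theory Defs
  imports "HOL-Analysis.Analysis" "HOL-Probability.Essential_Supremum"
    "HOL-Library.Landau_Symbols"
begin

section \<open>Lebesgue spaces\<close>

definition Lp_space :: "'a measure \<Rightarrow> ennreal \<Rightarrow> ('a \<Rightarrow> 'b::euclidean_space) set" where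
  "Lp_space M p = {f \<in> borel_measurable M.
     if p = \<infinity> then (\<exists>C. AE x in M. norm (f x) \<le> C)
     else integrable M (\<lambda>x. norm (f x) powr enn2real p)}"

text \<open>The norm is real-valued; it is only meaningful for members of \<^const>\<open>Lp_space\<close>.\<close>

definition Lp_norm :: "'a measure \<Rightarrow> ennreal \<Rightarrow> ('a \<Rightarrow> 'b::euclidean_space) \<Rightarrow> real" where
  "Lp_norm M p f =
     (if p = \<infinity> then enn2real (esssup M (\<lambda>x. ennreal (norm (f x))))
      else (LINT x|M. norm (f x) powr enn2real p) powr (1 / enn2real p))"


section \<open>Matrices and lattice points\<close>

definition int_vec :: "int ^ 'n \<Rightarrow> real ^ 'n" where
  "int_vec k = (\<chi> i. of_int (k $ i))"

text \<open>The operation \<open>*\<close>, and hence \<open>^\<close>, is componentwise on vectors, so matrix powers are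
  iterated with \<open>**\<close>.\<close>

definition mat_pow :: "real ^ 'n ^ 'n \<Rightarrow> nat \<Rightarrow> real ^ 'n ^ 'n" where
  "mat_pow M j = (((**) M) ^^ j) (mat 1)"

definition is_eigenvalue :: "real ^ 'n ^ 'n \<Rightarrow> complex \<Rightarrow> bool" where
  "is_eigenvalue M z \<longleftrightarrow>
     (\<exists>v :: complex ^ 'n. v \<noteq> 0 \<and> (\<chi> i j. complex_of_real (M $ i $ j)) *v v = z *s v)"

definition dilation_matrix :: "real ^ 'n ^ 'n \<Rightarrow> bool" where
  "dilation_matrix M \<longleftrightarrow> (\<forall>z. is_eigenvalue M z \<longrightarrow> cmod z > 1)"


section \<open>Multi-indices and partial derivatives\<close>

definition mi_abs :: "('n::finite \<Rightarrow> nat) \<Rightarrow> nat" where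
  "mi_abs \<beta> = (\<Sum>i\<in>UNIV. \<beta> i)"

definition mi_fact :: "('n::finite \<Rightarrow> nat) \<Rightarrow> real" where
  "mi_fact \<beta> = (\<Prod>i\<in>UNIV. fact (\<beta> i))"

definition mi_pow :: "real ^ 'n \<Rightarrow> ('n \<Rightarrow> nat) \<Rightarrow> real" where
  "mi_pow t \<beta> = (\<Prod>i\<in>UNIV. (t $ i) ^ \<beta> i)"

definition partial_deriv :: "'n \<Rightarrow> (real ^ 'n \<Rightarrow> complex) \<Rightarrow> real ^ 'n \<Rightarrow> complex" where
  "partial_deriv i f x = frechet_derivative f (at x) (axis i 1)"

primrec iter_partial :: "'n list \<Rightarrow> (real ^ 'n \<Rightarrow> complex) \<Rightarrow> real ^ 'n \<Rightarrow> complex" where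
  "iter_partial [] f = f"
| "iter_partial (i # is) f = partial_deriv i (iter_partial is f)"

text \<open>\<open>D\<^sup>\<beta>\<close>: differentiate \<open>\<beta> i\<close> times in the \<open>i\<close>-th coordinate. The index type carries no
  canonical order, so some order of differentiation is chosen; it is used for smooth functions
  only, where the order is immaterial.\<close>

definition mi_deriv :: "('n \<Rightarrow> nat) \<Rightarrow> (real ^ 'n \<Rightarrow> complex) \<Rightarrow> real ^ 'n \<Rightarrow> complex" where
  "mi_deriv \<beta> f = iter_partial (SOME is. \<forall>i. count_list is i = \<beta> i) f"

text \<open>\<open>C_on k S f\<close>: on \<open>S\<close> all partial derivatives of \<open>f\<close> of order at most \<open>k\<close> exist and are
  continuous. They are taken within \<open>S\<close>, so they are one-sided on the boundary of a box.\<close>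

primrec C_on :: "nat \<Rightarrow> (real ^ 'n) set \<Rightarrow> (real ^ 'n \<Rightarrow> complex) \<Rightarrow> bool" where
  "C_on 0 S f \<longleftrightarrow> continuous_on S f"
| "C_on (Suc k) S f \<longleftrightarrow> continuous_on S f \<and>
     (\<forall>i. \<exists>g. C_on k S g \<and>
        (\<forall>x\<in>S. ((\<lambda>t. f (x + t *\<^sub>R axis i 1)) has_vector_derivative g x)
                   (at 0 within {t. x + t *\<^sub>R axis i 1 \<in> S})))"


section \<open>Fourier transform and tempered distributions\<close>

definition fourier :: "(real ^ 'n \<Rightarrow> complex) \<Rightarrow> real ^ 'n \<Rightarrow> complex" where
  "fourier f \<xi> = (LINT x|lebesgue. f x * cis (- 2 * pi * (x \<bullet> \<xi>)))"

definition schwartz :: "(real ^ 'n \<Rightarrow> complex) set" where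
  "schwartz = {\<psi>. \<forall>is. (\<forall>x. iter_partial is \<psi> differentiable (at x)) \<and>
                       (\<forall>n. bounded (range (\<lambda>x. norm x ^ n *\<^sub>R iter_partial is \<psi> x)))}"

text \<open>A tempered distribution is given by its values on \<^const>\<open>schwartz\<close>; the pairing is
  bilinear (no complex conjugation).\<close>

type_synonym 'n distribution = "(real ^ 'n \<Rightarrow> complex) \<Rightarrow> complex"

definition dist_of_fun :: "(real ^ 'n \<Rightarrow> complex) \<Rightarrow> 'n distribution" where
  "dist_of_fun f \<psi> = (LINT x|lebesgue. f x * \<psi> x)"

definition dist_delta :: "'n::finite distribution" where
  "dist_delta \<psi> = \<psi> 0"

definition dist_deriv :: "('n::finite \<Rightarrow> nat) \<Rightarrow> 'n distribution \<Rightarrow> 'n distribution" where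
  "dist_deriv \<beta> T \<psi> = (- 1) ^ mi_abs \<beta> * T (mi_deriv \<beta> \<psi>)"

definition dist_fourier :: "'n::finite distribution \<Rightarrow> 'n distribution" where
  "dist_fourier T \<psi> = T (fourier \<psi>)"

definition dist_is_fun :: "'n::finite distribution \<Rightarrow> (real ^ 'n \<Rightarrow> complex) \<Rightarrow> bool" where
  "dist_is_fun T g \<longleftrightarrow>
     (\<forall>\<psi>\<in>schwartz. integrable lebesgue (\<lambda>x. g x * \<psi> x) \<and> T \<psi> = dist_of_fun g \<psi>)"

text \<open>\<open>g\<close> represents the distributional Fourier transform of the function \<open>f\<close>, which determines
  \<open>g\<close> up to null sets.\<close>

definition has_fourier :: "(real ^ 'n \<Rightarrow> complex) \<Rightarrow> (real ^ 'n \<Rightarrow> complex) \<Rightarrow> bool" where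
  "has_fourier f g \<longleftrightarrow> dist_is_fun (dist_fourier (dist_of_fun f)) g"

definition strictly_compatible :: "'n::finite distribution \<Rightarrow> (real ^ 'n \<Rightarrow> complex) \<Rightarrow> bool" where
  "strictly_compatible T \<phi> \<longleftrightarrow>
     (\<exists>That phihat. dist_is_fun (dist_fourier T) That \<and> has_fourier \<phi> phihat \<and>
       (\<exists>\<delta>. 0 < \<delta> \<and> \<delta> < 1 / 2 \<and>
         (AE \<xi> in lebesgue. norm \<xi> < \<delta> \<longrightarrow> cnj (phihat \<xi>) * That \<xi> = 1) \<and>
         (\<forall>l. l \<noteq> 0 \<longrightarrow> (AE \<xi> in lebesgue. norm (int_vec l - \<xi>) < \<delta> \<longrightarrow> phihat \<xi> = 0))))"

text \<open>The distribution associated with the differential operator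
  \<open>\<Sum>\<^bsub>[\<beta>] \<le> N\<^esub> a\<^sub>\<beta> D\<^sup>\<beta>\<close>.\<close>

definition assoc_dist :: "nat \<Rightarrow> (('n::finite \<Rightarrow> nat) \<Rightarrow> complex) \<Rightarrow> 'n distribution" where
  "assoc_dist N a \<psi> =
     (\<Sum>\<beta> | mi_abs \<beta> \<le> N. cnj (a \<beta>) * (- 1) ^ mi_abs \<beta> * dist_deriv \<beta> dist_delta \<psi>)"


section \<open>Classes of generating functions\<close>

text \<open>Membership requires finiteness of the norm: the periodization
  \<open>\<Sum>\<^bsub>k\<^esub> \<bar>\<phi>(\<sqdot> + k)\<bar>\<close> must be finite almost everywhere on the unit cube and lie in \<open>L\<^sub>p\<close> there.\<close>

definition script_Lp :: "ennreal \<Rightarrow> (real ^ 'n \<Rightarrow> complex) set" where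
  "script_Lp p = {\<phi> \<in> Lp_space lebesgue p.
     let T = lebesgue_on (cbox (\<chi> i. - 1 / 2) (\<chi> i. 1 / 2)) in
       (AE x in T. (\<lambda>k. cmod (\<phi> (x + int_vec k))) summable_on UNIV) \<and>
       (\<lambda>x. \<Sum>\<^sub>\<infinity>k. cmod (\<phi> (x + int_vec k))) \<in> Lp_space T p}"

definition class_B :: "(real ^ 'n \<Rightarrow> complex) set" where
  "class_B = {\<phi>. \<exists>\<theta> a b. (\<forall>i. a $ i < b $ i) \<and> (\<forall>\<xi>. \<xi> \<notin> cbox a b \<longrightarrow> \<theta> \<xi> = 0) \<and>
     C_on CARD('n) (cbox a b) \<theta> \<and>
     (\<forall>x. \<phi> x = (LINT \<xi>|lebesgue. \<theta> \<xi> * cis (2 * pi * (x \<bullet> \<xi>))))}"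


section \<open>Quasi-projection operators with averaged sampling\<close>

definition ball_vol :: "'n::finite itself \<Rightarrow> real \<Rightarrow> real" where
  "ball_vol _ r = measure lebesgue (cball (0 :: real ^ 'n) r)"

text \<open>The averages of \<open>sample_avg\<close> below expand formally as \<open>\<Sum>\<^bsub>\<beta>\<^esub> a\<^sub>\<beta> D\<^sup>\<beta>f(y)\<close> at level \<open>0\<close>, with
  \<open>a\<^sub>\<beta>\<close> given by \<open>op_coeff w h \<beta>\<close>.\<close>

definition op_coeff :: "(real \<Rightarrow> real) \<Rightarrow> (real \<Rightarrow> real) \<Rightarrow> ('n::finite \<Rightarrow> nat) \<Rightarrow> real" where
  "op_coeff w h \<beta> =
     (LINT u:{0<..}|lebesgue. w u / (mi_fact \<beta> * ball_vol TYPE('n) (h u)) *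
        (LINT t:cball 0 (h u)|lebesgue. mi_pow t \<beta>))"

text \<open>\<open>sample_avg M w h j f y\<close> is \<open>E(f,y)\<close> at level \<open>j\<close>.\<close>

definition sample_avg ::
  "real ^ 'n ^ 'n \<Rightarrow> (real \<Rightarrow> real) \<Rightarrow> (real \<Rightarrow> real) \<Rightarrow> nat \<Rightarrow> (real ^ 'n \<Rightarrow> complex) \<Rightarrow> real ^ 'n \<Rightarrow> complex"
where
  "sample_avg M w h j f y =
     (LINT u:{0<..}|lebesgue.
        complex_of_real (w u * (\<bar>det M\<bar> ^ j / ball_vol TYPE('n) (h u))) *
        (LINT t:((*v) (mat_pow (matrix_inv M) j) ` cball 0 (h u))|lebesgue. f (y + t)))"

definition scaled_shift ::
  "real ^ 'n ^ 'n \<Rightarrow> (real ^ 'n \<Rightarrow> complex) \<Rightarrow> nat \<Rightarrow> int ^ 'n \<Rightarrow> real ^ 'n \<Rightarrow> complex"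
where
  "scaled_shift M \<phi> j k x =
     of_real (\<bar>det M\<bar> powr (real j / 2)) * \<phi> (mat_pow M j *v x + int_vec k)"

definition quasi_proj_term ::
  "real ^ 'n ^ 'n \<Rightarrow> (real \<Rightarrow> real) \<Rightarrow> (real \<Rightarrow> real) \<Rightarrow> (real ^ 'n \<Rightarrow> complex) \<Rightarrow>
   (real ^ 'n \<Rightarrow> complex) \<Rightarrow> nat \<Rightarrow> real ^ 'n \<Rightarrow> int ^ 'n \<Rightarrow> complex"
where
  "quasi_proj_term M w h f \<phi> j x k =
     sample_avg M w h j f (- (mat_pow (matrix_inv M) j *v int_vec k)) * scaled_shift M \<phi> j k x"

definition quasi_proj ::
  "real ^ 'n ^ 'n \<Rightarrow> (real \<Rightarrow> real) \<Rightarrow> (real \<Rightarrow> real) \<Rightarrow> (real ^ 'n \<Rightarrow> complex) \<Rightarrow>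
   (real ^ 'n \<Rightarrow> complex) \<Rightarrow> nat \<Rightarrow> real ^ 'n \<Rightarrow> complex"
where
  "quasi_proj M w h f \<phi> j x =
     of_real (\<bar>det M\<bar> powr (- (real j / 2))) * (\<Sum>\<^sub>\<infinity>k. quasi_proj_term M w h f \<phi> j x k)"

end

(* After a rescaling by M^j only level 0 is left: with g(eta) = m^j fhat(M^jT eta) and mu the
characteristic function of the averaging measure nu, the samples E(f, -M^-j k) are the Fourier
coefficients of g mu.  Split g at the radius delta of strict compatibility.  Frequencies below delta
are reproduced up to the factor 1 - mu phihat, which is O(|eta|^(N+1)) because the symbol of L is the
Taylor polynomial of mu and phihat inverts it near 0; Hausdorff-Young turns this into an L_p bound.
Frequencies above delta are small in the weighted L_q norm, and the synthesis operator is bounded on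
them because (N+1) p > d makes the weight |eta|^-(N+1) p-summable over lattice cosets.  In both cases
the synthesis operator is analysed by Poisson summation with Fejer means.  Rescaling back costs
|M^-jT|^(N+1) <= C theta^(-j(N+1)), by Cauchy's estimate for the resolvent of M. *)

theory Submission
 imports Defs "HOL-Probability.Probability" "HOL-Complex_Analysis.Complex_Analysis"
begin

text \<open>The samples are only in l_p, and a generator in \<open>class_B\<close> is only known to
  decay like the product of the 1 / (1 + |x_i|), so it need not be integrable. The error estimate
  therefore uses a generator through two properties alone, collected in \<open>synthesis\<close>:
  boundedness from the periodized L_q norm \<open>PN_le\<close> to L_p, and reproduction of spectra
  inside the ball of radius \<delta>. For \<open>script_Lp\<close> boundedness is Young's inequality
  on each lattice coset; for \<open>class_B\<close> the synthesized sum is itself an inverse Fourier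
  transform, and Hausdorff-Young on space applies. The powers of the determinant cost nothing:
  passing to g multiplies weighted L_q norms by |det M^j|^(1 - 1/q), returning multiplies L_p norms
  by the inverse, because 1 - 1/q = 1/p. The hypotheses speak of Lebesgue measure and of
  distributional transforms. The estimates run with Borel representatives, and transforms are
  identified by testing against modulated Gaussians, after multiplication by a Gaussian has made all
  functions integrable.\<close>

no_notation fps_nth (infixl "$" 75)

section \<open>Linear substitutions\<close>

text \<open>The library proves the scaling of Lebesgue measure under linear maps only for well-ordered
  index types; every finite index type has a well-ordered copy.\<close>

typedef 'a wo_copy = "UNIV :: 'a set" ..

text \<open>The order of the natural numbers is pulled back along the injection
  \<open>to_nat\<close>; induction on its values gives the well-order axiom.\<close>

instantiation wo_copy :: (finite) wellorder
begin
definition "x <= y \<longleftrightarrow> to_nat (Rep_wo_copy x) <= to_nat (Rep_wo_copy y)"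
definition "x < y \<longleftrightarrow> to_nat (Rep_wo_copy x) < to_nat (Rep_wo_copy y)"
instance
proof
 fix P :: "'a wo_copy => bool" and a
 assume *: "\<And>x. (\<And>y. y < x ==> P y) ==> P x"
 show "P a"
  by (induction a rule: measure_induct_rule[of "%x. to_nat (Rep_wo_copy x)"])
    (rule *, simp add: less_wo_copy_def)
qed (auto simp: less_eq_wo_copy_def less_wo_copy_def Rep_wo_copy_inject)
end

instance wo_copy :: (finite) finite
proof
 have "(UNIV :: 'a wo_copy set) = range Abs_wo_copy"
  by (metis Rep_wo_copy_inverse UNIV_eq_I rangeI)
 moreover have "finite (range (Abs_wo_copy :: 'a => _))" by (intro finite_imageI finite)
 ultimately show "finite (UNIV :: 'a wo_copy set)" by argo
qed

definition wo_vec :: "real ^ 'n => real ^ 'n::finite wo_copy" where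
 "wo_vec x = (\<chi> i. x $ Rep_wo_copy i)"

definition wo_mat :: "real ^ 'n ^ 'n => real ^ ('n::finite wo_copy) ^ 'n wo_copy" where
 "wo_mat A = (\<chi> i j. A $ Rep_wo_copy i $ Rep_wo_copy j)"

lemma bij_Rep_wo_copy: "bij Rep_wo_copy"
 by (metis Abs_wo_copy_inverse Rep_wo_copy_inject UNIV_I bijI')

lemma bij_Abs_wo_copy: "bij Abs_wo_copy"
 by (metis Abs_wo_copy_inject Rep_wo_copy_inverse UNIV_I bijI')

lemma all_Rep_wo_copy: "(\<forall>i. P i) \<longleftrightarrow> (\<forall>i. P (Abs_wo_copy i))"
 by (metis Rep_wo_copy_inverse)

lemma Rep_Abs_wo_copy [simp]: "Rep_wo_copy (Abs_wo_copy i) = i"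
 by (simp add: Abs_wo_copy_inverse)

lemma wo_vec_mult: "wo_vec (A *v x) = wo_mat A *v wo_vec x"
 unfolding wo_vec_def wo_mat_def matrix_vector_mult_def
 by (simp add: vec_eq_iff, intro allI sum.reindex_bij_betw[symmetric] bij_Rep_wo_copy)

text \<open>Relabelling the indices conjugates every permutation in the Leibniz formula;
  \<open>map_permutation\<close> is a bijection between the two permutation groups that preserves
  signs, and the products merely change their index.\<close>

lemma det_wo_mat: "det (wo_mat A) = det (A :: real ^ 'n ^ 'n::finite)"
proof -
 let ?R = "Rep_wo_copy :: 'n wo_copy => 'n"
 let ?F = "map_permutation UNIV ?R"
 have bij: "bij_betw ?R UNIV UNIV" using bij_Rep_wo_copy .
 have inj: "inj ?R" using bij by (simp add: bij_betw_def)
 have ap: "?F p (?R i) = ?R (p i)" for p i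
  by (rule map_permutation_apply) (use inj in auto)
 have bF: "bij_betw ?F {p. p permutes UNIV} {p. p permutes UNIV}"
  unfolding bij_betw_def
 proof
  show "inj_on ?F {p. p permutes UNIV}"
   by (intro inj_onI ext) (metis Rep_wo_copy_inject ap)
  show "?F ` {p. p permutes UNIV} = {p. p permutes UNIV}"
  proof safe
   fix p :: "'n wo_copy => 'n wo_copy" assume "p permutes UNIV"
   then show "?F p permutes UNIV" by (rule map_permutation_permutes[OF bij])
  next
   fix q :: "'n => 'n" assume q: "q permutes UNIV"
   have p: "map_permutation UNIV Abs_wo_copy q permutes UNIV"
    using bij_Abs_wo_copy q by (rule map_permutation_permutes)
   have "?F (map_permutation UNIV Abs_wo_copy q) = q"
    by (rule map_permutation_compose_inv[OF bij_Abs_wo_copy q]) (simp_all add: Abs_wo_copy_inverse)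
   with p show "q \<in> ?F ` {p. p permutes UNIV}" by (metis imageI mem_Collect_eq)
  qed
 qed
 have "det A = (\<Sum>p | p permutes UNIV. of_int (sign (?F p)) * (\<Prod>i\<in>UNIV. A $ i $ ?F p i))"
  unfolding det_def by (rule sum.reindex_bij_betw[OF bF, symmetric])
 also have "... = (\<Sum>p | p permutes UNIV. of_int (sign p) * (\<Prod>i\<in>UNIV. A $ ?R i $ ?R (p i)))"
 proof (rule sum.cong[OF refl])
  fix p :: "'n wo_copy => 'n wo_copy" assume "p \<in> {p. p permutes UNIV}"
  then have p: "p permutes UNIV" by simp
  have "sign (?F p) = sign p"
   by (rule sign_map_permutation) (use inj p in auto)
  moreover have "(\<Prod>i\<in>UNIV. A $ i $ ?F p i) = (\<Prod>i\<in>UNIV. A $ ?R i $ ?F p (?R i))"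
   by (rule prod.reindex_bij_betw[OF bij, symmetric])
  ultimately show "of_int (sign (?F p)) * (\<Prod>i\<in>UNIV. A $ i $ ?F p i) = of_int (sign p) * (\<Prod>i\<in>UNIV. A $ ?R i $ ?R (p i))"
   by (simp add: ap)
 qed
 finally show ?thesis by (simp add: det_def wo_mat_def)
qed

lemma wo_vec_borel_measurable [measurable]: "wo_vec \<in> borel \<rightarrow>\<^sub>M borel"
 unfolding wo_vec_def
 by (intro borel_measurable_continuous_onI continuous_intros)

lemma prod_Basis_vec: "(\<Prod>b\<in>(Basis :: (real ^ 'n) set). g b) = (\<Prod>i\<in>UNIV. g (axis i 1))"
proof -
 have B: "(Basis :: (real ^ 'n) set) = (%i. axis i 1) ` UNIV" by (auto simp: Basis_vec_def)
 have "inj (%i. axis i 1 :: real ^ 'n)" by (auto simp: inj_on_def axis_eq_axis)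
 then show ?thesis unfolding B by (subst prod.reindex) (simp_all add: o_def)
qed

text \<open>Lebesgue measure is determined by the volumes of boxes, and relabelling coordinates
  carries a box to a box with the same side lengths.\<close>

lemma distr_wo_vec: "distr lborel borel wo_vec = (lborel :: (real ^ 'n::finite wo_copy) measure)"
proof (rule lborel_eqI[symmetric])
 fix l u :: "real ^ 'n wo_copy" assume lu: "\<And>b. b \<in> Basis ==> l \<bullet> b <= u \<bullet> b"
 have lu': "l $ i <= u $ i" for i
  using lu[of "axis i 1"] by (auto simp: inner_axis Basis_vec_def)
 let ?v = "%l::real ^ 'n wo_copy. (\<chi> i. l $ Abs_wo_copy i) :: real ^ 'n"
 have "emeasure (distr lborel borel wo_vec) (box l u) = emeasure lborel (wo_vec -` box l u :: (real ^ 'n) set)"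
  by (simp add: emeasure_distr)
 also have "wo_vec -` box l u = (box (?v l) (?v u) :: (real ^ 'n) set)"
  unfolding wo_vec_def set_eq_iff vimage_def mem_Collect_eq mem_box_cart vec_lambda_beta
  by (subst all_Rep_wo_copy) simp
 also have "emeasure lborel ... = (\<Prod>i\<in>UNIV. (u - l) $ Abs_wo_copy i)"
 proof -
  have "emeasure lborel (box (?v l) (?v u)) = ennreal (\<Prod>b\<in>Basis. (?v u - ?v l) \<bullet> b)"
   by (rule emeasure_lborel_box) (auto simp: Basis_vec_def inner_axis lu')
  also have "(\<Prod>b\<in>Basis. (?v u - ?v l) \<bullet> b) = (\<Prod>i\<in>UNIV. (u - l) $ Abs_wo_copy i)"
   unfolding prod_Basis_vec by (simp add: inner_axis)
  finally show ?thesis .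
 qed
 also have "(\<Prod>i\<in>UNIV. (u - l) $ Abs_wo_copy i) = (\<Prod>i\<in>UNIV. (u - l) $ i)"
  by (rule prod.reindex_bij_betw[OF bij_Abs_wo_copy])
 also have "... = (\<Prod>b\<in>Basis. (u - l) \<bullet> b)"
  unfolding prod_Basis_vec by (simp add: inner_axis)
 finally show "emeasure (distr lborel borel wo_vec) (box l u) = ennreal (\<Prod>b\<in>Basis. (u - l) \<bullet> b)" .
qed simp

lemma matrix_vector_mult_borel_measurable [measurable]:
 "(*v) (A :: real ^ 'n ^ 'm) \<in> borel \<rightarrow>\<^sub>M borel"
 by (intro borel_measurable_continuous_onI matrix_vector_mult_linear_continuous_on)

lemma matrix_inv_mult:
 assumes "invertible (A :: real ^ 'n ^ 'n)"
 shows "matrix_inv A ** A = mat 1" "A ** matrix_inv A = mat 1"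
 using assms someI_ex[of "%A'. A ** A' = mat 1 \<and> A' ** A = mat 1"]
 by (auto simp: matrix_inv_def invertible_def)

lemma matrix_inv_mult_vec [simp]:
 assumes "det (A :: real ^ 'n ^ 'n) ~= 0"
 shows "matrix_inv A *v (A *v x) = x" "A *v (matrix_inv A *v x) = x"
proof -
 have inv: "invertible A" using assms by (simp add: invertible_det_nz)
 show "matrix_inv A *v (A *v x) = x" "A *v (matrix_inv A *v x) = x"
  by (simp_all add: matrix_vector_mul_assoc matrix_inv_mult[OF inv])
qed

text \<open>A preimage under \<open>A\<close> is an image under its inverse, so the image formula
  for linear maps applies. Boundedness of \<open>B\<close> supplies the finite measure which that
  formula asks for; only boxes are inserted later.\<close>

lemma emeasure_linear_vimage_wo:
 fixes A :: "real ^ 'n::{finite,wellorder} ^ 'n::{finite,wellorder}"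
 assumes A: "det A ~= 0" and B: "bounded B" "B \<in> sets borel"
 shows "emeasure lborel ((*v) A -` B) = ennreal (1 / \<bar>det A\<bar>) * emeasure lborel B"
proof -
 have inv: "invertible A" using A by (simp add: invertible_det_nz)
 let ?g = "(*v) (matrix_inv A)"
 have eq: "(*v) A -` B = ?g ` B"
  using A by (auto simp: image_iff) (metis matrix_inv_mult_vec(1))
 have B': "B \<in> lmeasurable" using B
  by (intro bounded_set_imp_lmeasurable) auto
 have "det (matrix_inv A) * det A = 1"
  using det_mul[of "matrix_inv A" A] by (simp add: matrix_inv_mult[OF inv])
 then have d: "det (matrix_inv A) = 1 / det A" using A by (simp add: field_simps)
 have m: "measure lebesgue (?g ` B) = \<bar>det (matrix_inv A)\<bar> * measure lebesgue B"
  using measure_linear_image[of ?g, OF matrix_vector_mul_linear B'] by simp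
 have g: "?g ` B \<in> lmeasurable"
  by (rule measurable_linear_image[OF matrix_vector_mul_linear B'])
 have gb: "?g ` B \<in> sets borel"
  using B(2) unfolding eq[symmetric] by (simp add: measurable_sets_borel[OF matrix_vector_mult_borel_measurable])
 have "emeasure lborel (?g ` B) = emeasure lebesgue (?g ` B)"
  using gb by simp
 also have "... = ennreal (measure lebesgue (?g ` B))"
  using g by (intro emeasure_eq_measure2)
 also have "... = ennreal (1 / \<bar>det A\<bar>) * ennreal (measure lebesgue B)"
  unfolding m d by (subst ennreal_mult[symmetric]) (auto simp: abs_divide)
 also have "ennreal (measure lebesgue B) = emeasure lborel B"
  using B B' by (subst emeasure_eq_measure2[symmetric]) auto
 finally show ?thesis by (simp add: eq)
qed

lemma lborel_distr_matrix:
 fixes A :: "real ^ 'n ^ 'n"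
 assumes A: "det A ~= 0"
 shows "distr lborel borel ((*v) A) = density lborel (%_. ennreal (1 / \<bar>det A\<bar>))" (is "?L = ?R")
proof -
 \<comment> \<open>Values on boxes identify a measure with \<open>lborel\<close>, so the
   push-forward is first multiplied by |det A| to become such a measure; the factor is divided out
   afterwards.\<close>
 have "lborel = density ?L (%_. ennreal \<bar>det A\<bar>)"
 proof (rule lborel_eqI)
  fix l u :: "real ^ 'n" assume lu: "\<And>b. b \<in> Basis ==> l \<bullet> b <= u \<bullet> b"
  have dn: "det (wo_mat A) ~= 0" using A by (simp add: det_wo_mat)
  let ?B = "box (wo_vec l) (wo_vec u)"
  have bx: "wo_vec -` ?B = box l u"
   unfolding wo_vec_def set_eq_iff vimage_def mem_Collect_eq mem_box_cart vec_lambda_beta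
   by (subst all_Rep_wo_copy) simp
  have "emeasure lborel ((*v) A -` box l u) = emeasure lborel (wo_vec -` ((*v) (wo_mat A) -` ?B))"
   by (subst bx[symmetric]) (simp add: vimage_def wo_vec_mult)
  also have "... = emeasure (distr lborel borel wo_vec) ((*v) (wo_mat A) -` ?B)"
   by (subst emeasure_distr) (auto intro: measurable_sets_borel[OF matrix_vector_mult_borel_measurable])
  also have "... = ennreal (1 / \<bar>det A\<bar>) * emeasure (distr lborel borel wo_vec) ?B"
   unfolding distr_wo_vec using dn by (subst emeasure_linear_vimage_wo) (auto simp: det_wo_mat)
  also have "emeasure (distr lborel borel wo_vec) ?B = emeasure lborel (box l u)"
   by (subst emeasure_distr) (auto simp: bx)
  finally have "emeasure ?L (box l u) = ennreal (1 / \<bar>det A\<bar>) * emeasure lborel (box l u)"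
   by (simp add: emeasure_distr)
  then have "emeasure (density ?L (%_. ennreal \<bar>det A\<bar>)) (box l u)
    = ennreal \<bar>det A\<bar> * (ennreal (1 / \<bar>det A\<bar>) * emeasure lborel (box l u))"
   by (simp add: emeasure_density nn_integral_cmult_indicator)
  also have "... = emeasure lborel (box l u)"
   using A by (simp add: mult.assoc[symmetric] ennreal_mult[symmetric])
  finally show "emeasure (density ?L (%_. ennreal \<bar>det A\<bar>)) (box l u) = ennreal (\<Prod>b\<in>Basis. (u - l) \<bullet> b)"
   using lu by simp
 qed simp
 then have "?R = density (density ?L (%_. ennreal \<bar>det A\<bar>)) (%_. ennreal (1 / \<bar>det A\<bar>))"
  by simp
 also have "... = ?L"
  using A by (subst density_density_eq) (auto simp: ennreal_mult[symmetric] density_1)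
 finally show ?thesis by simp
qed

lemma nn_integral_matrix:
 fixes A :: "real ^ 'n ^ 'n"
 assumes A: "det A ~= 0" and [measurable]: "u \<in> borel_measurable borel"
 shows "(\<integral>\<^sup>+x. u (A *v x) \<partial>lborel) = ennreal (1 / \<bar>det A\<bar>) * (\<integral>\<^sup>+x. u x \<partial>lborel)"
proof -
 have "(\<integral>\<^sup>+x. u (A *v x) \<partial>lborel) = (\<integral>\<^sup>+x. u x \<partial>distr lborel borel ((*v) A))"
  by (simp add: nn_integral_distr)
 then show ?thesis
  by (simp add: lborel_distr_matrix[OF A] nn_integral_density nn_integral_cmult)
qed

lemma integral_matrix:
 fixes A :: "real ^ 'n ^ 'n" and u :: "real ^ 'n => complex"
 assumes A: "det A ~= 0" and [measurable]: "u \<in> borel_measurable borel"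
 shows "(LINT x|lborel. u (A *v x)) = (1 / \<bar>det A\<bar>) *\<^sub>R (LINT x|lborel. u x)"
  and "integrable lborel (%x. u (A *v x)) \<longleftrightarrow> integrable lborel u"
proof -
 have "(LINT x|lborel. u (A *v x)) = (LINT x|distr lborel borel ((*v) A). u x)"
  by (simp add: integral_distr)
 then show "(LINT x|lborel. u (A *v x)) = (1 / \<bar>det A\<bar>) *\<^sub>R (LINT x|lborel. u x)"
  by (simp add: lborel_distr_matrix[OF A] integral_density)
 have "integrable lborel (%x. u (A *v x)) \<longleftrightarrow> integrable (distr lborel borel ((*v) A)) u"
  by (subst integrable_distr_eq) auto
 then show "integrable lborel (%x. u (A *v x)) \<longleftrightarrow> integrable lborel u"
  using A integrable_scaleR_right[of "\<bar>det A\<bar>" lborel "%x. (1 / \<bar>det A\<bar>) *\<^sub>R u x"]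
  by (auto simp: lborel_distr_matrix[OF A] integrable_density)
qed

lemma AE_lborel_matrix:
 fixes A :: "real ^ 'n ^ 'n"
 assumes A: "det A ~= 0" and P: "AE x in lborel. P x"
 shows "AE x in lborel. P (A *v x)"
proof -
 have "AE x in distr lborel borel ((*v) A). P x"
  using P unfolding lborel_distr_matrix[OF A] by (subst AE_density) auto
 then show ?thesis by (auto dest!: AE_distrD[rotated])
qed

section \<open>Hoelder and Hausdorff--Young inequalities\<close>

text \<open>Young's inequality for the normalized pair u / A and v / B, integrated. The bounds
  \<open>A\<close> and \<open>B\<close> stand in place of norms; when one of them is 0 the
  normalization breaks down, but then one factor vanishes almost everywhere.\<close>

lemma nn_integral_Hoelder:
 fixes u v :: "'a => real"
 assumes [measurable]: "u \<in> borel_measurable M" "v \<in> borel_measurable M"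
  and pq: "p > 1" "q > 1" "1 / p + 1 / q = 1"
  and nn: "\<And>x. u x \<ge> 0" "\<And>x. v x \<ge> 0" "A \<ge> 0" "B \<ge> 0"
  and uA: "(\<integral>\<^sup>+x. ennreal (u x powr p) \<partial>M) <= ennreal (A powr p)"
  and vB: "(\<integral>\<^sup>+x. ennreal (v x powr q) \<partial>M) <= ennreal (B powr q)"
 shows "(\<integral>\<^sup>+x. ennreal (u x * v x) \<partial>M) <= ennreal (A * B)"
proof -
 have ae0: "AE x in M. w x = 0" if [measurable]: "w \<in> borel_measurable M"
  and r: "(\<integral>\<^sup>+x. ennreal (w x powr r) \<partial>M) <= ennreal (0 powr r)" "\<And>x. w x \<ge> 0" "r > 1"
  for w :: "'a => real" and r :: real
 proof -
  have "(\<integral>\<^sup>+x. ennreal (w x powr r) \<partial>M) = 0" using r by simp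
  then have "AE x in M. ennreal (w x powr r) = 0" by (subst (asm) nn_integral_0_iff_AE) auto
  then show ?thesis by eventually_elim (use r in \<open>auto simp: ennreal_eq_0_iff powr_def split: if_splits\<close>)
 qed
 show ?thesis
 proof (cases "A = 0 \<or> B = 0")
  case True
  then have "AE x in M. u x * v x = 0"
   using ae0[of u p] ae0[of v q] uA vB nn pq by auto
  then have "(\<integral>\<^sup>+x. ennreal (u x * v x) \<partial>M) = (\<integral>\<^sup>+x. 0 \<partial>M)"
   by (intro nn_integral_cong_AE) auto
  then show ?thesis by simp
 next
  case False
  then have AB: "A > 0" "B > 0" using nn by auto
  have "u x * v x <= A * B * (1 / p / A powr p * u x powr p + 1 / q / B powr q * v x powr q)" for x
  proof -
   have "(u x / A) * (v x / B) <= (u x / A) powr p / p + (v x / B) powr q / q"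
    using pq nn by (intro Youngs_inequality) auto
   also have "... = 1 / p / A powr p * u x powr p + 1 / q / B powr q * v x powr q"
    using nn AB by (simp add: powr_divide mult.commute)
   finally show ?thesis using AB by (simp add: field_simps)
  qed
  then have "(\<integral>\<^sup>+x. ennreal (u x * v x) \<partial>M) <= (\<integral>\<^sup>+x. ennreal (A * B) *
    (ennreal (1 / p / A powr p) * ennreal (u x powr p) + ennreal (1 / q / B powr q) * ennreal (v x powr q)) \<partial>M)"
   using AB pq by (intro nn_integral_mono) (simp add: ennreal_mult[symmetric] ennreal_plus[symmetric] del: ennreal_plus)
  also have "... = ennreal (A * B) * (ennreal (1 / p / A powr p) * (\<integral>\<^sup>+x. ennreal (u x powr p) \<partial>M)
    + ennreal (1 / q / B powr q) * (\<integral>\<^sup>+x. ennreal (v x powr q) \<partial>M))"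
   by (simp add: nn_integral_cmult nn_integral_add)
  also have "... <= ennreal (A * B) * (ennreal (1 / p / A powr p) * ennreal (A powr p)
    + ennreal (1 / q / B powr q) * ennreal (B powr q))"
   by (intro mult_left_mono add_mono uA vB) auto
  also have "... = ennreal (A * B)"
   using AB pq by (simp add: ennreal_mult[symmetric] ennreal_plus[symmetric] del: ennreal_plus)
  finally show ?thesis .
 qed
qed

text \<open>The identity (p - 1) (q - 1) = 1 is the form of conjugacy that converts truncation
  heights into levels and back in the interpolation argument.\<close>

lemma conjugate_exponent:
 fixes p q :: real
 assumes "p > 1" "1 / p + 1 / q = 1"
 shows "q > 1" "(p - 1) * (q - 1) = 1"
proof -
 have q0: "q ~= 0" using assms by auto
 then have eq: "p + q = p * q" using assms by (simp add: field_simps)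
 then show 1: "(p - 1) * (q - 1) = 1" by (simp add: algebra_simps)
 then show "q > 1" using assms by (smt (verit) zero_less_mult_iff)
qed

lemma nn_integral_powr_Icc:
 assumes "a > -1" "c \<ge> (0::real)"
 shows "(\<integral>\<^sup>+x. ennreal (indicator {0..c} x * x powr a) \<partial>lborel) = ennreal (c powr (a + 1) / (a + 1))"
proof -
 have "((%x. if x \<in> {0..c} then x powr a else 0) has_integral (c powr (a + 1) / (a + 1))) UNIV"
  unfolding has_integral_restrict_UNIV by (rule has_integral_powr_from_0[OF assms])
 moreover have "(%x. if x \<in> {0..c} then x powr a else 0) = (%x. indicator {0..c} x * x powr a)"
  by (auto simp: fun_eq_iff)
 ultimately have "((%x. indicator {0..c} x * x powr a) has_integral (c powr (a + 1) / (a + 1))) UNIV"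
  by simp
 then show ?thesis by (rule nn_integral_has_integral_lborel[rotated 2]) auto
qed

text \<open>The value that the layer-cake computation in \<open>strong_bound\<close> produces. It
  blows up as p tends to 2, where the L_2 bound with constant 1 takes its place.\<close>

definition hy_const :: "real => real" where
 "hy_const p = (if p = 2 then 1 else (2 powr p * p / (p - 2)) powr (1 / p))"

lemma hy_const_nonneg: "hy_const p \<ge> 0"
 by (simp add: hy_const_def)

text \<open>Marcinkiewicz interpolation between the trivial bound \<open>L\<^sub>1 \<rightarrow> L\<^sub>\<infinity>\<close> and \<open>L\<^sub>2 \<rightarrow> L\<^sub>2\<close>: split the
 input at a height depending on the level \<open>%\<close> of the output.\<close>

locale L1_L2_kernel =
 M: sigma_finite_measure M + N: sigma_finite_measure N
 for M :: "'a measure" and N :: "'b measure" +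
 fixes K :: "'b => 'a => complex"
 assumes K_measurable [measurable]: "case_prod K \<in> borel_measurable (N \<Otimes>\<^sub>M M)"
  and K_le: "\<And>y x. norm (K y x) <= 1"
  and L2: "\<And>b. integrable M b ==>
   (\<integral>\<^sup>+y. ennreal ((cmod (LINT x|M. b x * K y x))\<^sup>2) \<partial>N) <= (\<integral>\<^sup>+x. ennreal ((cmod (b x))\<^sup>2) \<partial>M)"
begin

definition T :: "('a => complex) => 'b => complex" where
 "T b y = (LINT x|M. b x * K y x)"

lemma K_measurable' [measurable (raw)]:
 "f \<in> L \<rightarrow>\<^sub>M N ==> g \<in> L \<rightarrow>\<^sub>M M ==> (%z. K (f z) (g z)) \<in> borel_measurable L"
 using measurable_compose[OF measurable_Pair K_measurable] by simp

lemma T_measurable [measurable]: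
 assumes [measurable]: "b \<in> borel_measurable M"
 shows "T b \<in> borel_measurable N"
 unfolding T_def by measurable

lemma integrable_K: "integrable M b ==> y \<in> space N ==> integrable M (%x. b x * K y x)"
 by (rule Bochner_Integration.integrable_bound[of M b])
   (use K_le in \<open>auto simp: norm_mult intro!: mult_left_le AE_I2\<close>)

lemma T_le: "integrable M b ==> y \<in> space N ==> cmod (T b y) <= (LINT x|M. cmod (b x))"
 unfolding T_def
 by (rule order_trans[OF integral_norm_bound], rule integral_mono)
   (use K_le integrable_norm[OF integrable_K] in \<open>auto simp: norm_mult intro!: mult_left_le\<close>)

text \<open>Split b at the height s = (l / 2)^(1 - p). Above it |b| \<le> s^(1 - q) |b|^q, and s^(1
  - q) = l / 2, so the tall part changes the output by at most l / 2. Where the output is at least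
  l, the truncated part therefore contributes at least l / 2, and Chebyshev's inequality with the
  L_2 bound estimates that set.\<close>

lemma weak_bound:
 assumes b: "integrable M b" and pq: "p > 2" "1 / p + 1 / q = 1"
  and bq: "(\<integral>\<^sup>+x. ennreal (cmod (b x) powr q) \<partial>M) <= 1"
  and l: "l > 0"
 shows "(\<integral>\<^sup>+y. (if l <= cmod (T b y) then 1 else 0) \<partial>N)
  <= (\<integral>\<^sup>+x. ennreal (4 / l\<^sup>2 * (cmod (b x))\<^sup>2 * (if cmod (b x) <= (l / 2) powr (1 - p) then 1 else 0)) \<partial>M)"
proof -
 have [measurable]: "b \<in> borel_measurable M" by (rule borel_measurable_integrable[OF b])
 have q: "q > 1" "(p - 1) * (q - 1) = 1" using conjugate_exponent[of p q] pq by auto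
 define s where "s = (l / 2) powr (1 - p)"
 have s: "s > 0" using l by (simp add: s_def)
 define bs where "bs x = (if cmod (b x) <= s then b x else 0)" for x
 have [measurable]: "bs \<in> borel_measurable M" unfolding bs_def by measurable
 have ibs: "integrable M bs"
  by (rule Bochner_Integration.integrable_bound[OF b]) (auto simp: bs_def)
 have ibq: "integrable M (%x. cmod (b x) powr q)"
  using bq by (intro integrableI_nonneg) (auto simp: order_le_less_trans)
 have Ibq: "(LINT x|M. cmod (b x) powr q) <= 1"
  using bq by (subst integral_eq_nn_integral) (auto simp: enn2real_leI)
 have "(LINT x|M. cmod (b x - bs x)) <= (LINT x|M. s powr (1 - q) * cmod (b x) powr q)"
 proof (rule integral_mono)
  fix x
  show "cmod (b x - bs x) <= s powr (1 - q) * cmod (b x) powr q"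
  proof (cases "cmod (b x) <= s")
   case False
   then have "s powr (q - 1) <= cmod (b x) powr (q - 1)"
    using s q by (intro powr_mono2) auto
   then have "s powr (q - 1) * cmod (b x) <= cmod (b x) powr q"
    using False s mult_right_mono[of "s powr (q - 1)" "cmod (b x) powr (q - 1)" "cmod (b x)"]
    by (simp add: powr_diff split: if_splits)
   then have "s powr (1 - q) * (s powr (q - 1) * cmod (b x)) <= s powr (1 - q) * cmod (b x) powr q"
    by (intro mult_left_mono) auto
   moreover have "s powr (1 - q) * (s powr (q - 1) * cmod (b x)) = cmod (b x)"
    using s by (simp add: mult.assoc[symmetric] powr_add[symmetric])
   ultimately show ?thesis using False by (simp add: bs_def)
  qed (simp add: bs_def)
 qed (use b ibs ibq in auto)
 also have "... <= s powr (1 - q)" using Ibq by (simp add: mult_left_le)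
 also have "... = l / 2"
 proof -
  have "(1 - p) * (1 - q) = 1" using q by (simp add: algebra_simps)
  then show ?thesis using l by (simp add: s_def powr_powr)
 qed
 finally have diff: "(LINT x|M. cmod (b x - bs x)) <= l / 2" .
 have half: "l / 2 <= cmod (T bs y)" if y: "y \<in> space N" and ly: "l <= cmod (T b y)" for y
 proof -
  have "T b y - T bs y = T (%x. b x - bs x) y"
   unfolding T_def using y by (subst Bochner_Integration.integral_diff[symmetric])
    (auto intro!: integrable_K b ibs simp: algebra_simps)
  also have "cmod ... <= l / 2" 
   by (rule order_trans[OF T_le[OF Bochner_Integration.integrable_diff[OF b ibs] y] diff])
  finally have "cmod (T b y - T bs y) <= l / 2" .
  then show ?thesis using ly norm_triangle_ineq2[of "T b y" "T bs y"] by linarith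
 qed
 have "(\<integral>\<^sup>+y. (if l <= cmod (T b y) then 1 else 0) \<partial>N) <= (\<integral>\<^sup>+y. ennreal (4 / l\<^sup>2) * ennreal ((cmod (T bs y))\<^sup>2) \<partial>N)"
 proof (intro nn_integral_mono)
  fix y assume y: "y \<in> space N"
  show "(if l <= cmod (T b y) then 1 else 0) <= ennreal (4 / l\<^sup>2) * ennreal ((cmod (T bs y))\<^sup>2)"
  proof (cases "l <= cmod (T b y)")
   case True
   from power_mono[OF half[OF y True], of 2] l have "1 <= 4 / l\<^sup>2 * (cmod (T bs y))\<^sup>2"
    by (simp add: field_simps)
   then show ?thesis using True by (simp add: ennreal_mult[symmetric])
  qed simp
 qed
 also have "... = ennreal (4 / l\<^sup>2) * (\<integral>\<^sup>+y. ennreal ((cmod (T bs y))\<^sup>2) \<partial>N)"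
  by (simp add: nn_integral_cmult)
 also have "... <= ennreal (4 / l\<^sup>2) * (\<integral>\<^sup>+x. ennreal ((cmod (bs x))\<^sup>2) \<partial>M)"
  using L2[OF ibs] by (intro mult_left_mono) (auto simp: T_def)
 also have "... = (\<integral>\<^sup>+x. ennreal (4 / l\<^sup>2) * ennreal ((cmod (bs x))\<^sup>2) \<partial>M)"
  by (simp add: nn_integral_cmult)
 also have "... = (\<integral>\<^sup>+x. ennreal (4 / l\<^sup>2 * (cmod (b x))\<^sup>2 * (if cmod (b x) <= (l / 2) powr (1 - p) then 1 else 0)) \<partial>M)"
  by (intro nn_integral_cong) (auto simp: bs_def s_def[symmetric] ennreal_mult[symmetric])
 finally show ?thesis .
qed

text \<open>Layer-cake formula for the p-th power, the weak bound inserted at every level, and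
  Tonelli: for fixed x the level l then runs over a bounded interval, on which l^(p - 3) is
  integrable because p > 2.\<close>

lemma strong_bound:
 assumes b: "integrable M b" and pq: "p > 2" "1 / p + 1 / q = 1"
  and bq: "(\<integral>\<^sup>+x. ennreal (cmod (b x) powr q) \<partial>M) <= 1"
 shows "(\<integral>\<^sup>+y. ennreal (cmod (T b y) powr p) \<partial>N) <= ennreal (2 powr p * p / (p - 2))"
proof -
 have [measurable]: "b \<in> borel_measurable M" by (rule borel_measurable_integrable[OF b])
 have q: "q > 1" "(p - 1) * (q - 1) = 1" using conjugate_exponent[of p q] pq by auto
 have [measurable]: "T b \<in> borel_measurable N" by (rule T_measurable) measurable
 interpret NR: pair_sigma_finite N "lborel :: real measure" ..
 interpret MR: pair_sigma_finite M "lborel :: real measure" ..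
 have "(\<integral>\<^sup>+y. ennreal (cmod (T b y) powr p) \<partial>N)
   = (\<integral>\<^sup>+y. \<integral>\<^sup>+l. ennreal (p * l powr (p - 1)) * indicator {0<..} l * (if l <= cmod (T b y) then 1 else 0) \<partial>lborel \<partial>N)"
 proof (intro nn_integral_cong)
  fix y
  have "(\<integral>\<^sup>+l. ennreal (p * l powr (p - 1)) * indicator {0<..} l * (if l <= cmod (T b y) then 1 else 0) \<partial>lborel)
    = (\<integral>\<^sup>+l. ennreal p * ennreal (indicator {0..cmod (T b y)} l * l powr (p - 1)) \<partial>lborel)"
   using pq by (intro nn_integral_cong) (auto simp: ennreal_mult split: split_indicator)
  also have "... = ennreal p * ennreal (cmod (T b y) powr p / p)"
   using pq by (subst nn_integral_cmult) (simp_all add: nn_integral_powr_Icc)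
  also have "... = ennreal (cmod (T b y) powr p)"
   using pq by (simp add: ennreal_mult[symmetric])
  finally show "ennreal (cmod (T b y) powr p) = (\<integral>\<^sup>+l. ennreal (p * l powr (p - 1)) * indicator {0<..} l * (if l <= cmod (T b y) then 1 else 0) \<partial>lborel)"
   by simp
 qed
 also have "... = (\<integral>\<^sup>+l. \<integral>\<^sup>+y. ennreal (p * l powr (p - 1)) * indicator {0<..} l * (if l <= cmod (T b y) then 1 else 0) \<partial>N \<partial>lborel)"
  by (rule NR.Fubini'[symmetric]) measurable
 also have "... = (\<integral>\<^sup>+l. ennreal (p * l powr (p - 1)) * indicator {0<..} l * (\<integral>\<^sup>+y. (if l <= cmod (T b y) then 1 else 0) \<partial>N) \<partial>lborel)"
  by (intro nn_integral_cong nn_integral_cmult) measurable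
 also have "... <= (\<integral>\<^sup>+l. ennreal (p * l powr (p - 1)) * indicator {0<..} l *
   (\<integral>\<^sup>+x. ennreal (4 / l\<^sup>2 * (cmod (b x))\<^sup>2 * (if cmod (b x) <= (l / 2) powr (1 - p) then 1 else 0)) \<partial>M) \<partial>lborel)"
 proof (intro nn_integral_mono)
  fix l :: real
  show "ennreal (p * l powr (p - 1)) * indicator {0<..} l * (\<integral>\<^sup>+y. (if l <= cmod (T b y) then 1 else 0) \<partial>N)
   <= ennreal (p * l powr (p - 1)) * indicator {0<..} l *
   (\<integral>\<^sup>+x. ennreal (4 / l\<^sup>2 * (cmod (b x))\<^sup>2 * (if cmod (b x) <= (l / 2) powr (1 - p) then 1 else 0)) \<partial>M)"
   using weak_bound[OF b pq bq, of l]
   by (cases "l > 0") (auto intro!: mult_left_mono)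
 qed
 also have "... = (\<integral>\<^sup>+l. \<integral>\<^sup>+x. ennreal (p * l powr (p - 1)) * indicator {0<..} l *
   ennreal (4 / l\<^sup>2 * (cmod (b x))\<^sup>2 * (if cmod (b x) <= (l / 2) powr (1 - p) then 1 else 0)) \<partial>M \<partial>lborel)"
  by (intro nn_integral_cong nn_integral_cmult[symmetric]) measurable
 also have "... = (\<integral>\<^sup>+x. \<integral>\<^sup>+l. ennreal (p * l powr (p - 1)) * indicator {0<..} l *
   ennreal (4 / l\<^sup>2 * (cmod (b x))\<^sup>2 * (if cmod (b x) <= (l / 2) powr (1 - p) then 1 else 0)) \<partial>lborel \<partial>M)"
  by (rule MR.Fubini') measurable
 also have "... <= (\<integral>\<^sup>+x. ennreal (2 powr p * p / (p - 2)) * ennreal (cmod (b x) powr q) \<partial>M)"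
 proof (intro nn_integral_mono)
  fix x
  let ?I = "\<integral>\<^sup>+l. ennreal (p * l powr (p - 1)) * indicator {0<..} l *
   ennreal (4 / l\<^sup>2 * (cmod (b x))\<^sup>2 * (if cmod (b x) <= (l / 2) powr (1 - p) then 1 else 0)) \<partial>lborel"
  show "?I <= ennreal (2 powr p * p / (p - 2)) * ennreal (cmod (b x) powr q)"
  proof (cases "b x = 0")
   case False
   define c where "c = cmod (b x)"
   have c: "c > 0" using False by (simp add: c_def)
   \<comment> \<open>The truncation condition c \<le> (l / 2)^(1 - p) solved for l, again by (1 - p)
     (1 - q) = 1.\<close>
   define X where "X = 2 * c powr (1 - q)"
   have key: "l <= X" if l: "l > 0" "c <= (l / 2) powr (1 - p)" for l
   proof -
    have "((l / 2) powr (1 - p)) powr (1 - q) <= c powr (1 - q)"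
     using l c q by (intro powr_mono2') auto
    moreover have "(1 - p) * (1 - q) = 1" using q by (simp add: algebra_simps)
    ultimately show ?thesis using l by (simp add: powr_powr X_def)
   qed
   have "?I <= (\<integral>\<^sup>+l. ennreal (4 * p * c\<^sup>2) * ennreal (indicator {0..X} l * l powr (p - 3)) \<partial>lborel)"
   proof (intro nn_integral_mono)
    fix l :: real
    show "ennreal (p * l powr (p - 1)) * indicator {0<..} l * ennreal (4 / l\<^sup>2 * (cmod (b x))\<^sup>2 * (if cmod (b x) <= (l / 2) powr (1 - p) then 1 else 0))
     <= ennreal (4 * p * c\<^sup>2) * ennreal (indicator {0..X} l * l powr (p - 3))"
    proof (cases "l > 0 \<and> c <= (l / 2) powr (1 - p)")
     case True
     have "l powr (p - 3) = l powr ((p - 1) - 2)" by simp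
     also have "... = l powr (p - 1) / l\<^sup>2" using True by (subst powr_diff) simp
     finally have "l powr (p - 3) = l powr (p - 1) / l\<^sup>2" .
     then have "p * l powr (p - 1) * (4 / l\<^sup>2 * c\<^sup>2) = 4 * p * c\<^sup>2 * l powr (p - 3)" by simp
     then have "ennreal (p * l powr (p - 1)) * ennreal (4 / l\<^sup>2 * c\<^sup>2) = ennreal (4 * p * c\<^sup>2) * ennreal (l powr (p - 3))"
      using pq by (subst (1 2) ennreal_mult[symmetric]) auto
     then show ?thesis using True key[of l] by (simp add: c_def[symmetric])
    qed (auto simp: c_def)
   qed
   also have "... = ennreal (4 * p * c\<^sup>2) * ennreal (X powr (p - 2) / (p - 2))"
    using pq c by (subst nn_integral_cmult) (simp_all add: nn_integral_powr_Icc X_def)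
   also have "... = ennreal (2 powr p * p / (p - 2)) * ennreal (c powr q)"
   proof -
    \<comment> \<open>This identity makes the powers of c combine: c^2 X^(p - 2) is a multiple of
      c^q.\<close>
    have "(1 - q) * (p - 2) = q - 2" using q by (simp add: algebra_simps)
    then have "X powr (p - 2) = 2 powr p / 4 * (c powr q / c\<^sup>2)"
    proof -
     assume eq: "(1 - q) * (p - 2) = q - 2"
     have "X powr (p - 2) = 2 powr (p - 2) * c powr (q - 2)"
      unfolding X_def using c by (simp only: powr_mult powr_powr eq)
     also have "c powr (q - 2) = c powr q / c\<^sup>2" using c by (simp add: powr_diff)
     also have "2 powr (p - 2) = 2 powr p / 4" by (simp add: powr_diff)
     finally show ?thesis .
    qed
    then show ?thesis using c pq by (simp add: ennreal_mult[symmetric] field_simps)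
   qed
   finally show ?thesis by (simp add: c_def)
  qed simp
 qed
 also have "... = ennreal (2 powr p * p / (p - 2)) * (\<integral>\<^sup>+x. ennreal (cmod (b x) powr q) \<partial>M)"
  by (simp add: nn_integral_cmult)
 also have "... <= ennreal (2 powr p * p / (p - 2)) * 1"
  using bq by (intro mult_left_mono) auto
 finally show ?thesis by simp
qed

text \<open>Homogeneity reduces to A = 1, hence the separate case A = 0. Integrability of b is
  assumed besides the L_q bound, so that the transform is an absolutely convergent integral.\<close>

theorem hausdorff_young:
 assumes b: "integrable M b" and pq: "p \<ge> 2" "1 / p + 1 / q = 1" and A: "A \<ge> 0"
  and bq: "(\<integral>\<^sup>+x. ennreal (cmod (b x) powr q) \<partial>M) <= ennreal (A powr q)"
 shows "(\<integral>\<^sup>+y. ennreal (cmod (T b y) powr p) \<partial>N) <= ennreal ((hy_const p * A) powr p)"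
proof (cases "A = 0")
 have [measurable]: "b \<in> borel_measurable M" by (rule borel_measurable_integrable[OF b])
 have q: "q > 1" using conjugate_exponent[of p q] pq by auto
 case True
 then have "(\<integral>\<^sup>+x. ennreal (cmod (b x) powr q) \<partial>M) = 0" using bq q by simp
 then have "AE x in M. ennreal (cmod (b x) powr q) = 0"
  by (subst (asm) nn_integral_0_iff_AE) auto
 then have "AE x in M. b x = 0" by eventually_elim auto
 then have "T b y = 0" for y
  unfolding T_def by (intro integral_eq_zero_AE) auto
 then show ?thesis using pq by simp
next
 case False
 then have A: "A > 0" using A by simp
 have [measurable]: "b \<in> borel_measurable M" by (rule borel_measurable_integrable[OF b])
 show ?thesis
 proof (cases "p = 2")
  case True
  then have q: "q = 2" using pq by (auto simp: field_simps)
  show ?thesis using L2[OF b] bq True q A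
   by (simp add: T_def hy_const_def powr_numeral)
 next
  case False
  then have p: "p > 2" using pq by simp
  have "q > 1" using conjugate_exponent[of p q] pq by auto
  let ?b = "%x. b x / of_real A"
  have "(\<integral>\<^sup>+x. ennreal (cmod (?b x) powr q) \<partial>M) = (\<integral>\<^sup>+x. ennreal (1 / A powr q) * ennreal (cmod (b x) powr q) \<partial>M)"
   using A by (intro nn_integral_cong) (simp add: norm_divide powr_divide ennreal_mult[symmetric])
  also have "... = ennreal (1 / A powr q) * (\<integral>\<^sup>+x. ennreal (cmod (b x) powr q) \<partial>M)"
   by (simp add: nn_integral_cmult)
  also have "... <= ennreal (1 / A powr q) * ennreal (A powr q)"
   using bq by (intro mult_left_mono) auto
  also have "... = 1" using A by (simp add: ennreal_mult[symmetric])
  finally have 1: "(\<integral>\<^sup>+x. ennreal (cmod (?b x) powr q) \<partial>M) <= 1" .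
  have "T b y = of_real A * T ?b y" for y
   unfolding T_def using A by (subst integral_mult_right_zero[symmetric]) simp
  then have "(\<integral>\<^sup>+y. ennreal (cmod (T b y) powr p) \<partial>N) = (\<integral>\<^sup>+y. ennreal (A powr p) * ennreal (cmod (T ?b y) powr p) \<partial>N)"
   using A by (intro nn_integral_cong) (simp add: norm_mult powr_mult ennreal_mult[symmetric])
  also have "... = ennreal (A powr p) * (\<integral>\<^sup>+y. ennreal (cmod (T ?b y) powr p) \<partial>N)"
   by (rule nn_integral_cmult) measurable
  also have "... <= ennreal (A powr p) * ennreal (2 powr p * p / (p - 2))"
   using b by (intro mult_left_mono strong_bound[OF _ p pq(2) 1]) auto
  also have "... = ennreal ((hy_const p * A) powr p)"
   using A p by (simp add: ennreal_mult[symmetric] hy_const_def powr_mult powr_powr mult.commute)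
  finally show ?thesis .
 qed
qed

end

section \<open>The integer lattice and the torus\<close>

definition echar :: "real => complex" where
 "echar t = cis (2 * pi * t)"

lemma echar_0 [simp]: "echar 0 = 1"
 by (simp add: echar_def)

lemma norm_echar [simp]: "cmod (echar t) = 1"
 by (simp add: echar_def)

lemma echar_add: "echar (s + t) = echar s * echar t"
 by (simp add: echar_def distrib_left cis_mult)

lemma echar_minus: "echar (- t) = cnj (echar t)"
 by (simp add: echar_def cis_cnj)

lemma echar_diff: "echar (s - t) = echar s * cnj (echar t)"
 using echar_add[of s "- t"] by (simp add: echar_minus)

lemma echar_mult_cnj [simp]: "echar t * cnj (echar t) = 1" "cnj (echar t) * echar t = 1"
 by (simp_all add: echar_minus[symmetric] echar_add[symmetric])

lemma echar_of_int [simp]: "echar (of_int z) = 1"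
 by (simp add: echar_def cis_multiple_2pi)

lemma continuous_on_echar [continuous_intros]: "continuous_on S f ==> continuous_on S (%x. echar (f x))"
 unfolding echar_def cis_conv_exp by (intro continuous_intros)

lemma borel_measurable_echar [measurable]: "echar \<in> borel_measurable borel"
 by (intro borel_measurable_continuous_onI continuous_intros)

lemma borel_measurable_cnj [measurable]: "cnj \<in> borel_measurable borel"
 by (intro borel_measurable_continuous_onI continuous_intros)

lemma int_vec_zero [simp]: "int_vec 0 = 0"
 by (simp add: int_vec_def vec_eq_iff)

lemma int_vec_nth [simp]: "int_vec k $ i = of_int (k $ i)"
 by (simp add: int_vec_def)

lemma int_vec_add: "int_vec (k + l) = int_vec k + int_vec l"
 by (simp add: vec_eq_iff)

lemma int_vec_minus: "int_vec (- k) = - int_vec k"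
 by (simp add: vec_eq_iff)

lemma int_vec_diff: "int_vec (k - l) = int_vec k - int_vec l"
 by (simp add: vec_eq_iff)

lemma int_vec_inner: "int_vec k \<bullet> int_vec l = of_int (\<Sum>i\<in>UNIV. k $ i * l $ i)"
 by (simp add: inner_vec_def)

lemma echar_int_vec_inner [simp]: "echar (int_vec k \<bullet> int_vec l) = 1"
 unfolding int_vec_inner by (rule echar_of_int)

abbreviation lat :: "(int ^ 'n) measure" where
 "lat \<equiv> count_space UNIV"

text \<open>Half-open, so that every point of space lies in exactly one integer translate.\<close>

definition unit_cube :: "(real ^ 'n) set" where
 "unit_cube = {x. \<forall>i. - 1 / 2 <= x $ i \<and> x $ i < 1 / 2}"

lemma unit_cube_borel [measurable]: "unit_cube \<in> sets borel"
 unfolding unit_cube_def by measurable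

text \<open>The torus is Lebesgue measure cut down to the cube by a density, living on all of space
  with all Borel sets; periodic functions thus need no quotient.\<close>

definition torus :: "(real ^ 'n) measure" where
 "torus = density lborel (indicator unit_cube)"

lemma sets_torus [measurable_cong, simp]: "sets torus = sets borel"
 by (simp add: torus_def)

lemma space_torus [simp]: "space torus = UNIV"
 by (simp add: torus_def)

lemma AE_torus: "(AE x in torus. P x) \<longleftrightarrow> (AE x in lborel. x \<in> unit_cube --> P x)"
 unfolding torus_def by (subst AE_density) (auto simp: indicator_def)

lemma nn_integral_torus:
 "u \<in> borel_measurable borel ==> (\<integral>\<^sup>+x. u x \<partial>torus) = (\<integral>\<^sup>+x. indicator unit_cube x * u x \<partial>lborel)"
 unfolding torus_def by (subst nn_integral_density) auto

lemma int_vec_measurable [measurable]: "int_vec \<in> lat \<rightarrow>\<^sub>M borel"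
 by simp

definition near_int :: "real ^ 'n => int ^ 'n" where
 "near_int x = (\<chi> i. \<lfloor>x $ i + 1 / 2\<rfloor>)"

lemma near_int_iff: "x - int_vec l \<in> unit_cube \<longleftrightarrow> l = near_int x"
proof -
 have "(- 1 / 2 <= x $ i - of_int (l $ i) \<and> x $ i - of_int (l $ i) < 1 / 2) \<longleftrightarrow> l $ i = \<lfloor>x $ i + 1 / 2\<rfloor>" for i
  by (subst eq_commute[of "l $ i"]) (auto simp: floor_eq_iff)
 then show ?thesis by (simp add: unit_cube_def near_int_def vec_eq_iff)
qed

lemma nn_integral_lat_single: "(\<integral>\<^sup>+l. f l * indicator {a} l \<partial>lat) = f a"
 by (subst nn_integral_count_space'[of "{a}"]) auto

lemma sum_indicator_unit_cube: "(\<integral>\<^sup>+l. indicator unit_cube (x - int_vec l) \<partial>lat) = 1"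
proof -
 have "(%l. indicator unit_cube (x - int_vec l) :: ennreal) = (%l. 1 * indicator {near_int x} l)"
  by (auto simp: near_int_iff split: split_indicator)
 then show ?thesis by (simp only: nn_integral_lat_single)
qed

lemma sigma_finite_lat: "sigma_finite_measure (lat :: (int ^ 'n) measure)"
 by (rule sigma_finite_measure_count_space_countable) simp

lemma nn_integral_translate:
 fixes a :: "real ^ 'n"
 assumes [measurable]: "u \<in> borel_measurable borel"
 shows "(\<integral>\<^sup>+x. u (x + a) \<partial>lborel) = (\<integral>\<^sup>+x. u x \<partial>lborel)"
 by (subst (2) lborel_distr_plus[of a, symmetric]) (simp add: nn_integral_distr add.commute)

interpretation lat: sigma_finite_measure "lat :: (int ^ 'n) measure"
 by (rule sigma_finite_lat)

interpretation lat_lborel: pair_sigma_finite "lat :: (int ^ 'n) measure" "lborel :: (real ^ 'm) measure" ..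

text \<open>Translating the l-th cube back to its place turns the sum over l into an integral
  against the sum of the indicators of all cubes, which is 1.\<close>

lemma nn_integral_tile_aux:
 fixes u :: "real ^ 'n => ennreal"
 assumes [measurable]: "u \<in> borel_measurable borel"
 shows "(\<integral>\<^sup>+l. (\<integral>\<^sup>+x. indicator unit_cube x * u (x + int_vec l) \<partial>lborel) \<partial>lat) = (\<integral>\<^sup>+x. u x \<partial>lborel)"
proof -
 have "(\<integral>\<^sup>+l. (\<integral>\<^sup>+x. indicator unit_cube x * u (x + int_vec l) \<partial>lborel) \<partial>lat)
   = (\<integral>\<^sup>+l. (\<integral>\<^sup>+x. indicator unit_cube (x - int_vec l) * u x \<partial>lborel) \<partial>lat)"
 proof (rule nn_integral_cong)
  fix l :: "int ^ 'n"
  show "(\<integral>\<^sup>+x. indicator unit_cube x * u (x + int_vec l) \<partial>lborel) = (\<integral>\<^sup>+x. indicator unit_cube (x - int_vec l) * u x \<partial>lborel)"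
   by (subst nn_integral_translate[of "%x. indicator unit_cube (x - int_vec l) * u x" "int_vec l", symmetric]) simp_all
 qed
 also have "... = (\<integral>\<^sup>+x. (\<integral>\<^sup>+l. indicator unit_cube (x - int_vec l) * u x \<partial>lat) \<partial>lborel)"
  by (rule lat_lborel.Fubini'[symmetric]) measurable
 also have "... = (\<integral>\<^sup>+x. u x \<partial>lborel)"
  by (simp add: nn_integral_multc sum_indicator_unit_cube)
 finally show ?thesis .
qed

text \<open>Integer translates of the closed cube [0, 1]^d cover almost every point once.
  Integrating the sum of their indicators over the half-open cube gives its volume, while unfolding
  that sum gives the volume of [0, 1]^d.\<close>

lemma sigma_finite_torus: "prob_space (torus :: (real ^ 'n) measure)"
proof
 have "emeasure (torus :: (real ^ 'n) measure) UNIV = emeasure lborel (unit_cube :: (real ^ 'n) set)"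
  unfolding torus_def by (subst emeasure_density) auto
 also have "... = (\<integral>\<^sup>+l. (\<integral>\<^sup>+x. indicator unit_cube x * indicator (cbox (0 :: real ^ 'n) 1) (x + int_vec l) \<partial>lborel) \<partial>lat)"
 proof -
  let ?b = "cbox 0 1 :: (real ^ 'n) set"
  let ?f = "%(l :: int ^ 'n) (x :: real ^ 'n). indicator unit_cube x * indicator (cbox 0 1) (x + int_vec l) :: ennreal"
  have ae: "AE x in lborel. \<forall>(i :: 'n) (z :: int). (x :: real ^ 'n) $ i ~= of_int z"
  proof (subst AE_all_countable, intro allI)
   fix i :: 'n
   show "AE x in lborel. \<forall>z :: int. (x :: real ^ 'n) $ i ~= of_int z"
   proof (subst AE_all_countable, intro allI)
    fix z :: int
    have "negligible {x :: real ^ 'n. x $ i = of_int z}" 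
     using negligible_standard_hyperplane[of "axis i 1 :: real ^ 'n" "of_int z"] by (simp add: inner_axis)
    then have "{x :: real ^ 'n. x $ i = of_int z} \<in> null_sets lebesgue" by (simp add: negligible_iff_null_sets)
    then have "{x :: real ^ 'n. x $ i = of_int z} \<in> null_sets lborel"
     by (auto simp: null_sets_def)
    then show "AE x in lborel. (x :: real ^ 'n) $ i ~= of_int z"
     by (auto dest: AE_not_in)
   qed
  qed
  \<comment> \<open>Off the hyperplanes with an integer coordinate exactly one translate contains
    the point; on them closed cubes overlap.\<close>
  have one: "(\<integral>\<^sup>+l. ?f l x \<partial>lat) = indicator unit_cube x" if x: "\<forall>(i :: 'n) (z :: int). x $ i ~= of_int z" for x
  proof -
   have "indicator ?b (x + int_vec l) = (indicator {\<chi> i. - \<lfloor>x $ i\<rfloor>} l :: ennreal)" for l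
   proof -
    have "(0 <= x $ i + of_int (l $ i) \<and> x $ i + of_int (l $ i) <= 1) \<longleftrightarrow> l $ i = - \<lfloor>x $ i\<rfloor>" for i
    proof -
     have "x $ i ~= of_int (1 - l $ i)" using x by blast
     then have "x $ i + of_int (l $ i) ~= 1" by auto
     moreover have "l $ i = - \<lfloor>x $ i\<rfloor> \<longleftrightarrow> \<lfloor>x $ i\<rfloor> = - (l $ i)" by auto
     ultimately show ?thesis by (auto simp: floor_eq_iff)
    qed
    then show ?thesis by (auto simp: mem_box_cart vec_eq_iff split: split_indicator)
   qed
   then show ?thesis by (simp add: nn_integral_lat_single)
  qed
  have "emeasure lborel (unit_cube :: (real ^ 'n) set) = (\<integral>\<^sup>+x. indicator unit_cube (x :: real ^ 'n) \<partial>lborel)" by simp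
  also have "... = (\<integral>\<^sup>+x. (\<integral>\<^sup>+l. ?f l x \<partial>lat) \<partial>lborel)"
   by (rule nn_integral_cong_AE, rule AE_mp[OF ae], rule AE_I2, rule impI, rule one[symmetric])
  also have "... = (\<integral>\<^sup>+l. (\<integral>\<^sup>+x. ?f l x \<partial>lborel) \<partial>lat)"
   by (rule lat_lborel.Fubini') measurable
  finally show ?thesis .
 qed
 also have "... = emeasure lborel (cbox (0 :: real ^ 'n) 1)"
  by (subst nn_integral_tile_aux) auto
 also have "... = 1"
 proof -
  have "(\<Prod>b\<in>Basis. ((1 :: real ^ 'n) - 0) \<bullet> b) = 1"
   unfolding prod_Basis_vec by (simp add: inner_axis)
  then show ?thesis by (subst emeasure_lborel_cbox) (auto simp: Basis_vec_def inner_axis)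
 qed
 finally show "emeasure (torus :: (real ^ 'n) measure) (space torus) = 1" by simp
qed

interpretation torus: prob_space "torus :: (real ^ 'n) measure"
 by (rule sigma_finite_torus)

lemma measure_torus_UNIV [simp]: "measure (torus :: (real ^ 'n) measure) UNIV = 1"
 using prob_space.prob_space[OF sigma_finite_torus] by simp

interpretation torus_lat: pair_sigma_finite "torus :: (real ^ 'n) measure" "lat :: (int ^ 'm) measure" ..

lemma nn_integral_tile':
 assumes [measurable]: "u \<in> borel_measurable borel"
 shows "(\<integral>\<^sup>+l. (\<integral>\<^sup>+x. u (x + int_vec l) \<partial>torus) \<partial>lat) = (\<integral>\<^sup>+x. u x \<partial>lborel)"
 by (subst nn_integral_tile_aux[symmetric]) (auto simp: nn_integral_torus)

lemma nn_integral_tile: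
 assumes [measurable]: "u \<in> borel_measurable borel"
 shows "(\<integral>\<^sup>+x. (\<integral>\<^sup>+l. u (x + int_vec l) \<partial>lat) \<partial>torus) = (\<integral>\<^sup>+x. u x \<partial>lborel)"
 by (subst nn_integral_tile'[symmetric]) (auto intro!: torus_lat.Fubini'[symmetric])

text \<open>Unfolding as an identity of measures. In this form integrability and Bochner integrals
  over space pass to torus times lattice through the push-forward and Fubini theorems.\<close>

lemma distr_tile: "distr (torus \<Otimes>\<^sub>M lat) lborel (%(x, l). x + int_vec l) = (lborel :: (real ^ 'n) measure)"
proof (rule measure_eqI)
 fix A :: "(real ^ 'n) set" assume "A \<in> sets (distr (torus \<Otimes>\<^sub>M lat) lborel (%(x, l). x + int_vec l))"
 then have [measurable]: "A \<in> sets borel" by simp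
 have "emeasure (distr (torus \<Otimes>\<^sub>M lat) lborel (%(x, l). x + int_vec l)) A
   = (\<integral>\<^sup>+z. indicator A z \<partial>distr (torus \<Otimes>\<^sub>M lat) lborel (%(x, l). x + int_vec l))"
  by (rule nn_integral_indicator[symmetric]) simp
 also have "... = (\<integral>\<^sup>+z. indicator A (case z of (x, l) => x + int_vec l) \<partial>(torus \<Otimes>\<^sub>M lat))"
  by (rule nn_integral_distr) auto
 also have "... = (\<integral>\<^sup>+x. \<integral>\<^sup>+l. indicator A (x + int_vec l) \<partial>lat \<partial>torus)"
  by (subst lat.nn_integral_fst[symmetric]) auto
 also have "... = emeasure lborel A" by (simp add: nn_integral_tile)
 finally show "emeasure (distr (torus \<Otimes>\<^sub>M lat) lborel (%(x, l). x + int_vec l)) A = emeasure lborel A" .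
qed simp

lemma integrable_tile:
 fixes u :: "real ^ 'n => complex"
 assumes u: "integrable lborel u"
 shows "integrable (torus \<Otimes>\<^sub>M lat) (%(x, l). u (x + int_vec l))"
proof -
 have [measurable]: "u \<in> borel_measurable borel" using borel_measurable_integrable[OF u] by simp
 have "integrable (distr (torus \<Otimes>\<^sub>M lat) lborel (%(x, l). x + int_vec l)) u"
  unfolding distr_tile by (rule u)
 then show ?thesis by (subst (asm) integrable_distr_eq) (auto simp: split_beta')
qed

lemma integral_tile:
 fixes u :: "real ^ 'n => complex"
 assumes u: "integrable lborel u"
 shows "AE x in torus. integrable lat (%l. u (x + int_vec l))"
  and "integrable torus (%x. LINT l|lat. u (x + int_vec l))"
  and "(LINT x|torus. (LINT l|lat. u (x + int_vec l))) = (LINT x|lborel. u x)"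
proof -
 note i = integrable_tile[OF u]
 show "AE x in torus. integrable lat (%l. u (x + int_vec l))"
  using torus_lat.AE_integrable_fst'[OF i] by simp
 show "integrable torus (%x. LINT l|lat. u (x + int_vec l))"
  using torus_lat.integrable_fst'[OF i] by simp
 have "(LINT x|lborel. u x) = integral\<^sup>L (distr (torus \<Otimes>\<^sub>M lat) lborel (%(x, l). x + int_vec l)) u"
  unfolding distr_tile ..
 also have "... = (LINT z|(torus \<Otimes>\<^sub>M lat). u (case z of (x, l) => x + int_vec l))"
  using borel_measurable_integrable[OF u] by (intro integral_distr) auto
 also have "... = (LINT x|torus. (LINT l|lat. u (x + int_vec l)))"
  using torus_lat.integral_fst'[OF i] by (simp add: split_beta')
 finally show "(LINT x|torus. (LINT l|lat. u (x + int_vec l))) = (LINT x|lborel. u x)" ..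
qed

lemma AE_lborel_translate:
 fixes a :: "real ^ 'n"
 assumes "AE x in lborel. P x"
 shows "AE x in lborel. P (x + a)"
proof -
 have "AE x in distr lborel borel ((+) a). P x" using assms unfolding lborel_distr_plus .
 then have "AE x in lborel. P (a + x)" by (rule AE_distrD[rotated]) simp
 then show ?thesis by (simp add: add.commute)
qed

text \<open>Countably many translates of the exceptional set still form a null set, and every point
  has a translate in the cube.\<close>

lemma AE_periodic:
 fixes P :: "real ^ 'n => bool"
 assumes P: "AE x in torus. P x" and per: "\<And>x l. P (x + int_vec l) ==> P x"
 shows "AE x in lborel. P x"
proof -
 have "AE x in lborel. \<forall>l. x + int_vec l \<in> unit_cube --> P (x + int_vec l)"
  using P unfolding AE_torus by (subst AE_all_countable) (intro allI AE_lborel_translate)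
 then show ?thesis
 proof eventually_elim
  fix x assume *: "\<forall>l. x + int_vec l \<in> unit_cube --> P (x + int_vec l)"
  have "x + int_vec (- near_int x) \<in> unit_cube"
   using near_int_iff[of x "near_int x"] by (simp add: int_vec_minus)
  with * show "P x" using per by blast
 qed
qed

text \<open>A shift by a followed by reduction modulo the lattice preserves the torus measure,
  because the shifted cube is again a fundamental domain; a periodic u does not notice the
  reduction.\<close>

lemma integral_torus_translate:
 fixes u :: "real ^ 'n => complex"
 assumes [measurable]: "u \<in> borel_measurable borel" and per: "\<And>x l. u (x + int_vec l) = u x"
 shows "(LINT x|torus. u (x + a)) = (LINT x|torus. u x)"
proof -
 define r where "r x = x - int_vec (near_int x)" for x :: "real ^ 'n"
 have [measurable]: "r \<in> borel \<rightarrow>\<^sub>M borel"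
 proof -
  have "r = (%x. \<chi> i. x $ i - of_int \<lfloor>x $ i + 1 / 2\<rfloor>)"
   by (auto simp: r_def near_int_def vec_eq_iff)
  then show ?thesis
   by (subst borel_measurable_euclidean_space) (auto simp: Basis_vec_def inner_axis)
 qed
 have r_per: "r (x + int_vec l) = r x" for x l
 proof -
  have "\<lfloor>x $ i + of_int (l $ i) + 1 / 2\<rfloor> = \<lfloor>x $ i + 1 / 2\<rfloor> + l $ i" for i
   using floor_add_int[of "x $ i + 1 / 2" "l $ i"] by (simp add: add_ac)
  then show ?thesis by (simp add: r_def near_int_def vec_eq_iff)
 qed
 have r_id: "x \<in> unit_cube ==> r x = x" for x
  using near_int_iff[of x 0] by (simp add: r_def)
 have ur: "u (r x) = u x" for x
  using per[of x "- near_int x"] by (simp add: r_def int_vec_minus)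
 have "distr torus borel (%x. r (x + a)) = torus"
 proof (rule measure_eqI)
  fix A :: "(real ^ 'n) set" assume "A \<in> sets (distr torus borel (%x. r (x + a)))"
  then have [measurable]: "A \<in> sets borel" by simp
  have "emeasure (distr torus borel (%x. r (x + a))) A = (\<integral>\<^sup>+x. indicator A x \<partial>distr torus borel (%x. r (x + a)))"
   by (rule nn_integral_indicator[symmetric]) simp
  also have "... = (\<integral>\<^sup>+x. indicator A (r (x + a)) \<partial>torus)"
   by (rule nn_integral_distr) auto
  also have "... = (\<integral>\<^sup>+x. indicator unit_cube x * indicator A (r (x + a)) \<partial>lborel)"
   by (simp add: nn_integral_torus)
  also have "... = (\<integral>\<^sup>+x. indicator unit_cube (x - a) * indicator A (r x) \<partial>lborel)"
   by (subst nn_integral_translate[of "%x. indicator unit_cube (x - a) * indicator A (r x)" a, symmetric]) simp_all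
  also have "... = (\<integral>\<^sup>+x. (\<integral>\<^sup>+l. indicator unit_cube (x + int_vec l - a) * indicator A (r (x + int_vec l)) \<partial>lat) \<partial>torus)"
   by (subst nn_integral_tile[symmetric]) simp_all
  also have "... = (\<integral>\<^sup>+x. indicator A (r x) \<partial>torus)"
  proof (rule nn_integral_cong)
   fix x :: "real ^ 'n"
   have "bij_betw uminus UNIV (UNIV :: (int ^ 'n) set)" by (rule bij_uminus)
   from nn_integral_bij_count_space[OF this, of "%l. indicator unit_cube (x + int_vec l - a)"]
   have "(\<integral>\<^sup>+l. indicator unit_cube (x + int_vec l - a) \<partial>lat) = (\<integral>\<^sup>+l. indicator unit_cube ((x - a) - int_vec l) \<partial>lat)"
    by (simp add: int_vec_minus algebra_simps)
   then show "(\<integral>\<^sup>+l. indicator unit_cube (x + int_vec l - a) * indicator A (r (x + int_vec l)) \<partial>lat) = indicator A (r x)"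
    by (simp add: r_per nn_integral_multc sum_indicator_unit_cube)
  qed
  also have "... = (\<integral>\<^sup>+x. indicator A x \<partial>torus)"
   by (rule nn_integral_cong_AE) (simp add: AE_torus r_id)
  also have "... = emeasure torus A" by simp
  finally show "emeasure (distr torus borel (%x. r (x + a))) A = emeasure torus A" .
 qed simp
 then have "(LINT x|torus. u x) = (LINT x|distr torus borel (%x. r (x + a)). u x)" by simp
 also have "... = (LINT x|torus. u (r (x + a)))" by (rule integral_distr) auto
 finally show ?thesis by (simp add: ur)
qed

lemma integrable_torus_bounded:
 fixes u :: "real ^ 'n => complex"
 assumes "u \<in> borel_measurable borel" "\<And>x. cmod (u x) <= B"
 shows "integrable torus u"
 by (rule torus.integrable_const_bound[of _ B]) (use assms in auto)

lemma echar_periodic: "echar (int_vec k \<bullet> (x + int_vec l)) = echar (int_vec k \<bullet> x)"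
 by (simp add: inner_right_distrib echar_add)

lemma integral_torus_echar:
 "(LINT x|torus. echar (int_vec k \<bullet> x)) = (if k = 0 then 1 else 0)"
proof (cases "k = 0")
 case True
 then show ?thesis by simp
next
 case False
 then obtain i where i: "k $ i ~= 0" by (auto simp: vec_eq_iff)
 \<comment> \<open>Half a period in a coordinate where k does not vanish: the shift reverses the
   sign of the character, so its integral equals its own negative.\<close>
 let ?a = "axis i (1 / (2 * of_int (k $ i)))"
 have h: "int_vec k \<bullet> ?a = 1 / 2" using i by (simp add: inner_axis)
 have e: "echar (int_vec k \<bullet> ?a) = -1" unfolding h by (simp add: echar_def)
 have "(LINT x|torus. echar (int_vec k \<bullet> x)) = (LINT x|torus. echar (int_vec k \<bullet> (x + ?a)))"
  by (rule integral_torus_translate[symmetric]) (simp_all add: echar_periodic)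
 also have "... = (LINT x|torus. echar (int_vec k \<bullet> x) * (- 1))"
  by (simp only: inner_right_distrib echar_add e)
 also have "... = - (LINT x|torus. echar (int_vec k \<bullet> x))" by simp
 finally show ?thesis using False by simp
qed

section \<open>Bessel's inequality for Fourier coefficients on the torus\<close>

lemma nn_integral_count_space_le:
 fixes f :: "'a::countable => ennreal"
 assumes "\<And>K. finite K ==> sum f K <= C"
 shows "(\<integral>\<^sup>+k. f k \<partial>count_space UNIV) <= C"
proof -
 define K where "K n = {k :: 'a. to_nat k <= n}" for n :: nat
 have fin: "finite (K n)" for n
  unfolding K_def by (rule finite_imageD[of to_nat]) (auto intro: finite_subset[of _ "{..n}"] inj_on_subset[OF inj_to_nat])
 have sup: "f k = (SUP n. f k * indicator (K n) k)" for k
 proof (rule antisym)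
  show "f k <= (SUP n. f k * indicator (K n) k)"
   by (rule SUP_upper2[of "to_nat k"]) (auto simp: K_def)
  show "(SUP n. f k * indicator (K n) k) <= f k"
   by (rule SUP_least) (auto split: split_indicator)
 qed
 have "(\<integral>\<^sup>+k. f k \<partial>count_space UNIV) = (\<integral>\<^sup>+k. (SUP n. f k * indicator (K n) k) \<partial>count_space UNIV)"
  by (subst sup) simp
 also have "... = (SUP n. (\<integral>\<^sup>+k. f k * indicator (K n) k \<partial>count_space UNIV))"
  by (rule nn_integral_monotone_convergence_SUP)
    (auto simp: incseq_def le_fun_def K_def split: split_indicator)
 also have "... <= C"
 proof (rule SUP_least)
  fix n
  have "(\<integral>\<^sup>+k. f k * indicator (K n) k \<partial>count_space UNIV) = (\<Sum>k\<in>K n. f k * indicator (K n) k)"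
   by (rule nn_integral_count_space'[OF fin]) auto
  also have "... = sum f (K n)" by simp
  finally show "(\<integral>\<^sup>+k. f k * indicator (K n) k \<partial>count_space UNIV) <= C" using assms[OF fin] by simp
 qed
 finally show ?thesis .
qed

text \<open>The integral of |b - S|^2 is nonnegative, where S is the partial Fourier sum over a
  finite set of frequencies; expanding it gives the claim. If b is integrable but not square
  integrable, the right side is infinite.\<close>

lemma bessel:
 fixes b :: "real ^ 'n => complex"
 assumes b: "integrable torus b"
 shows "(\<integral>\<^sup>+k. ennreal ((cmod (LINT x|torus. b x * echar (- (int_vec k \<bullet> x))))\<^sup>2) \<partial>lat)
  <= (\<integral>\<^sup>+x. ennreal ((cmod (b x))\<^sup>2) \<partial>torus)"
proof (cases "(\<integral>\<^sup>+x. ennreal ((cmod (b x))\<^sup>2) \<partial>torus) = \<infinity>")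
 case False
 have [measurable]: "b \<in> borel_measurable borel"
  using borel_measurable_integrable[OF b] by simp
 have b2: "integrable torus (%x. (cmod (b x))\<^sup>2)"
  using False by (intro integrableI_nonneg) (auto simp: top.not_eq_extremum)
 define c where "c k = (LINT x|torus. b x * echar (- (int_vec k \<bullet> x)))" for k
 have "(\<Sum>k\<in>K. ennreal ((cmod (c k))\<^sup>2)) <= (\<integral>\<^sup>+x. ennreal ((cmod (b x))\<^sup>2) \<partial>torus)" if K: "finite K" for K
 proof -
  define S where "S x = (\<Sum>k\<in>K. c k * echar (int_vec k \<bullet> x))" for x
  have [measurable]: "S \<in> borel_measurable borel" unfolding S_def by measurable
  have iS: "integrable torus (%x. c k * echar (int_vec k \<bullet> x) * cnj (c l * echar (int_vec l \<bullet> x)))" for k l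
   by (rule integrable_torus_bounded[of _ "cmod (c k) * cmod (c l)"]) (auto simp: norm_mult)
  have ib: "integrable torus (%x. b x * echar (- (int_vec k \<bullet> x)))" for k
   by (rule Bochner_Integration.integrable_bound[OF b]) (auto simp: norm_mult)
  have eq1: "(LINT x|torus. S x * cnj (S x)) = (\<Sum>k\<in>K. c k * cnj (c k))"
  proof -
   have "(LINT x|torus. S x * cnj (S x)) = (LINT x|torus. (\<Sum>k\<in>K. \<Sum>l\<in>K. c k * echar (int_vec k \<bullet> x) * cnj (c l * echar (int_vec l \<bullet> x))))"
    by (simp add: S_def sum_product)
   also have "... = (\<Sum>k\<in>K. \<Sum>l\<in>K. (LINT x|torus. c k * echar (int_vec k \<bullet> x) * cnj (c l * echar (int_vec l \<bullet> x))))"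
    by (subst Bochner_Integration.integral_sum, intro Bochner_Integration.integrable_sum iS,
      rule sum.cong[OF refl], subst Bochner_Integration.integral_sum, rule iS, rule refl)
   also have "... = (\<Sum>k\<in>K. \<Sum>l\<in>K. if l = k then c k * cnj (c k) else 0)"
   proof (intro sum.cong refl)
    fix k l
    have "(%x. c k * echar (int_vec k \<bullet> x) * cnj (c l * echar (int_vec l \<bullet> x)))
      = (%x. c k * cnj (c l) * echar (int_vec (k - l) \<bullet> x))"
     by (auto simp: fun_eq_iff int_vec_diff inner_diff_left echar_diff)
    then show "(LINT x|torus. c k * echar (int_vec k \<bullet> x) * cnj (c l * echar (int_vec l \<bullet> x))) = (if l = k then c k * cnj (c k) else 0)"
     by (simp add: integral_torus_echar)
   qed
   also have "... = (\<Sum>k\<in>K. c k * cnj (c k))" using K by simp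
   finally show ?thesis .
  qed
  have ibS: "integrable torus (%x. b x * cnj (S x))"
   unfolding S_def cnj_sum sum_distrib_left
  proof (intro Bochner_Integration.integrable_sum)
   fix k show "integrable torus (%x. b x * cnj (c k * echar (int_vec k \<bullet> x)))"
    using integrable_mult_left[OF ib[of k], of "cnj (c k)"] by (simp add: echar_minus mult_ac)
  qed
  have eq2: "(LINT x|torus. b x * cnj (S x)) = (\<Sum>k\<in>K. c k * cnj (c k))"
  proof -
   have "(LINT x|torus. b x * cnj (S x)) = (LINT x|torus. (\<Sum>k\<in>K. b x * echar (- (int_vec k \<bullet> x)) * cnj (c k)))"
    by (simp add: S_def sum_distrib_left echar_minus mult_ac)
   also have "... = (\<Sum>k\<in>K. (LINT x|torus. b x * echar (- (int_vec k \<bullet> x)) * cnj (c k)))"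
    by (intro Bochner_Integration.integral_sum integrable_mult_left ib)
   finally show ?thesis by (simp add: c_def)
  qed
  have iSS: "integrable torus (%x. S x * cnj (S x))"
   unfolding S_def cnj_sum sum_product by (intro Bochner_Integration.integrable_sum iS)
  note i1 = integrable_mult_right[OF integrable_Re[OF ibS], of "2::real"] and i2 = integrable_Re[OF iSS]
  have "0 <= (LINT x|torus. (cmod (b x - S x))\<^sup>2)" by (rule integral_nonneg_AE) auto
  also have "... = (LINT x|torus. (cmod (b x))\<^sup>2 - 2 * Re (b x * cnj (S x)) + Re (S x * cnj (S x)))"
   by (intro Bochner_Integration.integral_cong refl)
     (simp only: cmod_power2, simp add: power2_eq_square algebra_simps)
  also have "... = (LINT x|torus. (cmod (b x))\<^sup>2) - 2 * Re (LINT x|torus. b x * cnj (S x)) + Re (LINT x|torus. S x * cnj (S x))"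
   using Bochner_Integration.integral_add[OF Bochner_Integration.integrable_diff[OF b2 i1] i2]
    Bochner_Integration.integral_diff[OF b2 i1]
   by (simp only: integral_mult_right_zero integral_Re[OF ibS] integral_Re[OF iSS])
  also have "... = (LINT x|torus. (cmod (b x))\<^sup>2) - (\<Sum>k\<in>K. (cmod (c k))\<^sup>2)"
   unfolding eq1 eq2 by (simp add: complex_mult_cnj cmod_power2)
  finally have "(\<Sum>k\<in>K. (cmod (c k))\<^sup>2) <= (LINT x|torus. (cmod (b x))\<^sup>2)" by simp
  then have "ennreal (\<Sum>k\<in>K. (cmod (c k))\<^sup>2) <= (\<integral>\<^sup>+x. ennreal ((cmod (b x))\<^sup>2) \<partial>torus)"
   using b2 by (subst nn_integral_eq_integral) (auto simp: ennreal_leI)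
  then show ?thesis by simp
 qed
 then show ?thesis unfolding c_def by (rule nn_integral_count_space_le)
qed simp

interpretation torus_hy: L1_L2_kernel "torus :: (real ^ 'n) measure" "lat :: (int ^ 'n) measure"
 "%k x. echar (- (int_vec k \<bullet> x))"
proof
 show "(%(k :: int ^ 'n, x). echar (- (int_vec k \<bullet> x))) \<in> borel_measurable (lat \<Otimes>\<^sub>M torus)"
  by measurable
qed (auto intro: bessel)

section \<open>Lattice sums\<close>

lemma emeasure_torus_UNIV [simp]: "emeasure (torus :: (real ^ 'n) measure) UNIV = 1"
 using prob_space.emeasure_space_1[OF sigma_finite_torus] by simp

lemma bij_vec_nth: "bij_betw (vec_nth :: 'a ^ 'n => 'n => 'a) UNIV (Pi\<^sub>E UNIV (%_. UNIV))"
 by (rule bij_betw_byWitness[of _ "vec_lambda"]) auto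

lemma nn_integral_lat_prod:
 fixes f :: "'n::finite => int => ennreal"
 shows "(\<integral>\<^sup>+l. (\<Prod>i\<in>UNIV. f i (l $ i)) \<partial>(lat :: (int ^ 'n) measure)) = (\<Prod>i\<in>UNIV. \<integral>\<^sup>+z. f i z \<partial>count_space UNIV)"
proof -
 interpret product_sigma_finite "%_ :: 'n. count_space (UNIV :: int set)"
  by (intro product_sigma_finite.intro sigma_finite_measure_count_space_countable) simp
 have "(\<integral>\<^sup>+l. (\<Prod>i\<in>UNIV. f i (l $ i)) \<partial>(lat :: (int ^ 'n) measure))
   = (\<integral>\<^sup>+g. (\<Prod>i\<in>UNIV. f i (g i)) \<partial>count_space (Pi\<^sub>E UNIV (%_. UNIV)))"
  by (rule nn_integral_bij_count_space[OF bij_vec_nth])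
 also have "... = (\<integral>\<^sup>+g. (\<Prod>i\<in>UNIV. f i (g i)) \<partial>PiM UNIV (%_ :: 'n. count_space (UNIV :: int set)))"
  by (subst count_space_PiM_finite) auto
 also have "... = (\<Prod>i\<in>UNIV. \<integral>\<^sup>+z. f i z \<partial>count_space UNIV)"
  by (rule product_nn_integral_prod) auto
 finally show ?thesis .
qed

text \<open>For 0 \<le> y < 1 the summands with z \<ge> 0 and those with z < 0 are each dominated by
  the series of (1 + n)^(-r), hence the factor 2; a general y is brought there by an integer shift
  of the summation index, which makes the bound uniform in y.\<close>

lemma int_sum_bound:
 assumes r: "r > 1"
 shows "\<exists>K\<ge>0. \<forall>y::real. (\<integral>\<^sup>+z. ennreal ((1 + \<bar>y + of_int z\<bar>) powr (- r)) \<partial>count_space UNIV) <= ennreal K"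
proof -
 define g :: "nat => real" where "g n = (1 + real n) powr (- r)" for n
 have "summable (%n. real n powr (- r))"
  using r by (simp add: summable_real_powr_iff)
 then have sg: "summable g"
  using summable_Suc_iff[of "%n. real n powr (- r)"] unfolding g_def[abs_def] by simp
 have g0: "g n \<ge> 0" for n by (simp add: g_def)
 have base: "(\<integral>\<^sup>+z. ennreal ((1 + \<bar>y + of_int z\<bar>) powr (- r)) \<partial>count_space UNIV) <= ennreal (2 * suminf g)"
  if y: "0 <= y" "y < 1" for y :: real
 proof (rule nn_integral_count_space_le)
  fix K :: "int set" assume K: "finite K"
  let ?f = "%z. (1 + \<bar>y + of_int z\<bar>) powr (- r)"
  let ?P = "{z\<in>K. z \<ge> 0}" and ?N = "{z\<in>K. z < 0}"
  have "sum ?f ?P <= (\<Sum>z\<in>?P. g (nat z))"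
   using y r by (intro sum_mono) (auto simp: g_def intro!: powr_mono2')
  also have "... = sum g (nat ` ?P)" by (subst sum.reindex) (auto simp: inj_on_def)
  also have "... <= suminf g" using K g0 by (intro sum_le_suminf sg) auto
  finally have 1: "sum ?f ?P <= suminf g" .
  have "sum ?f ?N <= (\<Sum>z\<in>?N. g (nat (- z - 1)))"
   using y r by (intro sum_mono) (auto simp: g_def intro!: powr_mono2')
  also have "... = sum g ((%z. nat (- z - 1)) ` ?N)" by (subst sum.reindex) (auto simp: inj_on_def)
  also have "... <= suminf g" using K g0 by (intro sum_le_suminf sg) auto
  finally have 2: "sum ?f ?N <= suminf g" .
  have "K = ?P \<union> ?N" by auto
  then have "sum ?f K = sum ?f ?P + sum ?f ?N"
   using K by (metis (no_types, lifting) disjoint_iff finite_Un linorder_not_less mem_Collect_eq sum.union_disjoint)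
  with 1 2 have "sum ?f K <= 2 * suminf g" by simp
  then show "(\<Sum>z\<in>K. ennreal (?f z)) <= ennreal (2 * suminf g)"
   by (subst sum_ennreal) (auto intro: ennreal_leI)
 qed
 show ?thesis
 proof (intro exI[of _ "2 * suminf g"] conjI allI)
  show "0 <= 2 * suminf g" using suminf_nonneg[OF sg g0] by simp
  fix y :: real
  have bij: "bij_betw (%z. z + \<lfloor>y\<rfloor>) UNIV (UNIV :: int set)"
   by (rule bij_betw_byWitness[of _ "%z. z - \<lfloor>y\<rfloor>"]) auto
  have "(\<integral>\<^sup>+z. ennreal ((1 + \<bar>y + of_int z\<bar>) powr (- r)) \<partial>count_space UNIV)
    = (\<integral>\<^sup>+z. ennreal ((1 + \<bar>frac y + of_int (z + \<lfloor>y\<rfloor>)\<bar>) powr (- r)) \<partial>count_space UNIV)"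
   by (simp add: frac_def algebra_simps)
  also have "... = (\<integral>\<^sup>+z. ennreal ((1 + \<bar>frac y + of_int z\<bar>) powr (- r)) \<partial>count_space UNIV)"
   by (rule nn_integral_bij_count_space[OF bij])
  also have "... <= ennreal (2 * suminf g)" by (rule base) (auto simp: frac_lt_1)
  finally show "(\<integral>\<^sup>+z. ennreal ((1 + \<bar>y + of_int z\<bar>) powr (- r)) \<partial>count_space UNIV) <= ennreal (2 * suminf g)" .
 qed
qed

lemma lattice_prod_sum_bound:
 assumes r: "r > 1"
 shows "\<exists>K\<ge>0. \<forall>x :: real ^ 'n. (\<integral>\<^sup>+l. ennreal (\<Prod>i\<in>UNIV. (1 + \<bar>(x + int_vec l) $ i\<bar>) powr (- r)) \<partial>lat) <= ennreal K"
proof -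
 obtain K where K: "K \<ge> 0"
  "\<And>y::real. (\<integral>\<^sup>+z. ennreal ((1 + \<bar>y + of_int z\<bar>) powr (- r)) \<partial>count_space UNIV) <= ennreal K"
  using int_sum_bound[OF r] by blast
 have "(\<integral>\<^sup>+l. ennreal (\<Prod>i\<in>UNIV. (1 + \<bar>(x + int_vec l) $ i\<bar>) powr (- r)) \<partial>lat) <= ennreal (K ^ CARD('n))"
  for x :: "real ^ 'n"
 proof -
  have "(\<integral>\<^sup>+l. ennreal (\<Prod>i\<in>UNIV. (1 + \<bar>(x + int_vec l) $ i\<bar>) powr (- r)) \<partial>lat)
    = (\<Prod>i\<in>UNIV. \<integral>\<^sup>+z. ennreal ((1 + \<bar>x $ i + of_int z\<bar>) powr (- r)) \<partial>count_space UNIV)"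
   by (subst nn_integral_lat_prod[symmetric]) (simp add: prod_ennreal)
  also have "... <= (\<Prod>i\<in>(UNIV :: 'n set). ennreal K)"
   by (intro prod_mono_ennreal K(2))
  also have "... = ennreal (K ^ CARD('n))" using K(1) by (simp add: ennreal_power)
  finally show ?thesis .
 qed
 then show ?thesis using K(1) by (intro exI[of _ "K ^ CARD('n)"]) auto
qed

text \<open>Each coordinate is at most the norm, so each of the d factors with exponent s / d is at
  least the d-th root of the left side. For s > d the exponent per coordinate exceeds 1, and
  one-dimensional sums suffice.\<close>

lemma norm_powr_le_prod:
 fixes x :: "real ^ 'n"
 assumes s: "s \<ge> 0"
 shows "(1 + norm x) powr (- s) <= (\<Prod>i\<in>UNIV. (1 + \<bar>x $ i\<bar>) powr (- (s / CARD('n))))"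
proof -
 have pos: "real CARD('n) > 0" by simp
 have "(1 + norm x) powr (- s) = ((1 + norm x) powr (- (s / CARD('n)))) powr real CARD('n)"
  using pos by (simp add: powr_powr)
 also have "... = (\<Prod>i\<in>(UNIV :: 'n set). (1 + norm x) powr (- (s / CARD('n))))"
 proof -
  have "0 < (1 + norm x) powr (- (s / CARD('n)))"
   using norm_ge_zero[of x] by (intro powr_gt_zero[THEN iffD2]) linarith
  then show ?thesis by (simp add: powr_realpow)
 qed
 also have "... <= (\<Prod>i\<in>UNIV. (1 + \<bar>x $ i\<bar>) powr (- (s / CARD('n))))"
 proof (intro prod_mono conjI)
  fix i :: 'n
  show "(1 + norm x) powr (- (s / CARD('n))) <= (1 + \<bar>x $ i\<bar>) powr (- (s / CARD('n)))"
   using s component_le_norm_cart[of x i] pos by (intro powr_mono2') (auto simp: divide_nonneg_pos)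
 qed simp
 finally show ?thesis .
qed

lemma lattice_sum_bound:
 assumes s: "s > real CARD('n)"
 shows "\<exists>K\<ge>0. \<forall>x :: real ^ 'n. (\<integral>\<^sup>+l. ennreal ((1 + norm (x + int_vec l)) powr (- s)) \<partial>lat) <= ennreal K"
proof -
 have pos: "real CARD('n) > 0" by simp
 have r: "s / CARD('n) > 1" using s pos by (simp add: field_simps)
 obtain K where K: "K \<ge> 0"
  "\<And>x :: real ^ 'n. (\<integral>\<^sup>+l. ennreal (\<Prod>i\<in>UNIV. (1 + \<bar>(x + int_vec l) $ i\<bar>) powr (- (s / CARD('n)))) \<partial>lat) <= ennreal K"
  using lattice_prod_sum_bound[OF r, where 'n = 'n] by blast
 have "s \<ge> 0" using s pos by linarith
 then have "(\<integral>\<^sup>+l. ennreal ((1 + norm (x + int_vec l)) powr (- s)) \<partial>lat) <= ennreal K" for x :: "real ^ 'n"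
  by (intro order_trans[OF nn_integral_mono K(2)[of x]] ennreal_leI norm_powr_le_prod)
 then show ?thesis using K(1) by blast
qed

text \<open>The integral is the torus average of the lattice sums, which are uniformly
  bounded.\<close>

lemma integral_norm_powr_bound:
 assumes s: "s > real CARD('n)"
 shows "\<exists>K\<ge>0. (\<integral>\<^sup>+x. ennreal ((1 + norm (x :: real ^ 'n)) powr (- s)) \<partial>lborel) <= ennreal K"
proof -
 obtain K where K: "K \<ge> 0"
  "\<And>x :: real ^ 'n. (\<integral>\<^sup>+l. ennreal ((1 + norm (x + int_vec l)) powr (- s)) \<partial>lat) <= ennreal K"
  using lattice_sum_bound[OF s] by blast
 have "(\<integral>\<^sup>+x. ennreal ((1 + norm (x :: real ^ 'n)) powr (- s)) \<partial>lborel)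
   = (\<integral>\<^sup>+x. (\<integral>\<^sup>+l. ennreal ((1 + norm ((x :: real ^ 'n) + int_vec l)) powr (- s)) \<partial>lat) \<partial>torus)"
  by (rule nn_integral_tile[symmetric]) measurable
 also have "... <= (\<integral>\<^sup>+x. ennreal K \<partial>(torus :: (real ^ 'n) measure))" by (intro nn_integral_mono K(2))
 also have "... = ennreal K" by simp
 finally show ?thesis using K(1) by blast
qed

lemma card_int_vec_box: "card {a :: int ^ 'n. \<forall>i. a $ i \<in> S i} = (\<Prod>i\<in>UNIV. card (S i))"
proof -
 have "bij_betw vec_nth {a :: int ^ 'n. \<forall>i. a $ i \<in> S i} (Pi\<^sub>E UNIV S)"
  by (rule bij_betw_byWitness[of _ "vec_lambda"]) auto
 then show ?thesis by (simp add: bij_betw_same_card card_PiE)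
qed

lemma finite_int_vec_box: "(\<And>i. finite (S i)) ==> finite {a :: int ^ 'n. \<forall>i. a $ i \<in> S i}"
proof -
 assume *: "\<And>i. finite (S i)"
 have "bij_betw vec_nth {a :: int ^ 'n. \<forall>i. a $ i \<in> S i} (Pi\<^sub>E UNIV S)"
  by (rule bij_betw_byWitness[of _ "vec_lambda"]) auto
 from bij_betw_finite[OF this] show ?thesis using * by (simp add: finite_PiE)
qed

lemma finite_lattice_ball: "finite {l :: int ^ 'n. norm (int_vec l) <= R}"
proof (rule finite_subset)
 show "{l :: int ^ 'n. norm (int_vec l) <= R} \<subseteq> {l. \<forall>i. l $ i \<in> {- \<lceil>R\<rceil> .. \<lceil>R\<rceil>}}"
 proof safe
  fix l :: "int ^ 'n" and i assume "norm (int_vec l) <= R"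
  then have "\<bar>of_int (l $ i)\<bar> <= R" using component_le_norm_cart[of "int_vec l" i] by simp
  then show "l $ i \<in> {- \<lceil>R\<rceil> .. \<lceil>R\<rceil>}" by (simp add: abs_le_iff) linarith
 qed
qed (rule finite_int_vec_box, simp)

section \<open>Fejer summation\<close>

definition int_box :: "nat => (int ^ 'n) set" where
 "int_box n = {a. \<forall>i. a $ i \<in> {0..<int n}}"

lemma finite_int_box [simp]: "finite (int_box n)"
 unfolding int_box_def by (rule finite_int_vec_box) simp

lemma card_int_box: "card (int_box n :: (int ^ 'n) set) = n ^ CARD('n)"
 unfolding int_box_def by (subst card_int_vec_box) simp

text \<open>Normalized number of pairs in the box with difference k. This is what squaring an
  exponential sum produces, so these are the Fourier coefficients of \<open>fejer\<close>; the usual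
  product of the factors 1 - |k_i| / n is a consequence.\<close>

definition fejer_weight :: "nat => int ^ 'n => real" where
 "fejer_weight n k = (\<Sum>a\<in>int_box n. \<Sum>b\<in>int_box n. of_bool (k = a - b)) / real (n ^ CARD('n))"

text \<open>Counting the b for which both b and b + k lie in the box factorizes over the
  coordinates, and in each of them an interval of n - |k_i| integers remains, empty if this is
  negative.\<close>

lemma fejer_weight_eq:
 "n > 0 ==> fejer_weight n (k :: int ^ 'n) = (\<Prod>i\<in>UNIV. real (nat (int n - \<bar>k $ i\<bar>)) / real n)"
proof -
 assume n: "n > 0"
 have "(\<Sum>a\<in>int_box n. \<Sum>b\<in>int_box n. of_bool (k = a - b)) = (\<Sum>b\<in>int_box n. \<Sum>a\<in>int_box n. of_bool (a = b + k) :: real)"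
  by (subst sum.swap) (intro sum.cong refl, auto simp: algebra_simps)
 also have "... = (\<Sum>b\<in>int_box n. of_bool (b + k \<in> int_box n))"
  by (intro sum.cong refl) (simp add: of_bool_def sum.delta)
 also have "... = real (card {b\<in>int_box n. b + k \<in> int_box n})"
  by (simp add: of_bool_def sum.If_cases Int_def)
 also have "{b\<in>int_box n. b + k \<in> int_box n} = {b. \<forall>i. b $ i \<in> {max 0 (- (k $ i))..<int n - max 0 (k $ i)}}"
  by (auto simp: int_box_def) (smt (verit))+
 also have "card ... = (\<Prod>i\<in>UNIV. nat (int n - \<bar>k $ i\<bar>))"
 proof -
  have "nat (int n - max 0 (k $ i) - max 0 (- (k $ i))) = nat (int n - \<bar>k $ i\<bar>)" for i
   by (rule arg_cong[of _ _ nat]) auto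
  then show ?thesis by (subst card_int_vec_box) (simp only: card_atLeastLessThan_int)
 qed
 finally show ?thesis by (simp add: fejer_weight_def prod_dividef)
qed

lemma fejer_weight_bounds: "n > 0 ==> 0 <= fejer_weight n k \<and> fejer_weight n k <= 1"
 by (auto simp: fejer_weight_eq intro!: prod_nonneg prod_le_1) 

lemma fejer_weight_tendsto: "(%n. fejer_weight n k) \<longlonglongrightarrow> 1"
proof -
 have lim: "(%n. real (nat (int n - \<bar>z\<bar>)) / real n) \<longlonglongrightarrow> 1" for z :: int
 proof -
  have "(%n. 1 - real_of_int \<bar>z\<bar> * (1 / real n)) \<longlonglongrightarrow> 1 - real_of_int \<bar>z\<bar> * 0"
   by (rule tendsto_diff[OF tendsto_const tendsto_mult[OF tendsto_const lim_1_over_n]])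
  moreover have "\<forall>\<^sub>F n in sequentially. 1 - real_of_int \<bar>z\<bar> * (1 / real n) = real (nat (int n - \<bar>z\<bar>)) / real n"
   using eventually_ge_at_top[of "nat \<bar>z\<bar> + 1"]
  proof eventually_elim
   case (elim n)
   then have "real (nat (int n - \<bar>z\<bar>)) = real n - real_of_int \<bar>z\<bar>" by simp
   then show ?case using elim by (simp add: diff_divide_distrib)
  qed
  ultimately show ?thesis by (simp add: filterlim_cong)
 qed
 have "(%n. \<Prod>i\<in>UNIV. real (nat (int n - \<bar>k $ i\<bar>)) / real n) \<longlonglongrightarrow> (\<Prod>i\<in>(UNIV :: 'a set). 1)"
  by (intro tendsto_prod lim)
 moreover have "\<forall>\<^sub>F n in sequentially. (\<Prod>i\<in>UNIV. real (nat (int n - \<bar>k $ i\<bar>)) / real n) = fejer_weight n k"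
  using eventually_gt_at_top[of 0] by eventually_elim (simp add: fejer_weight_eq)
 ultimately show ?thesis by (simp add: filterlim_cong)
qed

definition fejer :: "nat => real ^ 'n => real" where
 "fejer n x = (cmod (\<Sum>a\<in>int_box n. echar (int_vec a \<bullet> x)))\<^sup>2 / real (n ^ CARD('n))"

lemma fejer_nonneg: "fejer n x \<ge> 0"
 by (simp add: fejer_def)

lemma fejer_measurable [measurable]: "fejer n \<in> borel_measurable borel"
 unfolding fejer_def by measurable

lemma fejer_eq:
 "complex_of_real (fejer n x) = (\<Sum>a\<in>int_box n. \<Sum>b\<in>int_box n. echar (int_vec (a - b) \<bullet> x)) / of_nat (n ^ CARD('n))"
 for x :: "real ^ 'n"
proof -
 let ?S = "\<Sum>a\<in>int_box n. echar (int_vec a \<bullet> x)"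
 have "complex_of_real ((cmod ?S)\<^sup>2) = ?S * cnj ?S" by (simp only: complex_norm_square)
 also have "... = (\<Sum>a\<in>int_box n. \<Sum>b\<in>int_box n. echar (int_vec (a - b) \<bullet> x))"
  by (simp add: sum_product int_vec_diff inner_diff_left echar_diff)
 finally show ?thesis by (simp add: fejer_def)
qed

lemma fejer_periodic: "fejer n (x + int_vec l) = fejer n x"
 by (simp add: fejer_def echar_periodic)

lemma fejer_le: "fejer n (x :: real ^ 'n) <= real (n ^ CARD('n))"
proof -
 have "cmod (\<Sum>a\<in>int_box n. echar (int_vec a \<bullet> x)) <= (\<Sum>a\<in>(int_box n :: (int ^ 'n) set). 1)"
  by (rule sum_norm_le) simp
 also have "... = real (n ^ CARD('n))" by (simp add: card_int_box)
 finally have "(cmod (\<Sum>a\<in>int_box n. echar (int_vec a \<bullet> x)))\<^sup>2 <= (real (n ^ CARD('n)))\<^sup>2"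
  by (intro power_mono) auto
 then show ?thesis
  by (cases "n = 0") (simp_all add: fejer_def power2_eq_square divide_le_eq)
qed

lemma integrable_torus_fejer:
 fixes u :: "real ^ 'n => complex"
 assumes [measurable]: "u \<in> borel_measurable borel" and "\<And>x. cmod (u x) <= B"
 shows "integrable torus (%x. of_real (fejer n x) * u x)"
proof (rule integrable_torus_bounded[of _ "real (n ^ CARD('n)) * B"])
 fix x
 show "cmod (of_real (fejer n x) * u x) <= real (n ^ CARD('n)) * B"
  using mult_mono[OF fejer_le[of n x] assms(2)[of x]] by (simp add: norm_mult fejer_nonneg)
qed simp

lemma integral_fejer_echar:
 fixes k :: "int ^ 'n"
 shows
 "(LINT x|torus. of_real (fejer n x) * echar (- (int_vec k \<bullet> x))) = of_real (fejer_weight n k)"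
proof -
 have int: "integrable torus (%x. echar (int_vec (a - b) \<bullet> x) * echar (- (int_vec k \<bullet> x)))" for a b
  by (rule integrable_torus_bounded[of _ 1]) (auto simp: norm_mult)
 have one: "(LINT x|torus. echar (int_vec (a - b) \<bullet> x) * echar (- (int_vec k \<bullet> x))) = of_bool (k = a - b)" for a b
 proof -
  have "(%x. echar (int_vec (a - b) \<bullet> x) * echar (- (int_vec k \<bullet> x))) = (%x. echar (int_vec (a - b - k) \<bullet> x))"
   by (simp add: int_vec_diff inner_diff_left echar_add[symmetric])
  then show ?thesis by (auto simp: integral_torus_echar)
 qed
 have "(LINT x|torus. of_real (fejer n x) * echar (- (int_vec k \<bullet> x)))
   = (LINT x|torus. (\<Sum>a\<in>int_box n. \<Sum>b\<in>int_box n. echar (int_vec (a - b) \<bullet> x) * echar (- (int_vec k \<bullet> x))) / of_nat (n ^ CARD('n)))"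
  by (simp add: fejer_eq sum_distrib_right)
 also have "... = (\<Sum>a\<in>int_box n. \<Sum>b\<in>int_box n. (LINT x|torus. echar (int_vec (a - b) \<bullet> x) * echar (- (int_vec k \<bullet> x)))) / of_nat (n ^ CARD('n))"
  by (simp add: Bochner_Integration.integral_sum Bochner_Integration.integrable_sum int)
 also have "... = of_real (fejer_weight n k)"
  by (simp add: one fejer_weight_def)
 finally show ?thesis .
qed

lemma integral_fejer:
 assumes "n > 0"
 shows "(LINT x|torus. fejer n (x :: real ^ 'n)) = 1"
  and "integrable torus (fejer n :: real ^ 'n => real)"
proof -
 have i: "integrable torus (%x :: real ^ 'n. complex_of_real (fejer n x) * 1)"
  by (rule integrable_torus_fejer[of _ 1]) auto
 from integrable_Re[OF i] show "integrable torus (fejer n :: real ^ 'n => real)" by simp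
 have "(LINT x|torus. fejer n (x :: real ^ 'n)) = Re (LINT x|torus. complex_of_real (fejer n (x :: real ^ 'n)) * 1)"
  by (subst integral_Re[symmetric, OF i]) simp
 also have "... = fejer_weight n (0 :: int ^ 'n)" using integral_fejer_echar[of n "0 :: int ^ 'n"] by simp
 finally show "(LINT x|torus. fejer n (x :: real ^ 'n)) = 1" using assms by (simp add: fejer_weight_eq)
qed

text \<open>As in Korovkin's theorem, concentration at the origin follows from testing with
  \<open>1 - cos (2 \<pi> x\<^sub>i)\<close>.\<close>

lemma fejer_concentration:
 fixes r :: real
 assumes r: "r > 0"
 shows "\<exists>C\<ge>0. \<forall>n>0. (LINT x|torus. fejer n (x :: real ^ 'n) * (if norm x \<ge> r then 1 else 0)) <= C / real n"
proof -
 let ?d = "real CARD('n)"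
 \<comment> \<open>If all |x_i| were below r / d, with d the dimension, then norm x < r. The cap 1/2
   keeps 2 pi t within [0, pi], where the cosine decreases.\<close>
 define t where "t = min (r / ?d) (1 / 2)"
 have t: "0 < t" using r by (simp add: t_def)
 have t2: "t <= 1 / 2" by (simp only: t_def min.cobounded2)
 define c where "c = 1 - cos (2 * pi * t)"
 have "cos (2 * pi * t) < cos 0"
  using t t2 by (intro cos_monotone_0_pi) auto
 then have c: "c > 0" by (simp add: c_def)
 define g :: "real ^ 'n => real" where "g x = (\<Sum>i\<in>UNIV. 1 - Re (echar (- (int_vec (axis i 1) \<bullet> x))))" for x
 have [measurable]: "g \<in> borel_measurable borel" unfolding g_def by measurable
 have Re_le: "Re (echar s) <= 1" for s by (simp add: echar_def)
 have g0: "g x \<ge> 0" for x unfolding g_def by (intro sum_nonneg) (simp add: Re_le)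
 have ge: "c <= g x" if x: "x \<in> unit_cube" "norm x \<ge> r" for x
 proof -
  obtain i where i: "\<bar>x $ i\<bar> \<ge> t"
  proof (rule ccontr)
   assume *: "\<not> thesis"
   have lt: "\<bar>x $ i\<bar> < r / ?d" for i
   proof -
    have "\<bar>x $ i\<bar> < t" using * that by (meson not_le)
    also have "t <= r / ?d" by (simp only: t_def min.cobounded1)
    finally show ?thesis .
   qed
   have "norm x <= (\<Sum>i\<in>UNIV. \<bar>x $ i\<bar>)" by (rule norm_le_l1_cart)
   also have "... < (\<Sum>i\<in>(UNIV :: 'n set). r / ?d)"
    using lt by (intro sum_strict_mono) auto
   finally show False using x by simp
  qed
  have xi: "\<bar>x $ i\<bar> <= 1 / 2" using x by (auto simp: unit_cube_def abs_le_iff intro: less_imp_le) (smt (verit) field_sum_of_halves)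
  have "int_vec (axis i 1) \<bullet> x = x $ i"
   by (simp add: inner_vec_def int_vec_def axis_def if_distrib if_distribR sum.delta cong: if_cong)
  then have "Re (echar (- (int_vec (axis i 1) \<bullet> x))) = cos (2 * pi * \<bar>x $ i\<bar>)"
   by (cases "x $ i \<ge> 0") (simp_all add: echar_def)
  also have "... <= cos (2 * pi * t)" using i xi t t2 by (intro cos_monotone_0_pi_le) auto
  finally have "c <= 1 - Re (echar (- (int_vec (axis i 1) \<bullet> x)))" by (simp add: c_def)
  also have "... <= g x" unfolding g_def by (rule member_le_sum) (auto simp: Re_le)
  finally show ?thesis .
 qed
 have "(LINT x|torus. fejer n (x :: real ^ 'n) * (if norm x \<ge> r then 1 else 0)) <= (?d / c) / real n" if n: "n > 0" for n
 proof -
  have ie: "integrable torus (%x. fejer n x * Re (echar (- (int_vec k \<bullet> x))))" for k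
   using integrable_Re[OF integrable_torus_fejer[of "%x. echar (- (int_vec k \<bullet> x))" 1 n]] by simp
  \<comment> \<open>The coefficient of the kernel at a unit vector is 1 - 1/n, so the test function
    has integral d / n against the kernel; this is the source of the rate.\<close>
  have ieq: "(LINT x|torus. fejer n x * Re (echar (- (int_vec (axis i 1) \<bullet> x)))) = 1 - 1 / real n" for i :: 'n
  proof -
   have "(LINT x|torus. fejer n x * Re (echar (- (int_vec (axis i 1) \<bullet> x))))
     = Re (LINT x|torus. of_real (fejer n x) * echar (- (int_vec (axis i 1) \<bullet> x)))"
    by (subst integral_Re[symmetric]) (auto intro!: integrable_torus_fejer[of _ 1])
   also have "... = fejer_weight n (axis i 1)" by (simp add: integral_fejer_echar)
   also have "... = (\<Prod>j\<in>UNIV. if j = i then 1 - 1 / real n else 1)"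
    unfolding fejer_weight_eq[OF n]
    by (intro prod.cong) (use n in \<open>auto simp: axis_def field_simps of_nat_diff nat_diff_distrib'\<close>)
   also have "... = 1 - 1 / real n" by simp
   finally show ?thesis .
  qed
  have gi: "integrable torus (%x. fejer n x * g x)"
   unfolding g_def sum_distrib_left right_diff_distrib
   by (intro Bochner_Integration.integrable_sum Bochner_Integration.integrable_diff ie) (use integral_fejer[OF n] in simp)
  note F = integral_fejer[OF n, where 'n = 'n]
  have di: "integrable torus (%x. fejer n x - fejer n x * Re (echar (- (int_vec (axis i 1) \<bullet> x))))" for i :: 'n
   by (intro Bochner_Integration.integrable_diff ie F)
  have "(LINT x|torus. fejer n x * g x) = (\<Sum>i\<in>(UNIV :: 'n set). (LINT x|torus. fejer n x - fejer n x * Re (echar (- (int_vec (axis i 1) \<bullet> x)))))"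
   unfolding g_def sum_distrib_left right_diff_distrib mult_1_right
   by (rule Bochner_Integration.integral_sum[OF di])
  also have "... = (\<Sum>i\<in>(UNIV :: 'n set). (LINT x|torus. fejer n (x :: real ^ 'n)) - (1 - 1 / real n))"
   using Bochner_Integration.integral_diff[OF F(2) ie] by (intro sum.cong refl) (simp only: ieq)
  also have "... = ?d / real n" using F(1) by simp
  finally have eq: "(LINT x|torus. fejer n x * g x) = ?d / real n" .
  have "(LINT x|torus. fejer n (x :: real ^ 'n) * (if norm x \<ge> r then 1 else 0)) <= (LINT x|torus. 1 / c * (fejer n x * g x))"
  proof (rule integral_mono_AE)
   show "integrable torus (%x. fejer n x * (if norm x \<ge> r then 1 else 0))"
    by (rule Bochner_Integration.integrable_bound[OF integral_fejer(2)[OF n]]) (auto simp: fejer_nonneg)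
   show "AE x in torus. fejer n x * (if norm x \<ge> r then 1 else 0) <= 1 / c * (fejer n x * g x)"
    unfolding AE_torus
   proof (intro AE_I2 impI)
    fix x :: "real ^ 'n" assume "x \<in> unit_cube"
    then show "fejer n x * (if norm x \<ge> r then 1 else 0) <= 1 / c * (fejer n x * g x)"
     using ge[of x] c g0[of x] fejer_nonneg[of n x] mult_left_mono[of c "g x" "fejer n x"]
     by (auto simp: field_simps)
   qed
  qed (use gi in auto)
  also have "... = (?d / c) / real n" by (simp add: eq)
  finally show ?thesis .
 qed
 then show ?thesis using c by (intro exI[of _ "?d / c"]) auto
qed

section \<open>Periodization and Poisson summation in weak form\<close>

lemma integral_lat_finite:
 fixes f :: "int ^ 'n => complex"
 assumes "finite L" "\<And>l. l \<notin> L ==> f l = 0"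
 shows "(LINT l|lat. f l) = sum f L" "integrable lat f"
proof -
 have fin: "finite {a \<in> UNIV. f a ~= 0}"
  using assms by (auto intro: finite_subset[of _ L])
 show "(LINT l|lat. f l) = sum f L"
  unfolding lebesgue_integral_count_space_finite_support[OF fin]
  using assms by (intro sum.mono_neutral_left) auto
 show "integrable lat f" 
 proof (rule integrableI_bounded)
  have "(\<integral>\<^sup>+l. ennreal (norm (f l)) \<partial>lat) = (\<Sum>l\<in>L. ennreal (norm (f l)))"
   by (rule nn_integral_count_space') (use assms in auto)
  then show "(\<integral>\<^sup>+l. ennreal (norm (f l)) \<partial>lat) < \<infinity>" by simp
 qed simp
qed

lemma integral_translate:
 fixes u :: "real ^ 'n => complex"
 assumes [measurable]: "u \<in> borel_measurable borel"
 shows "(LINT x|lborel. u (x + a)) = (LINT x|lborel. u x)"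
  and "integrable lborel (%x. u (x + a)) \<longleftrightarrow> integrable lborel u"
proof -
 have "(LINT x|lborel. u (x + a)) = integral\<^sup>L (distr lborel borel ((+) a)) u"
  by (subst integral_distr) (simp_all add: add.commute)
 then show "(LINT x|lborel. u (x + a)) = (LINT x|lborel. u x)" by (simp add: lborel_distr_plus)
 have "integrable (distr lborel borel ((+) a)) u \<longleftrightarrow> integrable lborel (%x. u (x + a))"
  by (subst integrable_distr_eq) (simp_all add: add.commute)
 then show "integrable lborel (%x. u (x + a)) \<longleftrightarrow> integrable lborel u" by (simp add: lborel_distr_plus)
qed

text \<open>Bounded support makes the periodization a locally finite sum, and almost everywhere
  continuity suffices for its Fejer means to converge almost everywhere. Indicators of boxes and the
  transforms of \<open>class_B\<close> generators, which may jump at the boundary of a box, both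
  qualify.\<close>

locale periodization =
 fixes v :: "real ^ 'n => complex" and R B :: real
 assumes v_measurable [measurable]: "v \<in> borel_measurable borel"
  and v_bound: "\<And>x. cmod (v x) <= B"
  and v_support: "\<And>x. norm x > R ==> v x = 0"
  and v_cont: "AE x in lborel. isCont v x"
begin

definition per :: "real ^ 'n => complex" where
 "per eta = (LINT l|lat. v (eta + int_vec l))"

lemma near_support: "finite {l. norm (eta + int_vec l :: real ^ 'n) <= R + 1}"
proof (rule finite_subset[OF _ finite_lattice_ball])
 show "{l. norm (eta + int_vec l :: real ^ 'n) <= R + 1} \<subseteq> {l. norm (int_vec l :: real ^ 'n) <= R + 1 + norm eta}"
 proof safe
  fix l assume "norm (eta + int_vec l) <= R + 1"
  then show "norm (int_vec l) <= R + 1 + norm eta"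
   using norm_triangle_ineq4[of "eta + int_vec l" eta] by simp
 qed
qed

text \<open>One finite set of lattice points serves the whole unit ball around \<open>eta\<close>,
  thanks to the margin 1 in the radius; continuity of the periodization rests on this.\<close>

lemma per_eq:
 assumes "norm (\<zeta> - eta) < 1"
 shows "per \<zeta> = (\<Sum>l | norm (eta + int_vec l) <= R + 1. v (\<zeta> + int_vec l))"
 unfolding per_def
proof (rule integral_lat_finite(1)[OF near_support])
 fix l assume "l \<notin> {l. norm (eta + int_vec l) <= R + 1}"
 then have "norm (\<zeta> + int_vec l) > R"
  using assms norm_triangle_ineq4[of "\<zeta> + int_vec l" "\<zeta> - eta"] by (simp add: algebra_simps)
 then show "v (\<zeta> + int_vec l) = 0" by (rule v_support)
qed

lemma integrable_lat_v: "integrable lat (%l. v (eta + int_vec l))"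
 by (rule integral_lat_finite(2)[OF near_support[of eta]]) (use v_support in force)

lemma per_measurable [measurable]: "per \<in> borel_measurable borel"
 unfolding per_def by measurable

lemma per_periodic: "per (eta + int_vec l) = per eta"
proof -
 have bij: "bij_betw (%k. l + k) UNIV (UNIV :: (int ^ 'n) set)"
  by (rule bij_betw_byWitness[of _ "%k. k - l"]) auto
 have "per eta = (LINT k|lat. v (eta + int_vec (l + k)))"
  unfolding per_def by (rule integral_bij_count_space[OF bij, symmetric])
 then show ?thesis by (simp add: per_def int_vec_add add.assoc)
qed

lemma per_bounded: "\<exists>C\<ge>0. \<forall>eta. cmod (per eta) <= C"
proof -
 have bnd: "cmod (per eta) <= B * real (card {l. norm (int_vec l :: real ^ 'n) <= R + 1 + real CARD('n)})" (is "_ <= B * real (card ?L)")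
  if eta: "eta \<in> unit_cube" for eta
 proof -
  have "norm eta <= (\<Sum>i\<in>UNIV. \<bar>eta $ i\<bar>)" by (rule norm_le_l1_cart)
  also have "... <= (\<Sum>i\<in>(UNIV :: 'n set). 1)"
  proof (rule sum_mono)
   fix i show "\<bar>eta $ i\<bar> <= 1" using eta unfolding unit_cube_def by (smt (verit) field_sum_of_halves mem_Collect_eq)
  qed
  finally have n: "norm eta <= real CARD('n)" by simp
  have "per eta = (\<Sum>l\<in>?L. v (eta + int_vec l))"
   unfolding per_def
  proof (rule integral_lat_finite(1)[OF finite_lattice_ball])
   fix l assume "l \<notin> ?L"
   then have "norm (eta + int_vec l) > R"
    using n norm_triangle_ineq4[of "eta + int_vec l" "eta"] by (simp add: algebra_simps)
   then show "v (eta + int_vec l) = 0" by (rule v_support)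
  qed
  also have "cmod ... <= (\<Sum>l\<in>?L. B)" by (rule sum_norm_le) (rule v_bound)
  finally show ?thesis by (simp add: mult.commute)
 qed
 have "B \<ge> 0" using v_bound[of 0] norm_ge_zero order_trans by blast
 moreover have "cmod (per eta) <= B * real (card {l. norm (int_vec l :: real ^ 'n) <= R + 1 + real CARD('n)})" for eta
 proof -
  have "eta + int_vec (- near_int eta) \<in> unit_cube"
   using near_int_iff[of eta "near_int eta"] by (simp add: int_vec_minus)
  from bnd[OF this] show ?thesis by (simp only: per_periodic)
 qed
 ultimately show ?thesis
  by (intro exI[of _ "B * real (card {l. norm (int_vec l :: real ^ 'n) <= R + 1 + real CARD('n)})"]) simp
qed

lemma per_isCont:
 assumes "\<And>l. isCont v (eta + int_vec l)"
 shows "isCont per eta"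
proof -
 have "isCont (%\<zeta>. \<Sum>l | norm (eta + int_vec l) <= R + 1. v (\<zeta> + int_vec l)) eta"
 proof (rule continuous_sum)
  fix l
  have "isCont (%\<zeta>. \<zeta> + int_vec l) eta" by (intro continuous_intros)
  then show "isCont (%\<zeta>. v (\<zeta> + int_vec l)) eta" by (rule isCont_o2) (rule assms)
 qed
 moreover have "\<forall>\<^sub>F \<zeta> in nhds eta. (\<Sum>l | norm (eta + int_vec l) <= R + 1. v (\<zeta> + int_vec l)) = per \<zeta>"
  by (rule eventually_nhds_metric[THEN iffD2]) (auto simp: dist_norm per_eq intro!: exI[of _ 1])
 ultimately show ?thesis by (simp add: isCont_cong)
qed

lemma v_integrable: "integrable lborel v"
proof (rule Bochner_Integration.integrable_bound[of lborel "%x. indicator (cball 0 R) x * B"])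
 show "integrable lborel (%x :: real ^ 'n. indicator (cball 0 R) x * B)"
  by (intro integrable_mult_left integrable_real_indicator) (use emeasure_lborel_cball_finite in auto)
 show "AE x in lborel. norm (v x) <= norm (indicator (cball 0 R) x * B)"
 proof (intro AE_I2)
  fix x show "norm (v x) <= norm (indicator (cball 0 R) x * B)"
   using order_trans[OF v_bound abs_ge_self] v_support[of x] by (cases "norm x <= R") auto
 qed
qed simp

text \<open>The Fejer mean of \<open>per\<close> in unfolded form: the kernel is periodic, so the
  torus integral against \<open>per\<close> becomes an integral over space against v.\<close>

definition smooth :: "nat => real ^ 'n => complex" where
 "smooth n eta = (LINT \<zeta>|lborel. v \<zeta> * of_real (fejer n (\<zeta> - eta)))"

lemma v_fejer_integrable: "integrable lborel (%\<zeta>. v \<zeta> * of_real (fejer n (\<zeta> - eta)))"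
proof (rule Bochner_Integration.integrable_bound[of lborel "%\<zeta>. of_real (real (n ^ CARD('n))) * v \<zeta>"])
 show "integrable lborel (%\<zeta>. of_real (real (n ^ CARD('n))) * v \<zeta>)"
  by (intro integrable_mult_right v_integrable)
 show "AE \<zeta> in lborel. norm (v \<zeta> * of_real (fejer n (\<zeta> - eta))) <= norm (of_real (real (n ^ CARD('n))) * v \<zeta>)"
 proof (intro AE_I2)
  fix \<zeta>
  have "cmod (v \<zeta>) * fejer n (\<zeta> - eta) <= cmod (v \<zeta>) * real (n ^ CARD('n))"
   by (intro mult_left_mono fejer_le) simp
  then show "norm (v \<zeta> * of_real (fejer n (\<zeta> - eta))) <= norm (of_real (real (n ^ CARD('n))) * v \<zeta>)"
   unfolding norm_mult norm_of_real by (simp add: fejer_nonneg mult.commute)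
 qed
qed measurable

lemma smooth_eq_torus: "smooth n eta = (LINT \<tau>|torus. of_real (fejer n \<tau>) * per (\<tau> + eta))"
proof -
 have i: "integrable lborel (%\<zeta>. v (\<zeta> + eta) * of_real (fejer n \<zeta>))"
  using v_fejer_integrable[of n eta]
  by (subst (asm) integral_translate(2)[of _ eta, symmetric]) simp_all
 have "smooth n eta = (LINT \<zeta>|lborel. v (\<zeta> + eta) * of_real (fejer n \<zeta>))"
  unfolding smooth_def by (subst integral_translate(1)[of _ eta, symmetric]) simp_all
 also have "... = (LINT \<tau>|torus. (LINT l|lat. v (\<tau> + int_vec l + eta) * of_real (fejer n (\<tau> + int_vec l))))"
  by (rule integral_tile(3)[OF i, symmetric])
 also have "... = (LINT \<tau>|torus. of_real (fejer n \<tau>) * per (\<tau> + eta))"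
  by (intro Bochner_Integration.integral_cong refl) (simp add: fejer_periodic per_def add_ac)
 finally show ?thesis .
qed

lemma smooth_bounded:
 assumes C: "\<And>eta. cmod (per eta) <= C" and n: "n > 0"
 shows "cmod (smooth n eta) <= C"
proof -
 have "cmod (smooth n eta) <= (LINT \<tau>|torus. cmod (of_real (fejer n \<tau>) * per (\<tau> + eta)))"
  unfolding smooth_eq_torus by (rule integral_norm_bound)
 also have "... <= (LINT \<tau>|torus. fejer n (\<tau> :: real ^ 'n) * C)"
  using C integral_fejer[OF n, where 'n = 'n]
  by (intro integral_mono integrable_norm integrable_torus_fejer[of _ C] integrable_mult_left)
    (auto simp: norm_mult fejer_nonneg intro!: mult_left_mono)
 also have "... = C" using integral_fejer(1)[OF n, where 'n = 'n] by simp
 finally show ?thesis .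
qed

text \<open>Approximate identity: where \<open>per\<close> varies by less than e / 2 the kernel,
  having mass 1, contributes at most e / 2; the remaining mass is O(1 / n) and meets the bound 2
  C.\<close>

lemma smooth_tendsto:
 assumes cont: "isCont per eta"
 shows "(%n. smooth n eta) \<longlonglongrightarrow> per eta"
proof (rule LIMSEQ_I)
 fix e :: real assume e: "e > 0"
 obtain C where C: "C \<ge> 0" "\<And>eta. cmod (per eta) <= C" using per_bounded by blast
 from cont e obtain r where r: "r > 0" "\<And>\<zeta>. dist \<zeta> eta < r ==> dist (per \<zeta>) (per eta) < e / 2"
  unfolding continuous_at_eps_delta by (metis half_gt_zero)
 obtain D where D: "D \<ge> 0" "\<And>n. n > 0 ==> (LINT x|torus. fejer n (x :: real ^ 'n) * (if norm x \<ge> r then 1 else 0)) <= D / real n"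
  using fejer_concentration[OF r(1), where 'n = 'n] by blast
 obtain n0 :: nat where n0: "n0 > 0" "2 * C * D / e * 2 < real n0"
  using reals_Archimedean2[of "max 1 (2 * C * D / e * 2)"] by (metis max_less_iff_conj of_nat_0_less_iff zero_less_one less_trans)
 show "\<exists>no. \<forall>n\<ge>no. norm (smooth n eta - per eta) < e"
 proof (intro exI[of _ n0] allI impI)
  fix n assume "n0 <= n"
  then have n: "n > 0" "2 * C * D / e * 2 < real n" using n0 by auto
  note F = integral_fejer[OF n(1), where 'n = 'n]
  have iF: "integrable torus (%\<tau> :: real ^ 'n. fejer n \<tau> * (if norm \<tau> \<ge> r then 1 else 0))"
   by (rule Bochner_Integration.integrable_bound[OF F(2)]) (auto simp: fejer_nonneg)
  have i1: "integrable torus (%\<tau>. of_real (fejer n \<tau>) * per (\<tau> + eta))"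
   by (rule integrable_torus_fejer[of _ C]) (use C in auto)
  have i2: "integrable torus (%\<tau> :: real ^ 'n. of_real (fejer n \<tau>) * per eta)"
   by (rule integrable_torus_fejer[of _ C]) (use C in auto)
  have "(LINT \<tau>|torus. of_real (fejer n (\<tau> :: real ^ 'n)) * per eta) = (LINT \<tau>|torus. complex_of_real (fejer n (\<tau> :: real ^ 'n))) * per eta"
   by simp
  also have "... = per eta" using F(1) by simp
  finally have "(LINT \<tau>|torus. of_real (fejer n (\<tau> :: real ^ 'n)) * per eta) = per eta" .
  then have "smooth n eta - per eta = (LINT \<tau>|torus. of_real (fejer n \<tau>) * per (\<tau> + eta)) - (LINT \<tau>|torus. of_real (fejer n (\<tau> :: real ^ 'n)) * per eta)"
   by (simp add: smooth_eq_torus)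
  also have "... = (LINT \<tau>|torus. of_real (fejer n \<tau>) * per (\<tau> + eta) - of_real (fejer n \<tau>) * per eta)"
   by (rule Bochner_Integration.integral_diff[OF i1 i2, symmetric])
  also have "cmod ... <= (LINT \<tau>|torus. cmod (of_real (fejer n \<tau>) * per (\<tau> + eta) - of_real (fejer n \<tau>) * per eta))"
   by (rule integral_norm_bound)
  also have "... <= (LINT \<tau>|torus. fejer n (\<tau> :: real ^ 'n) * (e / 2) + (fejer n \<tau> * (if norm \<tau> \<ge> r then 1 else 0)) * (2 * C))"
  proof (rule integral_mono)
   fix \<tau> :: "real ^ 'n"
   have "cmod (of_real (fejer n \<tau>) * per (\<tau> + eta) - of_real (fejer n \<tau>) * per eta) = fejer n \<tau> * cmod (per (\<tau> + eta) - per eta)"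
    by (simp add: norm_mult fejer_nonneg right_diff_distrib[symmetric])
   moreover have "cmod (per (\<tau> + eta) - per eta) <= e / 2 + (if norm \<tau> \<ge> r then 1 else 0) * (2 * C)"
   proof (cases "norm \<tau> \<ge> r")
    case True
    then show ?thesis using norm_triangle_ineq4[of "per (\<tau> + eta)" "per eta"] C(2)[of "\<tau> + eta"] C(2)[of eta] e by simp
   next
    case False
    then show ?thesis using r(2)[of "\<tau> + eta"] by (simp add: dist_norm)
   qed
   then have "fejer n \<tau> * cmod (per (\<tau> + eta) - per eta) <= fejer n \<tau> * (e / 2 + (if norm \<tau> \<ge> r then 1 else 0) * (2 * C))"
    by (rule mult_left_mono) (rule fejer_nonneg)
   ultimately show "cmod (of_real (fejer n \<tau>) * per (\<tau> + eta) - of_real (fejer n \<tau>) * per eta)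
    <= fejer n \<tau> * (e / 2) + (fejer n \<tau> * (if norm \<tau> \<ge> r then 1 else 0)) * (2 * C)"
    by (simp only: distrib_left mult.assoc)
  qed (intro integrable_norm Bochner_Integration.integrable_diff i1 i2, intro Bochner_Integration.integrable_add integrable_mult_left F iF)
  also have "... = e / 2 + (LINT \<tau>|torus. fejer n (\<tau> :: real ^ 'n) * (if norm \<tau> \<ge> r then 1 else 0)) * (2 * C)"
   using F iF by (subst Bochner_Integration.integral_add) auto
  also have "... <= e / 2 + D / real n * (2 * C)"
   using D(2)[OF n(1)] C(1) by (intro add_left_mono mult_right_mono) auto
  also have "... < e"
  proof -
   have "D / real n * (2 * C) < e / 2" using n e by (simp add: field_simps)
   then show ?thesis by simp
  qed
  finally show "norm (smooth n eta - per eta) < e" .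
 qed
qed

lemma per_isCont_AE: "AE eta in lborel. isCont per eta"
proof -
 have "AE eta in lborel. \<forall>l. isCont v (eta + int_vec l)"
  by (subst AE_all_countable) (intro allI AE_lborel_translate v_cont)
 then show ?thesis by eventually_elim (rule per_isCont, simp)
qed

lemma smooth_measurable [measurable]: "smooth n \<in> borel_measurable borel"
 unfolding smooth_def by measurable

lemma integral_smooth_tendsto:
 assumes b: "integrable lborel b"
 shows "(%n. LINT eta|lborel. b eta * smooth n eta) \<longlonglongrightarrow> (LINT eta|lborel. b eta * per eta)"
proof -
 have [measurable]: "b \<in> borel_measurable borel" using borel_measurable_integrable[OF b] by simp
 obtain C where C: "C \<ge> 0" "\<And>eta. cmod (per eta) <= C" using per_bounded by blast
 have "(%n. LINT eta|lborel. b eta * smooth (Suc n) eta) \<longlonglongrightarrow> (LINT eta|lborel. b eta * per eta)"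
 proof (rule integral_dominated_convergence[of _ _ _ "%eta. cmod (b eta) * C"])
  show "AE eta in lborel. (%n. b eta * smooth (Suc n) eta) \<longlonglongrightarrow> b eta * per eta"
   using per_isCont_AE by eventually_elim (intro tendsto_mult tendsto_const LIMSEQ_Suc smooth_tendsto)
  show "AE eta in lborel. norm (b eta * smooth (Suc n) eta) <= cmod (b eta) * C" for n
   using smooth_bounded[OF C(2)] by (intro AE_I2) (simp add: norm_mult mult_left_mono)
 qed (use b in auto)
 then show ?thesis by (rule LIMSEQ_imp_Suc)
qed

text \<open>Opening the kernel as a double sum over the box leaves finitely many frequencies a - c,
  each occurring as often as \<open>fejer_weight\<close> counts. The finite sum is written as a
  lattice integral so that the limit in n can be taken by dominated convergence.\<close>

lemma integral_smooth:
 assumes b: "integrable lborel b"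
 shows "(LINT eta|lborel. b eta * smooth n eta)
  = (LINT k|lat. of_real (fejer_weight n k) * ((LINT \<zeta>|lborel. v \<zeta> * echar (int_vec k \<bullet> \<zeta>)) * (LINT eta|lborel. b eta * echar (- (int_vec k \<bullet> eta)))))"
proof -
 define D where "D k = (LINT \<zeta>|lborel. v \<zeta> * echar (int_vec k \<bullet> \<zeta>))" for k
 define E where "E k = (LINT eta|lborel. b eta * echar (- (int_vec k \<bullet> eta)))" for k
 have [measurable]: "b \<in> borel_measurable borel" using borel_measurable_integrable[OF b] by simp
 have iv: "integrable lborel (%\<zeta>. v \<zeta> * echar (g \<zeta>))" if [measurable]: "g \<in> borel_measurable borel" for g
  by (rule Bochner_Integration.integrable_bound[OF v_integrable]) (auto simp: norm_mult)
 have ib: "integrable lborel (%\<zeta>. b \<zeta> * echar (g \<zeta>))" if [measurable]: "g \<in> borel_measurable borel" for g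
  by (rule Bochner_Integration.integrable_bound[OF b]) (auto simp: norm_mult)
 have sm: "smooth n eta = (\<Sum>a\<in>int_box n. \<Sum>c\<in>int_box n. D (a - c) * echar (- (int_vec (a - c) \<bullet> eta))) / of_nat (n ^ CARD('n))" for eta
 proof -
  have "smooth n eta = (LINT \<zeta>|lborel. (\<Sum>a\<in>int_box n. \<Sum>c\<in>int_box n. v \<zeta> * echar (int_vec (a - c) \<bullet> \<zeta>) * echar (- (int_vec (a - c) \<bullet> eta))) / of_nat (n ^ CARD('n)))"
   unfolding smooth_def fejer_eq
   by (simp only: times_divide_eq_right sum_distrib_left inner_diff_right echar_diff echar_minus mult.assoc)
  also have "... = (\<Sum>a\<in>int_box n. \<Sum>c\<in>int_box n. (LINT \<zeta>|lborel. v \<zeta> * echar (int_vec (a - c) \<bullet> \<zeta>) * echar (- (int_vec (a - c) \<bullet> eta)))) / of_nat (n ^ CARD('n))"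
   by (simp add: Bochner_Integration.integral_sum Bochner_Integration.integrable_sum iv)
  finally show ?thesis by (simp add: D_def)
 qed
 have "(LINT eta|lborel. b eta * smooth n eta)
   = (LINT eta|lborel. (\<Sum>a\<in>int_box n. \<Sum>c\<in>int_box n. D (a - c) * (b eta * echar (- (int_vec (a - c) \<bullet> eta)))) / of_nat (n ^ CARD('n)))"
  by (simp only: sm times_divide_eq_right sum_distrib_left mult.left_commute)
 also have "... = (\<Sum>a\<in>int_box n. \<Sum>c\<in>int_box n. (LINT eta|lborel. D (a - c) * (b eta * echar (- (int_vec (a - c) \<bullet> eta))))) / of_nat (n ^ CARD('n))"
  by (simp add: Bochner_Integration.integral_sum Bochner_Integration.integrable_sum ib)
 also have "... = (\<Sum>a\<in>int_box n. \<Sum>c\<in>int_box n. (LINT k|lat. of_bool (k = a - c) * (D k * E k))) / of_nat (n ^ CARD('n))"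
 proof -
  have "(LINT k|lat. of_bool (k = a - c) * (D k * E k)) = D (a - c) * E (a - c)" for a c
   by (subst integral_lat_finite(1)[of "{a - c}"]) auto
  then show ?thesis by (simp add: E_def)
 qed
 also have "... = (LINT k|lat. (\<Sum>a\<in>int_box n. \<Sum>c\<in>int_box n. of_bool (k = a - c) * (D k * E k)) / of_nat (n ^ CARD('n)))"
 proof -
  have i: "integrable lat (%k. of_bool (k = a - c) * (D k * E k))" for a c
   by (rule integral_lat_finite(2)[of "{a - c}"]) auto
  show ?thesis
   unfolding integral_divide_zero
   by (subst Bochner_Integration.integral_sum[OF Bochner_Integration.integrable_sum[OF i]],
     subst Bochner_Integration.integral_sum[OF i]) (rule refl)
 qed
 also have "... = (LINT k|lat. of_real (fejer_weight n k) * (D k * E k))"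
 proof -
  have "complex_of_real (of_bool P) = of_bool P" for P by simp
  then show ?thesis
   by (simp only: fejer_weight_def of_real_divide of_real_sum of_real_of_nat_eq times_divide_eq_left sum_distrib_right)
 qed
 finally show ?thesis by (simp add: D_def E_def)
qed

text \<open>Both sides are limits of the pairing of b with Fejer means: on the left by dominated
  convergence, on the right because the weights are at most 1, tend to 1, and the series converges
  absolutely by assumption. Pairing with an integrable b replaces pointwise convergence of the
  series, for which v may be too rough.\<close>

theorem poisson:
 assumes b: "integrable lborel b"
  and sum: "integrable lat (%k. (LINT \<zeta>|lborel. v \<zeta> * echar (int_vec k \<bullet> \<zeta>)) * (LINT eta|lborel. b eta * echar (- (int_vec k \<bullet> eta))))"
 shows "(LINT eta|lborel. b eta * per eta)
  = (LINT k|lat. (LINT \<zeta>|lborel. v \<zeta> * echar (int_vec k \<bullet> \<zeta>)) * (LINT eta|lborel. b eta * echar (- (int_vec k \<bullet> eta))))"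
proof (rule LIMSEQ_unique)
 let ?g = "%k. (LINT \<zeta>|lborel. v \<zeta> * echar (int_vec k \<bullet> \<zeta>)) * (LINT eta|lborel. b eta * echar (- (int_vec k \<bullet> eta)))"
 show "(%n. LINT eta|lborel. b eta * smooth n eta) \<longlonglongrightarrow> (LINT eta|lborel. b eta * per eta)"
  by (rule integral_smooth_tendsto[OF b])
 have "(%n. LINT k|lat. of_real (fejer_weight (Suc n) k) * ?g k) \<longlonglongrightarrow> (LINT k|lat. ?g k)"
 proof (rule integral_dominated_convergence[of _ _ _ "%k. cmod (?g k)"])
  have "(%n. of_real (fejer_weight (Suc n) k) * ?g k) \<longlonglongrightarrow> of_real 1 * ?g k" for k
   by (intro tendsto_mult tendsto_const tendsto_of_real LIMSEQ_Suc fejer_weight_tendsto)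
  then show "AE k in lat. (%n. of_real (fejer_weight (Suc n) k) * ?g k) \<longlonglongrightarrow> ?g k" by simp
  show "AE k in lat. norm (of_real (fejer_weight (Suc n) k) * ?g k) <= cmod (?g k)" for n
  proof (intro AE_I2)
   fix k show "norm (of_real (fejer_weight (Suc n) k) * ?g k) <= cmod (?g k)"
    using fejer_weight_bounds[of "Suc n" k] by (subst norm_mult) (simp add: mult_left_le_one_le)
  qed
 qed (use sum in auto)
 then show "(%n. LINT eta|lborel. b eta * smooth n eta) \<longlonglongrightarrow> (LINT k|lat. ?g k)"
  unfolding integral_smooth[OF b] by (rule LIMSEQ_imp_Suc)
qed

end

section \<open>The Fourier transform of integrable functions\<close>

lemma integrable_mult_bounded:
 fixes b :: "'a => complex"
 assumes b: "integrable M b" and [measurable]: "u \<in> borel_measurable M" and u: "\<And>x. cmod (u x) <= C"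
 shows "integrable M (%x. b x * u x)"
proof (rule Bochner_Integration.integrable_bound[of M "%x. of_real C * b x"])
 have "0 <= C" using u norm_ge_zero order_trans by blast
 then show "AE x in M. norm (b x * u x) <= norm (of_real C * b x)"
  by (intro AE_I2) (simp add: norm_mult mult.commute[of C] mult_left_mono u)
qed (use b in auto)

section \<open>Uniqueness of Fourier transforms\<close>

lemma AE_zero_if_box_integrals_zero:
 fixes w :: "real ^ 'n => complex"
 assumes w: "integrable lborel w"
  and box: "\<And>l r. (LINT x|lborel. w x * indicator (box l r) x) = 0"
 shows "AE x in lborel. w x = 0"
proof -
 let ?Z = "%A. (LINT x:A|lborel. w x) = 0"
 have si: "set_integrable lborel A w" if "A \<in> sets borel" for A
  using w that unfolding set_integrable_def by (intro integrable_mult_indicator) auto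
 have box0: "?Z (box l r)" for l r
  using box[of l r] by (simp add: set_lebesgue_integral_def scaleR_conv_of_real mult.commute of_real_indicator)
 \<comment> \<open>Boxes generate the Borel sets and are stable under intersection, so vanishing
   passes to complements and disjoint unions. The complement case needs the whole space, which
   growing cubes exhaust.\<close>
 have Z: "?Z A" if "A \<in> sigma_sets UNIV (range (%(l, r). box l r :: (real ^ 'n) set))" for A
 proof (rule sigma_sets_induct_disjoint[OF _ _ that])
  show "Int_stable (range (%(l, r). box l r :: (real ^ 'n) set))"
  proof (clarsimp simp: Int_stable_def image_iff)
   fix a b c d :: "real ^ 'n"
   show "\<exists>e f. box a b \<inter> box c d = box e f" by (subst box_Int_box) blast
  qed
  have UNIV0: "?Z UNIV"
  proof (rule LIMSEQ_unique)
   let ?B = "%n :: nat. box (- (\<chi> i. real n)) (\<chi> i. real n) :: (real ^ 'n) set"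
   show "(%n. LINT x:?B n|lborel. w x) \<longlonglongrightarrow> 0" by (simp add: box0)
   show "(%n. LINT x:?B n|lborel. w x) \<longlonglongrightarrow> (LINT x:UNIV|lborel. w x)"
    unfolding set_lebesgue_integral_def
   proof (rule integral_dominated_convergence[of _ _ _ "%x. norm (w x)"])
    show "AE x in lborel. (%n. indicator (?B n) x *\<^sub>R w x) \<longlonglongrightarrow> indicator UNIV x *\<^sub>R w x"
    proof (intro AE_I2 tendsto_scaleR tendsto_const)
     fix x :: "real ^ 'n"
     obtain N :: nat where N: "norm x < real N" using reals_Archimedean2 by blast
     have "x \<in> ?B n" if "n \<ge> N" for n
     proof -
      have "\<bar>x $ i\<bar> < real n" for i using component_le_norm_cart[of x i] N that by linarith
      then show ?thesis by (auto simp: mem_box_cart abs_less_iff minus_less_iff)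
     qed
     then have "\<forall>\<^sub>F n in sequentially. indicator (?B n) x = (indicator UNIV x :: real)"
      by (intro eventually_sequentiallyI[of N]) auto
     then show "(%n. indicator (?B n) x :: real) \<longlonglongrightarrow> indicator UNIV x"
      by (rule tendsto_eventually)
    qed
   qed (use w in \<open>auto split: split_indicator\<close>)
  qed
  fix A assume "A \<in> sigma_sets UNIV (range (%(l, r). box l r :: (real ^ 'n) set))" and A0: "?Z A"
  then have A: "A \<in> sets borel" by (simp add: borel_eq_box)
  have "(LINT x:A \<union> (UNIV - A)|lborel. w x) = (LINT x:A|lborel. w x) + (LINT x:UNIV - A|lborel. w x)"
   using A by (intro set_integral_Un si) auto
  then show "?Z (UNIV - A)" using A0 UNIV0 by (simp add: Un_absorb1)
 next
  fix A :: "nat => (real ^ 'n) set"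
  assume d: "disjoint_family A" and "range A \<subseteq> sigma_sets UNIV (range (%(l, r). box l r :: (real ^ 'n) set))"
   and A0: "\<And>i. ?Z (A i)"
  then have A: "A i \<in> sets borel" for i by (auto simp: borel_eq_box)
  have "(LINT x:(\<Union>i. A i)|lborel. w x) = (\<Sum>i. (LINT x:A i|lborel. w x))"
   by (rule lebesgue_integral_countable_add) (use A d in \<open>auto intro!: si simp: disjoint_family_on_def\<close>)
  then show "?Z (\<Union>i. A i)" using A0 by simp
 qed (auto simp: box0[unfolded set_lebesgue_integral_def] set_lebesgue_integral_def)
 have "AE x in lborel. w x = (%_. 0) x"
  by (rule sigma_finite_measure.density_unique_banach[OF sigma_finite_lborel]) (use w Z in \<open>auto simp: borel_eq_box\<close>)
 then show ?thesis by simp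
qed

text \<open>Poisson summation for the indicator of a box modulated by \<tau>: all coefficients of w
  vanish, so w annihilates, for every \<tau>, the sum over k of the indicator at eta + k times echar
  (- \<tau> \<bullet> k). Averaging over \<tau> in the torus retains k = 0 alone, and the integral
  of w over the box is 0.\<close>

theorem fourier_injective:
 fixes w :: "real ^ 'n => complex"
 assumes w: "integrable lborel w"
  and zero: "\<And>xi. (LINT eta|lborel. w eta * echar (- (xi \<bullet> eta))) = 0"
 shows "AE x in lborel. w x = 0"
proof (rule AE_zero_if_box_integrals_zero[OF w])
 fix l r :: "real ^ 'n"
 have [measurable]: "w \<in> borel_measurable borel" using borel_measurable_integrable[OF w] by simp
 let ?I = "%x. indicator (box l r) x :: complex"
 obtain R where R: "\<And>x. x \<in> box l r ==> norm x <= R"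
  using bounded_box[of l r] unfolding bounded_iff by blast
 have ae: "AE x in lborel. isCont (%x. ?I x * echar (- (\<tau> \<bullet> x))) x" for \<tau>
 proof -
  have "negligible (frontier (box l r))" by (intro negligible_convex_frontier convex_box)
  then have "frontier (box l r) \<in> null_sets lborel"
   by (auto simp: negligible_iff_null_sets null_sets_def)
  then have "AE x in lborel. x \<notin> frontier (box l r)" by (rule AE_not_in)
  then show ?thesis
  proof eventually_elim
   fix x assume "x \<notin> frontier (box l r)"
   then have "isCont (indicator (box l r) :: _ => real) x" by (simp add: isCont_indicator)
   then have "isCont (%x. complex_of_real (indicator (box l r) x)) x" by (intro continuous_intros)
   moreover have "isCont (%x. echar (- (\<tau> \<bullet> x))) x"
    by (rule continuous_on_interior[of UNIV]) (auto intro!: continuous_intros)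
   ultimately show "isCont (%x. ?I x * echar (- (\<tau> \<bullet> x))) x"
    by (simp add: of_real_indicator continuous_mult)
  qed
 qed
 have P: "periodization (%x. ?I x * echar (- (\<tau> \<bullet> x))) R 1" for \<tau>
 proof
  show "cmod (?I x * echar (- (\<tau> \<bullet> x))) <= 1" for x by (auto simp: norm_mult split: split_indicator)
  show "norm x > R ==> ?I x * echar (- (\<tau> \<bullet> x)) = 0" for x using R[of x] by (auto split: split_indicator)
 qed (use ae in auto)
 \<comment> \<open>The periodization of the modulated indicator without its unimodular factor echar
   (- \<tau> \<bullet> eta). Its modulus is at most \<open>S 0 eta\<close>, which yields the bound
   uniform in \<tau> that Fubini needs.\<close>
 define S where "S \<tau> eta = (LINT k|lat. ?I (eta + int_vec k) * echar (- (\<tau> \<bullet> int_vec k)))" for \<tau> eta :: "real ^ 'n"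
 have [measurable]: "(%(\<tau>, eta). S \<tau> eta) \<in> borel_measurable (torus \<Otimes>\<^sub>M lborel)"
  unfolding S_def by measurable
 have per: "periodization.per (%x. ?I x * echar (- (\<tau> \<bullet> x))) eta = S \<tau> eta * echar (- (\<tau> \<bullet> eta))" for \<tau> eta
  unfolding periodization.per_def[OF P] S_def
  by (subst integral_mult_left_zero[symmetric]) (simp add: inner_right_distrib echar_add[symmetric] add.commute mult.assoc)
 obtain C where C: "\<And>eta. cmod (periodization.per (%x. ?I x * echar (- (0 \<bullet> x))) eta) <= C"
  using periodization.per_bounded[OF P[of 0]] by blast
 have SC: "cmod (S \<tau> eta) <= C" for \<tau> eta
 proof -
  have i: "integrable lat (%k. ?I (eta + int_vec k))"
   using periodization.integrable_lat_v[OF P[of 0], of eta] by simp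
  have "cmod (S \<tau> eta) <= (LINT k|lat. cmod (?I (eta + int_vec k) * echar (- (\<tau> \<bullet> int_vec k))))"
   unfolding S_def by (rule integral_norm_bound)
  also have "... = (LINT k|lat. Re (?I (eta + int_vec k)))"
   by (intro Bochner_Integration.integral_cong refl) (auto simp: norm_mult split: split_indicator)
  also have "... = Re (S 0 eta)" unfolding S_def using integral_Re[OF i] by simp
  also have "... <= C" using C[of eta] complex_Re_le_cmod[of "S 0 eta"] by (simp add: per[of 0, simplified])
  finally show ?thesis .
 qed
 have zero': "(LINT eta|lborel. w eta * S \<tau> eta) = 0" for \<tau>
 proof -
  have i: "integrable lborel (%eta. w eta * echar (\<tau> \<bullet> eta))"
   by (rule integrable_mult_bounded[OF w, of _ 1]) auto
  have z: "(LINT eta|lborel. (w eta * echar (\<tau> \<bullet> eta)) * echar (- (int_vec k \<bullet> eta))) = 0" for k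
   using zero[of "int_vec k - \<tau>"] by (simp add: mult.assoc echar_add[symmetric] inner_diff_left)
  have "(LINT eta|lborel. (w eta * echar (\<tau> \<bullet> eta)) * periodization.per (%x. ?I x * echar (- (\<tau> \<bullet> x))) eta) = 0"
   by (subst periodization.poisson[OF P i]) (simp_all add: z)
  moreover have "w eta * echar (\<tau> \<bullet> eta) * (S \<tau> eta * echar (- (\<tau> \<bullet> eta))) = w eta * S \<tau> eta" for eta
   by (simp only: mult.assoc mult.left_commute[of _ "S \<tau> eta"] echar_add[symmetric]) simp
  ultimately show ?thesis by (simp only: per)
 qed
 interpret TL: pair_sigma_finite "torus :: (real ^ 'n) measure" "lborel :: (real ^ 'n) measure" ..
 have int: "integrable (torus \<Otimes>\<^sub>M lborel) (%(\<tau>, eta). w eta * S \<tau> eta)"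
 proof (rule TL.Fubini_integrable)
  have wS: "integrable lborel (%eta. w eta * S \<tau> eta)" for \<tau>
   by (rule integrable_mult_bounded[OF w _ SC]) (simp add: S_def)
  then show "AE \<tau> in torus. integrable lborel (%eta. case (\<tau>, eta) of (\<tau>, eta) => w eta * S \<tau> eta)" by simp
  show "integrable torus (%\<tau>. LINT eta|lborel. norm (case (\<tau>, eta) of (\<tau>, eta) => w eta * S \<tau> eta))"
  proof (rule torus.integrable_const_bound[of _ "LINT eta|lborel. cmod (w eta) * C"])
   have "(LINT eta|lborel. cmod (w eta * S \<tau> eta)) <= (LINT eta|lborel. cmod (w eta) * C)" for \<tau>
    by (intro integral_mono integrable_norm wS integrable_mult_left w)
      (simp add: norm_mult mult_left_mono SC)
   then show "AE \<tau> in torus. norm (LINT eta|lborel. norm (case (\<tau>, eta) of (\<tau>, eta) => w eta * S \<tau> eta)) <= (LINT eta|lborel. cmod (w eta) * C)"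
    by simp
  qed measurable
 qed measurable
 have inner: "(LINT \<tau>|torus. S \<tau> eta) = ?I eta" for eta
 proof -
  let ?L = "{k. norm (eta + int_vec k) <= R + 1}"
  have fin: "finite ?L" using periodization.near_support[OF P[of 0]] .
  have "S \<tau> eta = (\<Sum>k\<in>insert 0 ?L. ?I (eta + int_vec k) * echar (int_vec (- k) \<bullet> \<tau>))" for \<tau>
  proof -
   have "?I (eta + int_vec k) * echar (- (\<tau> \<bullet> int_vec k)) = 0" if "k \<notin> insert 0 ?L" for k
   proof -
    have "norm (eta + int_vec k) > R + 1" using that by simp
    then have "eta + int_vec k \<notin> box l r" using R[of "eta + int_vec k"] by linarith
    then show ?thesis by simp
   qed
   then have "S \<tau> eta = (\<Sum>k\<in>insert 0 ?L. ?I (eta + int_vec k) * echar (- (\<tau> \<bullet> int_vec k)))"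
    unfolding S_def by (intro integral_lat_finite(1)) (use fin in auto)
   then show ?thesis by (simp add: int_vec_minus inner_commute)
  qed
  then have "(LINT \<tau>|torus. S \<tau> eta) = (\<Sum>k\<in>insert 0 ?L. (LINT \<tau>|torus. ?I (eta + int_vec k) * echar (int_vec (- k) \<bullet> \<tau>)))"
   by (simp only:, intro Bochner_Integration.integral_sum integrable_torus_bounded[of _ 1])
     (auto simp: norm_mult split: split_indicator)
  also have "... = (\<Sum>k\<in>insert 0 ?L. if k = 0 then ?I eta else 0)"
   by (intro sum.cong refl) (simp add: integral_torus_echar)
  also have "... = ?I eta" using fin by (subst sum.delta) auto
  finally show ?thesis .
 qed
 have "0 = (LINT \<tau>|torus. (LINT eta|lborel. w eta * S \<tau> eta))" by (simp add: zero')
 also have "... = (LINT eta|lborel. (LINT \<tau>|torus. w eta * S \<tau> eta))"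
  by (rule TL.Fubini_integral[OF int, symmetric])
 also have "... = (LINT eta|lborel. w eta * ?I eta)" by (simp add: inner)
 finally show "(LINT x|lborel. w x * ?I x) = 0" by simp
qed

section \<open>Plancherel's inequality on Euclidean space\<close>

definition ift :: "(real ^ 'n => complex) => real ^ 'n => complex" where
 "ift b x = (LINT xi|lborel. b xi * echar (x \<bullet> xi))"

lemma integrable_mult_echar:
 fixes b :: "real ^ 'n => complex"
 shows "integrable lborel b ==> g \<in> borel_measurable borel ==> integrable lborel (%xi. b xi * echar (g xi))"
 by (rule integrable_mult_bounded[of _ _ _ 1]) auto

text \<open>Absolute summability makes S bounded, so sums and torus integrals may be interchanged.
  The coefficients of S are then \<open>a\<close>, and integrating S times its conjugate term by
  term gives the identity.\<close>

lemma parseval_le: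
 fixes a :: "int ^ 'n => complex"
 assumes a: "integrable lat a"
 shows "(\<integral>\<^sup>+y. ennreal ((cmod (LINT l|lat. a l * echar (int_vec l \<bullet> y)))\<^sup>2) \<partial>torus) = (\<integral>\<^sup>+l. ennreal ((cmod (a l))\<^sup>2) \<partial>lat)"
proof -
 define S where "S y = (LINT l|lat. a l * echar (int_vec l \<bullet> y))" for y
 have [measurable]: "S \<in> borel_measurable borel" unfolding S_def by measurable
 define A where "A = (LINT l|lat. cmod (a l))"
 have SA: "cmod (S y) <= A" for y
  unfolding S_def A_def by (rule order_trans[OF integral_norm_bound]) (simp add: norm_mult)
 have iSe: "integrable torus (%y. S y * echar (- (int_vec l \<bullet> y)))" for l
  by (rule integrable_torus_bounded[of _ A]) (auto simp: norm_mult SA)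
 have prod_int: "integrable (torus \<Otimes>\<^sub>M lat) (%(y, l). U y * (c l * echar (g l y)))"
  if U[measurable]: "U \<in> borel_measurable borel" "\<And>y. cmod (U y) <= B" and c: "integrable lat c"
   and g[measurable]: "(%(l, y). g l y) \<in> borel_measurable (lat \<Otimes>\<^sub>M borel)"
  for U :: "real ^ 'n => complex" and c :: "int ^ 'n => complex" and B and g :: "int ^ 'n => real ^ 'n => real"
 proof (rule torus_lat.Fubini_integrable)
  have i: "integrable lat (%l. U y * (c l * echar (g l y)))" for y
   by (intro integrable_mult_right integrable_mult_bounded[OF c, of _ 1]) auto
  then show "AE y in torus. integrable lat (%l. case (y, l) of (y, l) => U y * (c l * echar (g l y)))" by simp
  show "integrable torus (%y. LINT l|lat. norm (case (y, l) of (y, l) => U y * (c l * echar (g l y))))"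
  proof (rule torus.integrable_const_bound[of _ "B * (LINT l|lat. cmod (c l))"])
   have "\<bar>LINT l|lat. cmod (U y * (c l * echar (g l y)))\<bar> <= B * (LINT l|lat. cmod (c l))" for y
    by (simp add: norm_mult mult_right_mono U(2))
   then show "AE y in torus. norm (LINT l|lat. norm (case (y, l) of (y, l) => U y * (c l * echar (g l y)))) <= B * (LINT l|lat. cmod (c l))"
    by simp
  qed measurable
 qed measurable
 have coeff: "(LINT y|torus. S y * echar (- (int_vec m \<bullet> y))) = a m" for m
 proof -
  have int: "integrable (torus \<Otimes>\<^sub>M lat) (%(y, l). 1 * (a l * echar (int_vec (l - m) \<bullet> y)))"
   by (rule prod_int[of _ 1, OF _ _ a]) auto
  have "(LINT y|torus. S y * echar (- (int_vec m \<bullet> y))) = (LINT y|torus. (LINT l|lat. 1 * (a l * echar (int_vec (l - m) \<bullet> y))))"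
   unfolding S_def
   by (intro Bochner_Integration.integral_cong refl, subst integral_mult_left_zero[symmetric])
     (simp add: mult.assoc echar_add[symmetric] int_vec_diff inner_diff_left)
  also have "... = (LINT l|lat. (LINT y|torus. 1 * (a l * echar (int_vec (l - m) \<bullet> y))))"
   by (rule torus_lat.Fubini_integral[OF int, symmetric])
  also have "... = (LINT l|lat. a l * (if l = m then 1 else 0))" by (simp add: integral_torus_echar)
  also have "... = a m" by (subst integral_lat_finite(1)[of "{m}"]) auto
  finally show ?thesis .
 qed
 have int2: "integrable (torus \<Otimes>\<^sub>M lat) (%(y, l). S y * (cnj (a l) * echar (- (int_vec l \<bullet> y))))"
  by (rule prod_int[OF _ SA]) (use a in auto)
 have "(LINT y|torus. S y * cnj (S y)) = (LINT y|torus. (LINT l|lat. S y * (cnj (a l) * echar (- (int_vec l \<bullet> y)))))"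
 proof (intro Bochner_Integration.integral_cong refl)
  fix y
  have "cnj (S y) = (LINT l|lat. cnj (a l) * echar (- (int_vec l \<bullet> y)))"
   unfolding S_def echar_minus complex_cnj_mult[symmetric] by (rule Bochner_Integration.integral_cnj[symmetric])
  then show "S y * cnj (S y) = (LINT l|lat. S y * (cnj (a l) * echar (- (int_vec l \<bullet> y))))" by simp
 qed
 also have "... = (LINT l|lat. (LINT y|torus. S y * (cnj (a l) * echar (- (int_vec l \<bullet> y)))))"
  by (rule torus_lat.Fubini_integral[OF int2, symmetric])
 also have "... = (LINT l|lat. cnj (a l) * (LINT y|torus. S y * echar (- (int_vec l \<bullet> y))))"
  by (simp only: integral_mult_right_zero[symmetric] mult.left_commute)
 also have "... = (LINT l|lat. cnj (a l) * a l)" by (simp add: coeff)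
 finally have eq: "(LINT y|torus. S y * cnj (S y)) = (LINT l|lat. cnj (a l) * a l)" .
 have nrm: "(cmod z)\<^sup>2 = Re (z * cnj z)" "(cmod z)\<^sup>2 = Re (cnj z * z)" for z
  by (subst cmod_power2, simp add: power2_eq_square)+
 have iSS: "integrable torus (%y. S y * cnj (S y))"
  by (rule integrable_torus_bounded[of _ "A * A"]) (auto simp: norm_mult intro!: mult_mono SA order_trans[OF norm_ge_zero SA])
 have iaa: "integrable lat (%l. cnj (a l) * a l)"
 proof (rule integrable_mult_bounded[of _ _ _ A])
  show "cmod (a l) <= A" for l
  proof -
   have "ennreal (cmod (a l)) = (\<integral>\<^sup>+k. ennreal (cmod (a k)) * indicator {l} k \<partial>lat)"
    by (rule nn_integral_lat_single[symmetric])
   also have "... <= (\<integral>\<^sup>+k. ennreal (cmod (a k)) \<partial>lat)"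
    by (intro nn_integral_mono) (auto split: split_indicator)
   also have "... = ennreal A"
    unfolding A_def by (rule nn_integral_eq_integral) (use a in auto)
   finally show ?thesis by (simp add: A_def integral_nonneg_AE)
  qed
 qed (use a in auto)
 have "(\<integral>\<^sup>+y. ennreal ((cmod (S y))\<^sup>2) \<partial>torus) = ennreal (LINT y|torus. Re (S y * cnj (S y)))"
  unfolding nrm(1) by (rule nn_integral_eq_integral) (use integrable_Re[OF iSS] in auto)
 also have "... = ennreal (LINT l|lat. Re (cnj (a l) * a l))"
  using eq integral_Re[OF iSS] integral_Re[OF iaa] by simp
 also have "... = (\<integral>\<^sup>+l. ennreal ((cmod (a l))\<^sup>2) \<partial>lat)"
  unfolding nrm(2) by (rule nn_integral_eq_integral[symmetric]) (use integrable_Re[OF iaa] in auto)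
 finally show ?thesis by (simp add: S_def)
qed

text \<open>The Zak transform \<open>P y xi\<close> of b splits the claim into two facts about the
  torus. For fixed y its Fourier coefficients in xi are the values of the transform on the coset of
  y, to which Bessel applies; for almost every xi it is, up to a unimodular factor, a Fourier series
  in y with coefficients b(xi + l), to which Parseval applies.\<close>

theorem plancherel_le:
 fixes b :: "real ^ 'n => complex"
 assumes b: "integrable lborel b"
 shows "(\<integral>\<^sup>+x. ennreal ((cmod (LINT xi|lborel. b xi * echar (x \<bullet> xi)))\<^sup>2) \<partial>lborel) <= (\<integral>\<^sup>+xi. ennreal ((cmod (b xi))\<^sup>2) \<partial>lborel)"
proof -
 have [measurable]: "b \<in> borel_measurable borel" using borel_measurable_integrable[OF b] by simp
 define B where "B x = (LINT xi|lborel. b xi * echar (x \<bullet> xi))" for x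
 define P where "P y xi = (LINT l|lat. b (xi + int_vec l) * echar (y \<bullet> (xi + int_vec l)))" for y xi :: "real ^ 'n"
 have [measurable]: "(%(y, xi). P y xi) \<in> borel_measurable (torus \<Otimes>\<^sub>M torus)" unfolding P_def by measurable
 have [measurable]: "B \<in> borel_measurable borel" unfolding B_def by measurable
 interpret TT: pair_sigma_finite "torus :: (real ^ 'n) measure" "torus :: (real ^ 'n) measure" ..
 have BP: "B (y + int_vec (- k)) = (LINT xi|torus. P y xi * echar (- (int_vec k \<bullet> xi)))" for y k
 proof -
  have i: "integrable lborel (%xi. b xi * echar ((y + int_vec (- k)) \<bullet> xi))"
   by (rule integrable_mult_echar[OF b]) simp
  have "B (y + int_vec (- k)) = (LINT xi|torus. (LINT l|lat. b (xi + int_vec l) * echar ((y + int_vec (- k)) \<bullet> (xi + int_vec l))))"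
   unfolding B_def by (rule integral_tile(3)[OF i, symmetric])
  also have "... = (LINT xi|torus. P y xi * echar (- (int_vec k \<bullet> xi)))"
  proof (intro Bochner_Integration.integral_cong refl)
   fix xi
   have "echar ((y + int_vec (- k)) \<bullet> (xi + int_vec l)) = echar (y \<bullet> (xi + int_vec l)) * echar (- (int_vec k \<bullet> xi))" for l
   proof -
    have "echar ((y + int_vec (- k)) \<bullet> (xi + int_vec l)) = echar (y \<bullet> (xi + int_vec l)) * echar (- (int_vec k \<bullet> xi)) * echar (int_vec (- k) \<bullet> int_vec l)"
     by (simp only: echar_add[symmetric]) (simp add: int_vec_minus inner_simps algebra_simps)
    then show ?thesis by simp
   qed
   then show "(LINT l|lat. b (xi + int_vec l) * echar ((y + int_vec (- k)) \<bullet> (xi + int_vec l))) = P y xi * echar (- (int_vec k \<bullet> xi))"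
    unfolding P_def by (subst integral_mult_left_zero[symmetric]) (simp add: mult.assoc)
  qed
  finally show ?thesis .
 qed
 have iP: "integrable torus (P y)" for y
  unfolding P_def by (rule integral_tile(2)) (rule integrable_mult_echar[OF b], simp)
 have bij: "bij_betw uminus UNIV (UNIV :: (int ^ 'n) set)" by (rule bij_uminus)
 have "(\<integral>\<^sup>+x. ennreal ((cmod (B x))\<^sup>2) \<partial>lborel) = (\<integral>\<^sup>+y. (\<integral>\<^sup>+k. ennreal ((cmod (B (y + int_vec k)))\<^sup>2) \<partial>lat) \<partial>torus)"
  by (rule nn_integral_tile[symmetric]) measurable
 also have "... = (\<integral>\<^sup>+y. (\<integral>\<^sup>+k. ennreal ((cmod (B (y + int_vec (- k))))\<^sup>2) \<partial>lat) \<partial>torus)"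
  by (intro nn_integral_cong nn_integral_bij_count_space[OF bij, symmetric])
 also have "... <= (\<integral>\<^sup>+y. (\<integral>\<^sup>+xi. ennreal ((cmod (P y xi))\<^sup>2) \<partial>torus) \<partial>torus)"
  unfolding BP by (intro nn_integral_mono bessel iP)
 also have "... = (\<integral>\<^sup>+xi. (\<integral>\<^sup>+y. ennreal ((cmod (P y xi))\<^sup>2) \<partial>torus) \<partial>torus)"
  by (rule TT.Fubini'[symmetric]) measurable
 also have "... = (\<integral>\<^sup>+xi. (\<integral>\<^sup>+l. ennreal ((cmod (b (xi + int_vec l)))\<^sup>2) \<partial>lat) \<partial>torus)"
 proof (rule nn_integral_cong_AE)
  show "AE xi in torus. (\<integral>\<^sup>+y. ennreal ((cmod (P y xi))\<^sup>2) \<partial>torus) = (\<integral>\<^sup>+l. ennreal ((cmod (b (xi + int_vec l)))\<^sup>2) \<partial>lat)"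
   using integral_tile(1)[OF b]
  proof eventually_elim
   fix xi assume i: "integrable lat (%l. b (xi + int_vec l))"
   have "P y xi = echar (y \<bullet> xi) * (LINT l|lat. b (xi + int_vec l) * echar (int_vec l \<bullet> y))" for y
    unfolding P_def by (subst integral_mult_right_zero[symmetric])
     (simp add: inner_right_distrib echar_add inner_commute mult_ac)
   then show "(\<integral>\<^sup>+y. ennreal ((cmod (P y xi))\<^sup>2) \<partial>torus) = (\<integral>\<^sup>+l. ennreal ((cmod (b (xi + int_vec l)))\<^sup>2) \<partial>lat)"
    using parseval_le[OF i] by (simp add: norm_mult)
  qed
 qed
 also have "... = (\<integral>\<^sup>+xi. ennreal ((cmod (b xi))\<^sup>2) \<partial>lborel)"
  by (rule nn_integral_tile) measurable
 finally show ?thesis by (simp add: B_def)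
qed

interpretation space_hy: L1_L2_kernel "lborel :: (real ^ 'n) measure" "lborel :: (real ^ 'n) measure" "%x xi. echar (x \<bullet> xi)"
proof
 show "(%(x :: real ^ 'n, xi). echar (x \<bullet> xi)) \<in> borel_measurable (lborel \<Otimes>\<^sub>M lborel)" by measurable
qed (auto intro: plancherel_le)

section \<open>Gaussian test functions\<close>

lemma integral_lebesgue_lborel:
 fixes u :: "'a::euclidean_space => complex"
 assumes "u \<in> borel_measurable borel"
 shows "(LINT x|lebesgue. u x) = (LINT x|lborel. u x)" "integrable lebesgue u \<longleftrightarrow> integrable lborel u"
 using assms integral_completion[of u lborel] integrable_completion[of u lborel] by auto

lemma borel_version:
 fixes f :: "'a::euclidean_space => complex"
 assumes f: "f \<in> borel_measurable lebesgue"
 obtains g where "g \<in> borel_measurable borel" "AE x in lebesgue. f x = g x"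
proof -
 from f have "(%x. Re (f x)) \<in> borel_measurable lebesgue" "(%x. Im (f x)) \<in> borel_measurable lebesgue" by auto
 from this[THEN completion_ex_borel_measurable_real] obtain a b where
  ab: "a \<in> borel_measurable lborel" "b \<in> borel_measurable lborel"
   "AE x in lborel. Re (f x) = a x" "AE x in lborel. Im (f x) = b x" by blast
 then have [measurable]: "a \<in> borel_measurable borel" "b \<in> borel_measurable borel" by auto
 have "(%x. complex_of_real (a x) + \<i> * of_real (b x)) \<in> borel_measurable borel" by measurable
 moreover have "AE x in lborel. f x = complex_of_real (a x) + \<i> * of_real (b x)"
  using ab(3,4) by eventually_elim (auto simp: complex_eq_iff)
 ultimately show ?thesis using that AE_completion by blast
qed

lemma integral_vec_prod:
 fixes g :: "'n::finite => real => complex"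
 assumes g: "\<And>i. integrable lborel (g i)"
 shows "(LINT x|lborel. (\<Prod>i\<in>UNIV. g i (x $ i))) = (\<Prod>i\<in>UNIV. LINT t|lborel. g i t)"
  and "integrable lborel (%x. \<Prod>i\<in>UNIV. g i (x $ i))"
proof -
 have [measurable]: "g i \<in> borel_measurable borel" for i using borel_measurable_integrable[OF g] by simp
 interpret product_sigma_finite "%_ :: real ^ 'n. lborel :: real measure"
  by (intro product_sigma_finite.intro) (rule sigma_finite_lborel)
 let ?F = "%f. \<Sum>b\<in>(Basis :: (real ^ 'n) set). f b *\<^sub>R b"
 have nth: "?F f $ i = f (axis i 1)" for f and i
 proof -
  have "?F f $ i = ?F f \<bullet> axis i 1" by (simp add: inner_axis)
  also have "... = f (axis i 1)" by (rule inner_sum_left_Basis) (auto simp: Basis_vec_def)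
  finally show ?thesis .
 qed
 have eq: "(\<Prod>i\<in>UNIV. g i (?F f $ i)) = (\<Prod>b\<in>Basis. g (axis_index b) (f b))" for f
  unfolding prod_Basis_vec by (simp only: nth axis_index_axis)
 have i: "integrable (\<Pi>\<^sub>M b\<in>Basis. lborel) (%f. \<Prod>b\<in>(Basis :: (real ^ 'n) set). g (axis_index b) (f b))"
  by (rule product_integrable_prod) (auto simp: g)
 show "integrable lborel (%x. \<Prod>i\<in>UNIV. g i (x $ i))"
  by (subst lborel_eq, subst integrable_distr_eq, simp, simp) (simp only: eq i)
 have "(LINT x|lborel. (\<Prod>i\<in>UNIV. g i (x $ i))) = (LINT f|(\<Pi>\<^sub>M b\<in>Basis. lborel). (\<Prod>i\<in>UNIV. g i (?F f $ i)))"
  by (subst lborel_eq, rule integral_distr) auto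
 also have "... = (\<Prod>b\<in>(Basis :: (real ^ 'n) set). LINT t|lborel. g (axis_index b) t)"
  unfolding eq by (rule product_integral_prod) (auto simp: g)
 also have "... = (\<Prod>i\<in>UNIV. LINT t|lborel. g i t)"
  unfolding prod_Basis_vec by (simp add: axis_index_axis)
 finally show "(LINT x|lborel. (\<Prod>i\<in>UNIV. g i (x $ i))) = (\<Prod>i\<in>UNIV. LINT t|lborel. g i t)" .
qed

text \<open>Characteristic function of the standard normal distribution, rescaled by c = sqrt (2 pi)
  to match the normalization of \<open>echar\<close>.\<close>

lemma integral_gauss_1:
 "(LINT x|lborel. complex_of_real (exp (- pi * x\<^sup>2)) * echar (x * t)) = of_real (exp (- pi * t\<^sup>2))"
 "integrable lborel (%x. complex_of_real (exp (- pi * x\<^sup>2)) * echar (x * t))"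
proof -
 define c where "c = sqrt (2 * pi)"
 have c: "c > 0" "c\<^sup>2 = 2 * pi" by (simp_all add: c_def)
 let ?f = "%x. complex_of_real (std_normal_density x) * iexp (c * t * x)"
 have arg: "exp (\<i> * complex_of_real (c * t * (0 + c * x))) = echar (x * t)" for x
 proof -
  have "c * t * (0 + c * x) = 2 * pi * (x * t)" using c(2) by (simp add: power2_eq_square mult_ac)
  then show ?thesis by (simp only: echar_def cis_conv_exp)
 qed
 have dens: "std_normal_density (0 + c * x) = (1 / c) * exp (- pi * x\<^sup>2)" for x
  using c by (simp add: std_normal_density_def c_def power_mult_distrib)
 have i: "integrable lborel ?f"
 proof (rule Bochner_Integration.integrable_bound[of lborel "%x. std_normal_density x"])
  show "integrable lborel std_normal_density"
   by (rule integrable_normal_density) simp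
 qed (auto simp: norm_mult)
 have h: "- ((c * t)\<^sup>2) / 2 = - pi * t\<^sup>2" using c by (simp add: power_mult_distrib)
 have "complex_of_real (exp (- pi * t\<^sup>2)) = char std_normal_distribution (c * t)"
  unfolding char_std_normal_distribution h ..
 also have "... = (LINT x|lborel. ?f x)"
  unfolding char_def by (subst integral_density) (auto simp: scaleR_conv_of_real)
 also have "... = c *\<^sub>R (LINT x|lborel. ?f (0 + c * x))"
  using lborel_integral_real_affine[of c ?f 0] c by simp
 also have "... = c *\<^sub>R (LINT x|lborel. of_real (1 / c) * (complex_of_real (exp (- pi * x\<^sup>2)) * echar (x * t)))"
  unfolding dens arg by (simp add: mult.assoc)
 also have "... = (LINT x|lborel. complex_of_real (exp (- pi * x\<^sup>2)) * echar (x * t))"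
  using c by (subst integral_mult_right_zero) (simp add: scaleR_conv_of_real)
 finally show "(LINT x|lborel. complex_of_real (exp (- pi * x\<^sup>2)) * echar (x * t)) = of_real (exp (- pi * t\<^sup>2))" ..
 have "integrable lborel (%x. ?f (0 + c * x))"
  using lborel_integrable_real_affine[OF i, of c 0] c by simp
 then have "integrable lborel (%x. of_real (1 / c) * (complex_of_real (exp (- pi * x\<^sup>2)) * echar (x * t)))"
  unfolding dens arg by (simp add: mult.assoc)
 from integrable_mult_right[OF this, of "of_real c"] c
 show "integrable lborel (%x. complex_of_real (exp (- pi * x\<^sup>2)) * echar (x * t))"
  by simp
qed

definition gauss :: "real ^ 'n => complex" where
 "gauss x = of_real (exp (- pi * (norm x)\<^sup>2))"

lemma gauss_measurable [measurable]: "gauss \<in> borel_measurable borel"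
 unfolding gauss_def by measurable

lemma gauss_nonzero [simp]: "gauss x ~= 0"
 by (simp add: gauss_def)

lemma norm_gauss: "cmod (gauss x) = exp (- pi * (norm x)\<^sup>2)"
 by (simp add: gauss_def)

lemma gauss_minus [simp]: "gauss (- x) = gauss x"
 by (simp add: gauss_def)

lemma integral_gauss:
 fixes xi :: "real ^ 'n"
 shows "(LINT x|lborel. gauss x * echar (x \<bullet> xi)) = gauss xi"
  and "integrable lborel (%x. gauss x * echar (x \<bullet> xi))"
proof -
 have n2: "(norm x)\<^sup>2 = (\<Sum>i\<in>UNIV. (x $ i)\<^sup>2)" for x :: "real ^ 'n"
  unfolding power2_norm_eq_inner inner_vec_def by (simp add: power2_eq_square)
 have ech: "echar (sum g A) = (\<Prod>i\<in>A. echar (g i))" if "finite A" for g :: "'n => real" and A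
  using that by induction (simp_all add: echar_add)
 have ga: "gauss x = (\<Prod>i\<in>UNIV. complex_of_real (exp (- pi * (x $ i)\<^sup>2)))" for x :: "real ^ 'n"
  unfolding gauss_def n2 by (simp only: sum_distrib_left exp_sum[OF finite] of_real_prod)
 have eq: "gauss x * echar (x \<bullet> xi) = (\<Prod>i\<in>UNIV. complex_of_real (exp (- pi * (x $ i)\<^sup>2)) * echar (x $ i * xi $ i))" for x
  unfolding ga by (simp add: inner_vec_def ech prod.distrib)
 show "integrable lborel (%x. gauss x * echar (x \<bullet> xi))"
  unfolding eq by (rule integral_vec_prod(2)) (rule integral_gauss_1)
 show "(LINT x|lborel. gauss x * echar (x \<bullet> xi)) = gauss xi"
  unfolding eq by (subst integral_vec_prod(1)) (simp_all only: integral_gauss_1 ga)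
qed

lemma gauss_integrable: "integrable lborel (gauss :: real ^ 'n => complex)"
 using integral_gauss(2)[of 0] by simp

text \<open>Translated and modulated Gaussians: Schwartz functions whose Fourier transforms are
  explicit. Varying y alone already separates functions, see \<open>gwave_unique\<close>.\<close>

definition gwave :: "real ^ 'n => real ^ 'n => real ^ 'n => complex" where
 "gwave z y x = gauss (x - z) * echar (- (y \<bullet> x))"

lemma gwave_measurable [measurable]: "gwave z y \<in> borel_measurable borel"
 unfolding gwave_def by measurable

lemma fourier_lborel:
 fixes u :: "real ^ 'n => complex"
 assumes "u \<in> borel_measurable borel"
 shows "fourier u xi = (LINT x|lborel. u x * echar (- (x \<bullet> xi)))"
proof -
 have "fourier u xi = (LINT x|lebesgue. u x * echar (- (x \<bullet> xi)))"
  by (simp add: fourier_def echar_def)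
 also have "... = (LINT x|lborel. u x * echar (- (x \<bullet> xi)))"
  by (rule integral_lebesgue_lborel(1)) (use assms in measurable)
 finally show ?thesis .
qed

lemma fourier_gwave: "fourier (gwave z y) xi = echar (- (z \<bullet> (y + xi))) * gauss (y + xi)"
proof -
 have "fourier (gwave z y) xi = (LINT x|lborel. gwave z y x * echar (- (x \<bullet> xi)))"
  by (rule fourier_lborel) simp
 also have "... = (LINT x|lborel. gwave z y (x + z) * echar (- ((x + z) \<bullet> xi)))"
  by (subst integral_translate(1)) simp_all
 also have "... = (LINT x|lborel. echar (- (z \<bullet> (y + xi))) * (gauss x * echar (x \<bullet> (- (y + xi)))))"
 proof (intro Bochner_Integration.integral_cong refl)
  fix x
  have "echar (- (y \<bullet> (x + z))) * echar (- ((x + z) \<bullet> xi)) = echar (- (z \<bullet> (y + xi))) * echar (x \<bullet> (- (y + xi)))"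
   unfolding echar_add[symmetric] by (rule arg_cong[of _ _ echar]) (simp add: inner_simps inner_commute)
  then show "gwave z y (x + z) * echar (- ((x + z) \<bullet> xi)) = echar (- (z \<bullet> (y + xi))) * (gauss x * echar (x \<bullet> (- (y + xi))))"
   by (simp add: gwave_def mult_ac)
 qed
 also have "... = echar (- (z \<bullet> (y + xi))) * gauss (- (y + xi))"
  by (simp only: integral_mult_right_zero integral_gauss)
 finally show ?thesis by (simp only: gauss_minus)
qed

text \<open>Complex polynomials in the coordinates, given inductively so that growth bounds and the
  polynomial form of derivatives follow by rule induction.\<close>

inductive cpoly :: "(real ^ 'n => complex) => bool" where
 cpoly_const: "cpoly (%_. c)"
| cpoly_nth: "cpoly (%x. of_real (x $ i))"
| cpoly_add: "cpoly P ==> cpoly Q ==> cpoly (%x. P x + Q x)"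
| cpoly_mult: "cpoly P ==> cpoly Q ==> cpoly (%x. P x * Q x)"

lemma cpoly_measurable [measurable_dest]: "cpoly P ==> P \<in> borel_measurable borel"
 by (induction rule: cpoly.induct) (auto intro!: borel_measurable_add borel_measurable_times)

lemma cpoly_bound: "cpoly P ==> \<exists>C n. C \<ge> 0 \<and> (\<forall>x. cmod (P x) <= C * (1 + norm x) ^ n)"
proof (induction rule: cpoly.induct)
 case (cpoly_const c)
 then show ?case by (intro exI[of _ "cmod c"] exI[of _ 0]) simp
next
 case (cpoly_nth i)
 have "\<bar>x $ i\<bar> <= 1 + norm x" for x
  using component_le_norm_cart[of x i] by linarith
 then show ?case by (intro exI[of _ 1] exI[of _ 1]) auto
next
 case (cpoly_add P Q)
 then obtain C n D m where *: "C \<ge> 0" "D \<ge> 0"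
  "\<And>x. cmod (P x) <= C * (1 + norm x) ^ n" "\<And>x. cmod (Q x) <= D * (1 + norm x) ^ m" by blast
 have "cmod (P x + Q x) <= (C + D) * (1 + norm x) ^ (n + m)" for x
 proof -
  have "C * (1 + norm x) ^ n <= C * (1 + norm x) ^ (n + m)" "D * (1 + norm x) ^ m <= D * (1 + norm x) ^ (n + m)"
   using * by (auto intro!: mult_left_mono power_increasing)
  then show ?thesis using *(3,4)[of x] norm_triangle_ineq[of "P x" "Q x"] by (simp add: distrib_right)
 qed
 then show ?case using * by (intro exI[of _ "C + D"] exI[of _ "n + m"]) auto
next
 case (cpoly_mult P Q)
 then obtain C n D m where *: "C \<ge> 0" "D \<ge> 0"
  "\<And>x. cmod (P x) <= C * (1 + norm x) ^ n" "\<And>x. cmod (Q x) <= D * (1 + norm x) ^ m" by blast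
 have "cmod (P x * Q x) <= (C * D) * (1 + norm x) ^ (n + m)" for x
  using mult_mono[OF *(3)[of x] *(4)[of x]] * by (simp add: norm_mult power_add mult_ac)
 then show ?case using * by (intro exI[of _ "C * D"] exI[of _ "n + m"]) auto
qed

lemma cpoly_derivative:
 "cpoly P ==> \<exists>D. (\<forall>x. (P has_derivative D x) (at x)) \<and> (\<forall>i. cpoly (%x. D x (axis i 1)))"
proof (induction rule: cpoly.induct)
 case (cpoly_const c)
 show ?case by (rule exI[of _ "%_ _. 0"]) (auto intro: cpoly.cpoly_const)
next
 case (cpoly_nth i)
 have bl: "bounded_linear (%x :: real ^ 'a. complex_of_real (x $ i))"
  using bounded_linear_compose[OF bounded_linear_of_real bounded_linear_vec_nth] .
 show ?case
  by (rule exI[of _ "%_ h. of_real (h $ i)"]) (auto intro!: cpoly.cpoly_const bounded_linear_imp_has_derivative[OF bl])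
next
 case (cpoly_add P Q)
 then obtain D E where *: "\<And>x. (P has_derivative D x) (at x)" "\<And>i. cpoly (%x. D x (axis i 1))"
  "\<And>x. (Q has_derivative E x) (at x)" "\<And>i. cpoly (%x. E x (axis i 1))" by blast
 show ?case
  by (rule exI[of _ "%x h. D x h + E x h"]) (auto intro!: has_derivative_add cpoly.cpoly_add *)
next
 case (cpoly_mult P Q)
 then obtain D E where *: "\<And>x. (P has_derivative D x) (at x)" "\<And>i. cpoly (%x. D x (axis i 1))"
  "\<And>x. (Q has_derivative E x) (at x)" "\<And>i. cpoly (%x. E x (axis i 1))" by blast
 show ?case
  by (rule exI[of _ "%x h. P x * E x h + D x h * Q x"])
    (auto intro!: has_derivative_mult cpoly.cpoly_add cpoly.cpoly_mult * cpoly_mult.hyps)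
qed

lemma gwave_derivative:
 "(gwave z y has_derivative (%h. (of_real (- 2 * pi * ((x - z) \<bullet> h)) + of_real (- 2 * pi * (y \<bullet> h)) * \<i>) * gwave z y x)) (at x)"
proof -
 have eq: "gwave z y = (%x. exp (of_real (- pi * ((x - z) \<bullet> (x - z))) + of_real (- 2 * pi * (y \<bullet> x)) * \<i>))"
  by (simp only: fun_eq_iff gwave_def gauss_def echar_def cis_conv_exp exp_add exp_of_real power2_norm_eq_inner)
    (simp add: mult_ac)
 have xz: "((%x. x - z) has_derivative (%h. h)) (at x)"
  by (auto intro!: derivative_eq_intros)
 have "((%x. of_real (- pi * ((x - z) \<bullet> (x - z))) + of_real (- 2 * pi * (y \<bullet> x)) * \<i>) has_derivative
   (%h. of_real (- pi * ((x - z) \<bullet> h + h \<bullet> (x - z))) + of_real (- 2 * pi * (y \<bullet> h)) * \<i>)) (at x)"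
  by (intro has_derivative_add has_derivative_mult_left has_derivative_of_real has_derivative_mult_right
    has_derivative_inner[OF xz xz] has_derivative_inner_right has_derivative_ident)
 from has_derivative_compose[OF this DERIV_exp[THEN has_field_derivative_imp_has_derivative]]
 show ?thesis unfolding eq by (rule has_derivative_eq_rhs) (simp add: fun_eq_iff inner_commute algebra_simps)
qed

text \<open>The logarithmic derivative of the wave is affine, so polynomial multiples of the wave
  are stable under partial differentiation.\<close>

lemma iter_partial_gwave:
 "\<exists>P. cpoly P \<and> iter_partial is (gwave z y) = (%x. P x * gwave z y x) \<and>
   (\<forall>x. (%x. P x * gwave z y x) differentiable (at x))"
proof (induction "is")
 case Nil
 have "gwave z y differentiable (at x)" for x
  using gwave_derivative unfolding differentiable_def by blast
 then show ?case by (intro exI[of _ "%_. 1"]) (auto intro: cpoly.intros)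
next
 case (Cons i "is")
 then obtain P where P: "cpoly P" "iter_partial is (gwave z y) = (%x. P x * gwave z y x)" by blast
 obtain D where D: "\<And>x. (P has_derivative D x) (at x)" "\<And>i. cpoly (%x. D x (axis i 1))"
  using cpoly_derivative[OF P(1)] by blast
 let ?G = "%x h. of_real (- 2 * pi * ((x - z) \<bullet> h)) + of_real (- 2 * pi * (y \<bullet> h)) * \<i>"
 have der: "((%x. P x * gwave z y x) has_derivative (%h. P x * (?G x h * gwave z y x) + D x h * gwave z y x)) (at x)" for x
  by (rule has_derivative_mult[OF D(1) gwave_derivative])
 let ?Q = "%x. P x * ?G x (axis i 1) + D x (axis i 1)"
 have lin: "?G x (axis i 1) = of_real (- 2 * pi) * (of_real (x $ i) + (- of_real (z $ i))) + of_real (- 2 * pi * y $ i) * \<i>" for x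
  by (simp add: inner_axis)
 have Q: "cpoly ?Q"
  unfolding lin by (intro cpoly.intros P D)
 have eq: "iter_partial (i # is) (gwave z y) = (%x. ?Q x * gwave z y x)"
 proof
  fix x
  have "iter_partial (i # is) (gwave z y) x = frechet_derivative (%x. P x * gwave z y x) (at x) (axis i 1)"
   by (simp add: partial_deriv_def P(2))
  also have "... = P x * (?G x (axis i 1) * gwave z y x) + D x (axis i 1) * gwave z y x"
   unfolding frechet_derivative_at[OF der, symmetric] ..
  finally show "iter_partial (i # is) (gwave z y) x = ?Q x * gwave z y x" by (simp add: distrib_right)
 qed
 obtain E where E: "\<And>x. (?Q has_derivative E x) (at x)"
  using cpoly_derivative[OF Q] by blast
 have "(%x. ?Q x * gwave z y x) differentiable (at x)" for x
  using has_derivative_mult[OF E gwave_derivative] unfolding differentiable_def by blast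
 then show ?case using Q eq by blast
qed

text \<open>With t = norm (x - z) the weight is at most (1 + norm z)^m exp (m t), by 1 + t \<le> exp
  t. Moreover m t - pi t^2 \<le> m^2: for t \<le> m because m t \<le> m^2, for t > m because m t
  \<le> t^2.\<close>

lemma gwave_decay: "\<exists>C. \<forall>x. (1 + norm x) ^ m * cmod (gwave z y x) <= C"
proof (intro exI allI)
 fix x
 define t where "t = norm (x - z)"
 have t: "t \<ge> 0" by (simp add: t_def)
 have "1 + norm x <= (1 + norm z) * (1 + t)"
 proof -
  have "norm x <= norm z + t" using norm_triangle_ineq[of z "x - z"] by (simp add: t_def)
  moreover have "0 <= norm z * t" using t by simp
  moreover have "(1 + norm z) * (1 + t) = 1 + norm z + t + norm z * t" by (simp add: algebra_simps)
  ultimately show ?thesis by linarith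
 qed
 then have "(1 + norm x) ^ m <= ((1 + norm z) * (1 + t)) ^ m" by (intro power_mono) auto
 also have "... <= (1 + norm z) ^ m * exp t ^ m"
  unfolding power_mult_distrib using t exp_ge_add_one_self[of t] by (intro mult_left_mono power_mono) auto
 also have "exp t ^ m = exp (real m * t)" by (simp add: exp_of_nat_mult)
 finally have "(1 + norm x) ^ m * cmod (gwave z y x) <= (1 + norm z) ^ m * exp (real m * t) * exp (- pi * t\<^sup>2)"
  by (simp add: gwave_def norm_mult norm_gauss t_def mult_right_mono)
 also have "... = (1 + norm z) ^ m * exp (real m * t - pi * t\<^sup>2)"
  by (simp add: exp_diff exp_minus field_simps)
 also have "... <= (1 + norm z) ^ m * exp ((real m)\<^sup>2)"
 proof (intro mult_left_mono)
  have "real m * t - pi * t\<^sup>2 <= (real m)\<^sup>2"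
  proof (cases "t <= real m")
   case True
   then have "real m * t <= (real m)\<^sup>2" by (simp add: power2_eq_square mult_left_mono)
   moreover have "0 <= pi * t\<^sup>2" by simp
   ultimately show ?thesis by linarith
  next
   case False
   then have "real m * t <= 1 * t\<^sup>2" using t by (simp add: power2_eq_square mult_right_mono)
   also have "... <= pi * t\<^sup>2" using pi_gt3 by (intro mult_right_mono) auto
   finally show ?thesis by (smt (verit) zero_le_power2)
  qed
  then show "exp (real m * t - pi * t\<^sup>2) <= exp ((real m)\<^sup>2)" by simp
 qed simp
 finally show "(1 + norm x) ^ m * cmod (gwave z y x) <= (1 + norm z) ^ m * exp ((real m)\<^sup>2)" .
qed

lemma cpoly_gwave_decay:
 assumes P: "cpoly P"
 shows "\<exists>C\<ge>0. \<forall>x. (1 + norm x) ^ n * cmod (P x * gwave z y x) <= C"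
proof -
 obtain C m where C: "C \<ge> 0" "\<And>x. cmod (P x) <= C * (1 + norm x) ^ m" using cpoly_bound[OF P] by blast
 obtain D where D: "\<And>x. (1 + norm x) ^ (n + m) * cmod (gwave z y x) <= D" using gwave_decay[of "n + m" z y] by blast
 have D0: "D \<ge> 0" by (rule order_trans[OF _ D[of 0]]) simp
 have "(1 + norm x) ^ n * cmod (P x * gwave z y x) <= C * D" for x
 proof -
  have "(1 + norm x) ^ n * cmod (P x * gwave z y x) <= (1 + norm x) ^ n * ((C * (1 + norm x) ^ m) * cmod (gwave z y x))"
   unfolding norm_mult using C by (intro mult_left_mono mult_right_mono) auto
  also have "... = C * ((1 + norm x) ^ (n + m) * cmod (gwave z y x))" by (simp add: power_add mult_ac)
  also have "... <= C * D" using C D by (intro mult_left_mono) auto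
  finally show ?thesis .
 qed
 then show ?thesis using C D0 by (intro exI[of _ "C * D"]) auto
qed

lemma gwave_schwartz: "gwave z y \<in> schwartz"
 unfolding schwartz_def
proof (intro CollectI allI conjI)
 fix "is" x n
 obtain P where P: "cpoly P" "iter_partial is (gwave z y) = (%x. P x * gwave z y x)"
   "\<And>x. (%x. P x * gwave z y x) differentiable (at x)"
  using iter_partial_gwave[of "is" z y] by blast
 show "iter_partial is (gwave z y) differentiable (at x)" using P by simp
 obtain C where C: "\<And>x. (1 + norm x) ^ n * cmod (P x * gwave z y x) <= C"
  using cpoly_gwave_decay[OF P(1), of n z y] by blast
 have "norm (norm x ^ n *\<^sub>R (P x * gwave z y x)) <= C" for x
 proof -
  have "norm x ^ n * cmod (P x * gwave z y x) <= (1 + norm x) ^ n * cmod (P x * gwave z y x)"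
   by (intro mult_right_mono power_mono) auto
  then show ?thesis using C[of x] by simp
 qed
 then show "bounded (range (%x. norm x ^ n *\<^sub>R iter_partial is (gwave z y) x))"
  unfolding bounded_iff P(2) by blast
qed

lemma cpoly_gwave_integrable:
 fixes P :: "real ^ 'n => complex"
 assumes P: "cpoly P"
 shows "integrable lborel (%x. of_real ((norm x) ^ k) * (P x * gwave z y x))"
proof -
 have [measurable]: "P \<in> borel_measurable borel" using P by (rule cpoly_measurable)
 let ?s = "CARD('n) + 1"
 obtain C where C: "C \<ge> 0" "\<And>x. (1 + norm x) ^ (k + ?s) * cmod (P x * gwave z y x) <= C"
  using cpoly_gwave_decay[OF P, of "k + ?s" z y] by blast
 obtain K where K: "(\<integral>\<^sup>+x. ennreal ((1 + norm (x :: real ^ 'n)) powr (- real ?s)) \<partial>lborel) <= ennreal K"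
  using integral_norm_powr_bound[of "real ?s", where 'n = 'n] by auto
 have i: "integrable lborel (%x :: real ^ 'n. (1 + norm x) powr (- real ?s))"
  using K by (intro integrableI_nonneg) (auto simp: order_le_less_trans)
 show ?thesis
 proof (rule Bochner_Integration.integrable_bound[OF integrable_mult_right[OF i, of C]])
  show "AE x in lborel. norm (of_real ((norm x) ^ k) * (P x * gwave z y x)) <= norm (C * (1 + norm x) powr (- real ?s))"
  proof (intro AE_I2)
   fix x :: "real ^ 'n"
   have pos: "1 + norm x > 0" by (smt (verit) norm_ge_zero)
   have "norm x ^ k * cmod (P x * gwave z y x) <= (1 + norm x) ^ k * cmod (P x * gwave z y x)"
    by (intro mult_right_mono power_mono) auto
   also have "... <= C / (1 + norm x) ^ ?s"
    using C(2)[of x] pos by (simp add: power_add pos_le_divide_eq mult_ac)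
   also have "... = C * (1 + norm x) powr (- real ?s)"
    using pos by (simp only: powr_minus powr_realpow divide_inverse)
   finally show "norm (of_real ((norm x) ^ k) * (P x * gwave z y x)) <= norm (C * (1 + norm x) powr (- real ?s))"
    using C(1) by (simp add: norm_mult norm_power)
  qed
 qed measurable
qed

section \<open>Identifying distributional Fourier transforms\<close>

lemma fourier_injective_lebesgue:
 fixes w :: "real ^ 'n => complex"
 assumes w: "integrable lebesgue w"
  and zero: "\<And>xi. (LINT eta|lebesgue. w eta * echar (- (xi \<bullet> eta))) = 0"
 shows "AE x in lebesgue. w x = 0"
proof -
 obtain v where v[measurable]: "v \<in> borel_measurable borel" and wv: "AE x in lebesgue. w x = v x"
  using borel_version[OF borel_measurable_integrable[OF w]] .
 have [measurable]: "w \<in> borel_measurable lebesgue" using w by (rule borel_measurable_integrable)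
 have e[measurable]: "(%eta. echar (- (xi \<bullet> eta))) \<in> borel_measurable lebesgue" for xi :: "real ^ 'n"
  by (intro measurable_completion) simp
 have vl[measurable]: "v \<in> borel_measurable lebesgue" by (intro measurable_completion) simp
 have "integrable lebesgue v"
  using integrable_cong_AE[THEN iffD1, OF _ _ wv] w by simp
 then have iv: "integrable lborel v" by (simp add: integral_lebesgue_lborel)
 have "(LINT eta|lborel. v eta * echar (- (xi \<bullet> eta))) = 0" for xi
 proof -
  have "(LINT eta|lborel. v eta * echar (- (xi \<bullet> eta))) = (LINT eta|lebesgue. v eta * echar (- (xi \<bullet> eta)))"
   by (rule integral_lebesgue_lborel(1)[symmetric]) simp
  also have "... = (LINT eta|lebesgue. w eta * echar (- (xi \<bullet> eta)))"
   by (rule integral_cong_AE) (use wv in \<open>auto elim: eventually_mono\<close>)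
  finally show ?thesis by (simp add: zero)
 qed
 then have "AE x in lborel. v x = 0" by (rule fourier_injective[OF iv])
 then have "AE x in lebesgue. v x = 0" by (rule AE_completion)
 with wv show ?thesis by eventually_elim simp
qed

lemma gwave_0: "gwave 0 y x = gauss x * echar (- (y \<bullet> x))"
 by (simp add: gwave_def)

text \<open>Testing against \<open>gwave 0 y\<close> for all y evaluates the Fourier transforms of
  g1 and g2 times \<open>gauss\<close>, which are integrable even where g1 and g2 are not. Equal
  transforms force equality almost everywhere, and \<open>gauss\<close> has no zeros.\<close>

lemma gwave_unique:
 fixes g1 g2 :: "real ^ 'n => complex"
 assumes g1: "integrable lebesgue (%x. g1 x * gauss x)"
  and g2[measurable]: "g2 \<in> borel_measurable borel" and ig2: "integrable lborel (%x. g2 x * gauss x)"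
  and eq: "\<And>y. (LINT x|lebesgue. g1 x * gwave 0 y x) = (LINT x|lborel. g2 x * gwave 0 y x)"
 shows "AE x in lebesgue. g1 x = g2 x"
proof -
 have e[measurable]: "(%eta. echar (- (xi \<bullet> eta))) \<in> borel_measurable lebesgue" for xi :: "real ^ 'n"
  by (intro measurable_completion) simp
 have g2': "integrable lebesgue (%x. g2 x * gauss x)" by (subst integral_lebesgue_lborel) (simp_all add: ig2)
 have i1: "integrable lebesgue (%x. (g1 x * gauss x) * echar (- (y \<bullet> x)))" for y
  by (rule integrable_mult_bounded[OF g1, of _ 1]) auto
 have i2: "integrable lebesgue (%x. (g2 x * gauss x) * echar (- (y \<bullet> x)))" for y
  by (rule integrable_mult_bounded[OF g2', of _ 1]) auto
 have "AE x in lebesgue. g1 x * gauss x - g2 x * gauss x = 0"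
 proof (rule fourier_injective_lebesgue)
  show "integrable lebesgue (%x. g1 x * gauss x - g2 x * gauss x)" by (intro Bochner_Integration.integrable_diff g1 g2')
  fix y
  have "(LINT x|lebesgue. (g1 x * gauss x - g2 x * gauss x) * echar (- (y \<bullet> x)))
   = (LINT x|lebesgue. (g1 x * gauss x) * echar (- (y \<bullet> x))) - (LINT x|lebesgue. (g2 x * gauss x) * echar (- (y \<bullet> x)))"
   by (subst Bochner_Integration.integral_diff[OF i1 i2, symmetric]) (simp add: left_diff_distrib)
  also have "(LINT x|lebesgue. (g2 x * gauss x) * echar (- (y \<bullet> x))) = (LINT x|lborel. g2 x * gwave 0 y x)"
   unfolding gwave_0 by (subst integral_lebesgue_lborel) (simp_all add: mult.assoc)
  also have "(LINT x|lebesgue. (g1 x * gauss x) * echar (- (y \<bullet> x))) = (LINT x|lebesgue. g1 x * gwave 0 y x)"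
   unfolding gwave_0 by (simp add: mult.assoc)
  finally show "(LINT x|lebesgue. (g1 x * gauss x - g2 x * gauss x) * echar (- (y \<bullet> x))) = 0" by (simp add: eq)
 qed
 then show ?thesis by eventually_elim (auto simp: left_diff_distrib[symmetric])
qed

lemma integrable_gwave_shift: "integrable lborel (%x. gauss (x + y) * echar (x \<bullet> xi))"
 and integral_gwave_shift: "(LINT x|lborel. gauss (x + y) * echar (x \<bullet> xi)) = gauss xi * echar (- (y \<bullet> xi))"
 for y xi :: "real ^ 'n"
proof -
 have eq: "gauss (x + y) * echar (x \<bullet> xi) = echar (- (y \<bullet> xi)) * (gauss (x + y) * echar ((x + y) \<bullet> xi))" for x
 proof -
  have "echar (x \<bullet> xi) = echar (- (y \<bullet> xi)) * echar ((x + y) \<bullet> xi)"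
   unfolding echar_add[symmetric] by (simp add: inner_add_left)
  then show ?thesis by simp
 qed
 have i: "integrable lborel (%x. gauss (x + y) * echar ((x + y) \<bullet> xi))"
  using integral_gauss(2)[of xi] by (subst integral_translate(2)) simp_all
 show "integrable lborel (%x. gauss (x + y) * echar (x \<bullet> xi))"
  unfolding eq by (intro integrable_mult_right i)
 show "(LINT x|lborel. gauss (x + y) * echar (x \<bullet> xi)) = gauss xi * echar (- (y \<bullet> xi))"
  unfolding eq by (subst integral_mult_right_zero, subst integral_translate(1)) (simp_all add: integral_gauss)
qed

text \<open>Multiplication formula for the Fourier transform; s = 1 and s = -1 give the two signs of
  the exponent that occur.\<close>

lemma fourier_swap:
 fixes a b :: "real ^ 'n => complex"
 assumes a: "integrable lborel a" and b: "integrable lborel b"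
 shows "(LINT xi|lborel. (LINT x|lborel. a x * echar (s * (x \<bullet> xi))) * b xi)
  = (LINT x|lborel. a x * (LINT xi|lborel. b xi * echar (s * (x \<bullet> xi))))"
proof -
 have [measurable]: "a \<in> borel_measurable borel" "b \<in> borel_measurable borel"
  using borel_measurable_integrable[OF a] borel_measurable_integrable[OF b] by auto
 have ib: "integrable lborel (%xi. b xi * echar (s * (x \<bullet> xi)))" for x
  by (rule integrable_mult_echar[OF b]) simp
 have int: "integrable (lborel \<Otimes>\<^sub>M lborel) (%(x, xi). a x * (b xi * echar (s * (x \<bullet> xi))))"
 proof (rule lborel_pair.Fubini_integrable)
  show "AE x in lborel. integrable lborel (%xi. case (x, xi) of (x, xi) => a x * (b xi * echar (s * (x \<bullet> xi))))"
   using ib by simp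
  have "(%x. LINT xi|lborel. norm (case (x, xi) of (x, xi) => a x * (b xi * echar (s * (x \<bullet> xi)))))
   = (%x. cmod (a x) * (LINT xi|lborel. cmod (b xi)))" by (simp add: norm_mult)
  then show "integrable lborel (%x. LINT xi|lborel. norm (case (x, xi) of (x, xi) => a x * (b xi * echar (s * (x \<bullet> xi)))))"
   using a by simp
 qed measurable
 have "(LINT x|lborel. a x * (LINT xi|lborel. b xi * echar (s * (x \<bullet> xi))))
   = (LINT x|lborel. (LINT xi|lborel. a x * (b xi * echar (s * (x \<bullet> xi)))))" by simp
 also have "... = (LINT xi|lborel. (LINT x|lborel. a x * (b xi * echar (s * (x \<bullet> xi)))))"
  by (rule lborel_pair.Fubini_integral[OF int, symmetric])
 also have "... = (LINT xi|lborel. (LINT x|lborel. a x * echar (s * (x \<bullet> xi))) * b xi)"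
  by (simp add: mult.assoc mult.commute[of "b _"] flip: integral_mult_left_zero)
 finally show ?thesis ..
qed

lemma has_fourier_gwave:
 assumes "has_fourier f g"
 shows "integrable lebesgue (%x. g x * gwave z y x)"
  and "(LINT x|lebesgue. g x * gwave z y x) = (LINT x|lebesgue. f x * (echar (- (z \<bullet> (y + x))) * gauss (y + x)))"
 using assms gwave_schwartz[of z y] unfolding has_fourier_def dist_is_fun_def
 by (auto simp: dist_fourier_def dist_of_fun_def fourier_gwave)

text \<open>For f in L_p the transform is only distributional. Its definition turns f against
  \<open>gwave 0 z\<close> into g against \<open>gwave z 0\<close>, and the multiplication formula
  moves the remaining integral back onto \<open>ift g0\<close>.\<close>

lemma has_fourier_ift:
 fixes f g :: "real ^ 'n => complex"
 assumes fg: "has_fourier f g" and f: "integrable lebesgue (%x. f x * gauss x)"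
  and g0: "integrable lborel g0" and gg0: "AE x in lebesgue. g x = g0 x"
 shows "AE x in lebesgue. f x = ift g0 x"
proof (rule gwave_unique[OF f])
 have [measurable]: "g0 \<in> borel_measurable borel" using borel_measurable_integrable[OF g0] by simp
 show [measurable]: "ift g0 \<in> borel_measurable borel" unfolding ift_def by measurable
 have bnd: "cmod (ift g0 x) <= (LINT xi|lborel. cmod (g0 xi))" for x
  unfolding ift_def by (rule order_trans[OF integral_norm_bound]) (simp add: norm_mult)
 show "integrable lborel (%x. ift g0 x * gauss x)"
  using integrable_mult_bounded[of lborel gauss "ift g0", OF gauss_integrable _ bnd] by (simp add: mult.commute)
 fix z :: "real ^ 'n"
 have gl: "(%x. g x * gwave z 0 x) \<in> borel_measurable lebesgue"
  using has_fourier_gwave(1)[OF fg] by (rule borel_measurable_integrable)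
 have "(LINT x|lebesgue. f x * gwave 0 z x) = (LINT x|lebesgue. g x * gwave z 0 x)"
  using has_fourier_gwave(2)[OF fg, of z 0] by (simp add: gwave_0 mult.commute)
 also have "... = (LINT x|lebesgue. g0 x * gwave z 0 x)"
  by (rule integral_cong_AE) (use gl gg0 in \<open>auto elim: eventually_mono intro!: measurable_completion\<close>)
 also have "... = (LINT x|lborel. g0 x * gwave z 0 x)"
  by (rule integral_lebesgue_lborel) simp
 also have "... = (LINT xi|lborel. g0 xi * (LINT x|lborel. (gauss x * echar (- (z \<bullet> x))) * echar (1 * (xi \<bullet> x))))"
 proof (intro Bochner_Integration.integral_cong refl)
  fix xi
  have "(LINT x|lborel. (gauss x * echar (- (z \<bullet> x))) * echar (1 * (xi \<bullet> x))) = (LINT x|lborel. gauss x * echar (x \<bullet> (xi - z)))"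
   by (simp add: mult.assoc echar_add[symmetric] inner_diff_right inner_commute)
  then show "g0 xi * gwave z 0 xi = g0 xi * (LINT x|lborel. (gauss x * echar (- (z \<bullet> x))) * echar (1 * (xi \<bullet> x)))"
   by (simp add: gwave_def integral_gauss)
 qed
 also have "... = (LINT x|lborel. (LINT xi|lborel. g0 xi * echar (1 * (xi \<bullet> x))) * (gauss x * echar (- (z \<bullet> x))))"
  by (rule fourier_swap[OF g0, symmetric]) (rule integrable_mult_echar[OF gauss_integrable], simp)
 also have "... = (LINT x|lborel. ift g0 x * gwave 0 z x)"
  by (simp add: ift_def gwave_0 inner_commute)
 finally show "(LINT x|lebesgue. f x * gwave 0 z x) = (LINT x|lborel. ift g0 x * gwave 0 z x)" .
qed

lemma has_fourier_gauss_integrable: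
 assumes "has_fourier f g"
 shows "integrable lebesgue (%x. g x * gauss x)"
 using has_fourier_gwave(1)[OF assms, of 0 0] by (simp add: gwave_0)

lemma has_fourier_L1:
 fixes f g :: "real ^ 'n => complex"
 assumes fg: "has_fourier f g" and f0: "integrable lborel f0" and ff0: "AE x in lebesgue. f x = f0 x"
  and f: "f \<in> borel_measurable lebesgue"
 shows "AE xi in lebesgue. g xi = (LINT x|lborel. f0 x * echar (- (x \<bullet> xi)))"
proof (rule gwave_unique[OF has_fourier_gauss_integrable[OF fg]])
 have [measurable]: "f0 \<in> borel_measurable borel" using borel_measurable_integrable[OF f0] by simp
 let ?F = "%xi. LINT x|lborel. f0 x * echar (- (x \<bullet> xi))"
 show [measurable]: "?F \<in> borel_measurable borel" by measurable
 have bnd: "cmod (?F x) <= (LINT xi|lborel. cmod (f0 xi))" for x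
  by (rule order_trans[OF integral_norm_bound]) (simp add: norm_mult)
 show "integrable lborel (%x. ?F x * gauss x)"
  using integrable_mult_bounded[of lborel gauss ?F, OF gauss_integrable _ bnd] by (simp add: mult.commute)
 fix y :: "real ^ 'n"
 have "(LINT x|lebesgue. g x * gwave 0 y x) = (LINT x|lebesgue. f x * gauss (y + x))"
  using has_fourier_gwave(2)[OF fg, of 0 y] by simp
 also have "... = (LINT x|lebesgue. f0 x * gauss (y + x))"
 proof (rule integral_cong_AE)
  have "(%x. gauss (y + x)) \<in> borel_measurable lebesgue" by (intro measurable_completion) simp
  then show "(%x. f x * gauss (y + x)) \<in> borel_measurable lebesgue" using f by (intro borel_measurable_times)
  show "(%x. f0 x * gauss (y + x)) \<in> borel_measurable lebesgue" by (intro measurable_completion) simp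
 qed (use ff0 in \<open>auto elim: eventually_mono\<close>)
 also have "... = (LINT x|lborel. f0 x * gauss (y + x))"
  by (rule integral_lebesgue_lborel) simp
 also have "... = (LINT x|lborel. f0 x * (LINT xi|lborel. (gauss xi * echar (- (y \<bullet> xi))) * echar (- 1 * (x \<bullet> xi))))"
 proof (intro Bochner_Integration.integral_cong refl)
  fix x
  have "(LINT xi|lborel. (gauss xi * echar (- (y \<bullet> xi))) * echar (- 1 * (x \<bullet> xi))) = (LINT xi|lborel. gauss xi * echar (xi \<bullet> (- (y + x))))"
   by (simp add: mult.assoc echar_add[symmetric] inner_simps inner_commute)
  then show "f0 x * gauss (y + x) = f0 x * (LINT xi|lborel. (gauss xi * echar (- (y \<bullet> xi))) * echar (- 1 * (x \<bullet> xi)))"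
   by (simp only: integral_gauss gauss_minus)
 qed
 also have "... = (LINT xi|lborel. (LINT x|lborel. f0 x * echar (- 1 * (x \<bullet> xi))) * (gauss xi * echar (- (y \<bullet> xi))))"
  by (rule fourier_swap[OF f0, symmetric]) (rule integrable_mult_echar[OF gauss_integrable], simp)
 also have "... = (LINT xi|lborel. ?F xi * gwave 0 y xi)"
  by (simp add: gwave_0)
 finally show "(LINT x|lebesgue. g x * gwave 0 y x) = (LINT xi|lborel. ?F xi * gwave 0 y xi)" .
qed

text \<open>The function \<open>ift \<theta>\<close> need not be integrable, so its transform is not
  an integral; the distributional definition with the multiplication formula still recovers
  \<theta>.\<close>

lemma has_fourier_of_ift:
 fixes f g \<theta> :: "real ^ 'n => complex"
 assumes fg: "has_fourier (ift \<theta>) g" and t: "integrable lborel \<theta>"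
 shows "AE xi in lebesgue. g xi = \<theta> xi"
proof (rule gwave_unique[OF has_fourier_gauss_integrable[OF fg]])
 show [measurable]: "\<theta> \<in> borel_measurable borel" using borel_measurable_integrable[OF t] by simp
 have [measurable]: "ift \<theta> \<in> borel_measurable borel" unfolding ift_def by measurable
 show "integrable lborel (%x. \<theta> x * gauss x)"
  by (rule integrable_mult_bounded[OF t, of _ 1]) (simp_all add: norm_gauss)
 fix y :: "real ^ 'n"
 have sw: "integrable lborel (%x :: real ^ 'n. gauss (x + y))"
  using integrable_gwave_shift[of y 0] by simp
 have "(LINT x|lebesgue. g x * gwave 0 y x) = (LINT x|lebesgue. ift \<theta> x * gauss (x + y))"
  using has_fourier_gwave(2)[OF fg, of 0 y] by (simp add: add.commute)
 also have "... = (LINT x|lborel. ift \<theta> x * gauss (x + y))"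
  by (rule integral_lebesgue_lborel) simp
 also have "... = (LINT x|lborel. (LINT xi|lborel. \<theta> xi * echar (1 * (xi \<bullet> x))) * gauss (x + y))"
  by (simp add: ift_def inner_commute)
 also have "... = (LINT xi|lborel. \<theta> xi * (LINT x|lborel. gauss (x + y) * echar (1 * (xi \<bullet> x))))"
  by (rule fourier_swap[OF t sw])
 also have "... = (LINT xi|lborel. \<theta> xi * gwave 0 y xi)"
  using integral_gwave_shift[of y] by (simp add: gwave_0 inner_commute)
 finally show "(LINT x|lebesgue. g x * gwave 0 y x) = (LINT x|lborel. \<theta> x * gwave 0 y x)" .
qed

section \<open>Differentiated Fourier integrals and the symbol of the operator\<close>

lemma fourier_integral_has_derivative:
 fixes u :: "real ^ 'n => complex"
 assumes u: "integrable lborel u" and u1: "integrable lborel (%x. of_real (norm x) * u x)"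
  and u2: "integrable lborel (%x. of_real ((norm x)\<^sup>2) * u x)"
 shows "((%xi. LINT x|lborel. u x * echar (- (x \<bullet> xi))) has_derivative
  (%h. LINT x|lborel. (of_real (- 2 * pi * (x \<bullet> h)) * \<i> * u x) * echar (- (x \<bullet> xi)))) (at xi)"
proof -
 have [measurable]: "u \<in> borel_measurable borel" using borel_measurable_integrable[OF u] by simp
 let ?D = "%h. LINT x|lborel. (of_real (- 2 * pi * (x \<bullet> h)) * \<i> * u x) * echar (- (x \<bullet> xi))"
 have iu: "integrable lborel (%x. u x * echar (- (x \<bullet> xi)))" for xi
  by (rule integrable_mult_echar[OF u]) simp
 have iD: "integrable lborel (%x. (of_real (- 2 * pi * (x \<bullet> h)) * \<i> * u x) * echar (- (x \<bullet> xi)))" for h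
 proof (rule Bochner_Integration.integrable_bound[OF integrable_mult_right[OF u1, of "of_real (2 * pi * norm h)"]])
  show "AE x in lborel. norm (of_real (- 2 * pi * (x \<bullet> h)) * \<i> * u x * echar (- (x \<bullet> xi))) <= norm (of_real (2 * pi * norm h) * (of_real (norm x) * u x))"
  proof (intro AE_I2)
   fix x
   have "\<bar>x \<bullet> h\<bar> * cmod (u x) <= norm x * norm h * cmod (u x)"
    by (intro mult_right_mono Cauchy_Schwarz_ineq2) simp
   then show "norm (of_real (- 2 * pi * (x \<bullet> h)) * \<i> * u x * echar (- (x \<bullet> xi))) <= norm (of_real (2 * pi * norm h) * (of_real (norm x) * u x))"
    by (simp add: norm_mult abs_mult mult_ac)
  qed
 qed measurable
 define C where "C = (LINT x|lborel. 2 * pi\<^sup>2 * cmod (of_real ((norm x)\<^sup>2) * u x))"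
 define C1 where "C1 = (LINT x|lborel. 2 * pi * cmod (of_real (norm x) * u x))"
 have lin: "bounded_linear ?D"
 proof (rule bounded_linear_intro[of _ C1])
  fix h k :: "real ^ 'n" and r :: real
  show "?D (h + k) = ?D h + ?D k"
   by (subst Bochner_Integration.integral_add[OF iD iD, symmetric])
     (simp add: inner_add_right algebra_simps)
  show "?D (r *\<^sub>R h) = r *\<^sub>R ?D h"
   by (subst integral_scaleR_right[symmetric], intro Bochner_Integration.integral_cong refl, simp only: inner_scaleR_right)
     (simp add: scaleR_conv_of_real mult_ac)
  have "norm (?D h) <= (LINT x|lborel. (2 * pi * cmod (of_real (norm x) * u x)) * norm h)"
   unfolding C1_def
  proof (rule order_trans[OF integral_norm_bound], rule integral_mono)
   fix x
   have "\<bar>x \<bullet> h\<bar> * cmod (u x) <= norm x * norm h * cmod (u x)"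
    by (intro mult_right_mono Cauchy_Schwarz_ineq2) simp
   then show "cmod (of_real (- 2 * pi * (x \<bullet> h)) * \<i> * u x * echar (- (x \<bullet> xi))) <= (2 * pi * cmod (of_real (norm x) * u x)) * norm h"
    by (simp add: norm_mult abs_mult mult_ac)
  qed (use u1 iD in \<open>auto intro!: integrable_norm\<close>)
  then show "norm (?D h) <= norm h * C1" by (simp add: C1_def mult.commute)
 qed
 show ?thesis
 proof (rule has_derivativeI_sandwich[where e = 1 and H = "%y. C * norm (y - xi)"])
  show "bounded_linear ?D" by (rule lin)
  fix y assume "y ~= xi"
  define h where "h = y - xi"
  have "(LINT x|lborel. u x * echar (- (x \<bullet> y))) - (LINT x|lborel. u x * echar (- (x \<bullet> xi))) - ?D h
    = (LINT x|lborel. u x * echar (- (x \<bullet> y)) - u x * echar (- (x \<bullet> xi)) - (of_real (- 2 * pi * (x \<bullet> h)) * \<i> * u x) * echar (- (x \<bullet> xi)))"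
   by (simp only: Bochner_Integration.integral_diff[OF Bochner_Integration.integrable_diff[OF iu iu] iD]
      Bochner_Integration.integral_diff[OF iu iu])
  also have "cmod ... <= (LINT x|lborel. (2 * pi\<^sup>2 * cmod (of_real ((norm x)\<^sup>2) * u x)) * (norm h)\<^sup>2)"
  proof (rule order_trans[OF integral_norm_bound], rule integral_mono)
   fix x
   define s where "s = - 2 * pi * (x \<bullet> h)"
   have e: "echar (- (x \<bullet> y)) = iexp s * echar (- (x \<bullet> xi))"
   proof -
    have "echar (- (x \<bullet> y)) = echar (- (x \<bullet> h)) * echar (- (x \<bullet> xi))"
     unfolding echar_add[symmetric] by (simp add: h_def inner_diff_right)
    then show ?thesis by (simp add: s_def echar_def cis_conv_exp mult_ac)
   qed
   \<comment> \<open>Quadratic Taylor remainder of the exponential; it is paid for by the second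
     moment of u.\<close>
   have "cmod (iexp s - 1 - of_real s * \<i>) <= \<bar>s\<bar>\<^sup>2 / 2"
    using iexp_approx1[of s 1] by (simp add: numeral_2_eq_2 algebra_simps)
   also have "... <= 2 * pi\<^sup>2 * ((norm x)\<^sup>2 * (norm h)\<^sup>2)"
   proof -
    have "\<bar>x \<bullet> h\<bar>\<^sup>2 <= (norm x * norm h)\<^sup>2" by (intro power_mono Cauchy_Schwarz_ineq2) simp
    then show ?thesis by (simp add: s_def abs_mult power_mult_distrib)
   qed
   finally have le: "cmod (iexp s - 1 - of_real s * \<i>) <= 2 * pi\<^sup>2 * ((norm x)\<^sup>2 * (norm h)\<^sup>2)" .
   have "u x * echar (- (x \<bullet> y)) - u x * echar (- (x \<bullet> xi)) - (of_real s * \<i> * u x) * echar (- (x \<bullet> xi))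
     = (iexp s - 1 - of_real s * \<i>) * (u x * echar (- (x \<bullet> xi)))"
    unfolding e by (simp add: algebra_simps)
   then have "cmod (u x * echar (- (x \<bullet> y)) - u x * echar (- (x \<bullet> xi)) - (of_real s * \<i> * u x) * echar (- (x \<bullet> xi)))
     = cmod (iexp s - 1 - of_real s * \<i>) * cmod (u x)"
    by (simp add: norm_mult)
   also have "... <= 2 * pi\<^sup>2 * ((norm x)\<^sup>2 * (norm h)\<^sup>2) * cmod (u x)"
    by (intro mult_right_mono le) simp
   finally show "cmod (u x * echar (- (x \<bullet> y)) - u x * echar (- (x \<bullet> xi)) - (of_real (- 2 * pi * (x \<bullet> h)) * \<i> * u x) * echar (- (x \<bullet> xi)))
     <= (2 * pi\<^sup>2 * cmod (of_real ((norm x)\<^sup>2) * u x)) * (norm h)\<^sup>2"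
    by (simp add: s_def norm_mult norm_power mult_ac)
  qed (use u2 iu iD in \<open>auto intro!: integrable_norm Bochner_Integration.integrable_diff\<close>)
  also have "... = C * (norm h)\<^sup>2" by (simp add: C_def)
  finally have "cmod ((LINT x|lborel. u x * echar (- (x \<bullet> y))) - (LINT x|lborel. u x * echar (- (x \<bullet> xi))) - ?D h) <= C * norm h * norm h"
   by (simp add: power2_eq_square mult.assoc)
  then show "cmod ((LINT x|lborel. u x * echar (- (x \<bullet> y))) - (LINT x|lborel. u x * echar (- (x \<bullet> xi))) - ?D (y - xi)) / norm (y - xi) <= C * norm (y - xi)"
   using \<open>y ~= xi\<close> by (simp add: h_def divide_le_eq)
 next
  have "((%y. C * norm (y - xi)) \<longlongrightarrow> C * norm (xi - xi)) (at xi)" by (intro tendsto_intros)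
  then show "((%y. C * norm (y - xi)) \<longlongrightarrow> 0) (at xi within UNIV)" by simp
 qed simp
qed

text \<open>One factor - 2 pi i x_j for each differentiation in direction j under the Fourier
  integral, recorded along the list that \<open>iter_partial\<close> follows.\<close>

definition dmono :: "'n list => real ^ 'n => complex" where
 "dmono is x = (\<Prod>j\<leftarrow>is. of_real (- 2 * pi * x $ j) * \<i>)"

lemma cpoly_dmono: "cpoly (dmono is)"
proof (induction "is")
 case Nil then show ?case using cpoly_const[of 1] by (simp add: dmono_def[abs_def])
next
 case (Cons i "is")
 have "cpoly (%x. of_real (- 2 * pi) * of_real (x $ i) * \<i> * dmono is x)"
  by (intro cpoly.intros Cons)
 then show ?case by (simp add: dmono_def[abs_def])
qed

lemma iter_partial_fourier_gwave:
 "iter_partial is (fourier (gwave z y)) = (%xi. LINT x|lborel. (dmono is x * gwave z y x) * echar (- (x \<bullet> xi)))"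
proof (induction "is")
 case Nil
 then show ?case by (simp add: dmono_def fourier_lborel fun_eq_iff)
next
 case (Cons i "is")
 note ig = cpoly_gwave_integrable[OF cpoly_dmono[of "is"], of _ z y]
 note der = fourier_integral_has_derivative[of "%x. dmono is x * gwave z y x"]
 have d: "((%xi. LINT x|lborel. (dmono is x * gwave z y x) * echar (- (x \<bullet> xi))) has_derivative
  (%h. LINT x|lborel. (of_real (- 2 * pi * (x \<bullet> h)) * \<i> * (dmono is x * gwave z y x)) * echar (- (x \<bullet> xi)))) (at xi)" for xi
  using der ig[of 0] ig[of 1] ig[of 2] by simp
 show ?case
 proof
  fix xi
  have "iter_partial (i # is) (fourier (gwave z y)) xi =
    (LINT x|lborel. (of_real (- 2 * pi * (x \<bullet> axis i 1)) * \<i> * (dmono is x * gwave z y x)) * echar (- (x \<bullet> xi)))"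
   by (simp only: iter_partial.simps partial_deriv_def Cons frechet_derivative_at[OF d, symmetric])
  then show "iter_partial (i # is) (fourier (gwave z y)) xi = (LINT x|lborel. (dmono (i # is) x * gwave z y x) * echar (- (x \<bullet> xi)))"
   by (simp add: inner_axis dmono_def mult.assoc)
 qed
qed

text \<open>Guarantees that the choice in \<open>mi_deriv\<close> picks a list with the prescribed
  multiplicities.\<close>

lemma exists_count_list: "\<exists>is. \<forall>i. count_list is i = \<beta> (i :: 'n::finite)"
proof -
 obtain "is" where "mset is = (\<Sum>i\<in>UNIV. replicate_mset (\<beta> i) i)" using ex_mset by blast
 then have "count_list is i = (\<Sum>j\<in>UNIV. count (replicate_mset (\<beta> j) j) i)" for i
  by (simp add: count_mset[symmetric] count_sum)
 also have "(\<Sum>j\<in>UNIV. count (replicate_mset (\<beta> j) j) i) = \<beta> i" for i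
  by (simp add: sum.delta)
 finally show ?thesis by blast
qed

lemma prod_list_count_list:
 "(\<Prod>j\<leftarrow>is. g j) = (\<Prod>i\<in>UNIV. g i ^ count_list is i)" for g :: "'n::finite => complex"
proof (induction "is")
 case (Cons a "is")
 have "(\<Prod>i\<in>UNIV. g i ^ count_list (a # is) i) = (\<Prod>i\<in>UNIV. (if i = a then g i else 1) * g i ^ count_list is i)"
  by (intro prod.cong) auto
 also have "... = g a * (\<Prod>i\<in>UNIV. g i ^ count_list is i)" by (simp add: prod.distrib)
 finally show ?case using Cons by simp
qed simp

text \<open>The Fourier symbol of the operator with coefficients \<open>a\<close>. The transform of
  the associated distribution is its conjugate, since there the coefficients are conjugated and - 2
  pi i replaces 2 pi i.\<close>

definition dsymbol :: "nat => (('n::finite => nat) => complex) => real ^ 'n => complex" where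
 "dsymbol N a xi = (\<Sum>\<beta> | mi_abs \<beta> <= N. a \<beta> * (\<Prod>i\<in>UNIV. (of_real (2 * pi * xi $ i) * \<i>) ^ \<beta> i))"

lemma mi_deriv_fourier_gwave:
 "mi_deriv \<beta> (fourier (gwave 0 y)) 0 = (LINT x|lborel. (\<Prod>i\<in>UNIV. (of_real (- 2 * pi * x $ i) * \<i>) ^ \<beta> i) * gwave 0 y x)"
proof -
 define js where "js = (SOME is. \<forall>i. count_list is i = \<beta> i)"
 have js: "\<forall>i. count_list js i = \<beta> i" unfolding js_def by (rule someI_ex[OF exists_count_list])
 have "dmono js x = (\<Prod>i\<in>UNIV. (of_real (- 2 * pi * x $ i) * \<i>) ^ \<beta> i)" for x
  unfolding dmono_def prod_list_count_list using js by simp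
 then show ?thesis
  by (simp add: mi_deriv_def js_def[symmetric] iter_partial_fourier_gwave)
qed

lemma finite_mi_abs: "finite {\<beta> :: 'n::finite => nat. mi_abs \<beta> <= N}"
proof (rule finite_subset)
 show "{\<beta> :: 'n => nat. mi_abs \<beta> <= N} \<subseteq> Pi\<^sub>E UNIV (%_. {..N})"
 proof safe
  fix \<beta> :: "'n => nat" and i assume "mi_abs \<beta> <= N"
  moreover have "\<beta> i <= mi_abs \<beta>" unfolding mi_abs_def by (rule member_le_sum) auto
  ultimately show "\<beta> i <= N" by simp
 qed simp
qed (simp add: finite_PiE)

lemma assoc_dist_fourier:
 fixes That :: "real ^ 'n => complex"
 assumes T: "dist_is_fun (dist_fourier (assoc_dist N a)) That"
 shows "AE xi in lebesgue. That xi = cnj (dsymbol N a xi)"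
proof (rule gwave_unique)
 have T': "integrable lebesgue (%x. That x * gwave 0 y x)"
  "assoc_dist N a (fourier (gwave 0 y)) = (LINT x|lebesgue. That x * gwave 0 y x)" for y
  using T gwave_schwartz[of 0 y] by (auto simp: dist_is_fun_def dist_fourier_def dist_of_fun_def)
 show "integrable lebesgue (%x. That x * gauss x)" using T'(1)[of 0] by (simp add: gwave_0)
 define m where "m \<beta> x = (\<Prod>i\<in>UNIV. (of_real (- 2 * pi * x $ i) * \<i>) ^ \<beta> i)" for \<beta> and x :: "real ^ 'n"
 have cm: "cpoly (m \<beta>)" for \<beta>
 proof -
  obtain "is" where "\<forall>i. count_list is i = \<beta> i" using exists_count_list by blast
  then have "m \<beta> = dmono is" by (auto simp: fun_eq_iff m_def dmono_def prod_list_count_list)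
  then show ?thesis by (simp add: cpoly_dmono)
 qed
 have [measurable]: "m \<beta> \<in> borel_measurable borel" for \<beta> by (rule cpoly_measurable[OF cm])
 have sym: "cnj (dsymbol N a xi) = (\<Sum>\<beta> | mi_abs \<beta> <= N. cnj (a \<beta>) * m \<beta> xi)" for xi
  by (simp add: dsymbol_def m_def)
 show "(%xi. cnj (dsymbol N a xi)) \<in> borel_measurable borel" unfolding sym by measurable
 have im: "integrable lborel (%x. m \<beta> x * gwave 0 y x)" for \<beta> y
  using cpoly_gwave_integrable[OF cm, where k = 0 and z = 0 and y = y] by simp
 have isy: "integrable lborel (%x. cnj (a \<beta>) * m \<beta> x * gwave 0 y x)" for \<beta> y
  unfolding mult.assoc by (intro integrable_mult_right im)
 show "integrable lborel (%x. cnj (dsymbol N a x) * gauss x)"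
  unfolding sym sum_distrib_right using isy[of _ 0] by (intro Bochner_Integration.integrable_sum) (simp add: gwave_0)
 fix y :: "real ^ 'n"
 \<comment> \<open>The sign (-1)^[\<beta>] in \<open>assoc_dist\<close> meets the one in
   \<open>dist_deriv\<close>, and the two cancel.\<close>
 have "(LINT x|lebesgue. That x * gwave 0 y x) = (\<Sum>\<beta> | mi_abs \<beta> <= N. cnj (a \<beta>) * (LINT x|lborel. m \<beta> x * gwave 0 y x))"
  unfolding T'(2)[symmetric] assoc_dist_def dist_deriv_def dist_delta_def mi_deriv_fourier_gwave
  by (simp add: m_def mult.assoc[symmetric] power_add[symmetric] mult_2[symmetric] power_mult)
    (simp add: mult.assoc power_add[symmetric] mult_2[symmetric])
 also have "... = (LINT x|lborel. cnj (dsymbol N a x) * gwave 0 y x)"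
  unfolding sym sum_distrib_right
  by (subst Bochner_Integration.integral_sum[OF isy]) (simp add: mult.assoc)
 finally show "(LINT x|lebesgue. That x * gwave 0 y x) = (LINT x|lborel. cnj (dsymbol N a x) * gwave 0 y x)" .
qed

section \<open>Powers of the inverse dilation matrix\<close>

definition eig_shift :: "real ^ 'n ^ 'n => complex => complex ^ 'n ^ 'n" where
 "eig_shift M z = (\<chi> i j. complex_of_real (M $ i $ j) - (if i = j then z else 0))"

lemma eig_shift_mult:
 "(eig_shift M z *v v) $ i = (\<Sum>j\<in>UNIV. complex_of_real (M $ i $ j) * v $ j) - z * v $ i"
proof -
 have "(eig_shift M z *v v) $ i = (\<Sum>j\<in>UNIV. complex_of_real (M $ i $ j) * v $ j - (if i = j then z * v $ j else 0))"
  unfolding eig_shift_def matrix_vector_mult_def vec_lambda_beta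
  by (intro sum.cong refl) (auto simp: algebra_simps)
 then show ?thesis by (simp add: sum_subtractf)
qed

lemma det_eig_shift:
 assumes "\<not> is_eigenvalue M z"
 shows "det (eig_shift M z) ~= 0"
proof
 assume "det (eig_shift M z) = 0"
 then have "\<not> (\<exists>B. B ** eig_shift M z = mat 1)"
  using invertible_det_nz[of "eig_shift M z"] invertible_left_inverse[of "eig_shift M z"] by blast
 then obtain v where v: "eig_shift M z *v v = 0" "v ~= 0"
  unfolding matrix_left_invertible_ker by blast
 have "(\<chi> i j. complex_of_real (M $ i $ j)) *v v = z *s v"
 proof (subst vec_eq_iff, rule allI)
  fix i
  have "(eig_shift M z *v v) $ i = 0" by (simp add: v)
  then show "((\<chi> i j. complex_of_real (M $ i $ j)) *v v) $ i = (z *s v) $ i"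
   unfolding eig_shift_mult by (simp add: matrix_vector_mult_def)
 qed
 with v assms show False unfolding is_eigenvalue_def by blast
qed

text \<open>By Cramer's rule the k-th coordinate of the solution v of (M - z) v = b. As a quotient
  of determinants it is visibly holomorphic in z off the eigenvalues.\<close>

definition resolvent :: "real ^ 'n ^ 'n => complex ^ 'n => 'n => complex => complex" where
 "resolvent M b k z = det (\<chi> i j. if j = k then b $ i else eig_shift M z $ i $ j) / det (eig_shift M z)"

lemma resolvent_eq:
 assumes "det (eig_shift M z) ~= 0"
 shows "(\<Sum>j\<in>UNIV. complex_of_real (M $ i $ j) * resolvent M b j z) - z * resolvent M b i z = b $ i"
proof -
 have "eig_shift M z *v (\<chi> k. resolvent M b k z) = b"
  unfolding resolvent_def using cramer[OF assms] by blast
 then have "(eig_shift M z *v (\<chi> k. resolvent M b k z)) $ i = b $ i" by simp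
 then show ?thesis unfolding eig_shift_mult by simp
qed

lemma holomorphic_on_det:
 assumes "\<And>i j. (%z. A z $ i $ j) holomorphic_on S"
 shows "(%z. det (A z)) holomorphic_on S"
 unfolding det_def by (intro holomorphic_intros assms)

lemma holomorphic_on_eig_shift: "(%z. eig_shift M z $ i $ j) holomorphic_on S"
 unfolding eig_shift_def by (cases "i = j") (auto intro!: holomorphic_intros)

lemma resolvent_holomorphic: "resolvent M b k holomorphic_on {z. det (eig_shift M z) ~= 0}"
proof -
 have "(%z. (\<chi> i j. if j = k then b $ i else eig_shift M z $ i $ j) $ i $ j) holomorphic_on S" for i j S
  by (cases "j = k") (auto intro!: holomorphic_intros holomorphic_on_eig_shift)
 then show ?thesis
  unfolding resolvent_def[abs_def]
  by (intro holomorphic_on_divide holomorphic_on_det holomorphic_on_eig_shift) auto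
qed

lemma open_resolvent_set: "open {z. det (eig_shift M z) ~= 0}"
proof -
 have "continuous_on UNIV (%z. det (eig_shift M z))"
  by (intro holomorphic_on_imp_continuous_on holomorphic_on_det holomorphic_on_eig_shift)
 then show ?thesis by (intro open_Collect_neq continuous_on_const) auto
qed

lemma mat_pow_0 [simp]: "mat_pow A 0 = mat 1"
 by (simp add: mat_pow_def)

lemma mat_pow_Suc: "mat_pow A (Suc j) = A ** mat_pow A j"
 by (simp add: mat_pow_def)

lemma det_mat_pow: "det (mat_pow A j) = det A ^ j" for A :: "real ^ 'n ^ 'n"
 by (induction j) (simp_all add: mat_pow_Suc det_mul)

text \<open>The strict inequality keeps the closed disc of radius \<theta> inside the resolvent set,
  so Cauchy's estimate is available on the circle of radius \<theta> itself.\<close>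

locale expanding =
 fixes M :: "real ^ 'n ^ 'n" and \<theta> :: real
 assumes theta: "\<theta> > 0" and eig: "\<And>z. is_eigenvalue M z ==> \<theta> < cmod z"
begin

lemma det_shift_nz: "cmod z <= \<theta> ==> det (eig_shift M z) ~= 0"
 using det_eig_shift eig by (metis not_less)

lemma det_nz: "det M ~= 0"
proof
 assume "det M = 0"
 then have "\<not> (\<exists>B. B ** M = mat 1)"
  using invertible_det_nz[of M] invertible_left_inverse[of M] by blast
 then obtain v where v: "M *v v = 0" "v ~= 0"
  unfolding matrix_left_invertible_ker by blast
 have "(\<chi> i j. complex_of_real (M $ i $ j)) *v (\<chi> i. complex_of_real (v $ i)) = 0 *s (\<chi> i. complex_of_real (v $ i))"
 proof (subst vec_eq_iff, rule allI)
  fix i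
  have "(M *v v) $ i = 0" by (simp add: v)
  then have "(\<Sum>j\<in>UNIV. M $ i $ j * v $ j) = 0" by (simp add: matrix_vector_mult_def)
  then have "complex_of_real (\<Sum>j\<in>UNIV. M $ i $ j * v $ j) = 0" by simp
  then show "((\<chi> i j. complex_of_real (M $ i $ j)) *v (\<chi> i. complex_of_real (v $ i))) $ i = (0 *s (\<chi> i. complex_of_real (v $ i))) $ i"
   by (simp add: matrix_vector_mult_def)
 qed
 moreover have "(\<chi> i. complex_of_real (v $ i)) ~= 0" using v(2) by (simp add: vec_eq_iff)
 ultimately have "is_eigenvalue M 0" unfolding is_eigenvalue_def by blast
 from eig[OF this] theta show False by simp
qed

lemma M_inv_pow: "M *v (mat_pow (matrix_inv M) (Suc j) *v x) = mat_pow (matrix_inv M) j *v x"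
proof -
 have "invertible M" using det_nz by (simp add: invertible_det_nz)
 then have "M ** matrix_inv M = mat 1"
  using someI_ex[of "%A'. M ** A' = mat 1 \<and> A' ** M = mat 1"] by (auto simp: matrix_inv_def invertible_def)
 then show ?thesis by (simp add: mat_pow_Suc matrix_vector_mul_assoc matrix_mul_assoc)
qed

text \<open>Neumann series: at 0 the function (M - z)^(-1) b has the coefficients M^(-n-1) b.
  Comparing formal power series in (M - z) R(z) = b yields M c_0 = b and M c_n = c_(n-1), and M is
  injective.\<close>

lemma resolvent_coeff:
 fixes b :: "real ^ 'n"
 shows "(deriv ^^ n) (resolvent M (\<chi> i. complex_of_real (b $ i)) k) 0 / fact n
  = complex_of_real ((mat_pow (matrix_inv M) (Suc n) *v b) $ k)"
proof -
 let ?b = "\<chi> i. complex_of_real (b $ i)"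
 let ?R = "%k. resolvent M ?b k"
 let ?F = "%k. fps_expansion (?R k) 0"
 define S where "S = {z. det (eig_shift M z) ~= 0}"
 have S: "open S" "0 \<in> S" using open_resolvent_set det_shift_nz[of 0] theta by (auto simp: S_def)
 have exp: "?R k has_fps_expansion ?F k" for k
  by (rule analytic_at_imp_has_fps_expansion_0)
    (use S resolvent_holomorphic[of M ?b k] in \<open>auto simp: analytic_at S_def[symmetric]\<close>)
 have eq: "(\<Sum>j\<in>UNIV. fps_const (complex_of_real (M $ i $ j)) * ?F j) - fps_X * ?F i = fps_const (?b $ i)" for i
 proof (rule fps_expansion_unique_complex)
  let ?f = "%z. (\<Sum>j\<in>UNIV. complex_of_real (M $ i $ j) * ?R j z) - z * ?R i z"
  show "?f has_fps_expansion (\<Sum>j\<in>UNIV. fps_const (complex_of_real (M $ i $ j)) * ?F j) - fps_X * ?F i"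
   by (intro fps_expansion_intros exp)
  have "\<forall>\<^sub>F z in nhds 0. ?f z = ?b $ i"
   using eventually_nhds_in_open[OF S] unfolding S_def mem_Collect_eq by eventually_elim (rule resolvent_eq)
  then show "?f has_fps_expansion fps_const (?b $ i)"
   by (subst has_fps_expansion_cong[OF _ refl]) auto
 qed
 define c where "c n = (\<chi> k. (deriv ^^ n) (?R k) 0 / fact n)" for n
 have nth: "fps_nth (?F k) n = c n $ k" for k n by (simp add: c_def fps_expansion_def)
 have step: "(\<Sum>j\<in>UNIV. complex_of_real (M $ i $ j) * c n $ j) = (if n = 0 then ?b $ i else c (n - 1) $ i)" for i n
  using arg_cong[OF eq[of i], of "%F. fps_nth F n"]
  by (cases n) (simp_all add: fps_sum_nth nth)
 have mv: "(\<Sum>j\<in>UNIV. M $ i $ j * v $ j) = (M *v v) $ i" for v i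
  by (simp add: matrix_vector_mult_def)
 have "c n = (\<chi> k. complex_of_real ((mat_pow (matrix_inv M) (Suc n) *v b) $ k))" for n
 proof (induction n)
  case (0)
  show ?case
  proof (rule ccontr)
   let ?a = "%n. \<chi> k. complex_of_real ((mat_pow (matrix_inv M) n *v b) $ k)"
   assume ne: "\<not> ?thesis"
   have "eig_shift M 0 *v (c 0 - ?a 1) = 0"
   proof (subst vec_eq_iff, rule allI)
    fix i
    have "(\<Sum>j\<in>UNIV. M $ i $ j * (mat_pow (matrix_inv M) (Suc 0) *v b) $ j) = b $ i"
     by (simp only: mv M_inv_pow mat_pow_0 matrix_vector_mul_lid)
    from arg_cong[OF this, of complex_of_real] show "(eig_shift M 0 *v (c 0 - ?a 1)) $ i = 0 $ i"
     unfolding eig_shift_mult using step[of i 0] by (simp add: right_diff_distrib sum_subtractf)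
   qed
   moreover have "inj ((*v) (eig_shift M 0))"
    using det_shift_nz[of 0] theta by (intro inj_matrix_vector_mult) (simp add: invertible_det_nz)
   ultimately have "c 0 - ?a 1 = 0" by (metis injD matrix_vector_mult_0_right)
   with ne show False by simp
  qed
 next
  case (Suc n)
  show ?case
  proof (rule ccontr)
   let ?a = "%n. \<chi> k. complex_of_real ((mat_pow (matrix_inv M) n *v b) $ k)"
   assume ne: "\<not> ?thesis"
   have "eig_shift M 0 *v (c (Suc n) - ?a (Suc (Suc n))) = 0"
   proof (subst vec_eq_iff, rule allI)
    fix i
    have "(\<Sum>j\<in>UNIV. M $ i $ j * (mat_pow (matrix_inv M) (Suc (Suc n)) *v b) $ j) = (mat_pow (matrix_inv M) (Suc n) *v b) $ i"
     by (simp only: mv M_inv_pow)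
    from arg_cong[OF this, of complex_of_real] show "(eig_shift M 0 *v (c (Suc n) - ?a (Suc (Suc n)))) $ i = 0 $ i"
     unfolding eig_shift_mult using step[of i "Suc n"] Suc by (simp add: right_diff_distrib sum_subtractf)
   qed
   moreover have "inj ((*v) (eig_shift M 0))"
    using det_shift_nz[of 0] theta by (intro inj_matrix_vector_mult) (simp add: invertible_det_nz)
   ultimately have "c (Suc n) - ?a (Suc (Suc n)) = 0" by (metis injD matrix_vector_mult_0_right)
   with ne show False by simp
  qed
 qed
 then have "c n $ k = complex_of_real ((mat_pow (matrix_inv M) (Suc n) *v b) $ k)" by simp
 then show ?thesis by (simp add: c_def)
qed

lemma inv_pow_nth_bound: "\<exists>B\<ge>0. \<forall>n. \<bar>(mat_pow (matrix_inv M) n *v b) $ k\<bar> <= B * (1 / \<theta>) ^ n"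
proof -
 let ?b = "\<chi> i. complex_of_real (b $ i)"
 let ?R = "resolvent M ?b k"
 have sub: "cball 0 \<theta> \<subseteq> {z. det (eig_shift M z) ~= 0}" using det_shift_nz by auto
 have hol: "?R holomorphic_on cball 0 \<theta>" by (rule holomorphic_on_subset[OF resolvent_holomorphic sub])
 have cont: "continuous_on (cball 0 \<theta>) ?R" by (rule holomorphic_on_imp_continuous_on[OF hol])
 have "bounded (?R ` cball 0 \<theta>)" by (intro compact_imp_bounded compact_continuous_image cont) simp
 then obtain B where B: "\<And>z. z \<in> cball 0 \<theta> ==> cmod (?R z) <= B" unfolding bounded_iff by blast
 have B0: "B \<ge> 0" using order_trans[OF norm_ge_zero B[of 0]] theta by simp
 have "\<bar>(mat_pow (matrix_inv M) (Suc n) *v b) $ k\<bar> <= B * \<theta> * (1 / \<theta>) ^ Suc n" for n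
 proof -
  have "cmod ((deriv ^^ n) ?R 0) <= fact n * B / \<theta> ^ n"
   by (rule Cauchy_inequality[OF holomorphic_on_subset[OF hol ball_subset_cball] cont theta]) (auto intro!: B)
  then have "cmod ((deriv ^^ n) ?R 0 / fact n) <= B / \<theta> ^ n"
   by (simp add: norm_divide divide_le_eq field_simps)
  then show ?thesis unfolding resolvent_coeff using theta by (simp add: field_simps)
 qed
 \<comment> \<open>The coefficient of order n bounds the power n + 1, which costs the factor
   \<theta>; the summand |b_k| covers the power 0.\<close>
 then have "\<bar>(mat_pow (matrix_inv M) n *v b) $ k\<bar> <= (B * \<theta> + \<bar>b $ k\<bar>) * (1 / \<theta>) ^ n" for n
 proof (cases n)
  case 0
  then show ?thesis using B0 theta by simp
 next
  case (Suc m)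
  have "B * \<theta> * (1 / \<theta>) ^ n <= (B * \<theta> + \<bar>b $ k\<bar>) * (1 / \<theta>) ^ n"
   using theta by (intro mult_right_mono) auto
  then show ?thesis using \<open>\<And>n. \<bar>(mat_pow (matrix_inv M) (Suc n) *v b) $ k\<bar> <= B * \<theta> * (1 / \<theta>) ^ Suc n\<close>[of m] Suc
   by (auto intro: order_trans)
 qed
 then show ?thesis using B0 theta by (intro exI[of _ "B * \<theta> + \<bar>b $ k\<bar>"]) auto
qed

lemma inv_pow_bound: "\<exists>C\<ge>0. \<forall>n x. norm (mat_pow (matrix_inv M) n *v x) <= C * (1 / \<theta>) ^ n * norm x"
proof -
 have "\<exists>B. B \<ge> 0 \<and> (\<forall>n. \<bar>(mat_pow (matrix_inv M) n *v axis i 1) $ k\<bar> <= B * (1 / \<theta>) ^ n)" for i k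
  using inv_pow_nth_bound by blast
 then obtain B where B: "\<And>i k. B i k \<ge> 0" "\<And>i k n. \<bar>(mat_pow (matrix_inv M) n *v axis i 1) $ k\<bar> <= B i k * (1 / \<theta>) ^ n"
  by metis
 have "norm (mat_pow (matrix_inv M) n *v x) <= (\<Sum>k\<in>UNIV. \<Sum>i\<in>UNIV. B i k) * (1 / \<theta>) ^ n * norm x" for n x
 proof -
  let ?A = "mat_pow (matrix_inv M) n"
  have "norm (?A *v x) <= (\<Sum>k\<in>UNIV. \<bar>(?A *v x) $ k\<bar>)" by (rule norm_le_l1_cart)
  also have "... <= (\<Sum>k\<in>UNIV. \<Sum>i\<in>UNIV. B i k * (1 / \<theta>) ^ n * norm x)"
  proof (rule sum_mono)
   fix k
   have "(?A *v x) $ k = (\<Sum>i\<in>UNIV. (?A *v axis i 1) $ k * x $ i)"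
    by (simp add: matrix_vector_mult_def axis_def if_distrib if_distribR sum.delta cong: if_cong)
   also have "\<bar>...\<bar> <= (\<Sum>i\<in>UNIV. \<bar>(?A *v axis i 1) $ k * x $ i\<bar>)" by (rule sum_abs)
   also have "... <= (\<Sum>i\<in>UNIV. B i k * (1 / \<theta>) ^ n * norm x)"
   proof (rule sum_mono)
    fix i
    show "\<bar>(?A *v axis i 1) $ k * x $ i\<bar> <= B i k * (1 / \<theta>) ^ n * norm x"
     unfolding abs_mult using B theta component_le_norm_cart[of x i] by (intro mult_mono) auto
   qed
   finally show "\<bar>(?A *v x) $ k\<bar> <= (\<Sum>i\<in>UNIV. B i k * (1 / \<theta>) ^ n * norm x)" .
  qed
  finally show ?thesis by (simp add: sum_distrib_right)
 qed
 then show ?thesis using B by (intro exI[of _ "\<Sum>k\<in>UNIV. \<Sum>i\<in>UNIV. B i k"]) (auto intro!: sum_nonneg)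
qed

text \<open>Frequencies transform by the transpose. Pairing the image y with itself moves the matrix
  back onto y, and after Cauchy-Schwarz and the bound for the untransposed power one factor norm y
  cancels.\<close>

lemma inv_pow_transpose_bound:
 "\<exists>C\<ge>0. \<forall>n x. norm (transpose (mat_pow (matrix_inv M) n) *v x) <= C * (1 / \<theta>) ^ n * norm x"
proof -
 obtain C where C: "C \<ge> 0" "\<And>n x. norm (mat_pow (matrix_inv M) n *v x) <= C * (1 / \<theta>) ^ n * norm x"
  using inv_pow_bound by blast
 have "norm (transpose (mat_pow (matrix_inv M) n) *v x) <= C * (1 / \<theta>) ^ n * norm x" for n x
 proof -
  let ?A = "mat_pow (matrix_inv M) n" and ?y = "transpose (mat_pow (matrix_inv M) n) *v x"
  have "(norm ?y)\<^sup>2 = ?y \<bullet> ?y" by (rule power2_norm_eq_inner)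
  also have "... = x \<bullet> (?A *v ?y)" by (metis dot_lmul_matrix transpose_matrix_vector)
  also have "... <= norm x * norm (?A *v ?y)" by (rule norm_cauchy_schwarz)
  also have "... <= norm x * (C * (1 / \<theta>) ^ n * norm ?y)" by (intro mult_left_mono C) simp
  finally have "norm ?y * norm ?y <= (C * (1 / \<theta>) ^ n * norm x) * norm ?y" by (simp add: power2_eq_square mult_ac)
  then show ?thesis
   using C theta by (cases "norm ?y = 0") (auto intro!: mult_nonneg_nonneg)
 qed
 then show ?thesis using C by blast
qed

end

section \<open>Averaged sampling\<close>

text \<open>Induction on the index set: the exponent k of the new index is split off, and the sums
  over the remaining exponents recombine by the binomial theorem.\<close>

lemma multinomial_on:
 fixes x :: "'n::finite => complex"
 assumes "finite S"
 shows "(\<Sum>\<beta> | (\<forall>i. i \<notin> S --> \<beta> i = 0) \<and> sum \<beta> S = n. \<Prod>i\<in>S. x i ^ \<beta> i / fact (\<beta> i)) = (\<Sum>i\<in>S. x i) ^ n / fact n"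
 using assms
proof (induction S arbitrary: n)
 case empty
 have "{\<beta> :: 'n => nat. (\<forall>i. i \<notin> {} --> \<beta> i = 0) \<and> sum \<beta> {} = n} = (if n = 0 then {%_. 0} else {})"
  by (auto simp: fun_eq_iff)
 then show ?case by simp
next
 case (insert a S)
 let ?B = "%S n. {\<beta> :: 'n => nat. (\<forall>i. i \<notin> S --> \<beta> i = 0) \<and> sum \<beta> S = n}"
 let ?f = "%S \<beta>. \<Prod>i\<in>S. x i ^ \<beta> i / fact (\<beta> i)"
 have finB: "finite (?B S m)" for m
 proof (rule finite_subset)
  show "?B S m \<subseteq> Pi\<^sub>E UNIV (%_. {..m})"
  proof safe
   fix \<beta> :: "'n => nat" and i assume "\<forall>i. i \<notin> S --> \<beta> i = 0"
   then show "\<beta> i <= sum \<beta> S" using insert.hyps(1) by (cases "i \<in> S") (auto intro: member_le_sum)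
  qed simp
 qed (simp add: finite_PiE)
 have "(\<Sum>\<beta>\<in>?B (insert a S) n. ?f (insert a S) \<beta>)
   = (\<Sum>(k, \<beta>)\<in>(SIGMA k:{..n}. ?B S (n - k)). x a ^ k / fact k * ?f S \<beta>)"
 proof (rule sum.reindex_bij_witness[where i = "%(k, \<beta>). \<beta>(a := k)" and j = "%\<beta>. (\<beta> a, \<beta>(a := 0))"])
  fix \<beta> assume \<beta>: "\<beta> \<in> ?B (insert a S) n"
  have S0: "sum (\<beta>(a := 0)) S = sum \<beta> S" using insert.hyps(2) by (intro sum.cong) auto
  have "\<beta> a + sum \<beta> S = n" using \<beta> insert.hyps by simp
  then show "(\<beta> a, \<beta>(a := 0)) \<in> (SIGMA k:{..n}. ?B S (n - k))" using \<beta> S0 insert.hyps by auto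
  have "?f S (\<beta>(a := 0)) = ?f S \<beta>" using insert.hyps(2) by (intro prod.cong) auto
  then show "(case (\<beta> a, \<beta>(a := 0)) of (k, \<beta>) => x a ^ k / fact k * ?f S \<beta>) = ?f (insert a S) \<beta>"
   using insert.hyps by simp
 next
  fix p assume "p \<in> (SIGMA k:{..n}. ?B S (n - k))"
  then obtain k \<beta> where p: "p = (k, \<beta>)" "k <= n" "\<beta> \<in> ?B S (n - k)" by auto
  have "sum (\<beta>(a := k)) S = sum \<beta> S" using insert.hyps(2) by (intro sum.cong) auto
  then show "(case p of (k, \<beta>) => \<beta>(a := k)) \<in> ?B (insert a S) n" using p insert.hyps by simp
  show "((case p of (k, \<beta>) => \<beta>(a := k)) a, (case p of (k, \<beta>) => \<beta>(a := k))(a := 0)) = p"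
   using p insert.hyps by (auto simp: fun_eq_iff)
 qed auto
 also have "... = (\<Sum>k\<le>n. \<Sum>\<beta>\<in>?B S (n - k). x a ^ k / fact k * ?f S \<beta>)"
  by (rule sum.Sigma[symmetric]) (auto simp: finB)
 also have "... = (\<Sum>k\<le>n. x a ^ k / fact k * ((\<Sum>i\<in>S. x i) ^ (n - k) / fact (n - k)))"
  by (simp only: sum_distrib_left[symmetric] insert.IH)
 also have "... = (\<Sum>k\<le>n. of_nat (n choose k) * x a ^ k * (\<Sum>i\<in>S. x i) ^ (n - k)) / fact n"
  unfolding sum_divide_distrib by (intro sum.cong refl) (simp add: binomial_fact)
 also have "... = (\<Sum>i\<in>insert a S. x i) ^ n / fact n"
  using insert.hyps by (simp add: binomial_ring)
 finally show ?case .
qed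

lemma multinomial:
 fixes x :: "'n::finite => complex"
 shows "(\<Sum>\<beta> | mi_abs \<beta> = n. \<Prod>i\<in>UNIV. x i ^ \<beta> i / fact (\<beta> i)) = (\<Sum>i\<in>UNIV. x i) ^ n / fact n"
 using multinomial_on[of UNIV x n] by (simp add: mi_abs_def)

section \<open>The averaging measure and its characteristic function\<close>

lemma lebesgue_measurable_AE:
 fixes f g :: "'a::euclidean_space => complex"
 assumes g: "g \<in> borel_measurable lebesgue" and fg: "AE x in lebesgue. f x = g x"
 shows "f \<in> borel_measurable lebesgue"
proof (rule measurableI)
 fix B :: "complex set" assume B: "B \<in> sets borel"
 let ?N = "{x. f x ~= g x}"
 have N: "?N \<in> null_sets lebesgue" using fg by (simp add: completion.AE_iff_null_sets)
 have "f -` B \<inter> ?N \<in> null_sets lebesgue" by (rule completion.complete2[OF _ N]) auto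
 moreover have "g -` B \<in> sets lebesgue" using measurable_sets[OF g B] by simp
 ultimately have "(g -` B - ?N) \<union> (f -` B \<inter> ?N) \<in> sets lebesgue" using N by (intro sets.Un sets.Diff) auto
 also have "(g -` B - ?N) \<union> (f -` B \<inter> ?N) = f -` B \<inter> space lebesgue" by auto
 finally show "f -` B \<inter> space lebesgue \<in> sets lebesgue" .
qed simp

lemma integral_lebesgue_AE:
 fixes f g :: "'a::euclidean_space => complex"
 assumes g[measurable]: "g \<in> borel_measurable borel" and fg: "AE x in lebesgue. f x = g x"
 shows "(LINT x|lebesgue. f x) = (LINT x|lborel. g x)" "integrable lebesgue f \<longleftrightarrow> integrable lborel g"
proof -
 have gl[measurable]: "g \<in> borel_measurable lebesgue" by (intro measurable_completion) simp
 have fl[measurable]: "f \<in> borel_measurable lebesgue" by (rule lebesgue_measurable_AE[OF gl fg])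
 have "(LINT x|lebesgue. f x) = (LINT x|lebesgue. g x)" by (rule integral_cong_AE[OF fl gl fg])
 then show "(LINT x|lebesgue. f x) = (LINT x|lborel. g x)" by (simp add: integral_lebesgue_lborel)
 have "integrable lebesgue f \<longleftrightarrow> integrable lebesgue g" by (rule integrable_cong_AE[OF fl gl fg])
 then show "integrable lebesgue f \<longleftrightarrow> integrable lborel g" by (simp add: integral_lebesgue_lborel)
qed

text \<open>The averaging procedure is integration against a probability measure on \<open>\<real>\<^sup>n\<close>, the mixture
 of the uniform distributions on the balls.\<close>

locale averaging =
 fixes \<nu> :: "(real ^ 'n) measure" and N :: nat
 assumes prob: "prob_space \<nu>" and sets_nu [measurable_cong, simp]: "sets \<nu> = sets borel"
  and moment: "(\<integral>\<^sup>+s. ennreal (norm s ^ (N + 1)) \<partial>\<nu>) < \<infinity>"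

text \<open>The integrability assumptions make w and w (1 + h^(N+1)) measurable, but h itself is not
  assumed measurable. Borel versions of these two functions determine a Borel version of h wherever
  w > 0, and the values of h elsewhere carry no mass.\<close>

proposition averaging_measure:
 fixes h w :: "real => real"
 assumes h: "\<And>u. u > 0 ==> h u > 0"
  and w: "\<And>u. u > 0 ==> w u \<ge> 0" "set_integrable lebesgue {0<..} w"
   "(LINT u:{0<..}|lebesgue. w u) = 1"
  and wh: "set_integrable lebesgue {0<..} (%u. w u * (1 + h u ^ (N + 1)))"
 obtains \<nu> :: "(real ^ 'n) measure" where "averaging \<nu> N"
  "\<And>G C. G \<in> borel_measurable borel ==> (\<And>s. cmod (G s) <= C * (1 + norm s ^ (N + 1))) ==>
   (LINT u:{0<..}|lebesgue. complex_of_real (w u / ball_vol TYPE('n) (h u)) * (LINT s:cball 0 (h u)|lborel. G s)) = (LINT s|\<nu>. G s)"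
proof -
 let ?I = "indicator {0<..} :: real => real"
 have wl: "(%u. ?I u * w u) \<in> borel_measurable lebesgue"
  using borel_measurable_integrable[OF w(2)[unfolded set_integrable_def]] by simp
 have ql: "(%u. ?I u * (w u * (1 + h u ^ (N + 1)))) \<in> borel_measurable lebesgue"
  using borel_measurable_integrable[OF wh[unfolded set_integrable_def]] by simp
 obtain w' where w'[measurable]: "w' \<in> borel_measurable borel" and ww: "AE u in lborel. ?I u * w u = w' u"
  using completion_ex_borel_measurable_real[OF wl] by auto
 obtain q where q[measurable]: "q \<in> borel_measurable borel" and wq: "AE u in lborel. ?I u * (w u * (1 + h u ^ (N + 1))) = q u"
  using completion_ex_borel_measurable_real[OF ql] by auto
 define om where "om u = max 0 (w' u)" for u
 \<comment> \<open>The equation q = w' (1 + h^(N+1)) solved for h. Where the root is not positive,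
   \<open>h'\<close> defaults to radius 1, so that every ball volume is positive.\<close>
 define h0 where "h0 u = root (N + 1) (q u / w' u - 1)" for u
 define h' where "h' u = (if h0 u > 0 then h0 u else 1)" for u
 have [measurable]: "om \<in> borel_measurable borel" "h0 \<in> borel_measurable borel" "h' \<in> borel_measurable borel"
  unfolding om_def h0_def h'_def by measurable
 have h'_pos: "h' u > 0" for u by (simp add: h'_def)
 have om0: "om u \<ge> 0" for u by (simp add: om_def)
 have ae: "AE u in lborel. om u = ?I u * w u \<and> (om u > 0 --> u > 0 \<and> h' u = h u)"
  using ww wq
 proof eventually_elim
  fix u assume a: "?I u * w u = w' u" "?I u * (w u * (1 + h u ^ (N + 1))) = q u"
  have "?I u * w u \<ge> 0" using w(1)[of u] by (auto split: split_indicator)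
  then have om: "om u = ?I u * w u" using a by (simp add: om_def)
  moreover have "u > 0 \<and> h' u = h u" if "om u > 0"
  proof -
   have u: "u > 0" "w u > 0" using that om by (auto split: split_indicator_asm)
   then have "q u / w' u - 1 = h u ^ (N + 1)" using a by (simp add: field_simps)
   then have "h0 u = h u" unfolding h0_def using h[OF u(1)] by (simp only:) (rule real_root_power_cancel, auto)
   then show ?thesis using u h[OF u(1)] by (simp add: h'_def)
  qed
  ultimately show "om u = ?I u * w u \<and> (om u > 0 --> u > 0 \<and> h' u = h u)" by blast
 qed
 define V where "V r = measure lborel (cball (0 :: real ^ 'n) r)" for r
 have Ve: "ennreal (V r) = (\<integral>\<^sup>+s. (if norm (s :: real ^ 'n) <= r then 1 else 0) \<partial>lborel)" for r
 proof -
  have "ennreal (V r) = emeasure lborel (cball (0 :: real ^ 'n) r)"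
   unfolding V_def using emeasure_lborel_cball_finite[of "0 :: real ^ 'n" r] by (intro emeasure_eq_ennreal_measure[symmetric]) auto
  also have "... = (\<integral>\<^sup>+s. indicator (cball 0 r) (s :: real ^ 'n) \<partial>lborel)" by simp
  also have "... = (\<integral>\<^sup>+s. (if norm (s :: real ^ 'n) <= r then 1 else 0) \<partial>lborel)"
   by (intro nn_integral_cong) (auto split: split_indicator)
  finally show ?thesis .
 qed
 have V_eq: "V r = enn2real (\<integral>\<^sup>+s. (if norm (s :: real ^ 'n) <= r then 1 else 0) \<partial>lborel)" for r
  unfolding Ve[symmetric] by (simp add: V_def)
 have [measurable]: "V \<in> borel_measurable borel" unfolding V_eq[abs_def] by measurable
 have V_pos: "r > 0 ==> V r > 0" for r
  using content_cball_pos[of r "0 :: real ^ 'n"] by (simp add: V_def)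
 have bv: "ball_vol TYPE('n) r = V r" for r by (simp add: ball_vol_def V_def)
 \<comment> \<open>Joint density of the pair (u, s): u has density w, and s given u is uniform on
   the ball of radius h(u). The measure \<nu> is the law of s.\<close>
 define D where "D = (%(u, s). om u / V (h' u) * (if norm (s :: real ^ 'n) <= h' u then 1 else 0))"
 have [measurable]: "D \<in> borel_measurable (lborel \<Otimes>\<^sub>M lborel)" unfolding D_def by measurable
 have D0: "D z \<ge> 0" for z
  using om0 V_pos[OF h'_pos] by (auto simp: D_def split_beta less_imp_le)
 define \<nu> where "\<nu> = distr (density (lborel \<Otimes>\<^sub>M lborel) (%z. ennreal (D z))) borel snd"
 have nn: "(\<integral>\<^sup>+s. G s \<partial>\<nu>) = (\<integral>\<^sup>+u. (\<integral>\<^sup>+s. ennreal (D (u, s)) * G s \<partial>lborel) \<partial>lborel)"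
  if [measurable]: "G \<in> borel_measurable borel" for G
 proof -
  have "(\<integral>\<^sup>+s. G s \<partial>\<nu>) = (\<integral>\<^sup>+z. ennreal (D z) * G (snd z) \<partial>(lborel \<Otimes>\<^sub>M lborel))"
   unfolding \<nu>_def by (subst nn_integral_distr, simp, simp, subst nn_integral_density) simp_all
  also have "... = (\<integral>\<^sup>+u. (\<integral>\<^sup>+s. ennreal (D (u, s)) * G s \<partial>lborel) \<partial>lborel)"
   by (subst lborel.nn_integral_fst[symmetric]) simp_all
  finally show ?thesis .
 qed
 have inner: "(\<integral>\<^sup>+s. ennreal (D (u, s)) \<partial>lborel) = ennreal (om u)" for u
 proof -
  have "(\<integral>\<^sup>+s. ennreal (D (u, s)) \<partial>lborel) = (\<integral>\<^sup>+s. ennreal (om u / V (h' u)) * (if norm (s :: real ^ 'n) <= h' u then 1 else 0) \<partial>lborel)"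
   by (intro nn_integral_cong) (auto simp: D_def)
  also have "... = ennreal (om u / V (h' u)) * ennreal (V (h' u))"
   by (simp add: nn_integral_cmult Ve)
  also have "... = ennreal (om u)"
   using V_pos[OF h'_pos[of u]] om0[of u] by (subst ennreal_mult[symmetric]) auto
  finally show ?thesis .
 qed
 have aeL: "AE u in lebesgue. om u = ?I u * w u" by (rule AE_completion) (use ae in \<open>auto elim: eventually_mono\<close>)
 have om_int: "integrable lborel (%u. complex_of_real (om u))" "(LINT u|lborel. complex_of_real (om u)) = 1"
 proof -
  have ael: "AE u in lebesgue. complex_of_real (?I u * w u) = complex_of_real (om u)"
   using aeL by eventually_elim simp
  have "integrable lebesgue (%u. complex_of_real (?I u * w u))"
   using w(2) by (intro integrable_of_real) (simp add: set_integrable_def)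
  then show "integrable lborel (%u. complex_of_real (om u))"
   by (subst (asm) integral_lebesgue_AE(2)[OF _ ael]) simp_all
  have "(LINT u|lborel. complex_of_real (om u)) = (LINT u|lebesgue. complex_of_real (?I u * w u))"
   by (rule integral_lebesgue_AE(1)[OF _ ael, symmetric]) simp
  also have "... = complex_of_real (LINT u|lebesgue. ?I u * w u)" by (rule integral_complex_of_real)
  also have "... = 1" using w(3) by (simp add: set_lebesgue_integral_def)
  finally show "(LINT u|lborel. complex_of_real (om u)) = 1" .
 qed
 have nn_om: "(\<integral>\<^sup>+u. ennreal (om u) \<partial>lborel) = 1"
 proof -
  have "integrable lborel om" using integrable_Re[OF om_int(1)] by simp
  moreover have "(LINT u|lborel. om u) = 1" using integral_Re[OF om_int(1)] om_int(2) by simp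
  ultimately show ?thesis using om0 by (subst nn_integral_eq_integral) auto
 qed
 have av: "averaging \<nu> N"
 proof (rule averaging.intro)
  show "prob_space \<nu>"
  proof (rule prob_spaceI)
   have "emeasure \<nu> (space \<nu>) = (\<integral>\<^sup>+s. 1 \<partial>\<nu>)" by simp
   also have "... = 1" by (subst nn) (simp_all add: inner nn_om)
   finally show "emeasure \<nu> (space \<nu>) = 1" .
  qed
  show "sets \<nu> = sets borel" by (simp add: \<nu>_def)
  have "(\<integral>\<^sup>+s. ennreal (norm s ^ (N + 1)) \<partial>\<nu>) = (\<integral>\<^sup>+u. (\<integral>\<^sup>+s. ennreal (D (u, s)) * ennreal (norm s ^ (N + 1)) \<partial>lborel) \<partial>lborel)"
   by (rule nn) simp
  also have "... <= (\<integral>\<^sup>+u. (\<integral>\<^sup>+s. ennreal (D (u, s)) * ennreal (h' u ^ (N + 1)) \<partial>lborel) \<partial>lborel)"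
  proof (intro nn_integral_mono)
   fix u and s :: "real ^ 'n"
   show "ennreal (D (u, s)) * ennreal (norm s ^ (N + 1)) <= ennreal (D (u, s)) * ennreal (h' u ^ (N + 1))"
    by (cases "norm s <= h' u") (auto simp: D_def less_imp_le[OF h'_pos] intro!: mult_left_mono ennreal_leI mult_mono power_mono)
  qed
  also have "... = (\<integral>\<^sup>+u. ennreal (om u * h' u ^ (N + 1)) \<partial>lborel)"
   by (simp add: nn_integral_multc inner ennreal_mult om0 less_imp_le[OF h'_pos])
  also have "... <= (\<integral>\<^sup>+u. ennreal (cmod (complex_of_real (q u))) \<partial>lborel)"
  proof (rule nn_integral_mono_AE)
   show "AE u in lborel. ennreal (om u * h' u ^ (N + 1)) <= ennreal (cmod (complex_of_real (q u)))"
    using ae wq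
   proof eventually_elim
    fix u assume a: "om u = ?I u * w u \<and> (om u > 0 --> u > 0 \<and> h' u = h u)" "?I u * (w u * (1 + h u ^ (N + 1))) = q u"
    show "ennreal (om u * h' u ^ (N + 1)) <= ennreal (cmod (complex_of_real (q u)))"
    proof (cases "om u > 0")
     case True
     then have u: "u > 0" "h' u = h u" using a(1) by blast+
     have "om u = w u" using conjunct1[OF a(1)] u(1) by simp
     then have "q u = om u * (1 + h' u ^ (N + 1))" using a(2)[symmetric] u(1) unfolding u(2) by simp
     then have "om u * h' u ^ (N + 1) <= q u" using True by (simp add: distrib_left)
     then show ?thesis by (intro ennreal_leI) simp
    next
     case False
     then have "om u = 0" using om0[of u] by simp
     then show ?thesis by simp
    qed
   qed
  qed
  also have "... < \<infinity>"
  proof -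
   have ael: "AE u in lebesgue. complex_of_real (?I u * (w u * (1 + h u ^ (N + 1)))) = complex_of_real (q u)"
    by (rule AE_completion, use wq in eventually_elim) (simp only:)
   have "integrable lebesgue (%u. complex_of_real (?I u * (w u * (1 + h u ^ (N + 1)))))"
    using wh by (intro integrable_of_real) (simp add: set_integrable_def)
   then have "integrable lborel (%u. complex_of_real (q u))"
    by (subst (asm) integral_lebesgue_AE(2)[OF _ ael]) simp_all
   then show ?thesis by (simp add: integrable_iff_bounded)
  qed
  finally show "(\<integral>\<^sup>+s. ennreal (norm s ^ (N + 1)) \<partial>\<nu>) < \<infinity>" .
 qed
 interpret prob_space \<nu> using av by (simp add: averaging_def)
 have eq: "(LINT u:{0<..}|lebesgue. complex_of_real (w u / ball_vol TYPE('n) (h u)) * (LINT s:cball 0 (h u)|lborel. G s)) = (LINT s|\<nu>. G s)"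
  if G[measurable]: "G \<in> borel_measurable borel" and GC: "\<And>s. cmod (G s) <= C * (1 + norm s ^ (N + 1))" for G C
 proof -
  have Gi: "integrable \<nu> G"
  proof (rule Bochner_Integration.integrable_bound)
   have "integrable \<nu> (%s. norm s ^ (N + 1))"
    using av by (intro integrableI_nonneg) (auto simp: averaging_def)
   then show "integrable \<nu> (%s. C * (1 + norm s ^ (N + 1)))" by simp
   show "AE s in \<nu>. norm (G s) <= norm (C * (1 + norm s ^ (N + 1)))"
    unfolding real_norm_def by (intro AE_I2 order_trans[OF GC abs_ge_self])
  qed (use av in \<open>simp add: averaging_def cong: measurable_cong_sets\<close>)
  have i: "integrable (lborel \<Otimes>\<^sub>M lborel) (%z. D z *\<^sub>R G (snd z))"
  proof -
   have "integrable (density (lborel \<Otimes>\<^sub>M lborel) (%z. ennreal (D z))) (%z. G (snd z))"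
    using Gi unfolding \<nu>_def by (subst (asm) integrable_distr_eq) simp_all
   then show ?thesis by (subst (asm) integrable_density) (simp_all add: D0)
  qed
  have "(LINT s|\<nu>. G s) = (LINT z|density (lborel \<Otimes>\<^sub>M lborel) (%z. ennreal (D z)). G (snd z))"
   unfolding \<nu>_def by (rule integral_distr) simp_all
  also have "... = (LINT z|(lborel \<Otimes>\<^sub>M lborel). D z *\<^sub>R G (snd z))"
   by (rule integral_density) (simp_all add: D0)
  also have "... = (LINT u|lborel. (LINT s|lborel. D (u, s) *\<^sub>R G s))"
   by (subst lborel_pair.integral_fst'[OF i, symmetric]) simp
  also have "... = (LINT u|lebesgue. ?I u *\<^sub>R (complex_of_real (w u / ball_vol TYPE('n) (h u)) * (LINT s:cball 0 (h u)|lborel. G s)))"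
  proof (rule integral_lebesgue_AE(1)[symmetric])
   show "(%u. LINT s|lborel. D (u, s) *\<^sub>R G s) \<in> borel_measurable borel" by measurable
   show "AE u in lebesgue. ?I u *\<^sub>R (complex_of_real (w u / ball_vol TYPE('n) (h u)) * (LINT s:cball 0 (h u)|lborel. G s)) = (LINT s|lborel. D (u, s) *\<^sub>R G s)"
   proof (rule AE_completion, use ae in eventually_elim)
    fix u assume a: "om u = ?I u * w u \<and> (om u > 0 --> u > 0 \<and> h' u = h u)"
    show "?I u *\<^sub>R (complex_of_real (w u / ball_vol TYPE('n) (h u)) * (LINT s:cball 0 (h u)|lborel. G s)) = (LINT s|lborel. D (u, s) *\<^sub>R G s)"
    proof (cases "om u > 0")
     case True
     then have u: "u > 0" "h' u = h u" using a by blast+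
     have om: "om u = w u" using conjunct1[OF a] u(1) by simp
     have "D (u, s) *\<^sub>R G s = complex_of_real (w u / V (h u)) * (indicator (cball 0 (h u)) s *\<^sub>R G s)" for s
      by (simp add: D_def u om scaleR_conv_of_real)
     then have "(LINT s|lborel. D (u, s) *\<^sub>R G s) = complex_of_real (w u / V (h u)) * (LINT s|lborel. indicator (cball 0 (h u)) s *\<^sub>R G s)"
      by (simp only: integral_mult_right_zero)
     then show ?thesis using u(1) by (simp add: set_lebesgue_integral_def bv)
    next
     case False
     then have "om u = 0" using om0[of u] by simp
     moreover from this have "?I u * w u = 0" using conjunct1[OF a] by argo
     ultimately have "?I u = 0 \<or> w u = 0" "\<And>s. D (u, s) = 0" by (auto simp: D_def)
     then show ?thesis by (auto simp: scaleR_conv_of_real)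
    qed
   qed
  qed
  finally show ?thesis by (simp add: set_lebesgue_integral_def)
 qed
 show thesis by (rule that[OF av eq])
qed

context averaging
begin

interpretation nu: prob_space \<nu> by (rule prob)

lemma space_nu [simp]: "space \<nu> = UNIV"
 using sets_eq_imp_space_eq[OF sets_nu] by simp

lemma moment_integrable: "n <= N + 1 ==> integrable \<nu> (%s. norm s ^ n)"
proof (rule Bochner_Integration.integrable_bound[of \<nu> "%s. 1 + norm s ^ (N + 1)"])
 assume n: "n <= N + 1"
 have "integrable \<nu> (%s. norm s ^ (N + 1))"
  using moment by (intro integrableI_nonneg) auto
 then show "integrable \<nu> (%s. 1 + norm s ^ (N + 1))" by simp
 show "AE s in \<nu>. norm (norm s ^ n) <= norm (1 + norm s ^ (N + 1))"
 proof (intro AE_I2)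
  fix s :: "real ^ 'n"
  show "norm (norm s ^ n) <= norm (1 + norm s ^ (N + 1))"
  proof (cases "norm s <= 1")
   case True
   then have "norm s ^ n <= 1" by (intro power_le_one) auto
   moreover have "0 <= norm s ^ (N + 1)" by simp
   ultimately have "norm s ^ n <= 1 + norm s ^ (N + 1)" by linarith
   then show ?thesis by simp
  next
   case False
   then have "norm s ^ n <= norm s ^ (N + 1)" using n by (intro power_increasing) auto
   then show ?thesis by simp
  qed
 qed
qed simp

definition mu :: "real ^ 'n => complex" where
 "mu eta = (LINT s|\<nu>. echar (s \<bullet> eta))"

lemma mu_measurable [measurable]: "mu \<in> borel_measurable borel"
 unfolding mu_def by measurable

lemma norm_mu_le: "cmod (mu eta) <= 1"
proof -
 have "cmod (mu eta) <= (LINT s|\<nu>. cmod (echar (s \<bullet> eta)))" unfolding mu_def by (rule integral_norm_bound)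
 then show ?thesis using nu.prob_space by simp
qed

text \<open>Taylor expansion of the exponential at 2 pi (s \<bullet> eta), integrated over \<nu>:
  the moment of order N + 1 controls the remainder, and the multinomial theorem sorts the polynomial
  part by multi-indices into the symbol.\<close>

lemma mu_taylor:
 assumes a: "\<And>\<beta>. mi_abs \<beta> <= N ==> a \<beta> = (LINT s|\<nu>. complex_of_real (mi_pow s \<beta> / mi_fact \<beta>))"
 shows "\<exists>C\<ge>0. \<forall>eta. cmod (mu eta - dsymbol N a eta) <= C * norm eta ^ (N + 1)"
proof -
 define K where "K = (LINT s|\<nu>. norm s ^ (N + 1))"
 have ip: "integrable \<nu> (%s. (\<i> * of_real (2 * pi * (s \<bullet> eta))) ^ n / fact n)" if "n <= N" for n eta
 proof (rule Bochner_Integration.integrable_bound[of \<nu> "%s. (2 * pi * norm eta) ^ n * norm s ^ n"])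
  show "integrable \<nu> (%s. (2 * pi * norm eta) ^ n * norm s ^ n)"
   using moment_integrable[of n] that by simp
  show "AE s in \<nu>. norm ((\<i> * of_real (2 * pi * (s \<bullet> eta))) ^ n / fact n) <= norm ((2 * pi * norm eta) ^ n * norm s ^ n)"
  proof (intro AE_I2)
   fix s
   have "norm ((\<i> * of_real (2 * pi * (s \<bullet> eta))) ^ n / fact n) <= norm ((\<i> * complex_of_real (2 * pi * (s \<bullet> eta))) ^ n)"
    by (simp add: norm_divide divide_le_eq mult_le_cancel_left1 fact_ge_1 del: of_real_mult)
   also have "... = \<bar>2 * pi * (s \<bullet> eta)\<bar> ^ n" by (simp add: norm_power norm_mult abs_mult)
   also have "... <= (2 * pi * norm eta * norm s) ^ n"
    using Cauchy_Schwarz_ineq2[of s eta] by (intro power_mono) (auto simp: abs_mult mult_ac)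
   finally show "norm ((\<i> * of_real (2 * pi * (s \<bullet> eta))) ^ n / fact n) <= norm ((2 * pi * norm eta) ^ n * norm s ^ n)"
    by (simp add: power_mult_distrib)
  qed
 qed measurable
 have im: "integrable \<nu> (%s. complex_of_real (mi_pow s \<beta> / mi_fact \<beta>))" if "mi_abs \<beta> <= N" for \<beta>
 proof (rule Bochner_Integration.integrable_bound[of \<nu> "%s. norm s ^ mi_abs \<beta>"])
  show "integrable \<nu> (%s. norm s ^ mi_abs \<beta>)" using moment_integrable that by simp
  have f1: "mi_fact \<beta> \<ge> 1" unfolding mi_fact_def by (rule prod_ge_1) simp
  show "AE s in \<nu>. norm (complex_of_real (mi_pow s \<beta> / mi_fact \<beta>)) <= norm (norm s ^ mi_abs \<beta>)"
  proof (intro AE_I2)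
   fix s :: "real ^ 'n"
   have "\<bar>mi_pow s \<beta>\<bar> <= (\<Prod>i\<in>UNIV. norm s ^ \<beta> i)"
    unfolding mi_pow_def abs_prod power_abs using component_le_norm_cart[of s] by (intro prod_mono conjI power_mono) auto
   also have "... = norm s ^ mi_abs \<beta>" by (simp add: mi_abs_def power_sum)
   finally have le: "\<bar>mi_pow s \<beta>\<bar> <= norm s ^ mi_abs \<beta>" .
   have "\<bar>mi_pow s \<beta>\<bar> / mi_fact \<beta> <= \<bar>mi_pow s \<beta>\<bar>"
    using f1 by (simp add: divide_le_eq mult_le_cancel_left1)
   then show "norm (complex_of_real (mi_pow s \<beta> / mi_fact \<beta>)) <= norm (norm s ^ mi_abs \<beta>)"
    using le f1 by (simp add: norm_divide)
  qed
 qed (simp add: mi_pow_def)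
 have sym: "dsymbol N a eta = (LINT s|\<nu>. (\<Sum>n\<le>N. (\<i> * of_real (2 * pi * (s \<bullet> eta))) ^ n / fact n))" for eta
 proof -
  define c where "c \<beta> = (\<Prod>i\<in>UNIV. (of_real (2 * pi * eta $ i) * \<i>) ^ \<beta> i)" for \<beta>
  have "dsymbol N a eta = (\<Sum>\<beta> | mi_abs \<beta> <= N. (LINT s|\<nu>. complex_of_real (mi_pow s \<beta> / mi_fact \<beta>) * c \<beta>))"
   unfolding dsymbol_def c_def[symmetric] by (intro sum.cong refl) (simp add: a)
  also have "... = (LINT s|\<nu>. (\<Sum>\<beta> | mi_abs \<beta> <= N. complex_of_real (mi_pow s \<beta> / mi_fact \<beta>) * c \<beta>))"
   by (rule Bochner_Integration.integral_sum[symmetric]) (intro integrable_mult_left im, simp)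
  also have "... = (LINT s|\<nu>. (\<Sum>n\<le>N. (\<i> * of_real (2 * pi * (s \<bullet> eta))) ^ n / fact n))"
  proof (intro Bochner_Integration.integral_cong refl)
   fix s
   define x where "x i = \<i> * complex_of_real (2 * pi * (s $ i * eta $ i))" for i
   have x: "(\<Sum>i\<in>UNIV. x i) = \<i> * of_real (2 * pi * (s \<bullet> eta))"
    by (simp add: x_def inner_vec_def sum_distrib_left)
   have "(\<Sum>\<beta> | mi_abs \<beta> <= N. complex_of_real (mi_pow s \<beta> / mi_fact \<beta>) * c \<beta>) = (\<Sum>\<beta> | mi_abs \<beta> <= N. \<Prod>i\<in>UNIV. x i ^ \<beta> i / fact (\<beta> i))"
   proof (intro sum.cong refl)
    fix \<beta> :: "'n => nat"
    show "complex_of_real (mi_pow s \<beta> / mi_fact \<beta>) * c \<beta> = (\<Prod>i\<in>UNIV. x i ^ \<beta> i / fact (\<beta> i))"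
     unfolding mi_pow_def mi_fact_def c_def x_def prod_dividef[symmetric] of_real_prod prod.distrib[symmetric]
     by (intro prod.cong refl) (simp add: power_mult_distrib mult_ac)
   qed
   also have "... = (\<Sum>n\<le>N. \<Sum>\<beta> | \<beta> \<in> {\<beta>. mi_abs \<beta> <= N} \<and> mi_abs \<beta> = n. \<Prod>i\<in>UNIV. x i ^ \<beta> i / fact (\<beta> i))"
    by (rule sum.group[symmetric]) (auto simp: finite_mi_abs)
   also have "... = (\<Sum>n\<le>N. \<Sum>\<beta> | mi_abs \<beta> = n. \<Prod>i\<in>UNIV. x i ^ \<beta> i / fact (\<beta> i))"
    by (intro sum.cong) auto
   also have "... = (\<Sum>n\<le>N. (\<i> * of_real (2 * pi * (s \<bullet> eta))) ^ n / fact n)"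
    by (simp only: multinomial x)
   finally show "(\<Sum>\<beta> | mi_abs \<beta> <= N. complex_of_real (mi_pow s \<beta> / mi_fact \<beta>) * c \<beta>) = (\<Sum>n\<le>N. (\<i> * of_real (2 * pi * (s \<bullet> eta))) ^ n / fact n)" .
  qed
  finally show ?thesis .
 qed
 have "cmod (mu eta - dsymbol N a eta) <= ((2 * pi) ^ (N + 1) * K) * norm eta ^ (N + 1)" for eta
 proof -
  have ie: "integrable \<nu> (%s. echar (s \<bullet> eta))"
   by (rule nu.integrable_const_bound[of _ 1]) auto
  have isum: "integrable \<nu> (%s. \<Sum>n\<le>N. (\<i> * of_real (2 * pi * (s \<bullet> eta))) ^ n / fact n)"
   by (intro Bochner_Integration.integrable_sum ip) simp
  have "mu eta - dsymbol N a eta = (LINT s|\<nu>. echar (s \<bullet> eta) - (\<Sum>n\<le>N. (\<i> * of_real (2 * pi * (s \<bullet> eta))) ^ n / fact n))"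
   unfolding mu_def sym by (rule Bochner_Integration.integral_diff[OF ie isum, symmetric])
  also have "cmod ... <= (LINT s|\<nu>. ((2 * pi) ^ (N + 1) * norm eta ^ (N + 1)) * norm s ^ (N + 1))"
  proof (rule order_trans[OF integral_norm_bound], rule integral_mono)
   fix s
   let ?t = "2 * pi * (s \<bullet> eta)"
   have "cmod (echar (s \<bullet> eta) - (\<Sum>n\<le>N. (\<i> * of_real ?t) ^ n / fact n)) <= \<bar>?t\<bar> ^ Suc N / fact (Suc N)"
    using iexp_approx1[of ?t N] by (simp add: echar_def cis_conv_exp)
   also have "... <= \<bar>?t\<bar> ^ Suc N"
   proof -
    have "\<bar>?t\<bar> ^ Suc N / fact (Suc N) <= \<bar>?t\<bar> ^ Suc N / 1"
     by (intro divide_left_mono) (auto simp del: fact_Suc)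
    then show ?thesis by simp
   qed
   also have "... <= (2 * pi * (norm s * norm eta)) ^ Suc N"
    using Cauchy_Schwarz_ineq2[of s eta] by (intro power_mono) (auto simp: abs_mult)
   finally show "cmod (echar (s \<bullet> eta) - (\<Sum>n\<le>N. (\<i> * of_real ?t) ^ n / fact n)) <= ((2 * pi) ^ (N + 1) * norm eta ^ (N + 1)) * norm s ^ (N + 1)"
    by (simp add: power_mult_distrib mult_ac)
  qed (use ie isum moment_integrable[of "N + 1"] in \<open>auto intro!: integrable_norm Bochner_Integration.integrable_diff\<close>)
  also have "... = ((2 * pi) ^ (N + 1) * K) * norm eta ^ (N + 1)" 
   unfolding integral_mult_right_zero K_def by (simp only: mult_ac)
  finally show ?thesis .
 qed
 moreover have "K \<ge> 0" unfolding K_def by (rule integral_nonneg_AE) simp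
 ultimately show ?thesis by (intro exI[of _ "(2 * pi) ^ (N + 1) * K"]) auto
qed

end

section \<open>Synthesis operators\<close>

text \<open>An L_p bound as an inequality of nonnegative integrals: it presupposes no integrability,
  covers p = \<infinity>, and carries Borel measurability along.\<close>

definition Lp_le :: "ennreal => (real ^ 'n => complex) => real => bool" where
 "Lp_le p u A \<longleftrightarrow> u \<in> borel_measurable borel \<and> A \<ge> 0 \<and>
   (if p = \<infinity> then (AE x in lborel. cmod (u x) <= A)
   else (\<integral>\<^sup>+x. ennreal (cmod (u x) powr enn2real p) \<partial>lborel) <= ennreal (A powr enn2real p))"

lemma powr_add_superadditive:
 fixes a b p :: real
 assumes "a \<ge> 0" "b \<ge> 0" "p \<ge> 1"
 shows "a powr p + b powr p <= (a + b) powr p"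
proof (cases "a = 0 \<or> b = 0")
 case True then show ?thesis using assms by auto
next
 case False
 then have ab: "a > 0" "b > 0" using assms by auto
 have "a powr p = a * a powr (p - 1)" "b powr p = b * b powr (p - 1)" using ab by (simp_all add: powr_diff)
 moreover have "a * a powr (p - 1) <= a * (a + b) powr (p - 1)" "b * b powr (p - 1) <= b * (a + b) powr (p - 1)"
  using ab assms by (auto intro!: mult_left_mono powr_mono2)
 moreover have "(a + b) powr p = (a + b) * (a + b) powr (p - 1)" using ab by (simp add: powr_diff)
 ultimately show ?thesis by (simp add: distrib_right)
qed

text \<open>The modulus of a sum is at most twice the larger modulus. The factor 2 is harmless, as
  constants are not tracked, and it spares Minkowski's inequality.\<close>

lemma Lp_le_add:
 assumes u: "Lp_le p u A" and v: "Lp_le p v B" and p: "1 <= p"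
 shows "Lp_le p (%x. u x + v x) (2 * (A + B))"
proof -
 have [measurable]: "u \<in> borel_measurable borel" "v \<in> borel_measurable borel" and AB: "A \<ge> 0" "B \<ge> 0"
  using u v by (auto simp: Lp_le_def)
 show ?thesis
 proof (cases "p = \<infinity>")
  case True
  then have "AE x in lborel. cmod (u x) <= A" "AE x in lborel. cmod (v x) <= B" using u v by (auto simp: Lp_le_def)
  then have "AE x in lborel. cmod (u x + v x) <= 2 * (A + B)"
  proof eventually_elim
   fix x assume "cmod (u x) <= A" "cmod (v x) <= B"
   then have "cmod (u x + v x) <= A + B" using norm_triangle_ineq[of "u x" "v x"] by linarith
   also have "... <= 2 * (A + B)" using AB by simp
   finally show "cmod (u x + v x) <= 2 * (A + B)" .
  qed
  then show ?thesis using True AB by (simp add: Lp_le_def)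
 next
  case False
  define r where "r = enn2real p"
  have r: "r \<ge> 1"
  proof -
   have "p = ennreal r" using False by (simp add: r_def top.not_eq_extremum)
   then have "ennreal 1 <= ennreal r" using p by simp
   then have "0 <= r \<and> 1 <= r \<or> (1 :: real) <= 0 \<and> r <= 0" by (simp only: ennreal_le_iff2)
   then show ?thesis by linarith
  qed
  have "(\<integral>\<^sup>+x. ennreal (cmod (u x + v x) powr r) \<partial>lborel)
   <= (\<integral>\<^sup>+x. ennreal (2 powr r) * (ennreal (cmod (u x) powr r) + ennreal (cmod (v x) powr r)) \<partial>lborel)"
  proof (intro nn_integral_mono)
   fix x
   have "cmod (u x + v x) <= 2 * max (cmod (u x)) (cmod (v x))"
    using norm_triangle_ineq[of "u x" "v x"] by linarith
   then have "cmod (u x + v x) powr r <= (2 * max (cmod (u x)) (cmod (v x))) powr r"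
    using r by (intro powr_mono2) auto
   also have "... = 2 powr r * max (cmod (u x)) (cmod (v x)) powr r" by (subst powr_mult) auto
   also have "... <= 2 powr r * (cmod (u x) powr r + cmod (v x) powr r)"
    by (intro mult_left_mono) (auto simp: max_def)
   finally show "ennreal (cmod (u x + v x) powr r) <= ennreal (2 powr r) * (ennreal (cmod (u x) powr r) + ennreal (cmod (v x) powr r))"
    by (simp add: ennreal_mult[symmetric] ennreal_plus[symmetric] del: ennreal_plus)
  qed
  also have "... = ennreal (2 powr r) * ((\<integral>\<^sup>+x. ennreal (cmod (u x) powr r) \<partial>lborel) + (\<integral>\<^sup>+x. ennreal (cmod (v x) powr r) \<partial>lborel))"
   by (simp add: nn_integral_cmult nn_integral_add)
  also have "... <= ennreal (2 powr r) * (ennreal (A powr r) + ennreal (B powr r))"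
   using u v False by (intro mult_left_mono add_mono) (auto simp: Lp_le_def r_def)
  also have "... = ennreal (2 powr r * (A powr r + B powr r))"
   by (simp add: ennreal_mult[symmetric] ennreal_plus[symmetric] del: ennreal_plus)
  also have "... <= ennreal ((2 * (A + B)) powr r)"
   using powr_add_superadditive[OF AB r] AB by (intro ennreal_leI) (simp add: powr_mult mult_left_mono del: distrib_left_numeral)
  finally show ?thesis using False AB by (simp add: Lp_le_def r_def)
 qed
qed

lemma Lp_le_cong_AE:
 assumes u: "Lp_le p u A" and v: "v \<in> borel_measurable borel" "AE x in lborel. u x = v x"
 shows "Lp_le p v A"
proof (cases "p = \<infinity>")
 case True
 then have "AE x in lborel. cmod (u x) <= A" using u by (simp add: Lp_le_def)
 with v(2) have "AE x in lborel. cmod (v x) <= A" by eventually_elim simp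
 then show ?thesis using True u v by (simp add: Lp_le_def)
next
 case False
 have "(\<integral>\<^sup>+x. ennreal (cmod (v x) powr enn2real p) \<partial>lborel) = (\<integral>\<^sup>+x. ennreal (cmod (u x) powr enn2real p) \<partial>lborel)"
  using v(2) by (intro nn_integral_cong_AE) (auto elim: eventually_mono)
 then show ?thesis using False u v by (simp add: Lp_le_def)
qed

definition coef :: "(real ^ 'n => complex) => int ^ 'n => complex" where
 "coef b k = (LINT eta|lborel. b eta * echar (- (int_vec k \<bullet> eta)))"

text \<open>Where the series does not converge absolutely, the integral has the default value 0; for
  integrable b this concerns a null set only, see \<open>lsum_integrable\<close>.\<close>

definition lsum :: "(real ^ 'n => complex) => real ^ 'n => complex" where
 "lsum b eta = (LINT l|lat. b (eta + int_vec l))"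

definition labs :: "(real ^ 'n => complex) => real ^ 'n => real" where
 "labs b eta = (LINT l|lat. cmod (b (eta + int_vec l)))"

text \<open>The norm on spectra for which synthesis is bounded: the L_q norm over the torus of the
  periodized modulus. It dominates that of \<open>lsum b\<close>, whose Fourier coefficients are the
  samples, and integrability of b excludes the default values of \<open>labs\<close>.\<close>

definition PN_le :: "real => (real ^ 'n => complex) => real => bool" where
 "PN_le q b A \<longleftrightarrow> integrable lborel b \<and> A \<ge> 0 \<and>
   (\<integral>\<^sup>+eta. ennreal (labs b eta powr q) \<partial>torus) <= ennreal (A powr q)"

lemma lsum_measurable [measurable (raw)]:
 assumes [measurable]: "b \<in> borel_measurable borel"
 shows "lsum b \<in> borel_measurable borel" "labs b \<in> borel_measurable borel"
 unfolding lsum_def labs_def by measurable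

lemma labs_nonneg: "labs b eta \<ge> 0"
 unfolding labs_def by (rule integral_nonneg_AE) simp

lemma norm_lsum_le: "cmod (lsum b eta) <= labs b eta"
 unfolding lsum_def labs_def by (rule integral_norm_bound)

lemma bij_lat_shift: "bij_betw (%k. l + k) UNIV (UNIV :: (int ^ 'n) set)"
 by (rule bij_betw_byWitness[of _ "%k. k - l"]) auto

lemma lsum_periodic: "lsum b (eta + int_vec l) = lsum b eta"
proof -
 have "lsum b eta = (LINT k|lat. b (eta + int_vec (l + k)))"
  unfolding lsum_def by (rule integral_bij_count_space[OF bij_lat_shift, symmetric])
 then show ?thesis by (simp add: lsum_def int_vec_add add.assoc)
qed

lemma lsum_integrable:
 assumes "integrable lborel b"
 shows "integrable torus (lsum b)" "AE eta in torus. integrable lat (%l. b (eta + int_vec l))"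
 using integral_tile[OF assms] by (auto simp: lsum_def[abs_def])

lemma coef_eq:
 assumes b: "integrable lborel b"
 shows "coef b k = torus_hy.T (lsum b) k"
proof -
 have i: "integrable lborel (%eta. b eta * echar (- (int_vec k \<bullet> eta)))" by (rule integrable_mult_echar[OF b]) simp
 have "coef b k = (LINT eta|torus. (LINT l|lat. b (eta + int_vec l) * echar (- (int_vec k \<bullet> (eta + int_vec l)))))"
  unfolding coef_def by (rule integral_tile(3)[OF i, symmetric])
 also have "... = (LINT eta|torus. lsum b eta * echar (- (int_vec k \<bullet> eta)))"
  by (intro Bochner_Integration.integral_cong refl) (simp add: lsum_def echar_minus echar_periodic)
 finally show ?thesis by (simp add: torus_hy.T_def)
qed

lemma norm_coef_le: "integrable lborel b ==> cmod (coef b k) <= (LINT eta|lborel. cmod (b eta))"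
 unfolding coef_def by (rule order_trans[OF integral_norm_bound]) (simp add: norm_mult)

text \<open>The samples are the Fourier coefficients of the periodization, so Hausdorff-Young on the
  torus applies.\<close>

lemma coef_lp:
 assumes b: "PN_le q b A" and pq: "p \<ge> 2" "1 / p + 1 / q = 1"
 shows "(\<integral>\<^sup>+k. ennreal (cmod (coef b k) powr p) \<partial>lat) <= ennreal ((hy_const p * A) powr p)"
proof -
 have i: "integrable lborel b" and A: "A \<ge> 0" using b by (auto simp: PN_le_def)
 have q: "q > 1" using conjugate_exponent[of p q] pq by auto
 have "(\<integral>\<^sup>+eta. ennreal (cmod (lsum b eta) powr q) \<partial>torus) <= (\<integral>\<^sup>+eta. ennreal (labs b eta powr q) \<partial>torus)"
  using q by (intro nn_integral_mono ennreal_leI powr_mono2 norm_lsum_le) auto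
 also have "... <= ennreal (A powr q)" using b by (simp add: PN_le_def)
 finally show ?thesis
  unfolding coef_eq[OF i] by (rule torus_hy.hausdorff_young[OF lsum_integrable(1)[OF i] pq A])
qed

text \<open>What the error estimate asks of a generator; \<open>ph\<close> stands for its Fourier
  transform. \<open>synth_bounded\<close> is continuity of the synthesis operator with a constant
  uniform in b, and \<open>synth_eq\<close> expresses the absence of aliasing for spectra supported
  in the ball of radius \<delta>.\<close>

locale synthesis =
 fixes \<phi> ph :: "real ^ 'n => complex" and p :: ennreal and q \<delta> :: real
 assumes phi_measurable [measurable]: "\<phi> \<in> borel_measurable borel"
  and ph_measurable [measurable]: "ph \<in> borel_measurable borel"
  and ph_bounded: "\<exists>B. \<forall>eta. cmod (ph eta) <= B"
  and synth_bounded: "\<exists>C\<ge>0. \<forall>b A. PN_le q b A -->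
   (AE x in lborel. integrable lat (%k. coef b k * \<phi> (x + int_vec k))) \<and>
   Lp_le p (%x. LINT k|lat. coef b k * \<phi> (x + int_vec k)) (C * A)"
  and synth_eq: "\<And>b A. PN_le q b A ==> (\<And>eta. norm eta \<ge> \<delta> ==> b eta = 0) ==>
   AE x in lborel. (LINT k|lat. coef b k * \<phi> (x + int_vec k)) = ift (%eta. b eta * ph eta) x"

text \<open>Both sides fold to the torus integral of the product of the two periodizations.
  Integrability on the side of v holds because the periodization of |v| is bounded.\<close>

lemma (in periodization) integral_per_eq:
 assumes b: "integrable lborel b"
 shows "(LINT eta|lborel. b eta * per eta) = (LINT eta|lborel. v eta * lsum b eta)"
  and "integrable lborel (%eta. v eta * lsum b eta)"
proof -
 have [measurable]: "b \<in> borel_measurable borel" using borel_measurable_integrable[OF b] by simp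
 interpret av: periodization "%x. complex_of_real (cmod (v x))" R B
 proof
  show "AE x in lborel. isCont (%x. complex_of_real (cmod (v x))) x"
   using v_cont by eventually_elim (intro continuous_intros)
 qed (use v_bound v_support in auto)
 obtain C where C: "C \<ge> 0" "\<And>eta. cmod (per eta) <= C" using per_bounded by blast
 obtain C' where C': "\<And>eta. cmod (av.per eta) <= C'" using av.per_bounded by blast
 have i1: "integrable lborel (%eta. b eta * per eta)" by (rule integrable_mult_bounded[OF b _ C(2)]) simp
 have v_sum: "(\<integral>\<^sup>+l. ennreal (cmod (v (eta + int_vec l))) \<partial>lat) <= ennreal C'" for eta
 proof -
  have i: "integrable lat (%l. cmod (v (eta + int_vec l)))" using integrable_lat_v by (rule integrable_norm)
  have "av.per eta = complex_of_real (LINT l|lat. cmod (v (eta + int_vec l)))"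
   unfolding av.per_def by (rule integral_complex_of_real)
  then have "(LINT l|lat. cmod (v (eta + int_vec l))) <= C'" using C'[of eta] by simp
  then show ?thesis by (subst nn_integral_eq_integral[OF i]) (auto intro: ennreal_leI)
 qed
 show i2: "integrable lborel (%eta. v eta * lsum b eta)"
 proof (rule integrableI_bounded)
  have "(\<integral>\<^sup>+eta. ennreal (norm (v eta * lsum b eta)) \<partial>lborel) = (\<integral>\<^sup>+eta. (\<integral>\<^sup>+l. ennreal (norm (v (eta + int_vec l) * lsum b (eta + int_vec l))) \<partial>lat) \<partial>torus)"
   by (rule nn_integral_tile[symmetric]) measurable
  also have "... = (\<integral>\<^sup>+eta. ennreal (cmod (lsum b eta)) * (\<integral>\<^sup>+l. ennreal (cmod (v (eta + int_vec l))) \<partial>lat) \<partial>torus)"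
   by (intro nn_integral_cong) (simp add: lsum_periodic norm_mult ennreal_mult mult.commute nn_integral_cmult)
  also have "... <= (\<integral>\<^sup>+eta. ennreal (cmod (lsum b eta)) * ennreal C' \<partial>torus)"
   by (intro nn_integral_mono mult_left_mono v_sum) simp
  also have "... = (\<integral>\<^sup>+eta. ennreal (cmod (lsum b eta)) \<partial>torus) * ennreal C'"
   by (rule nn_integral_multc) measurable
  also have "... < \<infinity>"
   using lsum_integrable(1)[OF b] by (simp add: integrable_iff_bounded ennreal_mult_less_top)
  finally show "(\<integral>\<^sup>+eta. ennreal (norm (v eta * lsum b eta)) \<partial>lborel) < \<infinity>" .
 qed measurable
 have "(LINT eta|lborel. b eta * per eta) = (LINT eta|torus. (LINT l|lat. b (eta + int_vec l) * per (eta + int_vec l)))"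
  by (rule integral_tile(3)[OF i1, symmetric])
 also have "... = (LINT eta|torus. lsum b eta * per eta)" by (simp add: per_periodic lsum_def)
 also have "... = (LINT eta|torus. (LINT l|lat. v (eta + int_vec l) * lsum b (eta + int_vec l)))"
  by (simp add: lsum_periodic per_def mult.commute)
 also have "... = (LINT eta|lborel. v eta * lsum b eta)" by (rule integral_tile(3)[OF i2])
 finally show "(LINT eta|lborel. b eta * per eta) = (LINT eta|lborel. v eta * lsum b eta)" .
qed

text \<open>Young's inequality for l_p convolved with l_1, up to reflection. Writing a = a^(1/p)
  a^(1/q), Hoelder bounds the p-th power of the sum by a sum of c^p against a, and summation over l
  factorizes by Tonelli. The bound \<open>E\<close> makes the individual sums converge.\<close>

lemma discrete_young:
 fixes a c :: "int ^ 'n => real"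
 assumes pq: "p > 1" "1 / p + 1 / q = 1" and a: "integrable lat a" "\<And>k. a k \<ge> 0"
  and c: "\<And>k. c k \<ge> 0" "\<And>k. c k <= E" "D \<ge> 0" "(\<integral>\<^sup>+k. ennreal (c k powr p) \<partial>lat) <= ennreal (D powr p)"
 shows "(\<integral>\<^sup>+l. ennreal ((LINT k|lat. c (k - l) * a k) powr p) \<partial>lat) <= ennreal ((D * (LINT k|lat. a k)) powr p)"
proof -
 define S where "S = (LINT k|lat. a k)"
 have S0: "S \<ge> 0" unfolding S_def by (rule integral_nonneg_AE) (simp add: a)
 have Sn: "(\<integral>\<^sup>+k. ennreal (a k) \<partial>lat) = ennreal S"
  unfolding S_def by (rule nn_integral_eq_integral[OF a(1)]) (simp add: a)
 have E0: "E \<ge> 0" using c(1,2) order_trans by blast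
 have q: "q > 1" "(p - 1) * (q - 1) = 1" using conjugate_exponent[OF pq] by auto
 have pq': "p / q = p - 1" using q pq by (simp add: field_simps)
 define U where "U l = (LINT k|lat. c (k - l) powr p * a k)" for l
 have iU: "integrable lat (%k. c (k - l) powr p * a k)" for l
  by (rule Bochner_Integration.integrable_bound[OF integrable_mult_right[OF a(1), of "E powr p"]])
    (use a c pq E0 in \<open>auto simp: abs_mult intro!: AE_I2 mult_right_mono powr_mono2\<close>)
 have U0: "U l \<ge> 0" for l unfolding U_def by (rule integral_nonneg_AE) (simp add: a)
 have Un: "(\<integral>\<^sup>+k. ennreal (c (k - l) powr p * a k) \<partial>lat) = ennreal (U l)" for l
  unfolding U_def by (rule nn_integral_eq_integral[OF iU]) (simp add: a)
 have ica: "integrable lat (%k. c (k - l) * a k)" for l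
  by (rule Bochner_Integration.integrable_bound[OF integrable_mult_right[OF a(1), of E]])
    (use a c E0 in \<open>auto simp: abs_mult intro!: AE_I2 mult_right_mono\<close>)
 have hol: "(LINT k|lat. c (k - l) * a k) powr p <= U l * S powr (p - 1)" for l
 proof -
  have "(\<integral>\<^sup>+k. ennreal ((c (k - l) * a k powr (1 / p)) * a k powr (1 / q)) \<partial>lat) <= ennreal (U l powr (1 / p) * S powr (1 / q))"
  proof (rule nn_integral_Hoelder[where p = p and q = q])
   show "(\<integral>\<^sup>+k. ennreal ((c (k - l) * a k powr (1 / p)) powr p) \<partial>lat) <= ennreal ((U l powr (1 / p)) powr p)"
    using pq a c U0 Un by (simp add: powr_mult powr_powr)
   show "(\<integral>\<^sup>+k. ennreal ((a k powr (1 / q)) powr q) \<partial>lat) <= ennreal ((S powr (1 / q)) powr q)"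
    using q a S0 Sn by (simp add: powr_powr)
  qed (use pq q c in auto)
  also have "(\<integral>\<^sup>+k. ennreal ((c (k - l) * a k powr (1 / p)) * a k powr (1 / q)) \<partial>lat) = (\<integral>\<^sup>+k. ennreal (c (k - l) * a k) \<partial>lat)"
   using a pq by (intro nn_integral_cong arg_cong[of _ _ ennreal]) (simp add: mult.assoc powr_add[symmetric])
  also have "... = ennreal (LINT k|lat. c (k - l) * a k)"
   by (rule nn_integral_eq_integral[OF ica]) (simp add: a c)
  finally have "(LINT k|lat. c (k - l) * a k) <= U l powr (1 / p) * S powr (1 / q)"
   by (subst (asm) ennreal_le_iff) auto
  moreover have "0 <= (LINT k|lat. c (k - l) * a k)" by (rule integral_nonneg_AE) (simp add: a c)
  ultimately have "(LINT k|lat. c (k - l) * a k) powr p <= (U l powr (1 / p) * S powr (1 / q)) powr p"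
   using pq by (intro powr_mono2) auto
  also have "... = U l * S powr (p - 1)"
   using pq q U0 S0 by (simp add: powr_mult powr_powr pq')
  finally show ?thesis .
 qed
 interpret ll: pair_sigma_finite "lat :: (int ^ 'n) measure" "lat :: (int ^ 'n) measure" ..
 have "(\<integral>\<^sup>+l. ennreal ((LINT k|lat. c (k - l) * a k) powr p) \<partial>lat) <= (\<integral>\<^sup>+l. ennreal (S powr (p - 1)) * ennreal (U l) \<partial>lat)"
  using hol U0 by (intro nn_integral_mono) (simp add: ennreal_mult[symmetric] mult.commute ennreal_leI)
 also have "... = ennreal (S powr (p - 1)) * (\<integral>\<^sup>+l. (\<integral>\<^sup>+k. ennreal (c (k - l) powr p * a k) \<partial>lat) \<partial>lat)"
  by (simp add: nn_integral_cmult Un)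
 also have "(\<integral>\<^sup>+l. (\<integral>\<^sup>+k. ennreal (c (k - l) powr p * a k) \<partial>lat) \<partial>lat) = (\<integral>\<^sup>+k. (\<integral>\<^sup>+l. ennreal (c (k - l) powr p * a k) \<partial>lat) \<partial>lat)"
  by (rule ll.Fubini') (simp add: count_space_PiM_finite)
 also have "... = (\<integral>\<^sup>+k. ennreal (a k) * (\<integral>\<^sup>+l. ennreal (c (k - l) powr p) \<partial>lat) \<partial>lat)"
  using a by (intro nn_integral_cong) (simp add: nn_integral_cmult[symmetric] ennreal_mult mult.commute)
 also have "... <= (\<integral>\<^sup>+k. ennreal (a k) * ennreal (D powr p) \<partial>lat)"
 proof (intro nn_integral_mono mult_left_mono)
  fix k
  have bij: "bij_betw (%l. k - l) UNIV (UNIV :: (int ^ 'n) set)"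
   by (rule bij_betw_byWitness[of _ "%l. k - l"]) auto
  have "(\<integral>\<^sup>+l. ennreal (c (k - l) powr p) \<partial>lat) = (\<integral>\<^sup>+k. ennreal (c k powr p) \<partial>lat)"
   by (rule nn_integral_bij_count_space[OF bij])
  then show "(\<integral>\<^sup>+l. ennreal (c (k - l) powr p) \<partial>lat) <= ennreal (D powr p)" using c(4) by simp
 qed simp
 also have "... = ennreal S * ennreal (D powr p)" by (simp add: nn_integral_multc Sn)
 also have "ennreal (S powr (p - 1)) * (ennreal S * ennreal (D powr p)) = ennreal ((D * S) powr p)"
 proof (cases "S = 0")
  case False
  then have "S powr (p - 1) * (S * D powr p) = (D * S) powr p"
   using S0 c(3) by (simp add: powr_mult powr_diff)
  then show ?thesis using S0 by (simp add: ennreal_mult[symmetric])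
 qed (use pq in simp)
 finally show ?thesis unfolding S_def by (simp add: mult_left_mono)
qed

lemma AE_zero_if_local_box_integrals_zero:
 fixes w :: "real ^ 'n => complex"
 assumes [measurable]: "w \<in> borel_measurable borel"
  and i: "\<And>l r. integrable lborel (%x. indicator (box l r) x * w x)"
  and z: "\<And>l r. (LINT x|lborel. indicator (box l r) x * w x) = 0"
 shows "AE x in lborel. w x = 0"
proof -
 define c where "c n = (\<chi> j :: 'n. real n)" for n
 have "AE x in lborel. indicator (box (- c n) (c n)) x * w x = 0" for n
 proof (rule AE_zero_if_box_integrals_zero[OF i])
  fix l r :: "real ^ 'n"
  obtain l' r' where lr: "box (- c n) (c n) \<inter> box l r = box l' r'"
   using box_Int_box by blast
  have "indicator (box (- c n) (c n)) x * w x * indicator (box l r) x = indicator (box l' r') x * w x" for x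
   by (simp add: lr[symmetric] indicator_inter_arith mult_ac)
  then show "(LINT x|lborel. indicator (box (- c n) (c n)) x * w x * indicator (box l r) x) = 0"
   by (simp only: z)
 qed
 then have "AE x in lborel. \<forall>n. indicator (box (- c n) (c n)) x * w x = 0" by (intro AE_all_countable[THEN iffD2] allI)
 then show ?thesis
 proof eventually_elim
  fix x assume *: "\<forall>n. indicator (box (- c n) (c n)) x * w x = 0"
  obtain n where n: "norm x < real n" using reals_Archimedean2 by blast
  have "x \<in> box (- c n) (c n)"
   unfolding mem_box_cart
  proof
   fix j
   have "\<bar>x $ j\<bar> < real n" using component_le_norm_cart[of x j] n by linarith
   then show "(- c n) $ j < x $ j \<and> x $ j < c n $ j" unfolding c_def by (simp add: abs_less_iff)
  qed
  then show "w x = 0" using *[rule_format, of n] by simp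
 qed
qed

lemma indicator_box_periodization:
 fixes l r :: "real ^ 'n"
 obtains R where "periodization (indicator (box l r)) R 1"
proof -
 obtain R where R: "\<And>x. x \<in> box l r ==> norm x <= R" using bounded_box[of l r] by (auto simp: bounded_iff)
 have "periodization (indicator (box l r)) R 1"
 proof
 show "cmod (indicator (box l r) x) <= 1" for x by (simp add: indicator_def)
 have "AE x in lborel. x \<notin> cbox l r - box l r"
  using negligible_frontier_interval[of l r] by (intro AE_not_in) (simp add: null_sets_completion_iff negligible_iff_null_sets)
 then show "AE x in lborel. isCont (indicator (box l r) :: _ => complex) x"
 proof eventually_elim
  fix x assume x: "x \<notin> cbox l r - box l r"
  have "x \<notin> frontier (box l r)"
   using x by (cases "box l r = {}") (auto simp: frontier_box)
  then have "isCont (%x. complex_of_real (indicator (box l r) x)) x"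
   by (intro continuous_intros) (simp add: isCont_indicator)
  then show "isCont (indicator (box l r) :: _ => complex) x" by (simp add: of_real_indicator[abs_def] cong: )
 qed
 show "indicator (box l r) x = (0 :: complex)" if "norm x > R" for x
  using R[of x] that by (auto simp: indicator_def)
qed measurable
 then show thesis by (rule that)
qed

lemma AE_labs_finite:
 fixes b :: "real ^ 'n => complex"
 assumes b: "integrable lborel b"
 shows "AE x in lborel. integrable lat (%k. b (x + int_vec k))"
proof (rule AE_periodic[OF lsum_integrable(2)[OF b]])
 fix x l assume "integrable lat (%k. b (x + int_vec l + int_vec k))"
 then have "integrable lat (%k. b (x + int_vec (l + k)))" by (simp add: int_vec_add add.assoc)
 then show "integrable lat (%k. b (x + int_vec k))"
  by (rule integrable_bij_count_space[OF bij_lat_shift, THEN iffD1])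
qed

lemma labs_periodic: "labs b (eta + int_vec l) = labs b eta"
proof -
 have "labs b eta = (LINT k|lat. cmod (b (eta + int_vec (l + k))))"
  unfolding labs_def by (rule integral_bij_count_space[OF bij_lat_shift, symmetric])
 then show ?thesis by (simp add: labs_def int_vec_add add.assoc)
qed

lemma integral_labs:
 assumes b: "integrable lborel b"
 shows "(\<integral>\<^sup>+eta. ennreal (labs b eta) \<partial>torus) = ennreal (LINT eta|lborel. cmod (b eta))"
proof -
 have [measurable]: "b \<in> borel_measurable borel" using borel_measurable_integrable[OF b] by simp
 have "(\<integral>\<^sup>+eta. ennreal (labs b eta) \<partial>torus) = (\<integral>\<^sup>+eta. (\<integral>\<^sup>+l. ennreal (cmod (b (eta + int_vec l))) \<partial>lat) \<partial>torus)"
 proof (intro nn_integral_cong_AE)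
  show "AE eta in torus. ennreal (labs b eta) = (\<integral>\<^sup>+l. ennreal (cmod (b (eta + int_vec l))) \<partial>lat)"
   using lsum_integrable(2)[OF b]
  proof eventually_elim
   fix eta assume "integrable lat (%l. b (eta + int_vec l))"
   then show "ennreal (labs b eta) = (\<integral>\<^sup>+l. ennreal (cmod (b (eta + int_vec l))) \<partial>lat)"
    unfolding labs_def by (intro nn_integral_eq_integral[symmetric] integrable_norm) auto
  qed
 qed
 also have "... = (\<integral>\<^sup>+eta. ennreal (cmod (b eta)) \<partial>lborel)" by (rule nn_integral_tile) measurable
 also have "... = ennreal (LINT eta|lborel. cmod (b eta))"
  by (rule nn_integral_eq_integral) (use b in auto)
 finally show ?thesis .
qed

text \<open>A function on the torus whose coefficients vanish off 0 is constant. Poisson summation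
  against the indicator of a box reduces to the term k = 0, so \<open>lsum b\<close> and the
  constant have equal integrals over every box.\<close>

lemma lsum_eq_fourier_value:
 fixes b :: "real ^ 'n => complex"
 assumes b: "integrable lborel b" and coef: "\<And>k. k ~= 0 ==> coef b k = 0"
 shows "AE x in lborel. lsum b x = coef b 0"
proof -
 have [measurable]: "b \<in> borel_measurable borel" using borel_measurable_integrable[OF b] by simp
 have *: "integrable lborel (%x. indicator (box l r) x * (lsum b x - coef b 0)) \<and>
   (LINT x|lborel. indicator (box l r) x * (lsum b x - coef b 0)) = 0" for l r
 proof -
  obtain R where "periodization (indicator (box l r)) R 1" by (rule indicator_box_periodization)
  then interpret periodization "indicator (box l r)" R 1 .
  let ?v = "indicator (box l r) :: real ^ 'n => complex"
  let ?g = "%k. (LINT \<zeta>|lborel. ?v \<zeta> * echar (int_vec k \<bullet> \<zeta>)) * coef b k"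
  have "(LINT eta|lborel. b eta * per eta) = (LINT k|lat. ?g k)"
   unfolding coef_def
  proof (rule poisson[OF b])
   show "integrable lat (%k. (LINT \<zeta>|lborel. ?v \<zeta> * echar (int_vec k \<bullet> \<zeta>)) * (LINT eta|lborel. b eta * echar (- (int_vec k \<bullet> eta))))"
    unfolding coef_def[symmetric] by (rule integral_lat_finite(2)[of "{0}"]) (auto simp: coef)
  qed
  also have "... = ?g 0" by (subst integral_lat_finite(1)[of "{0}"]) (auto simp: coef)
  also have "... = (LINT x|lborel. ?v x * coef b 0)" by simp
  finally have "(LINT x|lborel. ?v x * lsum b x) = (LINT x|lborel. ?v x * coef b 0)"
   using integral_per_eq(1)[OF b] by simp
  moreover have "integrable lborel (%x. ?v x * coef b 0)"
   using v_integrable by simp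
  ultimately show ?thesis
   using integral_per_eq(2)[OF b] by (simp add: right_diff_distrib)
 qed
 have "AE x in lborel. lsum b x - coef b 0 = 0"
  by (rule AE_zero_if_local_box_integrals_zero) (use * in auto)
 then show ?thesis by simp
qed

section \<open>Synthesis with integrable generators\<close>

locale integrable_generator =
 fixes \<phi> :: "real ^ 'n => complex" and p :: ennreal and q \<delta> D :: real
 assumes phi_int: "integrable lborel \<phi>"
  and pq: "2 <= p" "p = \<infinity> ==> q = 1" "p ~= \<infinity> ==> 1 / enn2real p + 1 / q = 1"
  and D: "D \<ge> 0"
  and torus_fin: "p ~= \<infinity> ==> (\<integral>\<^sup>+x. ennreal (labs \<phi> x powr enn2real p) \<partial>torus) <= ennreal (D powr enn2real p)"
  and torus_inf: "p = \<infinity> ==> AE x in torus. labs \<phi> x <= D"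
  and vanish: "\<And>l. l ~= 0 ==> AE xi in lborel. norm (int_vec l - xi) < \<delta> --> (LINT x|lborel. \<phi> x * echar (- (x \<bullet> xi))) = 0"
begin

lemma phi_meas [measurable]: "\<phi> \<in> borel_measurable borel"
 using borel_measurable_integrable[OF phi_int] by simp

definition ph :: "real ^ 'n => complex" where
 "ph xi = (LINT x|lborel. \<phi> x * echar (- (x \<bullet> xi)))"

lemma ph_meas [measurable]: "ph \<in> borel_measurable borel"
 unfolding ph_def by measurable

lemma ph_bound: "cmod (ph xi) <= (LINT x|lborel. cmod (\<phi> x))"
 unfolding ph_def by (rule order_trans[OF integral_norm_bound]) (simp add: norm_mult)

lemma isCont_ph: "isCont ph xi"
 unfolding continuous_at_sequentially comp_def ph_def
proof (intro allI impI)
 fix X assume X: "X \<longlonglongrightarrow> xi"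
 show "(%n. LINT x|lborel. \<phi> x * echar (- (x \<bullet> X n))) \<longlonglongrightarrow> (LINT x|lborel. \<phi> x * echar (- (x \<bullet> xi)))"
 proof (rule integral_dominated_convergence[where w = "%x. cmod (\<phi> x)"])
  have "(%n. \<phi> x * echar (- (x \<bullet> X n))) \<longlonglongrightarrow> \<phi> x * echar (- (x \<bullet> xi))" for x
  proof -
   have "isCont echar t" for t using continuous_on_echar[of UNIV "%t. t"] by (simp add: continuous_on_eq_continuous_at)
   then show ?thesis by (intro tendsto_intros isCont_tendsto_compose[of _ echar] X) auto
  qed
  then show "AE x in lborel. (%n. \<phi> x * echar (- (x \<bullet> X n))) \<longlonglongrightarrow> \<phi> x * echar (- (x \<bullet> xi))" by simp
 qed (use phi_int in \<open>auto simp: norm_mult\<close>)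
qed

text \<open>The compatibility condition is given almost everywhere; continuity of the transform of
  an integrable function extends it to every point of the open ball. Pointwise vanishing is wanted
  because a fixed xi is inserted afterwards.\<close>

lemma ph_zero:
 assumes l: "l ~= 0" and xi: "norm (int_vec l - xi) < \<delta>"
 shows "ph xi = 0"
proof (rule ccontr)
 assume nz: "ph xi ~= 0"
 let ?U = "ball (int_vec l) \<delta> \<inter> ph -` (- {0})"
 have "continuous_on UNIV ph" using isCont_ph by (simp add: continuous_on_eq_continuous_at)
 then have "open ?U" by (intro open_Int open_ball open_vimage) auto
 moreover have "xi \<in> ?U" using nz xi by (simp add: dist_norm)
 ultimately have "\<not> negligible ?U" using open_not_negligible by blast
 moreover have "AE xi in lborel. xi \<notin> ?U"
  using vanish[OF l] by eventually_elim (auto simp: ph_def dist_norm)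
 then have "?U \<in> null_sets lborel" by (subst AE_iff_null_sets) (auto simp: \<open>open ?U\<close>)
 then have "negligible ?U" by (simp add: negligible_iff_null_sets null_sets_completionI)
 ultimately show False by blast
qed

lemma coef_modulated: "coef (%x. \<phi> x * echar (- (x \<bullet> xi))) k = ph (xi + int_vec k)"
 unfolding coef_def ph_def
 by (intro Bochner_Integration.integral_cong refl) (simp add: inner_add_right echar_add[symmetric] mult.assoc inner_commute)

text \<open>The Fourier coefficients of the periodization of \<phi> modulated by - xi are the values
  \<open>ph (xi + int_vec k)\<close>. For norm xi < \<delta> all of them with k \<noteq> 0 vanish,
  so the periodization is constant in x.\<close>

lemma modulated_sum:
 assumes "norm xi < \<delta>"
 shows "AE x in lborel. (LINT k|lat. \<phi> (x + int_vec k) * echar (- ((x + int_vec k) \<bullet> xi))) = ph xi"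
proof -
 have "AE x in lborel. lsum (%x. \<phi> x * echar (- (x \<bullet> xi))) x = coef (%x. \<phi> x * echar (- (x \<bullet> xi))) 0"
 proof (rule lsum_eq_fourier_value)
  show "integrable lborel (%x. \<phi> x * echar (- (x \<bullet> xi)))" by (rule integrable_mult_echar[OF phi_int]) measurable
  show "coef (%x. \<phi> x * echar (- (x \<bullet> xi))) k = 0" if "k ~= 0" for k
   unfolding coef_modulated by (rule ph_zero[OF that]) (use assms in simp)
 qed
 then show ?thesis by (simp add: lsum_def coef_modulated)
qed

lemma AE_integrable_synth:
 assumes b: "integrable lborel b"
 shows "AE x in lborel. integrable lat (%k. coef b k * \<phi> (x + int_vec k))"
 using AE_labs_finite[OF phi_int]
proof eventually_elim
 fix x assume "integrable lat (%k. \<phi> (x + int_vec k))"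
 then have "integrable lat (%k. \<phi> (x + int_vec k) * coef b k)"
  by (rule integrable_mult_bounded[OF _ _ norm_coef_le[OF b]]) simp
 then show "integrable lat (%k. coef b k * \<phi> (x + int_vec k))" by (simp add: mult.commute)
qed

text \<open>On the support of b, \<open>modulated_sum\<close> replaces \<open>ph\<close> by a
  lattice series, and interchanging it with the integral over xi leaves the samples of b against
  \<phi>. The exceptional null set in x depends on xi, so Fubini exchanges the two almost-everywhere
  quantifiers beforehand.\<close>

lemma synth_band_limited:
 assumes b: "integrable lborel b" and supp: "\<And>eta. norm eta \<ge> \<delta> ==> b eta = 0"
 shows "AE x in lborel. (LINT k|lat. coef b k * \<phi> (x + int_vec k)) = ift (%eta. b eta * ph eta) x"
proof -
 have [measurable]: "b \<in> borel_measurable borel" using borel_measurable_integrable[OF b] by simp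
 let ?Q = "%x xi. b xi * (LINT k|lat. \<phi> (x + int_vec k) * echar (- ((x + int_vec k) \<bullet> xi))) = b xi * ph xi"
 have "AE x in lborel. ?Q x xi" for xi
 proof (cases "norm xi < \<delta>")
  case True
  show ?thesis by (rule eventually_mono[OF modulated_sum[OF True]]) simp
 qed (use supp in simp)
 then have "AE xi in lborel. AE x in lborel. ?Q x xi" by simp
 moreover have "Measurable.pred (lborel \<Otimes>\<^sub>M lborel) (%z. ?Q (fst z) (snd z))"
 proof -
  let ?f = "%z. b (snd z) * (LINT k|lat. \<phi> (fst z + int_vec k) * echar (- ((fst z + int_vec k) \<bullet> snd z))) - b (snd z) * ph (snd z)"
  have "?f \<in> borel_measurable (lborel \<Otimes>\<^sub>M lborel)" by measurable
  from measurable_sets[OF this, of "{0}"] show ?thesis by (simp add: pred_def vimage_def space_pair_measure)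
 qed
 ultimately have "AE x in lborel. AE xi in lborel. ?Q x xi"
  by (subst lborel_pair.AE_commute) (simp_all add: pred_def)
 with AE_labs_finite[OF phi_int] show ?thesis
 proof eventually_elim
  fix x assume i: "integrable lat (%k. \<phi> (x + int_vec k))" and Q: "AE xi in lborel. ?Q x xi"
  have ib: "integrable lborel (%xi. b xi * \<phi> (x + int_vec k) * echar (- (int_vec k \<bullet> xi)))" for k
   by (rule integrable_mult_echar[OF integrable_mult_left[OF b]]) simp
  have int: "integrable (lat \<Otimes>\<^sub>M lborel) (%(k, xi). b xi * \<phi> (x + int_vec k) * echar (- (int_vec k \<bullet> xi)))"
  proof (rule lat_lborel.Fubini_integrable)
   show "integrable lat (%k. LINT xi|lborel. norm (case (k, xi) of (k, xi) => b xi * \<phi> (x + int_vec k) * echar (- (int_vec k \<bullet> xi))))"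
    using i by (simp add: norm_mult)
  qed (use ib in auto)
  have "ift (%eta. b eta * ph eta) x = (LINT xi|lborel. b xi * (LINT k|lat. \<phi> (x + int_vec k) * echar (- ((x + int_vec k) \<bullet> xi))) * echar (x \<bullet> xi))"
   unfolding ift_def
  proof (rule integral_cong_AE)
   show "AE xi in lborel. b xi * ph xi * echar (x \<bullet> xi) = b xi * (LINT k|lat. \<phi> (x + int_vec k) * echar (- ((x + int_vec k) \<bullet> xi))) * echar (x \<bullet> xi)"
    using Q by eventually_elim auto
  qed measurable
  also have "... = (LINT xi|lborel. (LINT k|lat. b xi * \<phi> (x + int_vec k) * echar (- (int_vec k \<bullet> xi))))"
  proof (intro Bochner_Integration.integral_cong refl)
   fix xi
   have "b xi * (LINT k|lat. \<phi> (x + int_vec k) * echar (- ((x + int_vec k) \<bullet> xi))) * echar (x \<bullet> xi)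
    = (LINT k|lat. b xi * (\<phi> (x + int_vec k) * echar (- ((x + int_vec k) \<bullet> xi))) * echar (x \<bullet> xi))"
    by simp
   also have "... = (LINT k|lat. b xi * \<phi> (x + int_vec k) * echar (- (int_vec k \<bullet> xi)))"
    by (intro Bochner_Integration.integral_cong refl)
      (simp add: inner_add_left echar_add[symmetric] mult.assoc)
   finally show "b xi * (LINT k|lat. \<phi> (x + int_vec k) * echar (- ((x + int_vec k) \<bullet> xi))) * echar (x \<bullet> xi)
    = (LINT k|lat. b xi * \<phi> (x + int_vec k) * echar (- (int_vec k \<bullet> xi)))" .
  qed
  also have "... = (LINT k|lat. (LINT xi|lborel. b xi * \<phi> (x + int_vec k) * echar (- (int_vec k \<bullet> xi))))"
   by (rule lat_lborel.Fubini_integral[OF int])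
  also have "... = (LINT k|lat. coef b k * \<phi> (x + int_vec k))"
  proof (intro Bochner_Integration.integral_cong refl)
   fix k
   have "(LINT xi|lborel. b xi * \<phi> (x + int_vec k) * echar (- (int_vec k \<bullet> xi)))
    = (LINT xi|lborel. b xi * echar (- (int_vec k \<bullet> xi)) * \<phi> (x + int_vec k))"
    by (simp only: mult_ac)
   then show "(LINT xi|lborel. b xi * \<phi> (x + int_vec k) * echar (- (int_vec k \<bullet> xi))) = coef b k * \<phi> (x + int_vec k)"
    by (simp add: coef_def)
  qed
  finally show "(LINT k|lat. coef b k * \<phi> (x + int_vec k)) = ift (%eta. b eta * ph eta) x" by simp
 qed
qed

text \<open>On the coset of x the synthesized function is, up to reflection, the convolution of the
  samples in l_p with the values of \<phi>, whose l_1 norm is \<open>labs \<phi> x\<close>. Young's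
  inequality bounds the l_p norm on the coset, and integration over the torus uses the L_p bound on
  \<open>labs \<phi>\<close>.\<close>

lemma synth_Lp_finite:
 assumes b: "PN_le q b A" and p: "p ~= \<infinity>"
 shows "Lp_le p (%x. LINT k|lat. coef b k * \<phi> (x + int_vec k)) (hy_const (enn2real p) * D * A)"
proof -
 define r where "r = enn2real p"
 have pr: "p = ennreal r" using p by (simp add: r_def top.not_eq_extremum)
 have "ennreal 2 <= ennreal r" using pq(1) pr by (simp add: ennreal_numeral[symmetric] del: ennreal_numeral)
 then have "0 <= r \<and> 2 <= r \<or> (2 :: real) <= 0 \<and> r <= 0" by (simp only: ennreal_le_iff2)
 then have r: "r \<ge> 2" "1 / r + 1 / q = 1" using pq(3)[OF p] by (auto simp: r_def)
 have i: "integrable lborel b" and A: "A \<ge> 0" using b by (auto simp: PN_le_def)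
 have [measurable]: "b \<in> borel_measurable borel" using borel_measurable_integrable[OF i] by simp
 let ?u = "%x. LINT k|lat. coef b k * \<phi> (x + int_vec k)"
 let ?H = "hy_const r * A"
 have H0: "?H \<ge> 0" using A hy_const_nonneg by simp
 have [measurable]: "?u \<in> borel_measurable borel" by measurable
 have "(\<integral>\<^sup>+x. ennreal (cmod (?u x) powr r) \<partial>lborel) = (\<integral>\<^sup>+x. (\<integral>\<^sup>+l. ennreal (cmod (?u (x + int_vec l)) powr r) \<partial>lat) \<partial>torus)"
  by (rule nn_integral_tile[symmetric]) measurable
 also have "... <= (\<integral>\<^sup>+x. ennreal (?H powr r) * ennreal (labs \<phi> x powr r) \<partial>torus)"
 proof (rule nn_integral_mono_AE)
  show "AE x in torus. (\<integral>\<^sup>+l. ennreal (cmod (?u (x + int_vec l)) powr r) \<partial>lat) <= ennreal (?H powr r) * ennreal (labs \<phi> x powr r)"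
   using lsum_integrable(2)[OF phi_int]
  proof eventually_elim
   fix x assume ix: "integrable lat (%l. \<phi> (x + int_vec l))"
   have "(\<integral>\<^sup>+l. ennreal (cmod (?u (x + int_vec l)) powr r) \<partial>lat)
    <= (\<integral>\<^sup>+l. ennreal ((LINT k|lat. cmod (coef b (k - l)) * cmod (\<phi> (x + int_vec k))) powr r) \<partial>lat)"
   proof (intro nn_integral_mono ennreal_leI powr_mono2)
    fix l
    have "?u (x + int_vec l) = (LINT k|lat. coef b ((l + k) - l) * \<phi> (x + int_vec (l + k)))"
     by (simp add: int_vec_add add.assoc)
    also have "... = (LINT k|lat. coef b (k - l) * \<phi> (x + int_vec k))"
     by (rule integral_bij_count_space[OF bij_lat_shift])
    also have "cmod ... <= (LINT k|lat. cmod (coef b (k - l) * \<phi> (x + int_vec k)))"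
     by (rule integral_norm_bound)
    finally show "cmod (?u (x + int_vec l)) <= (LINT k|lat. cmod (coef b (k - l)) * cmod (\<phi> (x + int_vec k)))"
     by (simp add: norm_mult)
   qed (use r in auto)
   also have "... <= ennreal ((?H * (LINT k|lat. cmod (\<phi> (x + int_vec k)))) powr r)"
   proof (rule discrete_young[where q = q and E = "LINT eta|lborel. cmod (b eta)"])
    show "(\<integral>\<^sup>+k. ennreal (cmod (coef b k) powr r) \<partial>lat) <= ennreal ((hy_const r * A) powr r)"
     by (rule coef_lp[OF b r])
   qed (use r ix norm_coef_le[OF i] H0 in auto)
   also have "... = ennreal (?H powr r) * ennreal (labs \<phi> x powr r)"
    using H0 labs_nonneg[of \<phi> x] by (simp add: labs_def[symmetric] powr_mult ennreal_mult)
   finally show "(\<integral>\<^sup>+l. ennreal (cmod (?u (x + int_vec l)) powr r) \<partial>lat) <= ennreal (?H powr r) * ennreal (labs \<phi> x powr r)" .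
  qed
 qed
 also have "... = ennreal (?H powr r) * (\<integral>\<^sup>+x. ennreal (labs \<phi> x powr r) \<partial>torus)"
  by (rule nn_integral_cmult) measurable
 also have "... <= ennreal (?H powr r) * ennreal (D powr r)"
  using torus_fin[OF p] by (intro mult_left_mono) (auto simp: r_def)
 also have "... = ennreal ((hy_const r * D * A) powr r)"
  using H0 D hy_const_nonneg[of r] A by (simp add: ennreal_mult[symmetric] powr_mult mult_ac)
 finally show ?thesis using p A D hy_const_nonneg[of r] by (simp add: Lp_le_def r_def)
qed

text \<open>Here q = 1, so \<open>A\<close> bounds the L_1 norm of b and thereby every sample; the
  essential supremum of \<open>labs \<phi>\<close> does the rest.\<close>

lemma synth_Lp_infinite:
 assumes b: "PN_le q b A" and p: "p = \<infinity>"
 shows "Lp_le p (%x. LINT k|lat. coef b k * \<phi> (x + int_vec k)) (D * A)"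
proof -
 have i: "integrable lborel b" and A: "A \<ge> 0" using b by (auto simp: PN_le_def)
 have [measurable]: "b \<in> borel_measurable borel" using borel_measurable_integrable[OF i] by simp
 have "ennreal (LINT eta|lborel. cmod (b eta)) <= ennreal A"
  using b pq(2)[OF p] integral_labs[OF i] A labs_nonneg[of b] by (simp add: PN_le_def)
 then have bA: "(LINT eta|lborel. cmod (b eta)) <= A" using A by (simp add: ennreal_le_iff)
 have "AE x in lborel. labs \<phi> x <= D"
  by (rule AE_periodic[OF torus_inf[OF p]]) (simp add: labs_periodic)
 with AE_labs_finite[OF phi_int] AE_integrable_synth[OF i]
 have "AE x in lborel. cmod (LINT k|lat. coef b k * \<phi> (x + int_vec k)) <= D * A"
 proof eventually_elim
  fix x assume ix: "integrable lat (%k. \<phi> (x + int_vec k))" and l: "labs \<phi> x <= D"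
   and ic: "integrable lat (%k. coef b k * \<phi> (x + int_vec k))"
  have "cmod (LINT k|lat. coef b k * \<phi> (x + int_vec k)) <= (LINT k|lat. cmod (coef b k * \<phi> (x + int_vec k)))"
   by (rule integral_norm_bound)
  also have "... <= (LINT k|lat. A * cmod (\<phi> (x + int_vec k)))"
   by (rule integral_mono)
     (use integrable_norm[OF ic] ix order_trans[OF norm_coef_le[OF i] bA] in \<open>auto simp: norm_mult intro!: mult_right_mono integrable_norm\<close>)
  also have "... = A * labs \<phi> x" by (simp add: labs_def)
  also have "... <= A * D" by (rule mult_left_mono[OF l A])
  finally show "cmod (LINT k|lat. coef b k * \<phi> (x + int_vec k)) <= D * A" by (simp add: mult.commute)
 qed
 then show ?thesis using p A D by (simp add: Lp_le_def)
qed

proposition synthesis: "synthesis \<phi> ph p q \<delta>"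
proof
 show "\<exists>B. \<forall>eta. cmod (ph eta) <= B" using ph_bound by blast
 have i: "integrable lborel b" if "PN_le q b A" for b :: "real ^ 'n => complex" and A using that by (simp add: PN_le_def)
 define C where "C = (if p = \<infinity> then D else hy_const (enn2real p) * D)"
 have "C \<ge> 0" using D hy_const_nonneg by (simp add: C_def)
 moreover have "Lp_le p (%x. LINT k|lat. coef b k * \<phi> (x + int_vec k)) (C * A)" if "PN_le q b A" for b A
  using synth_Lp_finite[OF that] synth_Lp_infinite[OF that] by (cases "p = \<infinity>") (simp_all add: C_def)
 ultimately show "\<exists>C\<ge>0. \<forall>b A. PN_le q b A -->
   (AE x in lborel. integrable lat (%k. coef b k * \<phi> (x + int_vec k))) \<and>
   Lp_le p (%x. LINT k|lat. coef b k * \<phi> (x + int_vec k)) (C * A)"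
  using AE_integrable_synth[OF i] by blast
 show "AE x in lborel. (LINT k|lat. coef b k * \<phi> (x + int_vec k)) = ift (%eta. b eta * ph eta) x"
  if "PN_le q b A" "\<And>eta. norm eta \<ge> \<delta> ==> b eta = 0" for b A
  by (rule synth_band_limited[OF i[OF that(1)] that(2)])
qed measurable

end

section \<open>Band-limited generators\<close>

lemma C_on_mono: "C_on k S f ==> j <= k ==> C_on j S f"
proof (induction k arbitrary: f j)
 case (Suc k)
 show ?case
 proof (cases j)
  case 0 then show ?thesis using Suc.prems by simp
 next
  case (Suc j')
  then show ?thesis using Suc.prems Suc.IH[of _ j'] by (simp add: ) blast
 qed
qed simp

lemma C_on_continuous: "C_on k S f ==> continuous_on S f"
 by (cases k) auto

section \<open>Integration by parts and oscillatory integrals over a box\<close>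

lemma norm_le_add_axis:
 fixes x :: "real ^ 'n"
 assumes "norm (x + t *\<^sub>R axis i 1) <= R" "\<bar>t\<bar> <= 1"
 shows "norm x <= R + 1"
proof -
 have "norm x <= norm (x + t *\<^sub>R axis i 1) + norm (t *\<^sub>R axis i (1 :: real))"
  by (metis add_diff_cancel_right' norm_triangle_ineq4)
 then show ?thesis using assms by simp
qed

text \<open>F is extended by 0 off the box and vanishes on the two faces orthogonal to direction i,
  so no boundary terms arise in that direction. It may jump across the other faces, and its
  derivative along direction i is one-sided at the end points.\<close>

locale box_parts =
 fixes i :: "'n :: finite" and a b :: "real ^ 'n" and F F' :: "real ^ 'n => complex" and L :: real
 assumes F_int: "integrable lborel F" and F'_meas [measurable]: "F' \<in> borel_measurable borel"
  and F'_bound: "\<And>xi. cmod (F' xi) <= L"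
  and F_out: "\<And>xi. xi \<notin> cbox a b ==> F xi = 0" and F'_out: "\<And>xi. xi \<notin> cbox a b ==> F' xi = 0"
  and F_ends: "\<And>xi. xi $ i = a $ i \<or> xi $ i = b $ i ==> F xi = 0"
  and ab: "a $ i <= b $ i"
  and deriv: "\<And>xi. xi \<in> cbox a b ==>
   ((%t. F (xi + t *\<^sub>R axis i 1)) has_vector_derivative F' xi) (at 0 within {t. xi + t *\<^sub>R axis i 1 \<in> cbox a b})"
begin

abbreviation e :: "real ^ 'n" where "e \<equiv> axis i 1"

lemma L0: "L \<ge> 0"
 using F'_bound norm_ge_zero order_trans by blast

lemma Lipschitz_inside:
 assumes "xi \<in> cbox a b" "xi + t *\<^sub>R e \<in> cbox a b"
 shows "cmod (F (xi + t *\<^sub>R e) - F xi) <= L * \<bar>t\<bar>"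
proof -
 let ?T = "{s. xi + s *\<^sub>R e \<in> cbox a b}"
 have "convex ?T"
 proof (rule convexI)
  fix x y u v :: real assume *: "x \<in> ?T" "y \<in> ?T" "0 <= u" "0 <= v" "u + v = 1"
  have "xi + (u *\<^sub>R x + v *\<^sub>R y) *\<^sub>R e = (u + v) *\<^sub>R xi + (u *\<^sub>R x + v *\<^sub>R y) *\<^sub>R e" using * by simp
  also have "... = u *\<^sub>R (xi + x *\<^sub>R e) + v *\<^sub>R (xi + y *\<^sub>R e)"
   by (simp add: algebra_simps)
  also have "... \<in> cbox a b" using * by (intro convexD[OF convex_box(1)]) auto
  finally show "u *\<^sub>R x + v *\<^sub>R y \<in> ?T" by simp
 qed
 moreover have "((%s. F (xi + s *\<^sub>R e)) has_derivative (%h. h *\<^sub>R F' (xi + s *\<^sub>R e))) (at s within ?T)" if s: "s \<in> ?T" for s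
 proof -
  have "((%t. F ((xi + s *\<^sub>R e) + t *\<^sub>R e)) has_vector_derivative F' (xi + s *\<^sub>R e)) (at (s - s) within (%u. u - s) ` ?T)"
   using deriv[of "xi + s *\<^sub>R e"] s
   by (rule_tac has_vector_derivative_within_subset[where S = "{t. xi + s *\<^sub>R e + t *\<^sub>R e \<in> cbox a b}"]) (auto simp: algebra_simps)
  moreover have "((%u. u - s) has_vector_derivative 1) (at s within ?T)"
   by (auto intro!: derivative_eq_intros)
  ultimately have "((%t. F ((xi + s *\<^sub>R e) + t *\<^sub>R e)) \<circ> (%u. u - s) has_vector_derivative F' (xi + s *\<^sub>R e)) (at s within ?T)"
   using vector_diff_chain_within[of "%u. u - s" 1] by fastforce
  moreover have "(%t. F ((xi + s *\<^sub>R e) + t *\<^sub>R e)) \<circ> (%u. u - s) = (%s. F (xi + s *\<^sub>R e))"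
   by (auto simp: fun_eq_iff algebra_simps)
  ultimately show ?thesis by (simp add: has_vector_derivative_def)
 qed
 ultimately have "norm (F (xi + t *\<^sub>R e) - F (xi + 0 *\<^sub>R e)) <= L * norm (t - 0)"
 proof (rule differentiable_bound)
  fix s assume "s \<in> ?T"
  show "onorm (%h. h *\<^sub>R F' (xi + s *\<^sub>R e)) <= L"
   by (rule onorm_le) (simp add: F'_bound mult_left_mono mult.commute[of L])
 qed (use assms in auto)
 then show ?thesis by simp
qed

text \<open>A point of the line beyond the box is replaced by the nearer end point, where F vanishes
  as well; Lipschitz bounds for the extended F thus reduce to those inside the box.\<close>

lemma clamp_line:
 assumes "xi \<in> cbox a b"
 obtains s where "xi + s *\<^sub>R e \<in> cbox a b" "\<bar>s\<bar> <= \<bar>t\<bar>" "F (xi + s *\<^sub>R e) = F (xi + t *\<^sub>R e)"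
proof -
 have box: "a $ j <= xi $ j" "xi $ j <= b $ j" for j using assms by (auto simp: mem_box_cart)
 have line: "xi + s *\<^sub>R e \<in> cbox a b \<longleftrightarrow> a $ i <= xi $ i + s \<and> xi $ i + s <= b $ i" for s
  using box by (auto simp: mem_box_cart axis_def)
 consider "xi + t *\<^sub>R e \<in> cbox a b" | "xi $ i + t < a $ i" | "xi $ i + t > b $ i" using line[of t] by linarith
 then show thesis
 proof cases
  case 1 then show ?thesis by (rule that) auto
 next
  case 2
  have "F (xi + t *\<^sub>R e) = 0" by (rule F_out) (use 2 line[of t] in auto)
  moreover have "F (xi + (a $ i - xi $ i) *\<^sub>R e) = 0" by (rule F_ends) (simp add: axis_def)
  ultimately show ?thesis using 2 box[of i] ab by (intro that[of "a $ i - xi $ i"]) (auto simp: line)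
 next
  case 3
  have "F (xi + t *\<^sub>R e) = 0" by (rule F_out) (use 3 line[of t] in auto)
  moreover have "F (xi + (b $ i - xi $ i) *\<^sub>R e) = 0" by (rule F_ends) (simp add: axis_def)
  ultimately show ?thesis using 3 box[of i] ab by (intro that[of "b $ i - xi $ i"]) (auto simp: line)
 qed
qed

lemma Lipschitz_line: "cmod (F (xi + t *\<^sub>R e) - F xi) <= L * \<bar>t\<bar>"
proof -
 have main: "cmod (F (\<zeta> + t *\<^sub>R e) - F \<zeta>) <= L * \<bar>t\<bar>" if \<zeta>: "\<zeta> \<in> cbox a b" for \<zeta> t
 proof -
  obtain s where s: "\<zeta> + s *\<^sub>R e \<in> cbox a b" "\<bar>s\<bar> <= \<bar>t\<bar>" "F (\<zeta> + s *\<^sub>R e) = F (\<zeta> + t *\<^sub>R e)"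
   using clamp_line[OF \<zeta>] by metis
  show ?thesis using Lipschitz_inside[OF \<zeta> s(1)] s(2,3) L0 mult_left_mono[OF s(2) L0] by simp
 qed
 consider "xi \<in> cbox a b" | "xi + t *\<^sub>R e \<in> cbox a b" | "xi \<notin> cbox a b" "xi + t *\<^sub>R e \<notin> cbox a b" by blast
 then show ?thesis
 proof cases
  case 2
  then show ?thesis using main[OF 2, of "- t"] by (simp add: norm_minus_commute)
 qed (use main F_out L0 in auto)
qed

lemma difference_quotient:
 assumes "xi \<in> box a b \<or> xi \<notin> cbox a b"
 shows "(%n. real (Suc n) *\<^sub>R (F (xi + inverse (real (Suc n)) *\<^sub>R e) - F xi)) \<longlonglongrightarrow> F' xi"
proof -
 have lim: "(%n. inverse (real (Suc n))) \<longlonglongrightarrow> 0" by (rule LIMSEQ_inverse_real_of_nat)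
 have "(%n. xi + inverse (real (Suc n)) *\<^sub>R e) \<longlonglongrightarrow> xi + 0 *\<^sub>R e" by (intro tendsto_intros lim)
 then have seq: "(%n. xi + inverse (real (Suc n)) *\<^sub>R e) \<longlonglongrightarrow> xi" by simp
 show ?thesis
 proof (cases "xi \<in> box a b")
  case True
  then have cb: "xi \<in> cbox a b" using box_subset_cbox by blast
  let ?T = "{t. xi + t *\<^sub>R e \<in> cbox a b}"
  have ev: "eventually (%n. inverse (real (Suc n)) \<in> ?T) sequentially"
   using topological_tendstoD[OF seq open_box True] by eventually_elim (use box_subset_cbox in auto)
  have "((%t. F (xi + t *\<^sub>R e)) has_derivative (%h. h *\<^sub>R F' xi)) (at 0 within ?T)"
   using deriv[OF cb] by (simp add: has_vector_derivative_def)
  then have d: "((%t. norm (F (xi + t *\<^sub>R e) - F xi - t *\<^sub>R F' xi) / norm t) \<longlongrightarrow> 0) (at 0 within ?T)"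
   by (simp add: has_derivative_iff_norm)
  have "filterlim (%n. inverse (real (Suc n))) (at 0 within ?T) sequentially"
   unfolding filterlim_at using lim ev by (simp add: eventually_conj_iff)
  from filterlim_compose[OF d this]
  have "(%n. norm (F (xi + inverse (real (Suc n)) *\<^sub>R e) - F xi - inverse (real (Suc n)) *\<^sub>R F' xi) / norm (inverse (real (Suc n)))) \<longlonglongrightarrow> 0" .
  also have "(%n. norm (F (xi + inverse (real (Suc n)) *\<^sub>R e) - F xi - inverse (real (Suc n)) *\<^sub>R F' xi) / norm (inverse (real (Suc n))))
   = (%n. norm (real (Suc n) *\<^sub>R (F (xi + inverse (real (Suc n)) *\<^sub>R e) - F xi) - F' xi))"
  proof
   fix n
   have "real (Suc n) *\<^sub>R (F (xi + inverse (real (Suc n)) *\<^sub>R e) - F xi) - F' xi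
    = real (Suc n) *\<^sub>R (F (xi + inverse (real (Suc n)) *\<^sub>R e) - F xi - inverse (real (Suc n)) *\<^sub>R F' xi)"
    by (simp add: scaleR_diff_right del: of_nat_Suc)
   then show "norm (F (xi + inverse (real (Suc n)) *\<^sub>R e) - F xi - inverse (real (Suc n)) *\<^sub>R F' xi) / norm (inverse (real (Suc n)))
    = norm (real (Suc n) *\<^sub>R (F (xi + inverse (real (Suc n)) *\<^sub>R e) - F xi) - F' xi)"
    by (simp add: divide_inverse mult.commute del: of_nat_Suc)
  qed
  finally show ?thesis by (simp add: tendsto_norm_zero_iff LIM_zero_iff del: of_nat_Suc)
 next
  case False
  then have out: "xi \<notin> cbox a b" using assms by blast
  have "eventually (%n. xi + inverse (real (Suc n)) *\<^sub>R e \<in> - cbox a b) sequentially"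
   by (rule topological_tendstoD[OF seq]) (use out in \<open>auto intro: closed_cbox\<close>)
  then have "eventually (%n. real (Suc n) *\<^sub>R (F (xi + inverse (real (Suc n)) *\<^sub>R e) - F xi) = F' xi) sequentially"
   by eventually_elim (use out F_out F'_out in auto)
  then show ?thesis by (rule tendsto_eventually)
 qed
qed

text \<open>The difference quotients of F along the axis have integral 0 by translation invariance.
  They are bounded by L on a fixed ball, vanish off it, and converge to F' away from the boundary of
  the box, which is a null set.\<close>

lemma integral_derivative_zero: "(LINT xi|lborel. F' xi) = 0"
proof -
 have F_meas [measurable]: "F \<in> borel_measurable borel" using borel_measurable_integrable[OF F_int] by simp
 obtain R where R: "\<And>xi. xi \<in> cbox a b ==> norm xi <= R" using bounded_cbox[of a b] by (auto simp: bounded_iff)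
 let ?D = "%n xi. real (Suc n) *\<^sub>R (F (xi + inverse (real (Suc n)) *\<^sub>R e) - F xi)"
 have "(%n. LINT xi|lborel. ?D n xi) \<longlonglongrightarrow> (LINT xi|lborel. F' xi)"
 proof (rule integral_dominated_convergence[where w = "%xi. L * indicator (cball 0 (R + 1)) xi"])
  have "emeasure lborel (cball (0 :: real ^ 'n) (R + 1)) < \<infinity>"
   using emeasure_lborel_cball_finite by blast
  then show "integrable lborel (%xi :: real ^ 'n. L * indicator (cball 0 (R + 1)) xi)"
   by (intro integrable_mult_right integrable_real_indicator) auto
  have "AE xi in lborel. xi \<notin> cbox a b - box a b"
   using negligible_frontier_interval[of a b] by (intro AE_not_in) (simp add: null_sets_completion_iff negligible_iff_null_sets)
  then show "AE xi in lborel. (%n. ?D n xi) \<longlonglongrightarrow> F' xi"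
   by (rule eventually_mono) (rule difference_quotient, blast)
  show "AE xi in lborel. norm (?D n xi) <= L * indicator (cball 0 (R + 1)) xi" for n
  proof (intro AE_I2)
   fix xi
   show "norm (?D n xi) <= L * indicator (cball 0 (R + 1)) xi"
   proof (cases "xi \<in> cball 0 (R + 1)")
    case True
    have "norm (?D n xi) <= real (Suc n) * (L * \<bar>inverse (real (Suc n))\<bar>)"
     unfolding norm_scaleR by (intro mult_mono Lipschitz_line) auto
    also have "... = L" by (simp del: of_nat_Suc)
    finally show ?thesis using True by simp
   next
    case False
    then have n: "norm xi > R + 1" by simp
    have "\<bar>inverse (real (Suc n))\<bar> <= 1" by (simp add: inverse_le_1_iff del: of_nat_Suc)
    then have "xi + inverse (real (Suc n)) *\<^sub>R e \<notin> cbox a b"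
     using norm_le_add_axis[of xi "inverse (real (Suc n))" i R] R n by force
    moreover have "xi \<notin> cbox a b" using R[of xi] n by auto
    ultimately show ?thesis using F_out L0 by (simp add: indicator_def)
   qed
  qed
 qed measurable
 moreover have "(LINT xi|lborel. ?D n xi) = 0" for n
 proof -
  have "(LINT xi|lborel. F (xi + inverse (real (Suc n)) *\<^sub>R e) - F xi) = 0"
   by (subst Bochner_Integration.integral_diff) (use F_int in \<open>simp_all add: integral_translate\<close>)
  then show ?thesis by simp
 qed
 ultimately have "(%n. 0) \<longlonglongrightarrow> (LINT xi|lborel. F' xi)" by simp
 then show ?thesis by (simp add: LIMSEQ_const_iff)
qed

end

text \<open>The average of t \<mapsto> echar (x * t) over the interval from \<alpha> to \<beta>, for
  x \<noteq> 0.\<close>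

definition axis_mean :: "real => real => real => complex" where
 "axis_mean \<alpha> \<beta> x = (echar (x * \<beta>) - echar (x * \<alpha>)) / (2 * pi * \<i> * x * complex_of_real (\<beta> - \<alpha>))"

text \<open>A primitive of \<open>t \<mapsto> echar (x * t) - axis_mean \<alpha> \<beta> x\<close> that vanishes at both end points, so that
 integration by parts leaves no boundary terms.\<close>

definition axis_primitive :: "real => real => real => real => complex" where
 "axis_primitive \<alpha> \<beta> x t =
   (if \<alpha> <= t \<and> t <= \<beta> then (echar (x * t) - echar (x * \<alpha>)) / (2 * pi * \<i> * x) - axis_mean \<alpha> \<beta> x * complex_of_real (t - \<alpha>) else 0)"

lemma axis_primitive_measurable [measurable]: "axis_primitive \<alpha> \<beta> x \<in> borel_measurable borel"
 unfolding axis_primitive_def by measurable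

text \<open>The modulus is at most 2 / (2 pi |x|), and 1 + |x| \<le> 2 |x| \<le> pi |x|.\<close>

lemma norm_echar_diff_quotient:
 assumes "\<bar>x\<bar> \<ge> 1"
 shows "cmod ((echar s - echar t) / (2 * pi * \<i> * x)) <= 1 / (1 + \<bar>x\<bar>)"
proof -
 have "cmod (echar s - echar t) <= 2" using norm_triangle_ineq4[of "echar s" "echar t"] by simp
 then have "cmod ((echar s - echar t) / (2 * pi * \<i> * x)) <= 2 / cmod (2 * pi * \<i> * x)"
  unfolding norm_divide by (rule divide_right_mono) simp
 also have "... = 2 / (2 * pi * \<bar>x\<bar>)" by (simp add: norm_mult)
 also have "... <= 1 / (1 + \<bar>x\<bar>)"
 proof -
  have "1 + \<bar>x\<bar> <= 2 * \<bar>x\<bar>" using assms by simp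
  also have "... <= pi * \<bar>x\<bar>" using pi_ge_two by (intro mult_right_mono) auto
  finally show ?thesis using assms by (simp add: frac_le)
 qed
 finally show ?thesis .
qed

lemma norm_axis_mean:
 assumes "\<bar>x\<bar> \<ge> 1" "\<alpha> < \<beta>"
 shows "cmod (axis_mean \<alpha> \<beta> x) <= (1 / (\<beta> - \<alpha>)) * (1 / (1 + \<bar>x\<bar>))"
proof -
 have "cmod (axis_mean \<alpha> \<beta> x) = (1 / (\<beta> - \<alpha>)) * cmod ((echar (x * \<beta>) - echar (x * \<alpha>)) / (2 * pi * \<i> * x))"
  using assms by (simp add: axis_mean_def norm_divide norm_mult del: of_real_diff)
 also have "... <= (1 / (\<beta> - \<alpha>)) * (1 / (1 + \<bar>x\<bar>))"
  using assms by (intro mult_left_mono norm_echar_diff_quotient) auto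
 finally show ?thesis .
qed

lemma norm_axis_primitive:
 assumes "\<bar>x\<bar> \<ge> 1" "\<alpha> < \<beta>"
 shows "cmod (axis_primitive \<alpha> \<beta> x t) <= 2 * (1 / (1 + \<bar>x\<bar>))"
proof (cases "\<alpha> <= t \<and> t <= \<beta>")
 case True
 have "cmod (axis_mean \<alpha> \<beta> x * complex_of_real (t - \<alpha>)) = cmod (axis_mean \<alpha> \<beta> x) * (t - \<alpha>)"
  using True by (simp add: norm_mult del: of_real_diff)
 also have "... <= ((1 / (\<beta> - \<alpha>)) * (1 / (1 + \<bar>x\<bar>))) * (\<beta> - \<alpha>)"
  using True assms norm_axis_mean[OF assms] by (intro mult_mono) auto
 also have "... = 1 / (1 + \<bar>x\<bar>)" using assms by simp
 finally have 1: "cmod (axis_mean \<alpha> \<beta> x * complex_of_real (t - \<alpha>)) <= 1 / (1 + \<bar>x\<bar>)" .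
 have "cmod (axis_primitive \<alpha> \<beta> x t) <= cmod ((echar (x * t) - echar (x * \<alpha>)) / (2 * pi * \<i> * x)) + cmod (axis_mean \<alpha> \<beta> x * complex_of_real (t - \<alpha>))"
  using True unfolding axis_primitive_def by (simp add: norm_triangle_ineq4 del: of_real_diff)
 then show ?thesis using 1 norm_echar_diff_quotient[OF assms(1), of "x * t" "x * \<alpha>"] by linarith
qed (use assms in \<open>auto simp: axis_primitive_def\<close>)

lemma axis_primitive_ends:
 assumes "x ~= 0" "\<alpha> < \<beta>"
 shows "axis_primitive \<alpha> \<beta> x \<alpha> = 0" "axis_primitive \<alpha> \<beta> x \<beta> = 0"
proof -
 have "X / k - X / (k * c) * c = 0" if "c ~= 0" for X k c :: complex using that by simp
 from this[of "complex_of_real (\<beta> - \<alpha>)"] assms(2) show "axis_primitive \<alpha> \<beta> x \<beta> = 0"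
  unfolding axis_primitive_def axis_mean_def by (simp del: of_real_diff)
qed (simp add: axis_primitive_def)

lemma echar_vector_derivative:
 "((%t. echar (x * t)) has_vector_derivative (2 * pi * \<i> * x) * echar (x * t)) (at t within S)"
proof -
 have "echar (x * t) = exp (of_real t * (2 * pi * \<i> * x))" for t
  by (simp add: echar_def cis_conv_exp mult_ac)
 moreover have "((%t. exp (of_real t * (2 * pi * \<i> * x))) has_vector_derivative (2 * pi * \<i> * x) * exp (of_real t * (2 * pi * \<i> * x))) (at t within S)"
  by (rule has_vector_derivative_real_field) (auto intro!: derivative_eq_intros simp: mult.commute)
 ultimately show ?thesis by simp
qed

lemma axis_primitive_derivative:
 assumes x: "x ~= 0" and t: "t \<in> {\<alpha>..\<beta>}"
 shows "(axis_primitive \<alpha> \<beta> x has_vector_derivative echar (x * t) - axis_mean \<alpha> \<beta> x) (at t within {\<alpha>..\<beta>})"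
proof (rule has_vector_derivative_transform[OF t])
 show "axis_primitive \<alpha> \<beta> x s = (echar (x * s) - echar (x * \<alpha>)) * (1 / (2 * pi * \<i> * x)) - axis_mean \<alpha> \<beta> x * of_real (s - \<alpha>)" if "s \<in> {\<alpha>..\<beta>}" for s
  using that by (simp add: axis_primitive_def)
 have "((%s. (echar (x * s) - echar (x * \<alpha>)) * (1 / (2 * pi * \<i> * x)) - axis_mean \<alpha> \<beta> x * of_real (s - \<alpha>))
   has_vector_derivative ((2 * pi * \<i> * x) * echar (x * t) - 0) * (1 / (2 * pi * \<i> * x)) - axis_mean \<alpha> \<beta> x * of_real (1 - 0)) (at t within {\<alpha>..\<beta>})"
  by (intro has_vector_derivative_diff has_vector_derivative_mult_left has_vector_derivative_mult_right
    has_vector_derivative_of_real echar_vector_derivative has_vector_derivative_const derivative_intros)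
 then show "((%s. (echar (x * s) - echar (x * \<alpha>)) * (1 / (2 * pi * \<i> * x)) - axis_mean \<alpha> \<beta> x * of_real (s - \<alpha>))
   has_vector_derivative echar (x * t) - axis_mean \<alpha> \<beta> x) (at t within {\<alpha>..\<beta>})"
  using x by simp
qed

text \<open>Integration by parts in direction i for the product of g, the primitive and H. The
  derivative of the primitive is the character minus its mean, which accounts for the mean value
  term. H is constant along direction i and stays a passive factor.\<close>

lemma box_oscillation_step:
 fixes a b x :: "real ^ 'n" and g g' H :: "real ^ 'n => complex"
 assumes ab: "a $ i < b $ i" and x: "x $ i ~= 0"
  and g: "continuous_on (cbox a b) g" "continuous_on (cbox a b) g'"
  and d: "\<And>xi. xi \<in> cbox a b ==>
   ((%t. g (xi + t *\<^sub>R axis i 1)) has_vector_derivative g' xi) (at 0 within {t. xi + t *\<^sub>R axis i 1 \<in> cbox a b})"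
  and H [measurable]: "H \<in> borel_measurable borel" and HB: "\<And>xi. cmod (H xi) <= B"
  and Hi: "\<And>xi t. H (xi + t *\<^sub>R axis i 1) = H xi"
 shows "(LINT xi|lborel. indicator (cbox a b) xi *\<^sub>R (g xi * (echar (x $ i * xi $ i) * H xi)))
  = axis_mean (a $ i) (b $ i) (x $ i) * (LINT xi|lborel. indicator (cbox a b) xi *\<^sub>R (g xi * H xi))
   - (LINT xi|lborel. indicator (cbox a b) xi *\<^sub>R (g' xi * (axis_primitive (a $ i) (b $ i) (x $ i) (xi $ i) * H xi)))"
proof -
 let ?P = "axis_primitive (a $ i) (b $ i) (x $ i)" and ?m = "axis_mean (a $ i) (b $ i) (x $ i)"
 let ?I = "%xi. indicator (cbox a b) xi :: real"
 have Ig [measurable]: "(%xi. ?I xi *\<^sub>R g xi) \<in> borel_measurable borel" "(%xi. ?I xi *\<^sub>R g' xi) \<in> borel_measurable borel"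
  using g by (auto intro!: borel_measurable_continuous_on_indicator)
 have bounded_g: "\<exists>C. \<forall>xi. cmod (?I xi *\<^sub>R u xi) <= C" if u: "continuous_on (cbox a b) u" for u :: "real ^ 'n => complex"
 proof -
  have "bounded (u ` cbox a b)" using compact_continuous_image[OF u compact_cbox] by (rule compact_imp_bounded)
  then obtain C where "C > 0" "\<And>xi. xi \<in> cbox a b ==> cmod (u xi) <= C" by (auto simp: bounded_pos)
  then show ?thesis by (intro exI[of _ C]) (auto simp: indicator_def)
 qed
 have bounded_P: "\<exists>C. \<forall>t. cmod (?P t) <= C"
 proof -
  have "\<forall>t. cmod (?P t) <= (2 / cmod (2 * pi * \<i> * x $ i)) + cmod ?m * (b $ i - a $ i)"
  proof
   fix t
   show "cmod (?P t) <= (2 / cmod (2 * pi * \<i> * x $ i)) + cmod ?m * (b $ i - a $ i)"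
   proof (cases "a $ i <= t \<and> t <= b $ i")
    case True
    let ?A = "(echar (x $ i * t) - echar (x $ i * a $ i)) / (2 * pi * \<i> * x $ i)" and ?B = "?m * complex_of_real (t - a $ i)"
    have "cmod ((echar (x $ i * t) - echar (x $ i * a $ i)) / (2 * pi * \<i> * x $ i)) <= 2 / cmod (2 * pi * \<i> * x $ i)"
     unfolding norm_divide using norm_triangle_ineq4[of "echar (x $ i * t)" "echar (x $ i * a $ i)"]
     by (intro divide_right_mono) auto
    moreover have "cmod ?B <= cmod ?m * (b $ i - a $ i)"
     unfolding norm_mult using True by (intro mult_left_mono) (auto simp del: of_real_diff)
    ultimately show ?thesis
     using True norm_triangle_ineq4[of ?A ?B] unfolding axis_primitive_def if_P[OF True] by linarith
   next
    case False
    then show ?thesis using ab by (auto simp: axis_primitive_def intro!: add_nonneg_nonneg)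
   qed
  qed
  then show ?thesis by blast
 qed
 obtain Cg Cg' CP where C: "\<And>xi. cmod (?I xi *\<^sub>R g xi) <= Cg" "\<And>xi. cmod (?I xi *\<^sub>R g' xi) <= Cg'" "\<And>t. cmod (?P t) <= CP"
  using bounded_g[OF g(1)] bounded_g[OF g(2)] bounded_P by metis
 have C0: "Cg \<ge> 0" "Cg' \<ge> 0" "CP \<ge> 0" "B \<ge> 0" using C HB norm_ge_zero order_trans by blast+
 have iI: "integrable lborel ?I" by (rule integrable_real_indicator) (auto simp: emeasure_lborel_cbox_finite[unfolded infinity_ennreal_def])
 have int: "integrable lborel (%xi. ?I xi *\<^sub>R (u xi * K xi))"
  if [measurable]: "(%xi. ?I xi *\<^sub>R u xi) \<in> borel_measurable borel" "K \<in> borel_measurable borel"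
   and u: "\<And>xi. cmod (?I xi *\<^sub>R u xi) <= Cu" and K: "\<And>xi. cmod (K xi) <= CK" for u K :: "real ^ 'n => complex" and Cu CK
 proof -
  have "integrable lborel (%xi. (complex_of_real (?I xi) * (?I xi *\<^sub>R u xi)) * K xi)"
   by (rule integrable_mult_bounded[OF integrable_mult_bounded[OF integrable_of_real[OF iI] _ u] _ K]) simp_all
  moreover have "(complex_of_real (?I xi) * (?I xi *\<^sub>R u xi)) * K xi = ?I xi *\<^sub>R (u xi * K xi)" for xi
   by (simp add: indicator_def)
  ultimately show ?thesis by (simp only:)
 qed
 have nb: "cmod (?I xi *\<^sub>R (z * y)) <= c * d" if "cmod (?I xi *\<^sub>R z) <= c" "cmod y <= d" for xi z y c d
 proof -
  have "0 <= c" using that(1) norm_ge_zero order_trans by blast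
  then show ?thesis unfolding mult_scaleR_left[symmetric] norm_mult using that by (intro mult_mono norm_ge_zero)
 qed
 have norm_PH: "cmod (?P t * H xi) <= CP * B" for t xi
  unfolding norm_mult using C C0 HB by (intro mult_mono) auto
 have norm_eH: "cmod (echar t * H xi) <= B" for t xi using HB by (simp add: norm_mult)
 have i1: "integrable lborel (%xi. ?I xi *\<^sub>R (g' xi * (?P (xi $ i) * H xi)))"
  by (rule int[OF Ig(2) _ C(2) norm_PH]) measurable
 have i2: "integrable lborel (%xi. ?I xi *\<^sub>R (g xi * (echar (x $ i * xi $ i) * H xi)))"
  by (rule int[OF Ig(1) _ C(1) norm_eH]) measurable
 have i3: "integrable lborel (%xi. ?I xi *\<^sub>R (g xi * H xi))"
  by (rule int[OF Ig(1) _ C(1) HB]) measurable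
 define F where "F xi = ?I xi *\<^sub>R (g xi * (?P (xi $ i) * H xi))" for xi
 define F' where "F' xi = ?I xi *\<^sub>R (g' xi * (?P (xi $ i) * H xi)) + (?I xi *\<^sub>R (g xi * (echar (x $ i * xi $ i) * H xi)) - ?m * (?I xi *\<^sub>R (g xi * H xi)))" for xi
 interpret box_parts i a b F F' "Cg' * (CP * B) + (Cg * B + cmod ?m * (Cg * B))"
 proof
  show "integrable lborel F" unfolding F_def by (rule int[OF Ig(1) _ C(1) norm_PH]) measurable
  show "F' \<in> borel_measurable borel"
   unfolding F'_def
   by (intro borel_measurable_add borel_measurable_diff borel_measurable_times borel_measurable_const
     i1[THEN borel_measurable_integrable, simplified] i2[THEN borel_measurable_integrable, simplified] i3[THEN borel_measurable_integrable, simplified])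
  show "cmod (F' xi) <= Cg' * (CP * B) + (Cg * B + cmod ?m * (Cg * B))" for xi
  proof -
   have "cmod (?I xi *\<^sub>R (g' xi * (?P (xi $ i) * H xi))) <= Cg' * (CP * B)"
    by (rule nb[OF C(2) norm_PH])
   moreover have "cmod (?I xi *\<^sub>R (g xi * (echar (x $ i * xi $ i) * H xi))) <= Cg * B"
    by (rule nb[OF C(1) norm_eH])
   moreover have "cmod (?m * (?I xi *\<^sub>R (g xi * H xi))) <= cmod ?m * (Cg * B)"
    unfolding norm_mult[of ?m] by (rule mult_left_mono[OF nb[OF C(1) HB] norm_ge_zero])
   ultimately show ?thesis unfolding F'_def
    using norm_triangle_ineq[of "?I xi *\<^sub>R (g' xi * (?P (xi $ i) * H xi))" "?I xi *\<^sub>R (g xi * (echar (x $ i * xi $ i) * H xi)) - ?m * (?I xi *\<^sub>R (g xi * H xi))"]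
     norm_triangle_ineq4[of "?I xi *\<^sub>R (g xi * (echar (x $ i * xi $ i) * H xi))" "?m * (?I xi *\<^sub>R (g xi * H xi))"] by linarith
  qed
  show "F xi = 0" "F' xi = 0" if "xi \<notin> cbox a b" for xi using that by (simp_all add: F_def F'_def)
  show "F xi = 0" if "xi $ i = a $ i \<or> xi $ i = b $ i" for xi
   using that axis_primitive_ends[OF x ab] by (auto simp: F_def)
  show "a $ i <= b $ i" using ab by simp
  show "((%t. F (xi + t *\<^sub>R axis i 1)) has_vector_derivative F' xi) (at 0 within {t. xi + t *\<^sub>R axis i 1 \<in> cbox a b})"
   if xi: "xi \<in> cbox a b" for xi
  proof -
   let ?T = "{t. xi + t *\<^sub>R axis i 1 \<in> cbox a b}"
   have box: "a $ j <= xi $ j" "xi $ j <= b $ j" for j using xi by (auto simp: mem_box_cart)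
   have line: "t \<in> ?T \<longleftrightarrow> a $ i <= xi $ i + t \<and> xi $ i + t <= b $ i" for t
    using box by (auto simp: mem_box_cart axis_def)
   have "((%t. xi $ i + t) has_vector_derivative 1) (at 0 within ?T)"
    by (auto intro!: derivative_eq_intros)
   moreover have "(?P has_vector_derivative echar (x $ i * xi $ i) - ?m) (at (xi $ i + 0) within (%t. xi $ i + t) ` ?T)"
    by (rule has_vector_derivative_within_subset[where S = "{a $ i..b $ i}"])
      (use axis_primitive_derivative[OF x, of "xi $ i" "a $ i" "b $ i"] box line in auto)
   ultimately have "(?P \<circ> (%t. xi $ i + t) has_vector_derivative 1 *\<^sub>R (echar (x $ i * xi $ i) - ?m)) (at 0 within ?T)"
    by (rule vector_diff_chain_within)
   then have "((%t. ?P (xi $ i + t)) has_vector_derivative echar (x $ i * xi $ i) - ?m) (at 0 within ?T)"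
    by (simp add: o_def)
   from has_vector_derivative_mult[OF d[OF xi] has_vector_derivative_mult_left[OF this, of "H xi"]]
   have "((%t. g (xi + t *\<^sub>R axis i 1) * (?P (xi $ i + t) * H xi)) has_vector_derivative F' xi) (at 0 within ?T)"
    using xi by (simp add: F'_def algebra_simps)
   then show ?thesis
   proof (rule has_vector_derivative_transform[rotated 2])
    show "F (xi + t *\<^sub>R axis i 1) = g (xi + t *\<^sub>R axis i 1) * (?P (xi $ i + t) * H xi)" if "t \<in> ?T" for t
     using that by (simp add: F_def Hi)
   qed (use xi in simp)
  qed
 qed
 have "(LINT xi|lborel. F' xi) = (LINT xi|lborel. ?I xi *\<^sub>R (g' xi * (?P (xi $ i) * H xi)))
  + ((LINT xi|lborel. ?I xi *\<^sub>R (g xi * (echar (x $ i * xi $ i) * H xi))) - ?m * (LINT xi|lborel. ?I xi *\<^sub>R (g xi * H xi)))"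
  unfolding F'_def
  by (simp only: Bochner_Integration.integral_add[OF i1 Bochner_Integration.integrable_diff[OF i2 integrable_mult_right[OF i3]]]
    Bochner_Integration.integral_diff[OF i2 integrable_mult_right[OF i3]] integral_mult_right_zero)
 then show ?thesis using integral_derivative_zero by (simp add: algebra_simps)
qed

text \<open>Induction over the coordinates in S, each consuming one derivative of g. The bounded
  factor H, independent of the coordinates in S, absorbs what a treated coordinate leaves behind:
  its character if |x_i| < 1, its primitive of size 2 / (1 + |x_i|) otherwise.\<close>

lemma box_oscillation_decay:
 fixes a b :: "real ^ 'n" and g :: "real ^ 'n => complex" and S :: "'n set"
 assumes ab: "\<And>i. a $ i < b $ i"
 shows "C_on (card S) (cbox a b) g ==> \<exists>C\<ge>0. \<forall>(x :: real ^ 'n) H B. H \<in> borel_measurable borel --> (\<forall>xi. cmod (H xi) <= B) -->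
   (\<forall>i\<in>S. \<forall>xi t. H (xi + t *\<^sub>R axis i 1) = H xi) -->
   cmod (LINT xi|lborel. indicator (cbox a b) xi *\<^sub>R (g xi * ((\<Prod>i\<in>S. echar (x $ i * xi $ i)) * H xi)))
    <= C * B * (\<Prod>i\<in>S. 1 / (1 + \<bar>x $ i\<bar>))"
 using finite[of S]
proof (induction S arbitrary: g rule: finite_induct)
 case empty
 have m [measurable]: "(%xi. indicator (cbox a b) xi *\<^sub>R g xi) \<in> borel_measurable borel"
  using empty by (intro borel_measurable_continuous_on_indicator) auto
 have i: "integrable lborel (%xi. indicator (cbox a b) xi *\<^sub>R g xi)"
  using borel_integrable_compact[OF compact_cbox, of a b g] empty by (simp add: indicator_scaleR_eq_if)
 show ?case
 proof (intro exI[of _ "LINT xi|lborel. cmod (indicator (cbox a b) xi *\<^sub>R g xi)"] conjI allI impI)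
  show "0 <= (LINT xi|lborel. cmod (indicator (cbox a b) xi *\<^sub>R g xi))" by simp
  fix x :: "real ^ 'n" and H :: "real ^ 'n => complex" and B :: real
  assume [measurable]: "H \<in> borel_measurable borel" and HB: "\<forall>xi. cmod (H xi) <= B"
  have "cmod (LINT xi|lborel. (indicator (cbox a b) xi *\<^sub>R g xi) * H xi) <= (LINT xi|lborel. cmod ((indicator (cbox a b) xi *\<^sub>R g xi) * H xi))"
   by (rule integral_norm_bound)
  also have "... <= (LINT xi|lborel. cmod (indicator (cbox a b) xi *\<^sub>R g xi) * B)"
   using HB i
   by (intro integral_mono integrable_norm integrable_mult_bounded[of _ _ _ B] integrable_mult_left)
     (auto simp: norm_mult mult.assoc[symmetric] simp del: mult_scaleR_left intro!: mult_left_mono)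
  finally show "cmod (LINT xi|lborel. indicator (cbox a b) xi *\<^sub>R (g xi * ((\<Prod>i\<in>{}. echar (x $ i * xi $ i)) * H xi)))
    <= (LINT xi|lborel. cmod (indicator (cbox a b) xi *\<^sub>R g xi)) * B * (\<Prod>i\<in>{}. 1 / (1 + \<bar>x $ i\<bar>))"
   by simp
 qed
next
 case (insert i S)
 have C_Suc: "C_on (Suc (card S)) (cbox a b) g" using insert by simp
 then obtain g' where g': "C_on (card S) (cbox a b) g'"
  and d: "\<And>xi. xi \<in> cbox a b ==> ((%t. g (xi + t *\<^sub>R axis i 1)) has_vector_derivative g' xi) (at 0 within {t. xi + t *\<^sub>R axis i 1 \<in> cbox a b})"
  unfolding C_on.simps by blast
 have g: "C_on (card S) (cbox a b) g" by (rule C_on_mono[OF C_Suc]) simp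
 let ?W = "%x :: real ^ 'n. \<Prod>i\<in>S. 1 / (1 + \<bar>x $ i\<bar>)"
 let ?E = "%(x :: real ^ 'n) xi. \<Prod>i\<in>S. echar (x $ i * xi $ i)"
 obtain C1 where C1: "C1 \<ge> 0" "\<And>(x :: real ^ 'n) H B. H \<in> borel_measurable borel ==> (\<And>xi. cmod (H xi) <= B) ==>
   (\<And>i xi t. i \<in> S ==> H (xi + t *\<^sub>R axis i 1) = H xi) ==>
   cmod (LINT xi|lborel. indicator (cbox a b) xi *\<^sub>R (g xi * (?E x xi * H xi))) <= C1 * B * ?W x"
  using insert.IH[OF g] by blast
 obtain C2 where C2: "C2 \<ge> 0" "\<And>(x :: real ^ 'n) H B. H \<in> borel_measurable borel ==> (\<And>xi. cmod (H xi) <= B) ==>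
   (\<And>i xi t. i \<in> S ==> H (xi + t *\<^sub>R axis i 1) = H xi) ==>
   cmod (LINT xi|lborel. indicator (cbox a b) xi *\<^sub>R (g' xi * (?E x xi * H xi))) <= C2 * B * ?W x"
  using insert.IH[OF g'] by blast
 \<comment> \<open>For |x_i| < 1 the factor 1 + |x_i| is at most 2, giving \<open>2 * C1\<close>.
   The other summands come from the mean value term and from the term with g', where the primitive
   contributes its factor 2.\<close>
 define C where "C = 2 * C1 + (1 / (b $ i - a $ i)) * C1 + 2 * C2"
 have bai: "1 / (b $ i - a $ i) \<ge> 0" using ab[of i] by simp
 have C0: "C \<ge> 0" unfolding C_def using C1(1) C2(1) bai by (intro add_nonneg_nonneg mult_nonneg_nonneg) auto
 have W0: "?W x \<ge> 0" for x :: "real ^ 'n" by (rule prod_nonneg) simp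
 show ?case
 proof (intro exI[of _ C] conjI allI impI C0)
  fix x :: "real ^ 'n" and H :: "real ^ 'n => complex" and B :: real
  assume H [measurable]: "H \<in> borel_measurable borel" and HB: "\<forall>xi. cmod (H xi) <= B"
   and inv: "\<forall>j\<in>insert i S. \<forall>xi t. H (xi + t *\<^sub>R axis j 1) = H xi"
  have B0: "B \<ge> 0" using HB norm_ge_zero order_trans by blast
  have ne: "j ~= i" if "j \<in> S" for j using insert that by auto
  have nth: "(xi + t *\<^sub>R axis j 1) $ i = xi $ i" if "j ~= i" for xi :: "real ^ 'n" and t j i
   using that by (simp add: axis_def)
  have BW: "B * ?W x * (1 / (1 + \<bar>x $ i\<bar>)) \<ge> 0" using B0 W0 by simp
  have "cmod (LINT xi|lborel. indicator (cbox a b) xi *\<^sub>R (g xi * (echar (x $ i * xi $ i) * (?E x xi * H xi))))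
   <= C * (B * ?W x * (1 / (1 + \<bar>x $ i\<bar>)))"
  proof (cases "\<bar>x $ i\<bar> \<ge> 1")
   case False
   have "cmod (LINT xi|lborel. indicator (cbox a b) xi *\<^sub>R (g xi * (?E x xi * (echar (x $ i * xi $ i) * H xi)))) <= C1 * B * ?W x"
   proof (rule C1(2))
    show "echar (x $ i * (xi + t *\<^sub>R axis j 1) $ i) * H (xi + t *\<^sub>R axis j 1) = echar (x $ i * xi $ i) * H xi" if "j \<in> S" for j xi t
     unfolding nth[OF ne[OF that]] using inv that by simp
   qed (use HB in \<open>auto simp: norm_mult\<close>)
   also have "... = C1 * (1 + \<bar>x $ i\<bar>) * (B * ?W x * (1 / (1 + \<bar>x $ i\<bar>)))" by (simp add: field_simps)
   also have "... <= C * (B * ?W x * (1 / (1 + \<bar>x $ i\<bar>)))"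
   proof (rule mult_right_mono[OF _ BW])
    have "C1 * (1 + \<bar>x $ i\<bar>) <= C1 * 2" using False C1(1) by (intro mult_left_mono) auto
    moreover have "0 <= (1 / (b $ i - a $ i)) * C1" using bai C1(1) by (rule mult_nonneg_nonneg)
    ultimately show "C1 * (1 + \<bar>x $ i\<bar>) <= C" using C2(1) unfolding C_def by linarith
   qed
   finally show ?thesis by (simp add: mult.left_commute)
  next
   case True
   let ?m = "axis_mean (a $ i) (b $ i) (x $ i)" and ?P = "axis_primitive (a $ i) (b $ i) (x $ i)"
   have E1: "cmod (?E x xi) = 1" for xi by (simp flip: prod_norm)
   have "(LINT xi|lborel. indicator (cbox a b) xi *\<^sub>R (g xi * (echar (x $ i * xi $ i) * (?E x xi * H xi))))
    = ?m * (LINT xi|lborel. indicator (cbox a b) xi *\<^sub>R (g xi * (?E x xi * H xi)))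
     - (LINT xi|lborel. indicator (cbox a b) xi *\<^sub>R (g' xi * (?P (xi $ i) * (?E x xi * H xi))))"
   proof (rule box_oscillation_step[OF ab _ C_on_continuous[OF g] C_on_continuous[OF g'] d, where B = B])
    show "cmod (?E x xi * H xi) <= B" for xi using HB E1 by (simp add: norm_mult)
    show "?E x (xi + t *\<^sub>R axis i 1) * H (xi + t *\<^sub>R axis i 1) = ?E x xi * H xi" for xi t
    proof -
     have "?E x (xi + t *\<^sub>R axis i 1) = ?E x xi"
      by (intro prod.cong refl) (simp only: nth[OF ne[symmetric]])
     then show ?thesis using inv by simp
    qed
   qed (use True in auto)
   then have "cmod (LINT xi|lborel. indicator (cbox a b) xi *\<^sub>R (g xi * (echar (x $ i * xi $ i) * (?E x xi * H xi))))
    <= cmod ?m * cmod (LINT xi|lborel. indicator (cbox a b) xi *\<^sub>R (g xi * (?E x xi * H xi)))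
     + cmod (LINT xi|lborel. indicator (cbox a b) xi *\<^sub>R (g' xi * (?P (xi $ i) * (?E x xi * H xi))))"
    by (simp only: norm_mult[symmetric] norm_triangle_ineq4)
   also have "... <= ((1 / (b $ i - a $ i)) * (1 / (1 + \<bar>x $ i\<bar>))) * (C1 * B * ?W x) + C2 * (2 * (1 / (1 + \<bar>x $ i\<bar>)) * B) * ?W x"
   proof (intro add_mono mult_mono)
    show "cmod ?m <= (1 / (b $ i - a $ i)) * (1 / (1 + \<bar>x $ i\<bar>))" by (rule norm_axis_mean[OF True ab])
    show "cmod (LINT xi|lborel. indicator (cbox a b) xi *\<^sub>R (g xi * (?E x xi * H xi))) <= C1 * B * ?W x"
     by (rule C1(2)) (use HB inv in auto)
    have "cmod (LINT xi|lborel. indicator (cbox a b) xi *\<^sub>R (g' xi * (?E x xi * (?P (xi $ i) * H xi)))) <= C2 * (2 * (1 / (1 + \<bar>x $ i\<bar>)) * B) * ?W x"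
    proof (rule C2(2))
     show "cmod (?P (xi $ i) * H xi) <= 2 * (1 / (1 + \<bar>x $ i\<bar>)) * B" for xi
      unfolding norm_mult using HB B0 by (intro mult_mono norm_axis_primitive[OF True ab]) auto
     show "?P ((xi + t *\<^sub>R axis j 1) $ i) * H (xi + t *\<^sub>R axis j 1) = ?P (xi $ i) * H xi" if "j \<in> S" for j xi t
      unfolding nth[OF ne[OF that]] using inv that by simp
    qed measurable
    then show "cmod (LINT xi|lborel. indicator (cbox a b) xi *\<^sub>R (g' xi * (?P (xi $ i) * (?E x xi * H xi)))) <= C2 * (2 * (1 / (1 + \<bar>x $ i\<bar>)) * B) * ?W x"
     by (simp only: mult.left_commute)
    show "0 <= (1 / (b $ i - a $ i)) * (1 / (1 + \<bar>x $ i\<bar>))" using bai by (intro mult_nonneg_nonneg) auto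
   qed simp
   also have "... = ((1 / (b $ i - a $ i)) * C1 + 2 * C2) * (B * ?W x * (1 / (1 + \<bar>x $ i\<bar>)))"
   proof -
    have "(k * v) * (C1 * B * W) + C2 * (2 * v * B) * W = (k * C1 + 2 * C2) * (B * W * v)" for k v W :: real
     by (simp add: algebra_simps)
    then show ?thesis .
   qed
   also have "... <= C * (B * ?W x * (1 / (1 + \<bar>x $ i\<bar>)))"
    by (rule mult_right_mono[OF _ BW]) (use C1(1) in \<open>simp add: C_def\<close>)
   finally show ?thesis .
  qed
  then show "cmod (LINT xi|lborel. indicator (cbox a b) xi *\<^sub>R (g xi * ((\<Prod>i\<in>insert i S. echar (x $ i * xi $ i)) * H xi)))
    <= C * B * (\<Prod>i\<in>insert i S. 1 / (1 + \<bar>x $ i\<bar>))"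
   using insert.hyps by (simp add: mult_ac)
 qed
qed

lemma echar_sum: "echar (\<Sum>i\<in>S. f i) = (\<Prod>i\<in>S. echar (f i))"
 by (induction S rule: infinite_finite_induct) (auto simp: echar_add)

lemma ift_box_decay:
 fixes a b :: "real ^ 'n"
 assumes ab: "\<And>i. a $ i < b $ i" and th: "\<And>xi. xi \<notin> cbox a b ==> th xi = 0" "C_on CARD('n) (cbox a b) th"
 shows "\<exists>C\<ge>0. \<forall>x. cmod (ift th x) <= C * (\<Prod>i\<in>UNIV. 1 / (1 + \<bar>x $ i\<bar>))"
proof -
 obtain C where C: "C \<ge> 0" "\<forall>(x :: real ^ 'n) H B. H \<in> borel_measurable borel --> (\<forall>xi. cmod (H xi) <= B) -->
   (\<forall>i\<in>UNIV. \<forall>xi t. H (xi + t *\<^sub>R axis i 1) = H xi) -->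
   cmod (LINT xi|lborel. indicator (cbox a b) xi *\<^sub>R (th xi * ((\<Prod>i\<in>UNIV. echar (x $ i * xi $ i)) * H xi)))
    <= C * B * (\<Prod>i\<in>UNIV. 1 / (1 + \<bar>x $ i\<bar>))"
  using box_oscillation_decay[OF ab th(2)] by (elim exE conjE)
 have "cmod (ift th x) <= C * (\<Prod>i\<in>UNIV. 1 / (1 + \<bar>x $ i\<bar>))" for x
 proof -
  have "indicator (cbox a b) xi *\<^sub>R (th xi * ((\<Prod>i\<in>UNIV. echar (x $ i * xi $ i)) * 1)) = th xi * echar (x \<bullet> xi)" for xi
   using th(1)[of xi] by (simp add: inner_vec_def echar_sum indicator_def)
  then show ?thesis using C(2)[rule_format, of "%_. 1" 1 x] by (simp add: ift_def)
 qed
 then show ?thesis using C(1) by blast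
qed

lemma ift_measurable [measurable]:
 assumes [measurable]: "g \<in> borel_measurable borel"
 shows "ift g \<in> borel_measurable borel"
 unfolding ift_def by measurable

section \<open>Synthesis with band-limited generators\<close>

locale band_limited =
 fixes th :: "real ^ 'n => complex" and p :: ennreal and q \<delta> R B Cd :: real
 assumes th_per: "periodization th R B"
  and decay: "Cd \<ge> 0" "\<And>x. cmod (ift th x) <= Cd * (\<Prod>i\<in>UNIV. 1 / (1 + \<bar>x $ i\<bar>))"
  and pq: "p ~= \<infinity>" "2 <= enn2real p" "1 / enn2real p + 1 / q = 1"
  and vanish: "\<And>l. l ~= 0 ==> AE xi in lborel. norm (int_vec l - xi) < \<delta> --> th xi = 0"
begin

interpretation th: periodization th R B by (rule th_per)

definition "r = enn2real p"

lemma r: "r \<ge> 2" "1 / r + 1 / q = 1" and q: "q > 1"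
 using pq conjugate_exponent[of "enn2real p" q] by (auto simp: r_def)

lemma B0: "B \<ge> 0" using th.v_bound norm_ge_zero order_trans by blast

lemma modulated: "periodization (%xi. th xi * echar (x \<bullet> xi)) R B"
proof
 show "AE xi in lborel. isCont (%xi. th xi * echar (x \<bullet> xi)) xi"
  using th.v_cont
 proof eventually_elim
  fix xi assume "isCont th xi"
  moreover have "isCont (%xi. echar (x \<bullet> xi)) xi"
   using continuous_on_echar[of UNIV "%xi. x \<bullet> xi"] by (simp add: continuous_on_eq_continuous_at continuous_intros)
  ultimately show "isCont (%xi. th xi * echar (x \<bullet> xi)) xi" by (intro continuous_intros)
 qed
qed (use th.v_bound th.v_support in \<open>auto simp: norm_mult\<close>)

lemma ift_shift: "(LINT \<zeta>|lborel. (th \<zeta> * echar (x \<bullet> \<zeta>)) * echar (int_vec k \<bullet> \<zeta>)) = ift th (x + int_vec k)"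
 unfolding ift_def by (intro Bochner_Integration.integral_cong refl) (simp add: inner_add_left echar_add)

text \<open>The product of the 1 / (1 + |x_i|) is not summable over the lattice, but its q-th power
  is, because a finite p forces q > 1.\<close>

lemma samples_lq: "\<exists>K\<ge>0. \<forall>x. (\<integral>\<^sup>+k. ennreal (cmod (ift th (x + int_vec k)) powr q) \<partial>lat) <= ennreal (K powr q)"
proof -
 obtain K where K: "K \<ge> 0"
  "\<And>x :: real ^ 'n. (\<integral>\<^sup>+l. ennreal (\<Prod>i\<in>UNIV. (1 + \<bar>(x + int_vec l) $ i\<bar>) powr (- q)) \<partial>lat) <= ennreal K"
  using lattice_prod_sum_bound[OF q, where 'n = 'n] by blast
 have "(\<integral>\<^sup>+k. ennreal (cmod (ift th (x + int_vec k)) powr q) \<partial>lat) <= ennreal ((Cd * K powr (1 / q)) powr q)" for x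
 proof -
  have pw: "cmod (ift th y) powr q <= Cd powr q * (\<Prod>i\<in>UNIV. (1 + \<bar>y $ i\<bar>) powr (- q))" for y
  proof -
   have "cmod (ift th y) powr q <= (Cd * (\<Prod>i\<in>UNIV. 1 / (1 + \<bar>y $ i\<bar>))) powr q"
    using q by (intro powr_mono2 decay) auto
   also have "... = Cd powr q * (\<Prod>i\<in>UNIV. 1 / (1 + \<bar>y $ i\<bar>)) powr q"
    by (rule powr_mult)
   also have "(\<Prod>i\<in>UNIV. 1 / (1 + \<bar>y $ i\<bar>)) powr q = (\<Prod>i\<in>UNIV. (1 / (1 + \<bar>y $ i\<bar>)) powr q)"
    by (rule prod_powr_distrib)
   also have "... = (\<Prod>i\<in>UNIV. (1 + \<bar>y $ i\<bar>) powr (- q))"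
    by (intro prod.cong refl) (simp add: powr_divide powr_minus_divide)
   finally show ?thesis .
  qed
  have "(\<integral>\<^sup>+k. ennreal (cmod (ift th (x + int_vec k)) powr q) \<partial>lat)
   <= (\<integral>\<^sup>+k. ennreal (Cd powr q) * ennreal (\<Prod>i\<in>UNIV. (1 + \<bar>(x + int_vec k) $ i\<bar>) powr (- q)) \<partial>lat)"
   by (intro nn_integral_mono, subst ennreal_mult[symmetric]) (auto intro!: prod_nonneg ennreal_leI pw simp del: vector_add_component)
  also have "... <= ennreal (Cd powr q) * ennreal K"
   using K(2) by (simp add: nn_integral_cmult mult_left_mono)
  also have "... = ennreal ((Cd * K powr (1 / q)) powr q)"
   using q K(1) decay(1) by (simp add: powr_mult powr_powr ennreal_mult)
  finally show ?thesis .
 qed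
 then show ?thesis using K(1) decay(1) by (intro exI[of _ "Cd * K powr (1 / q)"]) auto
qed

text \<open>Samples in l_p meet values of the generator in l_q, so Hoelder's inequality gives
  absolute convergence at every x.\<close>

lemma integrable_synth:
 assumes b: "PN_le q b A"
 shows "integrable lat (%k. coef b k * ift th (x + int_vec k))"
proof (rule integrableI_bounded)
 obtain K where K: "K \<ge> 0" "\<And>x. (\<integral>\<^sup>+k. ennreal (cmod (ift th (x + int_vec k)) powr q) \<partial>lat) <= ennreal (K powr q)"
  using samples_lq by blast
 have A: "A \<ge> 0" using b by (simp add: PN_le_def)
 have "(\<integral>\<^sup>+k. ennreal (norm (coef b k * ift th (x + int_vec k))) \<partial>lat)
  = (\<integral>\<^sup>+k. ennreal (cmod (coef b k) * cmod (ift th (x + int_vec k))) \<partial>lat)" by (simp add: norm_mult)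
 also have "... <= ennreal ((hy_const r * A) * K)"
  by (rule nn_integral_Hoelder[where p = r and q = q])
    (use r q A hy_const_nonneg K coef_lp[OF b r] in auto)
 finally show "(\<integral>\<^sup>+k. ennreal (norm (coef b k * ift th (x + int_vec k))) \<partial>lat) < \<infinity>"
  by (rule order_le_less_trans) simp
qed simp

text \<open>Poisson summation for \<open>th\<close> modulated by x, whose Fourier coefficients are
  the values of the generator on the coset of x. Moving the periodization from \<open>th\<close>
  onto b exhibits the synthesized function as an inverse transform.\<close>

lemma synth_eq_ift:
 assumes b: "PN_le q b A"
 shows "(LINT k|lat. coef b k * ift th (x + int_vec k)) = ift (%eta. lsum b eta * th eta) x"
proof -
 have i: "integrable lborel b" using b by (simp add: PN_le_def)
 interpret v: periodization "%xi. th xi * echar (x \<bullet> xi)" R B by (rule modulated)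
 have "(LINT k|lat. coef b k * ift th (x + int_vec k)) = (LINT k|lat. ift th (x + int_vec k) * coef b k)"
  by (simp add: mult.commute)
 also have "... = (LINT eta|lborel. b eta * v.per eta)"
  using v.poisson[OF i] integrable_synth[OF b, of x]
  unfolding ift_shift coef_def[symmetric] by (simp add: mult.commute)
 also have "... = (LINT eta|lborel. (th eta * echar (x \<bullet> eta)) * lsum b eta)" by (rule v.integral_per_eq(1)[OF i])
 also have "... = ift (%eta. lsum b eta * th eta) x" by (simp add: ift_def mult_ac)
 finally show ?thesis .
qed

text \<open>A bounded function of bounded support lies below a multiple of (1 + norm y)^(-d-1),
  whose lattice sums are uniformly bounded.\<close>

lemma th_lq: "\<exists>K\<ge>0. \<forall>x. (\<integral>\<^sup>+l. ennreal (cmod (th (x + int_vec l)) powr q) \<partial>lat) <= ennreal K"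
proof -
 let ?s = "real CARD('n) + 1"
 obtain K where K: "K \<ge> 0" "\<And>x :: real ^ 'n. (\<integral>\<^sup>+l. ennreal ((1 + norm (x + int_vec l)) powr (- ?s)) \<partial>lat) <= ennreal K"
  using lattice_sum_bound[of ?s, where 'n = 'n] by auto
 define c where "c = B powr q * (1 + \<bar>R\<bar>) powr ?s"
 have pw: "cmod (th y) powr q <= c * (1 + norm y) powr (- ?s)" for y
 proof (cases "norm y > R")
  case True then show ?thesis using th.v_support by (simp add: c_def)
 next
  case False
  have "1 = (1 + norm y) powr ?s * (1 + norm y) powr (- ?s)"
   by (simp add: add_nonneg_eq_0_iff flip: powr_add)
  also have "... <= (1 + \<bar>R\<bar>) powr ?s * (1 + norm y) powr (- ?s)"
   using False by (intro mult_right_mono powr_mono2) auto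
  finally have "B powr q * 1 <= B powr q * ((1 + \<bar>R\<bar>) powr ?s * (1 + norm y) powr (- ?s))"
   by (rule mult_left_mono) simp
  moreover have "cmod (th y) powr q <= B powr q" using q th.v_bound by (intro powr_mono2) auto
  ultimately show ?thesis by (simp add: c_def mult.assoc)
 qed
 have c0: "c \<ge> 0" by (simp add: c_def)
 have "(\<integral>\<^sup>+l. ennreal (cmod (th (x + int_vec l)) powr q) \<partial>lat) <= ennreal (c * K)" for x
 proof -
  have "(\<integral>\<^sup>+l. ennreal (cmod (th (x + int_vec l)) powr q) \<partial>lat) <= (\<integral>\<^sup>+l. ennreal c * ennreal ((1 + norm (x + int_vec l)) powr (- ?s)) \<partial>lat)"
   using pw c0 by (intro nn_integral_mono) (simp add: ennreal_mult[symmetric])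
  also have "... <= ennreal c * ennreal K" using K(2) by (simp add: nn_integral_cmult mult_left_mono)
  finally show ?thesis using c0 K(1) by (simp add: ennreal_mult)
 qed
 then show ?thesis using c0 K(1) by (intro exI[of _ "c * K"]) auto
qed

text \<open>The synthesized function is the inverse transform of \<open>lsum b\<close> times
  \<open>th\<close>, so Hausdorff-Young bounds its L_p norm. The L_q norm of that product folds to
  the torus, where \<open>lsum b\<close> is periodic and \<open>th_lq\<close> bounds the inner
  sum.\<close>

proposition synthesis: "synthesis (ift th) th p q \<delta>"
proof
 show "\<exists>C. \<forall>eta. cmod (th eta) <= C" using th.v_bound by blast
 obtain K where K: "K \<ge> 0" "\<And>x. (\<integral>\<^sup>+l. ennreal (cmod (th (x + int_vec l)) powr q) \<partial>lat) <= ennreal K"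
  using th_lq by blast
 have Lp: "Lp_le p (%x. LINT k|lat. coef b k * ift th (x + int_vec k)) (hy_const r * K powr (1 / q) * A)"
  if b: "PN_le q b A" for b A
 proof -
  have i: "integrable lborel b" and A: "A \<ge> 0" using b by (auto simp: PN_le_def)
  have [measurable]: "b \<in> borel_measurable borel" using borel_measurable_integrable[OF i] by simp
  have il: "integrable lborel (%eta. lsum b eta * th eta)"
   using th.integral_per_eq(2)[OF i] by (simp add: mult.commute)
  have "(\<integral>\<^sup>+eta. ennreal (cmod (lsum b eta * th eta) powr q) \<partial>lborel)
   = (\<integral>\<^sup>+eta. (\<integral>\<^sup>+l. ennreal (cmod (lsum b (eta + int_vec l) * th (eta + int_vec l)) powr q) \<partial>lat) \<partial>torus)"
   by (rule nn_integral_tile[symmetric]) measurable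
  also have "... = (\<integral>\<^sup>+eta. ennreal (cmod (lsum b eta) powr q) * (\<integral>\<^sup>+l. ennreal (cmod (th (eta + int_vec l)) powr q) \<partial>lat) \<partial>torus)"
   by (intro nn_integral_cong) (simp add: lsum_periodic norm_mult powr_mult ennreal_mult nn_integral_cmult)
  also have "... <= (\<integral>\<^sup>+eta. ennreal (labs b eta powr q) * ennreal K \<partial>torus)"
   using q K by (intro nn_integral_mono mult_mono ennreal_leI powr_mono2 norm_lsum_le) auto
  also have "... = (\<integral>\<^sup>+eta. ennreal (labs b eta powr q) \<partial>torus) * ennreal K" by (rule nn_integral_multc) measurable
  also have "... <= ennreal (A powr q) * ennreal K" using b by (intro mult_right_mono) (auto simp: PN_le_def)
  also have "... = ennreal ((K powr (1 / q) * A) powr q)"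
   using q K(1) A by (simp add: powr_mult powr_powr ennreal_mult mult.commute)
  finally have "(\<integral>\<^sup>+x. ennreal (cmod (space_hy.T (%eta. lsum b eta * th eta) x) powr r) \<partial>lborel) <= ennreal ((hy_const r * (K powr (1 / q) * A)) powr r)"
   using A by (intro space_hy.hausdorff_young[OF il r]) auto
  moreover have "space_hy.T (%eta. lsum b eta * th eta) = ift (%eta. lsum b eta * th eta)"
   by (simp add: fun_eq_iff space_hy.T_def ift_def)
  moreover have "ift (%eta. lsum b eta * th eta) \<in> borel_measurable borel" by measurable
  ultimately show ?thesis
   using pq(1) A hy_const_nonneg[of r]
   unfolding Lp_le_def synth_eq_ift[OF b] r_def[symmetric] by (simp add: mult.assoc)
 qed
 have "hy_const r * K powr (1 / q) \<ge> 0" using hy_const_nonneg by simp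
 then show "\<exists>C\<ge>0. \<forall>b A. PN_le q b A -->
   (AE x in lborel. integrable lat (%k. coef b k * ift th (x + int_vec k))) \<and>
   Lp_le p (%x. LINT k|lat. coef b k * ift th (x + int_vec k)) (C * A)"
  using Lp integrable_synth by (intro exI[of _ "hy_const r * K powr (1 / q)"]) simp
 show "AE x in lborel. (LINT k|lat. coef b k * ift th (x + int_vec k)) = ift (%eta. b eta * th eta) x"
  if b: "PN_le q b A" and supp: "\<And>eta. norm eta \<ge> \<delta> ==> b eta = 0" for b A
 proof -
  have [measurable]: "b \<in> borel_measurable borel" using b borel_measurable_integrable[of lborel b] by (simp add: PN_le_def)
  have "AE eta in lborel. \<forall>l. l ~= 0 --> norm (int_vec l - eta) < \<delta> --> th eta = 0"
   unfolding AE_all_countable using vanish by simp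
  then have "AE eta in lborel. lsum b eta * th eta = b eta * th eta"
  proof eventually_elim
   fix eta assume v: "\<forall>l. l ~= 0 --> norm (int_vec l - eta) < \<delta> --> th eta = 0"
   show "lsum b eta * th eta = b eta * th eta"
   proof (cases "th eta = 0")
    case False
    \<comment> \<open>If \<open>th eta\<close> is nonzero, compatibility keeps eta at distance at
      least \<delta> from every nonzero lattice point, so eta + l with l \<noteq> 0 lies where b
      vanishes.\<close>
    have z: "b (eta + int_vec l) = 0" if "l ~= 0" for l
    proof (rule supp)
     have "\<not> norm (int_vec (- l) - eta) < \<delta>" using v that False by auto
     moreover have "norm (int_vec (- l) - eta) = norm (eta + int_vec l)"
      by (metis int_vec_minus minus_add_distrib norm_minus_cancel uminus_add_conv_diff diff_conv_add_uminus add.commute)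
     ultimately show "norm (eta + int_vec l) \<ge> \<delta>" by simp
    qed
    have "lsum b eta = sum (%l. b (eta + int_vec l)) {0}"
     unfolding lsum_def by (rule integral_lat_finite(1)) (use z in auto)
    then show ?thesis by simp
   qed simp
  qed
  then have "ift (%eta. lsum b eta * th eta) x = ift (%eta. b eta * th eta) x" for x
   unfolding ift_def by (intro integral_cong_AE) (auto elim: eventually_mono)
  then show ?thesis by (simp add: synth_eq_ift[OF b])
 qed
qed measurable

end

section \<open>The error estimate at level zero\<close>

locale exponent_pair =
 fixes p :: ennreal and q :: real
 assumes p2: "2 <= p" and q_inf: "p = \<infinity> ==> q = 1" and pq_fin: "p ~= \<infinity> ==> 1 / enn2real p + 1 / q = 1"
begin

lemma p_fin:
 assumes "p ~= \<infinity>"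
 shows "p = ennreal (enn2real p)" "enn2real p \<ge> 2" "q > 1"
proof -
 show p: "p = ennreal (enn2real p)" using assms by (simp add: top.not_eq_extremum)
 then have "ennreal 2 <= ennreal (enn2real p)" using p2 by (simp add: ennreal_numeral[symmetric] del: ennreal_numeral)
 then have "0 <= enn2real p \<and> 2 <= enn2real p \<or> (2 :: real) <= 0 \<and> enn2real p <= 0" by (simp only: ennreal_le_iff2)
 then show r: "enn2real p \<ge> 2" by linarith
 show "q > 1" using conjugate_exponent[of "enn2real p" q] r pq_fin[OF assms] by auto
qed

lemma q1: "q \<ge> 1"
 using q_inf p_fin(3) by (cases "p = \<infinity>") auto

text \<open>For p = \<infinity> the trivial bound by the L_1 norm, otherwise Hausdorff-Young on
  space.\<close>

lemma Lp_le_ift: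
 "\<exists>H\<ge>0. \<forall>b A. integrable lborel b --> A \<ge> 0 -->
  (\<integral>\<^sup>+eta. ennreal (cmod (b eta) powr q) \<partial>lborel) <= ennreal (A powr q) --> Lp_le p (ift b :: real ^ 'n => complex) (H * A)"
proof (cases "p = \<infinity>")
 case True
 have "Lp_le p (ift b) (1 * A)" if b: "integrable lborel b" and A: "A \<ge> 0"
  and le: "(\<integral>\<^sup>+eta. ennreal (cmod (b eta) powr q) \<partial>lborel) <= ennreal (A powr q)" for b :: "real ^ 'n => complex" and A
 proof -
  have [measurable]: "b \<in> borel_measurable borel" using borel_measurable_integrable[OF b] by simp
  have "ennreal (LINT eta|lborel. cmod (b eta)) = (\<integral>\<^sup>+eta. ennreal (cmod (b eta)) \<partial>lborel)"
   by (rule nn_integral_eq_integral[symmetric]) (use b in auto)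
  also have "... <= ennreal A" using le A by (simp add: q_inf[OF True])
  finally have "(LINT eta|lborel. cmod (b eta)) <= A" using A by (simp add: ennreal_le_iff)
  moreover have "cmod (ift b x) <= (LINT eta|lborel. cmod (b eta))" for x
   unfolding ift_def by (rule order_trans[OF integral_norm_bound]) (simp add: norm_mult)
  ultimately have "cmod (ift b x) <= A" for x using order_trans by blast
  moreover have "ift b \<in> borel_measurable borel" by measurable
  ultimately show ?thesis using True A by (simp add: Lp_le_def)
 qed
 then show ?thesis by (intro exI[of _ 1]) simp
next
 case False
 have "Lp_le p (ift b) (hy_const (enn2real p) * A)" if b: "integrable lborel b" and A: "A \<ge> 0"
  and le: "(\<integral>\<^sup>+eta. ennreal (cmod (b eta) powr q) \<partial>lborel) <= ennreal (A powr q)" for b :: "real ^ 'n => complex" and A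
 proof -
  have [measurable]: "b \<in> borel_measurable borel" using borel_measurable_integrable[OF b] by simp
  have "space_hy.T b = ift b" by (simp add: fun_eq_iff space_hy.T_def ift_def)
  moreover have "ift b \<in> borel_measurable borel" by measurable
  ultimately show ?thesis
   using space_hy.hausdorff_young[OF b p_fin(2)[OF False] pq_fin[OF False] A le] False A hy_const_nonneg[of "enn2real p"]
   by (simp add: Lp_le_def)
 qed
 then show ?thesis using hy_const_nonneg by (intro exI[of _ "hy_const (enn2real p)"]) simp
qed

text \<open>Since \<open>(N + 1) p > d\<close>, the weight \<open>(1 + \<bar>\<eta>\<bar>)\<^sup>-\<^sup>(\<^sup>N\<^sup>+\<^sup>1\<^sup>)\<close> is \<open>p\<close>-summable over lattice cosets, so a
 weighted \<open>L\<^sub>q\<close> bound controls the periodization.\<close>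

lemma coset_sum_le_weighted:
 fixes N :: nat
 assumes dim: "p ~= \<infinity> ==> real CARD('n) < enn2real p"
 shows "\<exists>K\<ge>0. \<forall>(g :: real ^ 'n => complex) eta v. v \<ge> 0 -->
  (\<integral>\<^sup>+l. ennreal ((cmod (g (eta + int_vec l)) * (1 + norm (eta + int_vec l)) ^ (N + 1)) powr q) \<partial>lat) <= ennreal v -->
  (\<integral>\<^sup>+l. ennreal (cmod (g (eta + int_vec l))) \<partial>lat) <= ennreal (K * v powr (1 / q))"
proof (cases "p = \<infinity>")
 case True
 have "(\<integral>\<^sup>+l. ennreal (cmod (g (eta + int_vec l))) \<partial>lat) <= ennreal v"
  if "(\<integral>\<^sup>+l. ennreal ((cmod (g (eta + int_vec l)) * (1 + norm (eta + int_vec l)) ^ (N + 1)) powr q) \<partial>lat) <= ennreal v"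
  for g :: "real ^ 'n => complex" and eta v
 proof (rule order_trans[OF nn_integral_mono that], rule ennreal_leI)
  fix l
  have "cmod (g (eta + int_vec l)) * 1 <= cmod (g (eta + int_vec l)) * (1 + norm (eta + int_vec l)) ^ (N + 1)"
   by (intro mult_left_mono one_le_power) auto
  then show "cmod (g (eta + int_vec l)) <= (cmod (g (eta + int_vec l)) * (1 + norm (eta + int_vec l)) ^ (N + 1)) powr q"
   by (simp add: q_inf[OF True])
 qed
 then show ?thesis by (intro exI[of _ 1]) (simp add: q_inf[OF True])
next
 case False
 define r where "r = enn2real p"
 have r: "r \<ge> 2" "1 / r + 1 / q = 1" "q > 1" "real CARD('n) < r"
  using p_fin[OF False] pq_fin[OF False] dim[OF False] by (auto simp: r_def)
 have "real CARD('n) < real (N + 1) * r"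
 proof -
  have "1 * r <= real (N + 1) * r" using r by (intro mult_right_mono) auto
  then show ?thesis using r(4) by linarith
 qed
 then obtain K where K: "K \<ge> 0" "\<And>x :: real ^ 'n. (\<integral>\<^sup>+l. ennreal ((1 + norm (x + int_vec l)) powr (- (real (N + 1) * r))) \<partial>lat) <= ennreal K"
  using lattice_sum_bound[where 'n = 'n] by blast
 have "(\<integral>\<^sup>+l. ennreal (cmod (g (eta + int_vec l))) \<partial>lat) <= ennreal (K powr (1 / r) * v powr (1 / q))"
  if v: "v \<ge> 0" "(\<integral>\<^sup>+l. ennreal ((cmod (g (eta + int_vec l)) * (1 + norm (eta + int_vec l)) ^ (N + 1)) powr q) \<partial>lat) <= ennreal v"
  for g :: "real ^ 'n => complex" and eta v
 proof -
  have "(\<integral>\<^sup>+l. ennreal ((1 + norm (eta + int_vec l)) powr (- real (N + 1)) * (cmod (g (eta + int_vec l)) * (1 + norm (eta + int_vec l)) ^ (N + 1))) \<partial>lat)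
   <= ennreal (K powr (1 / r) * v powr (1 / q))"
  proof (rule nn_integral_Hoelder[where p = r and q = q])
   show "(\<integral>\<^sup>+l. ennreal (((1 + norm (eta + int_vec l)) powr (- real (N + 1))) powr r) \<partial>lat) <= ennreal ((K powr (1 / r)) powr r)"
    using K(2)[of eta] K(1) r unfolding powr_powr mult_minus_left by simp
   show "(\<integral>\<^sup>+l. ennreal ((cmod (g (eta + int_vec l)) * (1 + norm (eta + int_vec l)) ^ (N + 1)) powr q) \<partial>lat) <= ennreal ((v powr (1 / q)) powr q)"
    using v r by (simp add: powr_powr)
  qed (use r in auto)
  also have "(\<integral>\<^sup>+l. ennreal ((1 + norm (eta + int_vec l)) powr (- real (N + 1)) * (cmod (g (eta + int_vec l)) * (1 + norm (eta + int_vec l)) ^ (N + 1))) \<partial>lat)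
   = (\<integral>\<^sup>+l. ennreal (cmod (g (eta + int_vec l))) \<partial>lat)"
  proof (intro nn_integral_cong arg_cong[of _ _ ennreal])
   fix l
   have cancel: "y powr (- real (N + 1)) * (c * y ^ (N + 1)) = c" if "y > 0" for y c :: real
   proof -
    have z: "y ^ (N + 1) ~= 0" using that by simp
    show ?thesis
     unfolding powr_minus powr_realpow[OF that]
     by (simp only: mult.commute[of c] mult.assoc[symmetric] left_inverse[OF z] mult_1_left)
   qed
   show "(1 + norm (eta + int_vec l)) powr (- real (N + 1)) * (cmod (g (eta + int_vec l)) * (1 + norm (eta + int_vec l)) ^ (N + 1)) = cmod (g (eta + int_vec l))"
    by (rule cancel) (simp add: add_pos_nonneg)
  qed
  finally show ?thesis .
 qed
 then show ?thesis by (intro exI[of _ "K powr (1 / r)"]) simp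
qed

text \<open>The coset bound, raised to the power q and integrated over the torus, unfolds to the
  weighted L_q norm. Integrability of g belongs to the claim and is proved beforehand, since
  \<open>labs\<close> is meaningful only then.\<close>

lemma PN_le_weighted:
 fixes N :: nat
 assumes dim: "p ~= \<infinity> ==> real CARD('n) < enn2real p"
 shows "\<exists>K\<ge>0. \<forall>(g :: real ^ 'n => complex) A. g \<in> borel_measurable borel --> A \<ge> 0 -->
  (\<integral>\<^sup>+eta. ennreal ((cmod (g eta) * (1 + norm eta) ^ (N + 1)) powr q) \<partial>lborel) <= ennreal (A powr q) --> PN_le q g (K * A)"
proof -
 obtain K where K: "K \<ge> 0" "\<And>(g :: real ^ 'n => complex) eta v. v \<ge> 0 ==>
  (\<integral>\<^sup>+l. ennreal ((cmod (g (eta + int_vec l)) * (1 + norm (eta + int_vec l)) ^ (N + 1)) powr q) \<partial>lat) <= ennreal v ==>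
  (\<integral>\<^sup>+l. ennreal (cmod (g (eta + int_vec l))) \<partial>lat) <= ennreal (K * v powr (1 / q))"
  using coset_sum_le_weighted[OF dim] by blast
 have "PN_le q g (K * A)" if [measurable]: "g \<in> borel_measurable borel" and A: "A \<ge> 0"
  and le: "(\<integral>\<^sup>+eta. ennreal ((cmod (g eta) * (1 + norm eta) ^ (N + 1)) powr q) \<partial>lborel) <= ennreal (A powr q)"
  for g :: "real ^ 'n => complex" and A
 proof -
  let ?V = "%eta. \<integral>\<^sup>+l. ennreal ((cmod (g (eta + int_vec l)) * (1 + norm (eta + int_vec l)) ^ (N + 1)) powr q) \<partial>lat"
  let ?S = "%eta. \<integral>\<^sup>+l. ennreal (cmod (g (eta + int_vec l))) \<partial>lat"
  have [measurable]: "?V \<in> borel_measurable borel" "?S \<in> borel_measurable borel" by measurable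
  have V: "(\<integral>\<^sup>+eta. ?V eta \<partial>torus) <= ennreal (A powr q)"
   using le by (subst nn_integral_tile) measurable
  have V_fin: "AE eta in torus. ?V eta ~= \<infinity>"
   by (rule nn_integral_PInf_AE) (use order_le_less_trans[OF V ennreal_less_top] in auto)
  have S_le: "?S eta <= ennreal (K * v powr (1 / q))" if "v \<ge> 0" "?V eta = ennreal v" for eta v
   by (rule K(2)) (use that in simp_all)
  have "(\<integral>\<^sup>+eta. ennreal (cmod (g eta)) \<partial>lborel) = (\<integral>\<^sup>+eta. ?S eta \<partial>torus)"
   by (rule nn_integral_tile[symmetric]) measurable
  also have "... <= (\<integral>\<^sup>+eta. ennreal K * (1 + ?V eta) \<partial>torus)"
  proof (rule nn_integral_mono_AE, use V_fin in eventually_elim)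
   fix eta assume fin: "?V eta ~= \<infinity>"
   obtain v where v: "v \<ge> 0" "?V eta = ennreal v" using fin by (cases "?V eta") auto
   \<comment> \<open>Turns the bound with the power 1 / q into one that is affine in v and hence has
     a finite torus integral.\<close>
   have "v powr (1 / q) <= 1 + v"
   proof (cases "v <= 1")
    case True then have "v powr (1 / q) <= 1" using q1 v(1) by (intro powr_le1) auto
    then show ?thesis using v(1) by linarith
   next
    case False then have "v powr (1 / q) <= v powr 1" using q1 by (intro powr_mono) auto
    then show ?thesis using False by simp
   qed
   then have "K * v powr (1 / q) <= K * (1 + v)" using K(1) by (rule mult_left_mono)
   then have "?S eta <= ennreal (K * (1 + v))" using S_le[OF v] by (meson ennreal_leI order_trans)
   also have "... = ennreal K * (1 + ennreal v)" using K(1) using v(1) by (simp add: ennreal_mult ennreal_plus del: ennreal_plus[symmetric])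
   finally show "?S eta <= ennreal K * (1 + ?V eta)" unfolding v(2) .
  qed
  also have "... = ennreal K * (1 + (\<integral>\<^sup>+eta. ?V eta \<partial>torus))"
   by (simp add: nn_integral_cmult nn_integral_add torus.emeasure_space_1[simplified])
  also have "... < \<infinity>" using order_le_less_trans[OF V ennreal_less_top] by (simp add: ennreal_mult_less_top)
  finally have i: "integrable lborel g" by (intro integrableI_bounded) auto
  have "(\<integral>\<^sup>+eta. ennreal (labs g eta powr q) \<partial>torus) <= (\<integral>\<^sup>+eta. ennreal (K powr q) * ?V eta \<partial>torus)"
  proof (rule nn_integral_mono_AE, use V_fin lsum_integrable(2)[OF i] in eventually_elim)
   fix eta assume fin: "?V eta ~= \<infinity>" and il: "integrable lat (%l. g (eta + int_vec l))"
   obtain v where v: "v \<ge> 0" "?V eta = ennreal v" using fin by (cases "?V eta") auto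
   have "ennreal (labs g eta) = ?S eta"
    unfolding labs_def by (rule nn_integral_eq_integral[symmetric]) (use il in auto)
   then have "ennreal (labs g eta) <= ennreal (K * v powr (1 / q))" using S_le[OF v] by simp
   then have "labs g eta <= K * v powr (1 / q)" using K(1) by (subst (asm) ennreal_le_iff) auto
   then have "labs g eta powr q <= (K * v powr (1 / q)) powr q" using q1 labs_nonneg by (intro powr_mono2) auto
   also have "... = K powr q * v" using q1 K(1) v(1) by (simp add: powr_mult powr_powr)
   finally have "ennreal (labs g eta powr q) <= ennreal (K powr q * v)" by (rule ennreal_leI)
   also have "... = ennreal (K powr q) * ?V eta" unfolding v(2) by (simp add: ennreal_mult v(1))
   finally show "ennreal (labs g eta powr q) <= ennreal (K powr q) * ?V eta" .
  qed
  also have "... = ennreal (K powr q) * (\<integral>\<^sup>+eta. ?V eta \<partial>torus)" by (rule nn_integral_cmult) measurable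
  also have "... <= ennreal (K powr q) * ennreal (A powr q)" by (intro mult_left_mono V) simp
  also have "... = ennreal ((K * A) powr q)" using K(1) A by (simp add: powr_mult ennreal_mult)
  finally show ?thesis using i K(1) A by (simp add: PN_le_def)
 qed
 then show ?thesis using K(1) by blast
qed

end

lemma Lp_le_uminus: "Lp_le p u A ==> Lp_le p (%x. - u x) A"
 by (auto simp: Lp_le_def)

lemma nn_integral_powr_le:
 assumes u: "(\<integral>\<^sup>+x. ennreal (u x powr q) \<partial>M) <= ennreal (A powr q)" and q: "q \<ge> 0" and c: "c \<ge> 0" "A \<ge> 0"
  and [measurable]: "u \<in> borel_measurable M" and u0: "\<And>x. u x \<ge> 0" and v0: "\<And>x. v x \<ge> 0"
  and le: "AE x in M. v x <= c * u x"
 shows "(\<integral>\<^sup>+x. ennreal (v x powr q) \<partial>M) <= ennreal ((c * A) powr q)"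
proof -
 have "(\<integral>\<^sup>+x. ennreal (v x powr q) \<partial>M) <= (\<integral>\<^sup>+x. ennreal (c powr q) * ennreal (u x powr q) \<partial>M)"
 proof (rule nn_integral_mono_AE, use le in eventually_elim)
  fix x assume "v x <= c * u x"
  then have "v x powr q <= (c * u x) powr q" using q v0 by (intro powr_mono2)
  then show "ennreal (v x powr q) <= ennreal (c powr q) * ennreal (u x powr q)"
   using c u0 by (simp add: powr_mult ennreal_mult[symmetric])
 qed
 also have "... = ennreal (c powr q) * (\<integral>\<^sup>+x. ennreal (u x powr q) \<partial>M)" by (rule nn_integral_cmult) measurable
 also have "... <= ennreal (c powr q) * ennreal (A powr q)" by (intro mult_left_mono u) simp
 also have "... = ennreal ((c * A) powr q)" using c by (simp add: powr_mult ennreal_mult)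
 finally show ?thesis .
qed

locale sampled_synthesis = exponent_pair p q + synthesis \<phi> ph p q \<delta> + averaging \<nu> N
 for \<phi> ph :: "real ^ 'n => complex" and p q \<delta> and \<nu> :: "(real ^ 'n) measure" and N +
 assumes \<delta>: "\<delta> > 0" and dim: "p ~= \<infinity> ==> real CARD('n) < enn2real p"
  and approx: "\<exists>C\<ge>0. AE eta in lborel. norm eta < \<delta> --> cmod (1 - mu eta * ph eta) <= C * norm eta ^ (N + 1)"
begin

lemma coef_add:
 "integrable lborel b ==> integrable lborel b' ==> coef (%eta. b eta + b' eta) k = coef b k + coef b' k"
 unfolding coef_def distrib_right
 by (intro Bochner_Integration.integral_add integrable_mult_echar) auto

text \<open>With g = gl + gh split at \<delta>, the error is the inverse transform of gl (1 - mu
  ph), plus that of gh, minus the synthesis of gh mu. Each term is bounded through the weight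
  |eta|^(N+1), the quantity that gains under rescaling. The bound \<open>A'\<close> places gl mu in
  the domain of the synthesis operator; the constant multiplies \<open>A\<close> alone.\<close>

theorem error_level_zero:
 "\<exists>C\<ge>0. \<forall>(g :: real ^ 'n => complex) A A'. g \<in> borel_measurable borel --> integrable lborel g --> A \<ge> 0 --> A' \<ge> 0 -->
   (\<integral>\<^sup>+eta. ennreal (cmod (g eta) powr q) \<partial>lborel) <= ennreal (A' powr q) -->
   (\<integral>\<^sup>+eta. ennreal ((cmod (g eta) * norm eta ^ (N + 1)) powr q) \<partial>lborel) <= ennreal (A powr q) -->
   (AE x in lborel. integrable lat (%k. coef (%eta. g eta * mu eta) k * \<phi> (x + int_vec k))) \<and>
   Lp_le p (%x. ift g x - (LINT k|lat. coef (%eta. g eta * mu eta) k * \<phi> (x + int_vec k))) (C * A)"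
proof -
 obtain K where K: "K \<ge> 0" "\<And>(g :: real ^ 'n => complex) A. g \<in> borel_measurable borel ==> A \<ge> 0 ==>
  (\<integral>\<^sup>+eta. ennreal ((cmod (g eta) * (1 + norm eta) ^ (N + 1)) powr q) \<partial>lborel) <= ennreal (A powr q) ==> PN_le q g (K * A)"
  using PN_le_weighted[OF dim, of N] by blast
 obtain H where H: "H \<ge> 0" "\<And>(b :: real ^ 'n => complex) A. integrable lborel b ==> A \<ge> 0 ==>
  (\<integral>\<^sup>+eta. ennreal (cmod (b eta) powr q) \<partial>lborel) <= ennreal (A powr q) ==> Lp_le p (ift b) (H * A)"
  using Lp_le_ift[where 'n = 'n] by blast
 obtain Ca where Ca: "Ca \<ge> 0" "AE eta in lborel. norm eta < \<delta> --> cmod (1 - mu eta * ph eta) <= Ca * norm eta ^ (N + 1)"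
  using approx by blast
 obtain Cs where Cs: "Cs \<ge> 0" "\<And>b A. PN_le q b A ==> AE x in lborel. integrable lat (%k. coef b k * \<phi> (x + int_vec k))"
   "\<And>b A. PN_le q b A ==> Lp_le p (%x. LINT k|lat. coef b k * \<phi> (x + int_vec k)) (Cs * A)"
  using synth_bounded by blast
 obtain Bp where Bp: "\<And>eta. cmod (ph eta) <= Bp" using ph_bounded by blast
 have Bp0: "Bp \<ge> 0" using Bp norm_ge_zero order_trans by blast
 \<comment> \<open>For norm eta \<ge> \<delta> one has 1 + norm eta \<le> ((1 + \<delta>) /
   \<delta>) norm eta, so the homogeneous weight controls the inhomogeneous one on high
   frequencies.\<close>
 define c1 where "c1 = ((1 + \<delta>) / \<delta>) ^ (N + 1)"
 have c1: "c1 \<ge> 0" using \<delta> by (simp add: c1_def)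
 \<comment> \<open>Each use of \<open>Lp_le_add\<close> doubles the bound; H belongs to the two
   inverse transforms, Cs and K to the synthesized high part.\<close>
 define C where "C = 2 * (2 * (H * Ca + H * c1) + Cs * (K * c1))"
 have C0: "C \<ge> 0" unfolding C_def using H(1) Ca(1) c1 Cs(1) K(1) by (intro mult_nonneg_nonneg add_nonneg_nonneg) auto
 have "(AE x in lborel. integrable lat (%k. coef (%eta. g eta * mu eta) k * \<phi> (x + int_vec k))) \<and>
   Lp_le p (%x. ift g x - (LINT k|lat. coef (%eta. g eta * mu eta) k * \<phi> (x + int_vec k))) (C * A)"
  if [measurable]: "g \<in> borel_measurable borel" and gi: "integrable lborel g" and A: "A \<ge> 0" "A' \<ge> 0"
   and gq: "(\<integral>\<^sup>+eta. ennreal (cmod (g eta) powr q) \<partial>lborel) <= ennreal (A' powr q)"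
   and gw: "(\<integral>\<^sup>+eta. ennreal ((cmod (g eta) * norm eta ^ (N + 1)) powr q) \<partial>lborel) <= ennreal (A powr q)"
  for g :: "real ^ 'n => complex" and A A'
 proof -
  note mu_measurable [measurable]
  define gl where "gl eta = (if norm eta < \<delta> then g eta else 0)" for eta
  define gh where "gh eta = (if norm eta < \<delta> then 0 else g eta)" for eta
  have [measurable]: "gl \<in> borel_measurable borel" "gh \<in> borel_measurable borel"
   unfolding gl_def gh_def by measurable
  have g_split: "g eta = gl eta + gh eta" for eta by (simp add: gl_def gh_def)
  have gli: "integrable lborel gl" "integrable lborel gh"
   by (rule Bochner_Integration.integrable_bound[OF gi]; auto simp: gl_def gh_def)+
  define bl where "bl eta = gl eta * mu eta" for eta
  define bh where "bh eta = gh eta * mu eta" for eta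
  have [measurable]: "bl \<in> borel_measurable borel" "bh \<in> borel_measurable borel"
   unfolding bl_def bh_def by measurable
  have bi: "integrable lborel bl" "integrable lborel bh"
   unfolding bl_def bh_def by (rule integrable_mult_bounded[OF gli(1) _ norm_mu_le], simp, rule integrable_mult_bounded[OF gli(2) _ norm_mu_le], simp)
  have high: "cmod (gh eta) * (1 + norm eta) ^ (N + 1) <= c1 * (cmod (g eta) * norm eta ^ (N + 1))" for eta
  proof (cases "norm eta < \<delta>")
   case False
   then have "1 + norm eta <= ((1 + \<delta>) / \<delta>) * norm eta" using \<delta> by (simp add: field_simps)
   then have "(1 + norm eta) ^ (N + 1) <= c1 * norm eta ^ (N + 1)"
    unfolding c1_def power_mult_distrib[symmetric] by (intro power_mono) auto
   then have "cmod (g eta) * (1 + norm eta) ^ (N + 1) <= cmod (g eta) * (c1 * norm eta ^ (N + 1))"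
    by (rule mult_left_mono) simp
   then show ?thesis using False by (simp add: gh_def mult.left_commute)
  qed (use c1 in \<open>simp add: gh_def\<close>)
  have bh_le: "cmod (bh eta) * (1 + norm eta) ^ (N + 1) <= c1 * (cmod (g eta) * norm eta ^ (N + 1))" for eta
  proof (rule order_trans[OF _ high[of eta]], rule mult_right_mono)
   show "cmod (bh eta) <= cmod (gh eta)"
    unfolding bh_def norm_mult using mult_left_mono[OF norm_mu_le[of eta], of "cmod (gh eta)"] by simp
  qed simp
  have PNh: "PN_le q bh (K * (c1 * A))"
   by (rule K(2)) (use bh_le q1 c1 A in \<open>auto intro!: nn_integral_powr_le[OF gw] AE_I2\<close>)
  have PNl: "PN_le q bl (K * ((1 + \<delta>) ^ (N + 1) * A'))"
  proof (rule K(2))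
   have "cmod (bl eta) * (1 + norm eta) ^ (N + 1) <= (1 + \<delta>) ^ (N + 1) * cmod (g eta)" for eta
   proof (cases "norm eta < \<delta>")
    case True
    have "cmod (bl eta) <= cmod (g eta)"
     unfolding bl_def norm_mult using True mult_left_mono[OF norm_mu_le[of eta], of "cmod (g eta)"] by (simp add: gl_def)
    moreover have "(1 + norm eta) ^ (N + 1) <= (1 + \<delta>) ^ (N + 1)" using True by (intro power_mono) auto
    ultimately have "cmod (bl eta) * (1 + norm eta) ^ (N + 1) <= cmod (g eta) * (1 + \<delta>) ^ (N + 1)"
     by (rule mult_mono) auto
    then show ?thesis by (simp add: mult.commute)
   qed (use \<delta> in \<open>simp add: bl_def gl_def\<close>)
   then show "(\<integral>\<^sup>+eta. ennreal ((cmod (bl eta) * (1 + norm eta) ^ (N + 1)) powr q) \<partial>lborel) <= ennreal (((1 + \<delta>) ^ (N + 1) * A') powr q)"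
    using q1 \<delta> A by (intro nn_integral_powr_le[OF gq] AE_I2) auto
  qed (use \<delta> A in auto)
  define e1 where "e1 eta = gl eta - bl eta * ph eta" for eta
  have blp: "integrable lborel (%eta. bl eta * ph eta)" by (rule integrable_mult_bounded[OF bi(1) _ Bp]) simp
  have e1i: "integrable lborel e1" unfolding e1_def using gli(1) blp by simp
  have "Lp_le p (ift e1) (H * (Ca * A))"
  proof (rule H(2)[OF e1i])
   have "AE eta in lborel. cmod (e1 eta) <= Ca * (cmod (g eta) * norm eta ^ (N + 1))"
    using Ca(2)
   proof eventually_elim
    fix eta assume *: "norm eta < \<delta> --> cmod (1 - mu eta * ph eta) <= Ca * norm eta ^ (N + 1)"
    show "cmod (e1 eta) <= Ca * (cmod (g eta) * norm eta ^ (N + 1))"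
    proof (cases "norm eta < \<delta>")
     case True
     have "e1 eta = g eta * (1 - mu eta * ph eta)" using True by (simp add: e1_def bl_def gl_def right_diff_distrib mult.assoc)
     then have "cmod (e1 eta) <= cmod (g eta) * (Ca * norm eta ^ (N + 1))"
      using * True by (simp only: norm_mult) (intro mult_left_mono, auto)
     then show ?thesis by (simp add: mult.left_commute)
    qed (use Ca(1) in \<open>simp add: e1_def bl_def gl_def\<close>)
   qed
   then show "(\<integral>\<^sup>+eta. ennreal (cmod (e1 eta) powr q) \<partial>lborel) <= ennreal ((Ca * A) powr q)"
    using q1 Ca(1) A by (intro nn_integral_powr_le[OF gw]) auto
  qed (use Ca(1) A in auto)
  moreover have "Lp_le p (ift gh) (H * (c1 * A))"
  proof (rule H(2)[OF gli(2)])
   have "cmod (gh eta) <= c1 * (cmod (g eta) * norm eta ^ (N + 1))" for eta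
   proof (rule order_trans[OF _ high[of eta]])
    show "cmod (gh eta) <= cmod (gh eta) * (1 + norm eta) ^ (N + 1)"
     using mult_left_mono[of 1 "(1 + norm eta) ^ (N + 1)" "cmod (gh eta)"] one_le_power[of "1 + norm eta" "N + 1"] by simp
   qed
   then show "(\<integral>\<^sup>+eta. ennreal (cmod (gh eta) powr q) \<partial>lborel) <= ennreal ((c1 * A) powr q)"
    using q1 c1 A by (intro nn_integral_powr_le[OF gw] AE_I2) auto
  qed (use c1 A in auto)
  ultimately have "Lp_le p (%x. ift e1 x + ift gh x) (2 * (H * (Ca * A) + H * (c1 * A)))"
   by (rule Lp_le_add) (use p2 one_le_numeral order_trans in blast)
  from Lp_le_add[OF this Lp_le_uminus[OF Cs(3)[OF PNh]]]
  have L: "Lp_le p (%x. (ift e1 x + ift gh x) + - (LINT k|lat. coef bh k * \<phi> (x + int_vec k))) (2 * (2 * (H * (Ca * A) + H * (c1 * A)) + Cs * (K * (c1 * A))))"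
   using p2 one_le_numeral order_trans by blast
  have coef_split: "coef (%eta. g eta * mu eta) k = coef bl k + coef bh k" for k
   unfolding coef_add[OF bi, symmetric] by (intro arg_cong[of _ _ "%b. coef b k"]) (auto simp: fun_eq_iff bl_def bh_def g_split distrib_right)
  have ift_split: "ift e1 x + ift gh x = ift g x - ift (%eta. bl eta * ph eta) x" for x
  proof -
   have "ift e1 x = ift gl x - ift (%eta. bl eta * ph eta) x"
    unfolding ift_def e1_def left_diff_distrib
    by (intro Bochner_Integration.integral_diff integrable_mult_echar gli blp) simp_all
   moreover have "ift g x = ift gl x + ift gh x"
    unfolding ift_def g_split distrib_right
    by (intro Bochner_Integration.integral_add integrable_mult_echar gli) simp_all
   ultimately show ?thesis by simp
  qed
  have AEs: "AE x in lborel. integrable lat (%k. coef (%eta. g eta * mu eta) k * \<phi> (x + int_vec k)) \<and>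
    (ift e1 x + ift gh x) + - (LINT k|lat. coef bh k * \<phi> (x + int_vec k))
     = ift g x - (LINT k|lat. coef (%eta. g eta * mu eta) k * \<phi> (x + int_vec k))"
   using Cs(2)[OF PNl] Cs(2)[OF PNh] synth_eq[OF PNl, unfolded bl_def gl_def, simplified, folded gl_def, folded bl_def]
  proof eventually_elim
   fix x assume i: "integrable lat (%k. coef bl k * \<phi> (x + int_vec k))" "integrable lat (%k. coef bh k * \<phi> (x + int_vec k))"
    and e: "(LINT k|lat. coef bl k * \<phi> (x + int_vec k)) = ift (%eta. bl eta * ph eta) x"
   have "(LINT k|lat. coef (%eta. g eta * mu eta) k * \<phi> (x + int_vec k))
    = (LINT k|lat. coef bl k * \<phi> (x + int_vec k)) + (LINT k|lat. coef bh k * \<phi> (x + int_vec k))"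
    unfolding coef_split distrib_right by (rule Bochner_Integration.integral_add[OF i])
   moreover have "integrable lat (%k. coef (%eta. g eta * mu eta) k * \<phi> (x + int_vec k))"
    unfolding coef_split distrib_right by (rule Bochner_Integration.integrable_add[OF i])
   ultimately show "integrable lat (%k. coef (%eta. g eta * mu eta) k * \<phi> (x + int_vec k)) \<and>
    (ift e1 x + ift gh x) + - (LINT k|lat. coef bh k * \<phi> (x + int_vec k))
     = ift g x - (LINT k|lat. coef (%eta. g eta * mu eta) k * \<phi> (x + int_vec k))"
    using e ift_split[of x] by simp
  qed
  have "Lp_le p (%x. ift g x - (LINT k|lat. coef (%eta. g eta * mu eta) k * \<phi> (x + int_vec k)))
    (2 * (2 * (H * (Ca * A) + H * (c1 * A)) + Cs * (K * (c1 * A))))"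
   by (rule Lp_le_cong_AE[OF L]) (use AEs in \<open>auto elim: eventually_mono\<close>)
  moreover have "2 * (2 * (H * (Ca * A) + H * (c1 * A)) + Cs * (K * (c1 * A))) = C * A"
   by (simp add: C_def algebra_simps)
  ultimately show ?thesis using AEs by (auto elim: eventually_mono)
 qed
 then show ?thesis using C0 by blast
qed

end

section \<open>Rescaling\<close>

text \<open>Integrability for counting measure is absolute summability; this leads from the
  integrals of the proof to the unordered sums of the statement.\<close>

lemma lat_summable:
 fixes f :: "int ^ 'n => complex"
 assumes "integrable lat f"
 shows "f summable_on UNIV" "(\<Sum>\<^sub>\<infinity>k. f k) = (LINT k|lat. f k)"
proof -
 have a: "Infinite_Set_Sum.abs_summable_on f UNIV" using assms by (simp add: abs_summable_on_def)
 then have "(%k. norm (f k)) summable_on UNIV" by (simp add: abs_summable_equivalent)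
 then show "f summable_on UNIV" by (rule abs_summable_summable)
 show "(\<Sum>\<^sub>\<infinity>k. f k) = (LINT k|lat. f k)"
  using infsetsum_infsum[OF a] by (simp add: infsetsum_def)
qed

lemma summable_lat:
 fixes f :: "int ^ 'n => complex"
 assumes "(%k. cmod (f k)) summable_on UNIV"
 shows "integrable lat f" "(\<Sum>\<^sub>\<infinity>k. cmod (f k)) = (LINT k|lat. cmod (f k))"
proof -
 have a: "Infinite_Set_Sum.abs_summable_on f UNIV" using assms by (simp add: abs_summable_equivalent)
 then show "integrable lat f" by (simp add: abs_summable_on_def)
 have "Infinite_Set_Sum.abs_summable_on (%k. cmod (f k)) UNIV" using a by simp
 from infsetsum_infsum[OF this] show "(\<Sum>\<^sub>\<infinity>k. cmod (f k)) = (LINT k|lat. cmod (f k))" by (simp add: infsetsum_def)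
qed

text \<open>Passage from Borel functions back to the Lebesgue setting of the statement, for a
  function u that agrees with E almost everywhere.\<close>

lemma Lp_le_lebesgue:
 assumes E: "Lp_le p E A" and uE: "AE x in lebesgue. u x = E x" and p: "p = \<infinity> \<or> enn2real p > 0"
 shows "u \<in> Lp_space lebesgue p" "Lp_norm lebesgue p u <= A"
proof -
 have [measurable]: "E \<in> borel_measurable borel" and A: "A \<ge> 0" using E by (auto simp: Lp_le_def)
 have El: "E \<in> borel_measurable lebesgue" by (intro measurable_completion) simp
 have u [measurable]: "u \<in> borel_measurable lebesgue" by (rule lebesgue_measurable_AE[OF El uE])
 have "u \<in> Lp_space lebesgue p \<and> Lp_norm lebesgue p u <= A"
 proof (cases "p = \<infinity>")
  case True
  then have "AE x in lebesgue. cmod (E x) <= A" using E by (simp add: Lp_le_def AE_completion_iff)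
  with uE have b: "AE x in lebesgue. cmod (u x) <= A" by eventually_elim simp
  then have "esssup lebesgue (%x. ennreal (cmod (u x))) <= ennreal A"
   by (intro esssup_I) (auto elim!: eventually_mono intro: ennreal_leI)
  then show ?thesis using True u b A by (auto simp: Lp_space_def Lp_norm_def intro: enn2real_leI)
 next
  case False
  define r where "r = enn2real p"
  have r: "r > 0" using p False by (simp add: r_def)
  have "(\<integral>\<^sup>+x. ennreal (cmod (u x) powr r) \<partial>lebesgue) = (\<integral>\<^sup>+x. ennreal (cmod (E x) powr r) \<partial>lebesgue)"
   using uE by (intro nn_integral_cong_AE) (auto elim: eventually_mono)
  also have "... = (\<integral>\<^sup>+x. ennreal (cmod (E x) powr r) \<partial>lborel)" by (rule nn_integral_completion)
  also have "... <= ennreal (A powr r)" using E False by (simp add: Lp_le_def r_def)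
  finally have le: "(\<integral>\<^sup>+x. ennreal (cmod (u x) powr r) \<partial>lebesgue) <= ennreal (A powr r)" .
  then have i: "integrable lebesgue (%x. cmod (u x) powr r)"
   by (intro integrableI_bounded) (auto intro: order_le_less_trans)
  have "ennreal (LINT x|lebesgue. cmod (u x) powr r) <= ennreal (A powr r)"
   using le by (subst nn_integral_eq_integral[OF i, symmetric]) auto
  then have "(LINT x|lebesgue. cmod (u x) powr r) <= A powr r" by (simp add: ennreal_le_iff)
  then have "(LINT x|lebesgue. cmod (u x) powr r) powr (1 / r) <= (A powr r) powr (1 / r)"
   using r by (intro powr_mono2) (auto intro: integral_nonneg_AE)
  also have "... = A" using r A by (simp add: powr_powr)
  finally show ?thesis using False u i by (auto simp: Lp_space_def Lp_norm_def r_def)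
 qed
 then show "u \<in> Lp_space lebesgue p" "Lp_norm lebesgue p u <= A" by auto
qed

text \<open>The exponent 1 - 1/q is 1/p for finite p and 0 for p = \<infinity>, so one formula
  serves both cases.\<close>

lemma (in exponent_pair) Lp_le_matrix:
 fixes P :: "real ^ 'n ^ 'n"
 assumes P: "det P ~= 0" and u: "Lp_le p u B"
 shows "Lp_le p (%x. u (P *v x)) (\<bar>det P\<bar> powr - (1 - 1 / q) * B)"
proof -
 have [measurable]: "u \<in> borel_measurable borel" and B: "B \<ge> 0" using u by (auto simp: Lp_le_def)
 show ?thesis
 proof (cases "p = \<infinity>")
  case True
  then show ?thesis using u AE_lborel_matrix[OF P, of "%x. cmod (u x) <= B"] B P by (simp add: Lp_le_def q_inf)
 next
  case False
  define r where "r = enn2real p"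
  have r: "r \<ge> 2" "1 - 1 / q = 1 / r" using p_fin[OF False] pq_fin[OF False] by (auto simp: r_def)
  have "(\<integral>\<^sup>+x. ennreal (cmod (u (P *v x)) powr r) \<partial>lborel) = ennreal (1 / \<bar>det P\<bar>) * (\<integral>\<^sup>+x. ennreal (cmod (u x) powr r) \<partial>lborel)"
   by (rule nn_integral_matrix[OF P]) measurable
  also have "... <= ennreal (1 / \<bar>det P\<bar>) * ennreal (B powr r)"
   using u False by (intro mult_left_mono) (auto simp: Lp_le_def r_def)
  also have "... = ennreal ((\<bar>det P\<bar> powr - (1 - 1 / q) * B) powr r)"
  proof -
   have e: "- (1 / r) * r = - 1" using r by simp
   show ?thesis unfolding r(2) powr_mult powr_powr e using P by (simp add: powr_minus_divide ennreal_mult[symmetric])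
  qed
  finally show ?thesis using False B by (simp add: Lp_le_def r_def)
 qed
qed

text \<open>In the application P is M^j and Q its inverse. The factor |det P| in g makes
  \<open>ift g\<close> the dilate x \<mapsto> ift fh (Q x), that is, f seen at level 0.\<close>

locale rescaled =
 fixes P Q :: "real ^ 'n ^ 'n" and fh g :: "real ^ 'n => complex"
 assumes PQ: "P ** Q = mat 1" and fh_int: "integrable lborel fh"
  and g_def: "g = (%eta. of_real \<bar>det P\<bar> * fh (transpose P *v eta))"
begin

lemma det_P: "det P ~= 0"
 using arg_cong[OF PQ, of det] by (auto simp: det_mul)

lemma det_tP: "det (transpose P) ~= 0" "det (transpose P) = det P"
 using det_P by (simp_all add: det_transpose)

lemma P_Q [simp]: "P *v (Q *v x) = x" "Q *v (P *v x) = x" "x v* P v* Q = x"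
proof -
 have "Q ** P = mat 1" using PQ matrix_left_right_inverse by blast
 then show "P *v (Q *v x) = x" "Q *v (P *v x) = x" "x v* P v* Q = x"
  using PQ by (simp_all add: matrix_vector_mul_assoc vector_matrix_mul_assoc)
qed

lemma inner_transpose: "x \<bullet> (eta v* P) = (P *v x) \<bullet> eta"
 by (metis dot_lmul_matrix inner_commute)

lemma fh_measurable [measurable]: "fh \<in> borel_measurable borel"
 using borel_measurable_integrable[OF fh_int] by simp

lemma g_measurable [measurable]: "g \<in> borel_measurable borel"
 unfolding g_def by measurable

lemma g_int: "integrable lborel g"
 unfolding g_def by (intro integrable_mult_right integral_matrix(2)[OF det_tP(1), THEN iffD2] fh_int fh_measurable)

lemma ift_g: "ift fh (Q *v x) = ift g x"
proof -
 let ?u = "%xi. of_real \<bar>det P\<bar> * (fh xi * echar ((Q *v x) \<bullet> xi))"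
 have "ift g x = (LINT eta|lborel. ?u (transpose P *v eta))"
  unfolding ift_def g_def by (simp add: inner_transpose mult.assoc)
 also have "... = (1 / \<bar>det (transpose P)\<bar>) *\<^sub>R (LINT xi|lborel. ?u xi)"
  by (rule integral_matrix(1)[OF det_tP(1)]) measurable
 also have "... = ift fh (Q *v x)" using det_P by (simp add: det_tP ift_def scaleR_conv_of_real)
 finally show ?thesis ..
qed

text \<open>The substitution xi = P^T eta contributes |det P|^(-1/q) against the factor |det P| in
  g. A weight that grows at most by the factor c under Q^T carries c into the bound; for a power of
  the norm this is the gain in j.\<close>

lemma g_weighted:
 assumes q: "q \<ge> 1" and W [measurable]: "W \<in> borel_measurable borel" and W0: "\<And>xi. W xi \<ge> 0" and c: "c \<ge> 0" "A \<ge> 0"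
  and le: "(\<integral>\<^sup>+xi. ennreal ((cmod (fh xi) * W xi) powr q) \<partial>lborel) <= ennreal (A powr q)"
  and Wc: "\<And>xi. W (transpose Q *v xi) <= c * W xi"
 shows "(\<integral>\<^sup>+eta. ennreal ((cmod (g eta) * W eta) powr q) \<partial>lborel) <= ennreal ((\<bar>det P\<bar> powr (1 - 1 / q) * (c * A)) powr q)"
proof -
 let ?u = "%xi. \<bar>det P\<bar> * (cmod (fh xi) * W (transpose Q *v xi))"
 have "(\<integral>\<^sup>+eta. ennreal ((cmod (g eta) * W eta) powr q) \<partial>lborel) = (\<integral>\<^sup>+eta. ennreal (?u (transpose P *v eta) powr q) \<partial>lborel)"
  by (simp add: g_def norm_mult mult.assoc)
 also have "... = ennreal (1 / \<bar>det (transpose P)\<bar>) * (\<integral>\<^sup>+xi. ennreal (?u xi powr q) \<partial>lborel)"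
  by (rule nn_integral_matrix[OF det_tP(1)]) measurable
 also have "... <= ennreal (1 / \<bar>det P\<bar>) * ennreal ((\<bar>det P\<bar> * c * A) powr q)"
  unfolding det_tP(2)
 proof (intro mult_left_mono nn_integral_powr_le[OF le] AE_I2)
  fix xi
  have "?u xi <= \<bar>det P\<bar> * (cmod (fh xi) * (c * W xi))" by (intro mult_left_mono Wc) auto
  then show "?u xi <= \<bar>det P\<bar> * c * (cmod (fh xi) * W xi)" by (simp add: mult_ac)
 qed (use q c W0 in auto)
 also have "... = ennreal ((1 / \<bar>det P\<bar>) * (\<bar>det P\<bar> * c * A) powr q)" by (simp add: ennreal_mult[symmetric])
 also have "(1 / \<bar>det P\<bar>) * (\<bar>det P\<bar> * c * A) powr q = (\<bar>det P\<bar> powr (1 - 1 / q) * (c * A)) powr q"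
 proof -
  have e: "(1 - 1 / q) * q = q - 1" using q by (simp add: field_simps)
  have "\<bar>det P\<bar> powr (q - 1) = \<bar>det P\<bar> powr q / \<bar>det P\<bar>" using det_P by (simp add: powr_diff)
  then show ?thesis using c by (simp add: powr_mult powr_powr e)
 qed
 finally show ?thesis .
qed

text \<open>The substitution s = P t pulls the averaging set back to the ball. Its image under Q is
  measured against f directly, and f is replaced by \<open>ift fh\<close> only almost everywhere,
  which the integral does not see.\<close>

lemma ball_average:
 assumes f: "AE x in lebesgue. f x = ift fh x"
 shows "(LINT t:((*v) Q ` cball 0 \<rho>)|lebesgue. f (- (Q *v int_vec k) + t))
  = of_real (1 / \<bar>det P\<bar>) * (LINT s:cball 0 \<rho>|lborel. ift g (s - int_vec k))"
proof -
 let ?y = "- (Q *v int_vec k)"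
 have ind: "indicator ((*v) Q ` cball 0 \<rho>) t = (indicator (cball 0 \<rho>) (P *v t) :: real)" for t
 proof -
  have "t \<in> (*v) Q ` cball 0 \<rho> \<longleftrightarrow> P *v t \<in> cball 0 \<rho>"
   by (metis (no_types, lifting) P_Q(1,2) image_iff)
  then show ?thesis by (simp only: indicator_def)
 qed
 have Hm: "(%s. indicator (cball 0 \<rho>) s *\<^sub>R ift g (s - int_vec k)) \<in> borel_measurable borel"
  by (intro borel_measurable_scaleR borel_measurable_indicator measurable_compose[OF _ ift_measurable[OF g_measurable]]
    borel_measurable_continuous_onI continuous_intros) auto
 have "AE x in lborel. f x = ift fh x" using f by (simp only: AE_completion_iff)
 from AE_lborel_translate[OF this, of ?y] have "AE t in lebesgue. f (t + ?y) = ift fh (t + ?y)" by (simp only: AE_completion_iff)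
 then have "AE t in lebesgue. indicator ((*v) Q ` cball 0 \<rho>) t *\<^sub>R f (?y + t) = indicator (cball 0 \<rho>) (P *v t) *\<^sub>R ift g (P *v t - int_vec k)"
 proof eventually_elim
  fix t assume "f (t + ?y) = ift fh (t + ?y)"
  moreover have "t + ?y = Q *v (P *v t - int_vec k)" by (simp add: matrix_vector_mult_diff_distrib)
  ultimately have "f (?y + t) = ift g (P *v t - int_vec k)" using ift_g by (simp add: add.commute)
  then show "indicator ((*v) Q ` cball 0 \<rho>) t *\<^sub>R f (?y + t) = indicator (cball 0 \<rho>) (P *v t) *\<^sub>R ift g (P *v t - int_vec k)"
   by (simp only: ind)
 qed
 then have "(LINT t:((*v) Q ` cball 0 \<rho>)|lebesgue. f (?y + t)) = (LINT t|lborel. indicator (cball 0 \<rho>) (P *v t) *\<^sub>R ift g (P *v t - int_vec k))"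
  unfolding set_lebesgue_integral_def
  by (intro integral_lebesgue_AE(1) measurable_compose[OF matrix_vector_mult_borel_measurable Hm])
 also have "... = (1 / \<bar>det P\<bar>) *\<^sub>R (LINT s|lborel. indicator (cball 0 \<rho>) s *\<^sub>R ift g (s - int_vec k))"
  by (rule integral_matrix(1)[OF det_P Hm])
 finally show ?thesis by (simp add: set_lebesgue_integral_def scaleR_conv_of_real)
qed

end

lemma norm_ift_le: "cmod (ift g x) <= (LINT eta|lborel. cmod (g eta))"
 unfolding ift_def by (rule order_trans[OF integral_norm_bound]) (simp add: norm_mult)

text \<open>Fubini turns the average of an inverse transform into multiplication of the spectrum by
  \<open>mu\<close>; the shift by k makes the result a Fourier coefficient.\<close>

lemma (in averaging) integral_nu_ift:
 assumes g: "integrable lborel g"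
 shows "(LINT s|\<nu>. ift g (s - int_vec k)) = coef (%eta. g eta * mu eta) k"
proof -
 interpret nu: prob_space \<nu> by (rule prob)
 interpret nl: pair_sigma_finite \<nu> "lborel :: (real ^ 'n) measure" ..
 have [measurable]: "g \<in> borel_measurable borel" using borel_measurable_integrable[OF g] by simp
 have i: "integrable (\<nu> \<Otimes>\<^sub>M lborel) (%(s, eta). g eta * echar ((s - int_vec k) \<bullet> eta))"
 proof (rule nl.Fubini_integrable)
  show "AE s in \<nu>. integrable lborel (%eta. case (s, eta) of (s, eta) => g eta * echar ((s - int_vec k) \<bullet> eta))"
   unfolding prod.case by (intro AE_I2 integrable_mult_echar[OF g]) simp
  show "integrable \<nu> (%s. LINT eta|lborel. norm (case (s, eta) of (s, eta) => g eta * echar ((s - int_vec k) \<bullet> eta)))"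
   by (simp add: norm_mult)
 qed measurable
 have "(LINT s|\<nu>. ift g (s - int_vec k)) = (LINT eta|lborel. (LINT s|\<nu>. g eta * echar ((s - int_vec k) \<bullet> eta)))"
  unfolding ift_def by (rule nl.Fubini_integral[OF i, symmetric])
 also have "... = (LINT eta|lborel. (g eta * mu eta) * echar (- (int_vec k \<bullet> eta)))"
 proof (intro Bochner_Integration.integral_cong refl)
  fix eta
  have "g eta * echar ((s - int_vec k) \<bullet> eta) = (g eta * echar (- (int_vec k \<bullet> eta))) * echar (s \<bullet> eta)" for s
   by (simp add: inner_diff_left echar_diff echar_minus mult_ac)
  then have "(LINT s|\<nu>. g eta * echar ((s - int_vec k) \<bullet> eta)) = (g eta * echar (- (int_vec k \<bullet> eta))) * mu eta"
   by (simp only: integral_mult_right_zero mu_def)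
  then show "(LINT s|\<nu>. g eta * echar ((s - int_vec k) \<bullet> eta)) = (g eta * mu eta) * echar (- (int_vec k \<bullet> eta))"
   by (simp add: mult_ac)
 qed
 finally show ?thesis by (simp add: coef_def)
qed

lemma mat_pow_Suc_right: "mat_pow A (Suc j) = mat_pow A j ** A"
proof (induction j)
 case (Suc j) then show ?case by (metis mat_pow_Suc matrix_mul_assoc)
qed (simp add: mat_pow_Suc)

lemma (in expanding) mat_pow_inv: "mat_pow M j ** mat_pow (matrix_inv M) j = mat 1"
proof (induction j)
 case (Suc j)
 have "invertible M" using det_nz by (simp add: invertible_det_nz)
 then have "M ** matrix_inv M = mat 1" by (rule matrix_inv_mult(2))
 then have "mat_pow M (Suc j) ** mat_pow (matrix_inv M) (Suc j) = mat_pow M j ** mat_pow (matrix_inv M) j"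
  unfolding mat_pow_Suc_right[of M] mat_pow_Suc[of "matrix_inv M"]
  by (metis matrix_mul_assoc matrix_mul_lid)
 then show ?case using Suc by simp
qed simp

text \<open>The factor m^j cancels the Jacobian of the pulled-back ball, leaving averages of the
  bounded function \<open>ift g\<close> over balls at level 0, to which the representation by \<nu>
  applies.\<close>

lemma sample_avg_eq_coef:
 assumes M: "expanding M \<theta>" and nu: "averaging \<nu> N"
  and repr: "\<And>G C. G \<in> borel_measurable borel ==> (\<And>s :: real ^ 'n. cmod (G s) <= C * (1 + norm s ^ (N + 1))) ==>
   (LINT u:{0<..}|lebesgue. complex_of_real (w u / ball_vol TYPE('n) (h u)) * (LINT s:cball 0 (h u)|lborel. G s)) = (LINT s|\<nu>. G s)"
  and r: "rescaled (mat_pow M j) (mat_pow (matrix_inv M) j) fh g"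
  and f: "AE x in lebesgue. f x = ift fh x"
 shows "sample_avg M w h j f (- (mat_pow (matrix_inv M) j *v int_vec k)) = coef (%eta. g eta * averaging.mu \<nu> eta) k"
proof -
 interpret rescaled "mat_pow M j" "mat_pow (matrix_inv M) j" fh g by (rule r)
 have d: "\<bar>det M\<bar> ^ j = \<bar>det (mat_pow M j)\<bar>" by (simp add: det_mat_pow power_abs)
 have [measurable]: "ift g \<in> borel_measurable borel" by measurable
 let ?I = "%u. LINT s:cball 0 (h u)|lborel. ift g (s - int_vec k)"
 have "complex_of_real (w u * (\<bar>det M\<bar> ^ j / ball_vol TYPE('n) (h u))) *
    (LINT t:((*v) (mat_pow (matrix_inv M) j) ` cball 0 (h u))|lebesgue. f (- (mat_pow (matrix_inv M) j *v int_vec k) + t))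
   = complex_of_real (w u / ball_vol TYPE('n) (h u)) * ?I u" for u
  unfolding ball_average[OF f] d using det_P by (simp add: field_simps)
 then have "sample_avg M w h j f (- (mat_pow (matrix_inv M) j *v int_vec k))
  = (LINT u:{0<..}|lebesgue. complex_of_real (w u / ball_vol TYPE('n) (h u)) * ?I u)"
  unfolding sample_avg_def by (simp only:)
 also have "... = (LINT s|\<nu>. ift g (s - int_vec k))"
 proof (rule repr[where C = "LINT eta|lborel. cmod (g eta)"])
  fix s :: "real ^ 'n"
  have "(LINT eta|lborel. cmod (g eta)) * 1 <= (LINT eta|lborel. cmod (g eta)) * (1 + norm s ^ (N + 1))"
   by (rule mult_left_mono) auto
  then show "cmod (ift g (s - int_vec k)) <= (LINT eta|lborel. cmod (g eta)) * (1 + norm s ^ (N + 1))"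
   using norm_ift_le[of g "s - int_vec k"] by simp
 qed measurable
 also have "... = coef (%eta. g eta * averaging.mu \<nu> eta) k"
  by (rule averaging.integral_nu_ift[OF nu g_int])
 finally show ?thesis .
qed

section \<open>The two classes of generators\<close>

text \<open>A Borel representative of \<phi> has the same periodized modulus almost everywhere on
  the cube. Its integral over space equals that of the periodized modulus over the torus, which is
  finite because L_p is contained in L_1 on a probability space.\<close>

lemma (in exponent_pair) script_Lp_generator:
 fixes \<phi> :: "real ^ 'n => complex"
 assumes \<phi>: "\<phi> \<in> script_Lp p"
 obtains \<phi>0 D where "\<phi>0 \<in> borel_measurable borel" "AE x in lebesgue. \<phi> x = \<phi>0 x" "integrable lborel \<phi>0" "D \<ge> 0"
  "p ~= \<infinity> ==> (\<integral>\<^sup>+x. ennreal (labs \<phi>0 x powr enn2real p) \<partial>torus) <= ennreal (D powr enn2real p)"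
  "p = \<infinity> ==> AE x in torus. labs \<phi>0 x <= D"
proof -
 let ?Q = "cbox (\<chi> i. - 1 / 2) (\<chi> i. 1 / 2) :: (real ^ 'n) set"
 let ?T = "lebesgue_on ?Q"
 let ?\<Phi> = "%x. \<Sum>\<^sub>\<infinity>k. cmod (\<phi> (x + int_vec k))"
 have m: "\<phi> \<in> borel_measurable lebesgue" using \<phi> by (simp add: script_Lp_def Lp_space_def)
 have sT: "AE x in ?T. (%k. cmod (\<phi> (x + int_vec k))) summable_on UNIV" and PT: "?\<Phi> \<in> Lp_space ?T p"
  using \<phi> unfolding script_Lp_def Let_def by blast+
 obtain \<phi>0 where \<phi>0 [measurable]: "\<phi>0 \<in> borel_measurable borel" and eq: "AE x in lebesgue. \<phi> x = \<phi>0 x"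
  by (rule borel_version[OF m])
 have Qs: "?Q \<in> sets lebesgue" by simp
 have sub: "x \<in> ?Q" if "x \<in> unit_cube" for x
  using that by (auto simp: unit_cube_def mem_box_cart less_imp_le)
 have eq': "AE x in lborel. \<phi> x = \<phi>0 x" using eq by (simp only: AE_completion_iff)
 have eqk: "AE x in lborel. \<forall>k. \<phi> (x + int_vec k) = \<phi>0 (x + int_vec k)"
  unfolding AE_all_countable using AE_lborel_translate[OF eq'] by simp
 have "AE x in lebesgue. x \<in> ?Q --> (%k. cmod (\<phi> (x + int_vec k))) summable_on UNIV"
  using sT by (subst (asm) AE_restrict_space_iff) (simp_all add: Qs)
 then have s: "AE x in lborel. x \<in> ?Q --> (%k. cmod (\<phi> (x + int_vec k))) summable_on UNIV"
  by (simp only: AE_completion_iff)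
 have good: "AE x in lborel. x \<in> unit_cube --> integrable lat (%k. \<phi>0 (x + int_vec k)) \<and> labs \<phi>0 x = ?\<Phi> x"
  using s eqk
 proof eventually_elim
  fix x assume a: "x \<in> ?Q --> (%k. cmod (\<phi> (x + int_vec k))) summable_on UNIV"
   and b: "\<forall>k. \<phi> (x + int_vec k) = \<phi>0 (x + int_vec k)"
  show "x \<in> unit_cube --> integrable lat (%k. \<phi>0 (x + int_vec k)) \<and> labs \<phi>0 x = ?\<Phi> x"
  proof
   assume "x \<in> unit_cube"
   then have "(%k. cmod (\<phi>0 (x + int_vec k))) summable_on UNIV" using a sub b by simp
   from summable_lat[OF this] b show "integrable lat (%k. \<phi>0 (x + int_vec k)) \<and> labs \<phi>0 x = ?\<Phi> x"
    by (simp add: labs_def)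
  qed
 qed
 have S: "(\<integral>\<^sup>+x. ennreal (cmod (\<phi>0 x)) \<partial>lborel) = (\<integral>\<^sup>+x. ennreal (labs \<phi>0 x) \<partial>torus)"
 proof -
  have "(\<integral>\<^sup>+x. ennreal (cmod (\<phi>0 x)) \<partial>lborel) = (\<integral>\<^sup>+x. (\<integral>\<^sup>+l. ennreal (cmod (\<phi>0 (x + int_vec l))) \<partial>lat) \<partial>torus)"
   by (rule nn_integral_tile[symmetric]) measurable
  also have "... = (\<integral>\<^sup>+x. ennreal (labs \<phi>0 x) \<partial>torus)"
  proof (rule nn_integral_cong_AE)
   show "AE x in torus. (\<integral>\<^sup>+l. ennreal (cmod (\<phi>0 (x + int_vec l))) \<partial>lat) = ennreal (labs \<phi>0 x)"
    unfolding AE_torus using good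
   proof eventually_elim
    fix x assume *: "x \<in> unit_cube --> integrable lat (%k. \<phi>0 (x + int_vec k)) \<and> labs \<phi>0 x = ?\<Phi> x"
    show "x \<in> unit_cube --> (\<integral>\<^sup>+l. ennreal (cmod (\<phi>0 (x + int_vec l))) \<partial>lat) = ennreal (labs \<phi>0 x)"
    proof
     assume "x \<in> unit_cube"
     then have "integrable lat (%k. \<phi>0 (x + int_vec k))" using * by blast
     then show "(\<integral>\<^sup>+l. ennreal (cmod (\<phi>0 (x + int_vec l))) \<partial>lat) = ennreal (labs \<phi>0 x)"
      unfolding labs_def by (intro nn_integral_eq_integral integrable_norm) auto
    qed
   qed
  qed
  finally show ?thesis .
 qed
 show thesis
 proof (cases "p = \<infinity>")
  case True
  then obtain C where "AE x in ?T. norm (?\<Phi> x) <= C"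
   using PT unfolding Lp_space_def mem_Collect_eq if_P[OF True] by blast
  then have "AE x in lebesgue. x \<in> ?Q --> norm (?\<Phi> x) <= C" by (subst (asm) AE_restrict_space_iff) (simp_all add: Qs)
  then have "AE x in lborel. x \<in> ?Q --> norm (?\<Phi> x) <= C" by (simp only: AE_completion_iff)
  with good have "AE x in lborel. x \<in> unit_cube --> labs \<phi>0 x <= \<bar>C\<bar>"
   by eventually_elim (use sub in fastforce)
  then have D: "AE x in torus. labs \<phi>0 x <= \<bar>C\<bar>" by (simp add: AE_torus)
  have "(\<integral>\<^sup>+x. ennreal (labs \<phi>0 x) \<partial>torus) <= (\<integral>\<^sup>+x. ennreal \<bar>C\<bar> \<partial>(torus :: (real ^ 'n) measure))"
   using D by (intro nn_integral_mono_AE) (auto elim!: eventually_mono intro: ennreal_leI)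
  also have "... < \<infinity>" by (simp add: emeasure_torus_UNIV ennreal_mult_less_top)
  finally have "integrable lborel \<phi>0" using S by (intro integrableI_bounded) auto
  then show ?thesis using True D by (intro that[of \<phi>0 "\<bar>C\<bar>"]) (auto simp: eq)
 next
  case False
  define r where "r = enn2real p"
  have r: "r \<ge> 2" using p_fin[OF False] by (simp add: r_def)
  have iT: "integrable ?T (%x. norm (?\<Phi> x) powr r)" using PT False by (simp add: Lp_space_def r_def)
  have "(\<integral>\<^sup>+x. ennreal (labs \<phi>0 x powr r) \<partial>torus) = (\<integral>\<^sup>+x. indicator unit_cube x * ennreal (labs \<phi>0 x powr r) \<partial>lborel)"
   by (rule nn_integral_torus) measurable
  also have "... = (\<integral>\<^sup>+x. indicator unit_cube x * ennreal (labs \<phi>0 x powr r) \<partial>lebesgue)"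
   by (rule nn_integral_completion[symmetric])
  also have "... <= (\<integral>\<^sup>+x. ennreal (norm (?\<Phi> x) powr r) * indicator ?Q x \<partial>lebesgue)"
  proof (rule nn_integral_mono_AE)
   have "AE x in lebesgue. x \<in> unit_cube --> integrable lat (%k. \<phi>0 (x + int_vec k)) \<and> labs \<phi>0 x = ?\<Phi> x"
    using good by (simp only: AE_completion_iff)
   then show "AE x in lebesgue. indicator unit_cube x * ennreal (labs \<phi>0 x powr r) <= ennreal (norm (?\<Phi> x) powr r) * indicator ?Q x"
   proof eventually_elim
    fix x assume *: "x \<in> unit_cube --> integrable lat (%k. \<phi>0 (x + int_vec k)) \<and> labs \<phi>0 x = ?\<Phi> x"
    show "indicator unit_cube x * ennreal (labs \<phi>0 x powr r) <= ennreal (norm (?\<Phi> x) powr r) * indicator ?Q x"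
    proof (cases "x \<in> unit_cube")
     case True
     then have "norm (?\<Phi> x) = labs \<phi>0 x" using * labs_nonneg[of \<phi>0 x] by simp
     then show ?thesis using True sub[OF True] by (simp only: indicator_simps mult_1_left mult_1_right order_refl)
    qed simp
   qed
  qed
  also have "... = (\<integral>\<^sup>+x. ennreal (norm (?\<Phi> x) powr r) \<partial>?T)"
   by (rule nn_integral_restrict_space[symmetric]) (simp add: Qs)
  also have "... = ennreal (LINT x|?T. norm (?\<Phi> x) powr r)"
   by (rule nn_integral_eq_integral[OF iT]) simp
  also have "... = ennreal (((LINT x|?T. norm (?\<Phi> x) powr r) powr (1 / r)) powr r)"
   using r by (simp add: powr_powr integral_nonneg_AE)
  finally have D: "(\<integral>\<^sup>+x. ennreal (labs \<phi>0 x powr r) \<partial>torus) <= ennreal (((LINT x|?T. norm (?\<Phi> x) powr r) powr (1 / r)) powr r)" .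
  have "(\<integral>\<^sup>+x. ennreal (labs \<phi>0 x) \<partial>torus) <= (\<integral>\<^sup>+x. 1 + ennreal (labs \<phi>0 x powr r) \<partial>torus)"
  proof (rule nn_integral_mono)
   fix x
   have "labs \<phi>0 x <= 1 + labs \<phi>0 x powr r"
   proof (cases "labs \<phi>0 x <= 1")
    case False
    then have "labs \<phi>0 x powr 1 <= labs \<phi>0 x powr r" using r by (intro powr_mono) auto
    then show ?thesis using False by simp
   qed (simp add: add_increasing2)
   then have "ennreal (labs \<phi>0 x) <= ennreal (1 + labs \<phi>0 x powr r)" by (rule ennreal_leI)
   then show "ennreal (labs \<phi>0 x) <= 1 + ennreal (labs \<phi>0 x powr r)" by (simp add: ennreal_plus)
  qed
  also have "... = 1 + (\<integral>\<^sup>+x. ennreal (labs \<phi>0 x powr r) \<partial>torus)"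
   by (simp add: nn_integral_add emeasure_torus_UNIV)
  also have "... < \<infinity>" using order_le_less_trans[OF D ennreal_less_top] by simp
  finally have "integrable lborel \<phi>0" using S by (intro integrableI_bounded) auto
  then show ?thesis
   using False D by (intro that[of \<phi>0 "(LINT x|?T. norm (?\<Phi> x) powr r) powr (1 / r)"]) (auto simp: eq r_def)
 qed
qed

text \<open>Extension by 0 may create jumps, but only on the boundary of the box, which is
  negligible; the decay of the inverse transform comes from smoothness of order equal to the
  dimension.\<close>

lemma class_B_generator:
 fixes \<phi> :: "real ^ 'n => complex"
 assumes "\<phi> \<in> class_B"
 obtains th R B Cd where "periodization th R B" "\<phi> = ift th" "Cd \<ge> 0"
  "\<And>x. cmod (ift th x) <= Cd * (\<Prod>i\<in>UNIV. 1 / (1 + \<bar>x $ i\<bar>))"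
proof -
 obtain th a b where ab: "\<And>i. a $ i < b $ i" and out: "\<And>xi. xi \<notin> cbox a b ==> th xi = 0"
  and C: "C_on CARD('n) (cbox a b) th" and \<phi>: "\<And>x. \<phi> x = (LINT xi|lebesgue. th xi * cis (2 * pi * (x \<bullet> xi)))"
  using assms unfolding class_B_def by blast
 have cont: "continuous_on (cbox a b) th" by (rule C_on_continuous[OF C])
 have "th = (%xi. indicator (cbox a b) xi *\<^sub>R th xi)" using out by (auto simp: fun_eq_iff indicator_def)
 moreover have "(%xi. indicator (cbox a b) xi *\<^sub>R th xi) \<in> borel_measurable borel"
  using cont by (intro borel_measurable_continuous_on_indicator) auto
 ultimately have th [measurable]: "th \<in> borel_measurable borel" by simp
 obtain R where R: "\<And>xi. xi \<in> cbox a b ==> norm xi <= R" using bounded_cbox[of a b] by (auto simp: bounded_iff)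
 have "bounded (th ` cbox a b)" using compact_continuous_image[OF cont compact_cbox] by (rule compact_imp_bounded)
 then obtain B where B: "B > 0" "\<And>xi. xi \<in> cbox a b ==> cmod (th xi) <= B" by (auto simp: bounded_pos)
 have per: "periodization th R B"
 proof
  show "cmod (th x) <= B" for x using B out[of x] by (cases "x \<in> cbox a b") auto
  show "th x = 0" if "norm x > R" for x using R[of x] that by (intro out) auto
  have "AE x in lborel. x \<notin> cbox a b - box a b"
   using negligible_frontier_interval[of a b] by (intro AE_not_in) (simp add: null_sets_completion_iff negligible_iff_null_sets)
  then show "AE x in lborel. isCont th x"
  proof eventually_elim
   fix x assume x: "x \<notin> cbox a b - box a b"
   show "isCont th x"
   proof (cases "x \<in> box a b")
    case True
    have "continuous_on (box a b) th" using cont box_subset_cbox by (rule continuous_on_subset)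
    then show ?thesis using True by (simp add: continuous_on_eq_continuous_at open_box)
   next
    case False
    then have "x \<in> - cbox a b" using x by auto
    moreover have "continuous_on (- cbox a b) th"
     by (rule continuous_on_cong[THEN iffD2, of _ _ _ "%_. 0"]) (use out in auto)
    moreover have "open (- cbox a b)" by (simp add: closed_cbox open_Compl)
    ultimately show ?thesis using continuous_on_eq_continuous_at by blast
   qed
  qed
 qed (rule th)
 have "\<phi> = ift th"
 proof
  fix x
  have "\<phi> x = (LINT xi|lborel. th xi * cis (2 * pi * (x \<bullet> xi)))"
   unfolding \<phi> by (rule integral_lebesgue_lborel(1)) (simp add: echar_def[symmetric])
  then show "\<phi> x = ift th x" by (simp add: ift_def echar_def)
 qed
 then show thesis using ift_box_decay[OF ab out C] per that by blast
qed

text \<open>On a ball the weight is bounded and the L_q norm suffices. Outside, the q-th power of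
  the weighted function is of order -(d + \<epsilon> q), which is integrable since \<epsilon> >
  0.\<close>

lemma weighted_decay:
 fixes fh :: "real ^ 'n => complex" and N :: nat
 assumes [measurable]: "fh \<in> borel_measurable borel" and q: "q \<ge> 1" and e: "\<epsilon> > 0"
  and fq: "(\<integral>\<^sup>+xi. ennreal (cmod (fh xi) powr q) \<partial>lborel) < \<infinity>"
  and decay: "AE xi in lborel. norm xi \<ge> R --> cmod (fh xi) <= c * norm xi powr (- real N - 1 - real CARD('n) / q - \<epsilon>)"
 shows "(\<integral>\<^sup>+xi. ennreal ((cmod (fh xi) * (1 + norm xi) ^ (N + 1)) powr q) \<partial>lborel) < \<infinity>"
proof -
 \<comment> \<open>Beyond this radius both the decay estimate and 1 + norm xi \<le> 2 norm xi
   hold.\<close>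
 define S where "S = \<bar>R\<bar> + 1"
 define s where "s = real CARD('n) + \<epsilon> * q"
 define C1 where "C1 = ((1 + S) ^ (N + 1)) powr q"
 define C2 where "C2 = (\<bar>c\<bar> * 2 ^ (N + 1)) powr q * 2 powr s"
 have s: "s > real CARD('n)" using q e by (simp add: s_def)
 obtain K where K: "(\<integral>\<^sup>+x. ennreal ((1 + norm (x :: real ^ 'n)) powr (- s)) \<partial>lborel) <= ennreal K"
  using integral_norm_powr_bound[OF s] by blast
 have "(\<integral>\<^sup>+xi. ennreal ((cmod (fh xi) * (1 + norm xi) ^ (N + 1)) powr q) \<partial>lborel)
  <= (\<integral>\<^sup>+xi. ennreal C1 * ennreal (cmod (fh xi) powr q) + ennreal C2 * ennreal ((1 + norm xi) powr (- s)) \<partial>lborel)"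
 proof (rule nn_integral_mono_AE, use decay in eventually_elim)
  fix xi assume d: "norm xi \<ge> R --> cmod (fh xi) <= c * norm xi powr (- real N - 1 - real CARD('n) / q - \<epsilon>)"
  have "(cmod (fh xi) * (1 + norm xi) ^ (N + 1)) powr q <= C1 * cmod (fh xi) powr q + C2 * (1 + norm xi) powr (- s)"
  proof (cases "norm xi <= S")
   case True
   have "(cmod (fh xi) * (1 + norm xi) ^ (N + 1)) powr q <= (cmod (fh xi) * (1 + S) ^ (N + 1)) powr q"
    using True q by (intro powr_mono2 mult_left_mono power_mono) auto
   also have "... = C1 * cmod (fh xi) powr q" by (simp add: C1_def powr_mult mult.commute)
   finally show ?thesis by (simp add: C2_def add_increasing2)
  next
   case False
   then have n: "norm xi \<ge> R" "norm xi > 1" "norm xi > 0" by (auto simp: S_def)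
   have "cmod (fh xi) <= \<bar>c\<bar> * norm xi powr (- real N - 1 - real CARD('n) / q - \<epsilon>)"
    using d n(1) by (smt (verit) mult_right_mono powr_ge_zero)
   moreover have "(1 + norm xi) ^ (N + 1) <= 2 ^ (N + 1) * norm xi powr (real N + 1)"
   proof -
    have "(1 + norm xi) ^ (N + 1) <= (2 * norm xi) ^ (N + 1)" using n by (intro power_mono) auto
    also have "... = 2 ^ (N + 1) * norm xi powr real (N + 1)"
     unfolding power_mult_distrib powr_realpow[OF n(3)] ..
    finally show ?thesis by (simp only: of_nat_add of_nat_1)
   qed
   ultimately have "cmod (fh xi) * (1 + norm xi) ^ (N + 1)
    <= (\<bar>c\<bar> * norm xi powr (- real N - 1 - real CARD('n) / q - \<epsilon>)) * (2 ^ (N + 1) * norm xi powr (real N + 1))"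
    by (rule mult_mono) auto
   also have "... = (\<bar>c\<bar> * 2 ^ (N + 1)) * (norm xi powr (- real N - 1 - real CARD('n) / q - \<epsilon>) * norm xi powr (real N + 1))"
    by (simp only: mult_ac)
   also have "... = (\<bar>c\<bar> * 2 ^ (N + 1)) * norm xi powr (- (s / q))"
   proof -
    have "(- real N - 1 - real CARD('n) / q - \<epsilon>) + (real N + 1) = - (s / q)" using q by (simp add: s_def add_divide_distrib)
    then show ?thesis by (simp only: powr_add[symmetric])
   qed
   finally have "(cmod (fh xi) * (1 + norm xi) ^ (N + 1)) powr q <= ((\<bar>c\<bar> * 2 ^ (N + 1)) * norm xi powr (- (s / q))) powr q"
    using q by (intro powr_mono2) auto
   also have "... = (\<bar>c\<bar> * 2 ^ (N + 1)) powr q * norm xi powr (- s)"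
    using q unfolding powr_mult powr_powr by simp
   also have "... <= (\<bar>c\<bar> * 2 ^ (N + 1)) powr q * (2 powr s * (1 + norm xi) powr (- s))"
   proof (rule mult_left_mono)
    have "norm xi powr (- s) <= ((1 + norm xi) / 2) powr (- s)"
     using n s by (intro powr_mono2') auto
    also have "... = 2 powr s * (1 + norm xi) powr (- s)" by (simp add: powr_divide powr_minus field_simps)
    finally show "norm xi powr (- s) <= 2 powr s * (1 + norm xi) powr (- s)" .
   qed simp
   also have "... = C2 * (1 + norm xi) powr (- s)" by (simp add: C2_def mult.assoc)
   finally show ?thesis by (simp add: C1_def add_increasing)
  qed
  then have "ennreal ((cmod (fh xi) * (1 + norm xi) ^ (N + 1)) powr q) <= ennreal (C1 * cmod (fh xi) powr q + C2 * (1 + norm xi) powr (- s))"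
   by (rule ennreal_leI)
  also have "... = ennreal C1 * ennreal (cmod (fh xi) powr q) + ennreal C2 * ennreal ((1 + norm xi) powr (- s))"
   by (simp add: C1_def C2_def ennreal_mult ennreal_plus)
  finally show "ennreal ((cmod (fh xi) * (1 + norm xi) ^ (N + 1)) powr q)
   <= ennreal C1 * ennreal (cmod (fh xi) powr q) + ennreal C2 * ennreal ((1 + norm xi) powr (- s))" .
 qed
 also have "... = ennreal C1 * (\<integral>\<^sup>+xi. ennreal (cmod (fh xi) powr q) \<partial>lborel) + ennreal C2 * (\<integral>\<^sup>+xi. ennreal ((1 + norm (xi :: real ^ 'n)) powr (- s)) \<partial>lborel)"
  by (simp add: nn_integral_add nn_integral_cmult)
 also have "... < \<infinity>"
  using fq order_le_less_trans[OF K ennreal_less_top] by (simp add: ennreal_mult_less_top)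
 finally show ?thesis .
qed

text \<open>For finite p the modulus of f is at most 1 + |f|^p, and the Gaussian makes the summand 1
  integrable. This is the integrability that identification by test waves requires of f.\<close>

lemma (in exponent_pair) Lp_space_gauss_integrable:
 fixes f :: "real ^ 'n => complex"
 assumes f: "f \<in> Lp_space lebesgue p"
 shows "integrable lebesgue (%x. f x * gauss x)"
proof -
 have m: "f \<in> borel_measurable lebesgue" using f by (simp add: Lp_space_def)
 have gl [measurable]: "(gauss :: real ^ 'n => complex) \<in> borel_measurable lebesgue" by (intro measurable_completion) simp
 have g: "integrable lebesgue (gauss :: real ^ 'n => complex)"
  using gauss_integrable by (simp add: integral_lebesgue_lborel)
 have n1: "cmod (gauss x) <= 1" for x :: "real ^ 'n" by (simp add: norm_gauss)
 have mm: "(%x. f x * gauss x) \<in> borel_measurable lebesgue" using m gl by (rule borel_measurable_times)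
 show ?thesis
 proof (cases "p = \<infinity>")
  case True
  then obtain C where C: "AE x in lebesgue. cmod (f x) <= C" using f by (auto simp: Lp_space_def)
  show ?thesis
  proof (rule Bochner_Integration.integrable_bound[of _ "%x. of_real C * gauss x"])
   show "AE x in lebesgue. norm (f x * gauss x) <= norm (of_real C * gauss x :: complex)"
    using C by (rule eventually_mono) (auto simp: norm_mult intro!: mult_right_mono)
  qed (use g mm in auto)
 next
  case False
  define r where "r = enn2real p"
  have r: "r \<ge> 2" using p_fin[OF False] by (simp add: r_def)
  have i: "integrable lebesgue (%x. cmod (f x) powr r)" using f False by (simp add: Lp_space_def r_def)
  show ?thesis
  proof (rule Bochner_Integration.integrable_bound[of _ "%x. cmod (gauss x) + cmod (f x) powr r"])
   show "AE x in lebesgue. norm (f x * gauss x) <= norm (cmod (gauss x) + cmod (f x) powr r)"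
   proof (intro AE_I2)
    fix x
    have "cmod (f x) * cmod (gauss x) <= cmod (gauss x) + cmod (f x) powr r"
    proof (cases "cmod (f x) <= 1")
     case True
     then have "cmod (f x) * cmod (gauss x) <= 1 * cmod (gauss x)" by (intro mult_right_mono) auto
     then show ?thesis by (simp add: add_increasing2)
    next
     case False
     have "cmod (f x) * cmod (gauss x) <= cmod (f x) * 1" by (intro mult_left_mono n1) auto
     also have "... <= cmod (f x) powr r" using False r powr_mono[of 1 r "cmod (f x)"] by simp
     finally show ?thesis by (simp add: add_increasing)
    qed
    then show "norm (f x * gauss x) <= norm (cmod (gauss x) + cmod (f x) powr r)" by (simp add: norm_mult)
   qed
   show "integrable lebesgue (%x. cmod (gauss x) + cmod (f x) powr r)"
    by (intro Bochner_Integration.integrable_add integrable_norm g i)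
  qed (rule mm)
 qed
qed

text \<open>Conjugacy is stated in the extended nonnegative reals, where 1 / \<infinity> = 0 and 1 /
  0 = \<infinity>; the latter rules out q \<le> 0, since \<open>ennreal\<close> sends negative
  numbers to 0.\<close>

lemma exponent_pairI:
 assumes "2 <= p" "1 / p + 1 / ennreal q = 1"
 shows "exponent_pair p q"
proof -
 have q: "q > 0"
 proof (rule ccontr)
  assume "\<not> q > 0"
  then have "ennreal q = 0" by (simp add: ennreal_neg)
  then show False using assms(2) by (simp add: divide_ennreal_def)
 qed
 have 1: "1 / ennreal r = ennreal (1 / r)" if "r > 0" for r
  using divide_ennreal[of 1 r] that by simp
 show ?thesis
 proof
  show "q = 1" if "p = \<infinity>"
  proof -
   have "ennreal (1 / q) = ennreal 1" using assms(2) that 1[OF q] by simp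
   then have "1 / q = 1" using q by (subst (asm) ennreal_inj) auto
   then show ?thesis using q by simp
  qed
  show "1 / enn2real p + 1 / q = 1" if p: "p ~= \<infinity>"
  proof -
   have pr: "p = ennreal (enn2real p)" using p by (simp add: top.not_eq_extremum)
   have r: "enn2real p > 0"
   proof (rule ccontr)
    assume "\<not> enn2real p > 0"
    then have "p = 0" using pr by (metis enn2real_nonneg ennreal_0 less_eq_real_def)
    then show False using assms(1) by simp
   qed
   have "1 / p = ennreal (1 / enn2real p)" using 1[OF r] pr by simp
   then have "ennreal (1 / enn2real p + 1 / q) = ennreal 1"
    using assms(2) 1[OF q] r q by (simp add: ennreal_plus)
   then show ?thesis using r q by (subst (asm) ennreal_inj) (auto intro: add_nonneg_nonneg)
  qed
 qed (rule assms(1))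
qed

lemma norm_mi_pow_le: "\<bar>mi_pow s \<beta>\<bar> <= norm s ^ mi_abs \<beta>"
proof -
 have "\<bar>mi_pow s \<beta>\<bar> = (\<Prod>i\<in>UNIV. \<bar>s $ i\<bar> ^ \<beta> i)" by (simp add: mi_pow_def abs_prod power_abs)
 also have "... <= (\<Prod>i\<in>UNIV. norm s ^ \<beta> i)" by (intro prod_mono) (simp add: component_le_norm_cart power_mono)
 finally show ?thesis by (simp add: mi_abs_def power_sum)
qed

text \<open>The representation of averages by \<nu>, applied to a monomial. The condition [\<beta>]
  \<le> N keeps the monomial below the weight 1 + |s|^(N+1).\<close>

lemma op_coeff_eq:
 fixes \<nu> :: "(real ^ 'n) measure" and \<beta> :: "'n => nat"
 assumes repr: "\<And>G C. G \<in> borel_measurable borel ==> (\<And>s :: real ^ 'n. cmod (G s) <= C * (1 + norm s ^ (N + 1))) ==>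
   (LINT u:{0<..}|lebesgue. complex_of_real (w u / ball_vol TYPE('n) (h u)) * (LINT s:cball 0 (h u)|lborel. G s)) = (LINT s|\<nu>. G s)"
  and \<beta>: "mi_abs \<beta> <= N"
 shows "complex_of_real (op_coeff w h \<beta>) = (LINT s|\<nu>. complex_of_real (mi_pow s \<beta> / mi_fact \<beta>))"
proof -
 have [measurable]: "(%t :: real ^ 'n. mi_pow t \<beta>) \<in> borel_measurable borel" unfolding mi_pow_def by measurable
 have fact: "mi_fact \<beta> \<ge> 1" unfolding mi_fact_def by (rule prod_ge_1) simp
 have inner: "(LINT s:cball 0 \<rho>|lborel. complex_of_real (mi_pow s \<beta> / mi_fact \<beta>))
   = complex_of_real ((LINT t:cball 0 \<rho>|lebesgue. mi_pow t \<beta>) / mi_fact \<beta>)" for \<rho> and \<nu> :: "'n itself"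
 proof -
  have "(LINT t:cball (0 :: real ^ 'n) \<rho>|lebesgue. mi_pow t \<beta>) = (LINT t|lborel. indicator (cball 0 \<rho>) t *\<^sub>R mi_pow t \<beta>)"
   unfolding set_lebesgue_integral_def
   by (intro integral_completion borel_measurable_scaleR borel_measurable_indicator) (simp_all add: mi_pow_def)
  moreover have "(LINT s:cball 0 \<rho>|lborel. complex_of_real (mi_pow s \<beta> / mi_fact \<beta>))
   = (LINT s|lborel. complex_of_real ((indicator (cball 0 \<rho>) s *\<^sub>R mi_pow s \<beta>) / mi_fact \<beta>))"
   unfolding set_lebesgue_integral_def by (intro Bochner_Integration.integral_cong refl) (simp add: indicator_def)
  ultimately show ?thesis by (simp add: integral_complex_of_real del: of_real_divide)
 qed
 have "complex_of_real (op_coeff w h \<beta>) = (LINT u:{0<..}|lebesgue. complex_of_real (w u / (mi_fact \<beta> * ball_vol TYPE('n) (h u)) * (LINT t:cball (0 :: real ^ 'n) (h u)|lebesgue. mi_pow t \<beta>)))"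
  unfolding op_coeff_def set_lebesgue_integral_def
  by (subst integral_complex_of_real[symmetric], intro Bochner_Integration.integral_cong refl) (simp add: indicator_def)
 also have "... = (LINT u:{0<..}|lebesgue. complex_of_real (w u / ball_vol TYPE('n) (h u)) * (LINT s:cball 0 (h u)|lborel. complex_of_real (mi_pow s \<beta> / mi_fact \<beta>)))"
  unfolding inner of_real_mult[symmetric] by (simp add: field_simps)
 also have "... = (LINT s|\<nu>. complex_of_real (mi_pow s \<beta> / mi_fact \<beta>))"
 proof (rule repr[where C = 1])
  fix s :: "real ^ 'n"
  have "cmod (complex_of_real (mi_pow s \<beta> / mi_fact \<beta>)) = \<bar>mi_pow s \<beta>\<bar> / mi_fact \<beta>" using fact by (simp add: norm_divide)
  also have "... <= \<bar>mi_pow s \<beta>\<bar>" using fact by (simp add: divide_le_eq mult_le_cancel_left1)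
  also have "... <= norm s ^ mi_abs \<beta>" by (rule norm_mi_pow_le)
  also have "... <= 1 + norm s ^ (N + 1)"
  proof (cases "norm s <= 1")
   case True
   then have "norm s ^ mi_abs \<beta> <= 1" by (simp add: power_le_one)
   then show ?thesis by (simp add: add_increasing2)
  next
   case False
   then have "norm s ^ mi_abs \<beta> <= norm s ^ (N + 1)" using \<beta> by (intro power_increasing) auto
   then show ?thesis by linarith
  qed
  finally show "cmod (complex_of_real (mi_pow s \<beta> / mi_fact \<beta>)) <= 1 * (1 + norm s ^ (N + 1))" by simp
 qed measurable
 finally show ?thesis .
qed

text \<open>The distributional transform of \<phi> is identified either with the Fourier integral of
  a Borel representative or with the function that defines a member of \<open>class_B\<close>; the
  vanishing near nonzero lattice points then passes to it.\<close>

lemma (in exponent_pair) generator_synthesis: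
 fixes \<phi> phihat :: "real ^ 'n => complex"
 assumes \<phi>: "\<phi> \<in> script_Lp p \<or> (\<phi> \<in> class_B \<and> p ~= \<infinity>)" and ft: "has_fourier \<phi> phihat"
  and zero: "\<And>l. l ~= 0 ==> AE xi in lebesgue. norm (int_vec l - xi) < \<delta> --> phihat xi = 0"
 obtains \<phi>0 ph where "AE x in lebesgue. \<phi> x = \<phi>0 x" "AE xi in lborel. phihat xi = ph xi" "synthesis \<phi>0 ph p q \<delta>"
 using \<phi>
proof
 assume \<phi>: "\<phi> \<in> script_Lp p"
 obtain \<phi>0 D where \<phi>0: "\<phi>0 \<in> borel_measurable borel" "AE x in lebesgue. \<phi> x = \<phi>0 x" "integrable lborel \<phi>0" "D \<ge> 0"
  "p ~= \<infinity> ==> (\<integral>\<^sup>+x. ennreal (labs \<phi>0 x powr enn2real p) \<partial>torus) <= ennreal (D powr enn2real p)"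
  "p = \<infinity> ==> AE x in torus. labs \<phi>0 x <= D"
  by (rule script_Lp_generator[OF \<phi>]) blast
 let ?ph = "%xi. LINT x|lborel. \<phi>0 x * echar (- (x \<bullet> xi))"
 have m: "\<phi> \<in> borel_measurable lebesgue" using \<phi> by (simp add: script_Lp_def Lp_space_def)
 have eq: "AE xi in lborel. phihat xi = ?ph xi"
  using has_fourier_L1[OF ft \<phi>0(3,2) m] by (simp only: AE_completion_iff)
 interpret integrable_generator \<phi>0 p q \<delta> D
 proof
  fix l :: "int ^ 'n" assume "l ~= 0"
  from zero[OF this] have "AE xi in lborel. norm (int_vec l - xi) < \<delta> --> phihat xi = 0" by (simp only: AE_completion_iff)
  with eq show "AE xi in lborel. norm (int_vec l - xi) < \<delta> --> ?ph xi = 0" by eventually_elim simp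
 qed (use \<phi>0 p2 q_inf pq_fin in auto)
 show thesis
 proof (rule that[OF \<phi>0(2) _ synthesis])
  show "AE xi in lborel. phihat xi = ph xi" using eq by (simp add: ph_def)
 qed
next
 assume \<phi>: "\<phi> \<in> class_B \<and> p ~= \<infinity>"
 then have pf: "p ~= \<infinity>" by simp
 obtain th R B Cd where th: "periodization th R B" "\<phi> = ift th" "Cd \<ge> 0"
  "\<And>x. cmod (ift th x) <= Cd * (\<Prod>i\<in>UNIV. 1 / (1 + \<bar>x $ i\<bar>))"
  using class_B_generator \<phi> by blast
 have ti: "integrable lborel th" by (rule periodization.v_integrable[OF th(1)])
 have eq: "AE xi in lborel. phihat xi = th xi"
  using has_fourier_of_ift[OF ft[unfolded th(2)] ti] by (simp only: AE_completion_iff)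
 interpret band_limited th p q \<delta> R B Cd
 proof
  fix l :: "int ^ 'n" assume "l ~= 0"
  from zero[OF this] have "AE xi in lborel. norm (int_vec l - xi) < \<delta> --> phihat xi = 0" by (simp only: AE_completion_iff)
  with eq show "AE xi in lborel. norm (int_vec l - xi) < \<delta> --> th xi = 0" by eventually_elim simp
 qed (use th p_fin[OF pf] pq_fin[OF pf] pf in \<open>auto simp: periodization_def\<close>)
 show thesis by (rule that[OF _ eq synthesis]) (simp add: th(2))
qed

theorem theorem23:
  fixes M :: "real ^ 'n ^ 'n" and p :: ennreal and q :: real and N :: nat
    and h w :: "real \<Rightarrow> real" and f fhat \<phi> :: "real ^ 'n \<Rightarrow> complex"
    and \<epsilon> \<theta> :: real
  assumes M: "dilation_matrix M"
    and p: "of_nat CARD('n) < p" "2 \<le> p" "1 / p + 1 / ennreal q = 1"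
    and h: "\<And>u. u > 0 \<Longrightarrow> h u > 0"
    and w: "\<And>u. u > 0 \<Longrightarrow> w u \<ge> 0" "set_integrable lebesgue {0<..} w"
      "(LINT u:{0<..}|lebesgue. w u) = 1"
    and wh: "set_integrable lebesgue {0<..} (\<lambda>u. w u * (1 + h u ^ (N + 1)))"
    and \<phi>: "(\<phi> \<in> script_Lp p \<and>
               (\<exists>B>0. \<forall>\<xi>. (\<lambda>k. cmod (fourier \<phi> (\<xi> + int_vec k)) powr q) summable_on UNIV \<and>
                         (\<Sum>\<^sub>\<infinity>k. cmod (fourier \<phi> (\<xi> + int_vec k)) powr q) < B))
             \<or> (\<phi> \<in> class_B \<and> p \<noteq> \<infinity>)"
    and compat: "strictly_compatible (assoc_dist N (\<lambda>\<beta>. complex_of_real (op_coeff w h \<beta>))) \<phi>"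
    and f: "f \<in> Lp_space lebesgue p" "has_fourier f fhat" "fhat \<in> Lp_space lebesgue (ennreal q)"
    and \<epsilon>: "\<epsilon> > 0"
    and decay: "(\<lambda>\<xi>. cmod (fhat \<xi>))
                  \<in> O[at_infinity](\<lambda>\<xi>. norm \<xi> powr (- real N - 1 - real CARD('n) / q - \<epsilon>))"
    and \<theta>: "\<theta> > 0" "\<And>z. is_eigenvalue M z \<Longrightarrow> \<theta> < cmod z"
  shows "\<exists>C. \<forall>j.
           (AE x in lebesgue. quasi_proj_term M w h f \<phi> j x summable_on UNIV) \<and>
           (\<lambda>x. f x - quasi_proj M w h f \<phi> j x) \<in> Lp_space lebesgue p \<and>
           Lp_norm lebesgue p (\<lambda>x. f x - quasi_proj M w h f \<phi> j x)
             \<le> C * \<theta> powr (- (real j * (real N + 1)))"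
proof (rule averaging_measure[where 'n = 'n, OF h w wh])
 fix \<nu> :: "(real ^ 'n) measure"
 assume nu: "averaging \<nu> N"
  and repr: "\<And>G C. G \<in> borel_measurable borel ==> (\<And>s :: real ^ 'n. cmod (G s) <= C * (1 + norm s ^ (N + 1))) ==>
   (LINT u:{0<..}|lebesgue. complex_of_real (w u / ball_vol TYPE('n) (h u)) * (LINT s:cball 0 (h u)|lborel. G s)) = (LINT s|\<nu>. G s)"
 interpret exponent_pair p q by (rule exponent_pairI[OF p(2,3)])
 interpret expanding M \<theta> by standard (use \<theta> in auto)
 have dim: "real CARD('n) < enn2real p" if pf: "p ~= \<infinity>"
 proof -
  have "ennreal (real CARD('n)) < ennreal (enn2real p)"
   using p(1) p_fin(1)[OF pf] by (simp add: ennreal_of_nat_eq_real_of_nat)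
  then show ?thesis by (simp add: ennreal_less_iff)
 qed
 have p_pos: "p = \<infinity> \<or> enn2real p > 0" using p_fin(2) by force
 interpret averaging \<nu> N by (rule nu)
 let ?a = "%\<beta> :: 'n => nat. complex_of_real (op_coeff w h \<beta>)"
 have a_eq: "?a \<beta> = (LINT s|\<nu>. complex_of_real (mi_pow s \<beta> / mi_fact \<beta>))" if "mi_abs \<beta> <= N" for \<beta>
  by (rule op_coeff_eq[OF _ that]) (fact repr)
 obtain Ct where Ct: "Ct \<ge> 0" "\<And>eta. cmod (mu eta - dsymbol N ?a eta) <= Ct * norm eta ^ (N + 1)"
  using mu_taylor[of ?a, OF a_eq] by blast
 obtain That phihat \<delta> where T: "dist_is_fun (dist_fourier (assoc_dist N ?a)) That" and ft: "has_fourier \<phi> phihat"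
  and \<delta>: "0 < \<delta>" and one: "AE xi in lebesgue. norm xi < \<delta> --> cnj (phihat xi) * That xi = 1"
  and zero: "\<And>l. l ~= 0 ==> AE xi in lebesgue. norm (int_vec l - xi) < \<delta> --> phihat xi = 0"
  using compat unfolding strictly_compatible_def by blast
 have \<phi>': "\<phi> \<in> script_Lp p \<or> (\<phi> \<in> class_B \<and> p ~= \<infinity>)" using \<phi> by blast
 obtain \<phi>0 ph where \<phi>0: "AE x in lebesgue. \<phi> x = \<phi>0 x" and ph: "AE xi in lborel. phihat xi = ph xi"
  and syn: "synthesis \<phi>0 ph p q \<delta>"
  by (rule generator_synthesis[OF \<phi>' ft zero])
 interpret synthesis \<phi>0 ph p q \<delta> by (rule syn)
 interpret sampled_synthesis \<phi>0 ph p q \<delta> \<nu> N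
 proof
  obtain Bp where Bp: "\<And>eta. cmod (ph eta) <= Bp" using ph_bounded by blast
  have Bp0: "Bp \<ge> 0" using Bp norm_ge_zero order_trans by blast
  have "AE eta in lborel. That eta = cnj (dsymbol N ?a eta)" "AE xi in lborel. norm xi < \<delta> --> cnj (phihat xi) * That xi = 1"
   using assoc_dist_fourier[OF T] one by (simp_all only: AE_completion_iff)
  with ph have "AE eta in lborel. norm eta < \<delta> --> cmod (1 - mu eta * ph eta) <= (Bp * Ct) * norm eta ^ (N + 1)"
  proof eventually_elim
   fix eta assume *: "phihat eta = ph eta" "That eta = cnj (dsymbol N ?a eta)" "norm eta < \<delta> --> cnj (phihat eta) * That eta = 1"
   show "norm eta < \<delta> --> cmod (1 - mu eta * ph eta) <= (Bp * Ct) * norm eta ^ (N + 1)"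
   proof
    assume "norm eta < \<delta>"
    then have "cnj (ph eta * dsymbol N ?a eta) = cnj 1" using * by simp
    \<comment> \<open>Near 0 the transform \<open>ph\<close> inverts the symbol, so 1 - mu ph equals
      ph times the Taylor remainder of mu.\<close>
    then have "ph eta * dsymbol N ?a eta = 1" by (simp only: complex_cnj_cancel_iff)
    then have "1 - mu eta * ph eta = ph eta * (dsymbol N ?a eta - mu eta)" by (simp add: right_diff_distrib mult.commute)
    then have "cmod (1 - mu eta * ph eta) = cmod (ph eta) * cmod (mu eta - dsymbol N ?a eta)"
     by (simp add: norm_mult norm_minus_commute)
    also have "... <= Bp * (Ct * norm eta ^ (N + 1))" using Bp Ct Bp0 by (intro mult_mono) auto
    finally show "cmod (1 - mu eta * ph eta) <= (Bp * Ct) * norm eta ^ (N + 1)" by (simp add: mult.assoc)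
   qed
  qed
  then show "\<exists>C\<ge>0. AE eta in lborel. norm eta < \<delta> --> cmod (1 - mu eta * ph eta) <= C * norm eta ^ (N + 1)"
   using Bp0 Ct(1) by (intro exI[of _ "Bp * Ct"]) auto
 qed (use \<delta> dim in auto)
 have fhm: "fhat \<in> borel_measurable lebesgue" using f(3) by (simp add: Lp_space_def)
 obtain fh where fh [measurable]: "fh \<in> borel_measurable borel" and fheq: "AE x in lebesgue. fhat x = fh x"
  by (rule borel_version[OF fhm])
 have fheq': "AE x in lborel. fhat x = fh x" using fheq by (simp only: AE_completion_iff)
 have fq: "(\<integral>\<^sup>+xi. ennreal (cmod (fh xi) powr q) \<partial>lborel) < \<infinity>"
 proof -
  have i: "integrable lebesgue (%x. cmod (fhat x) powr q)" using f(3) q1 by (simp add: Lp_space_def)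
  have "(\<integral>\<^sup>+xi. ennreal (cmod (fh xi) powr q) \<partial>lborel) = (\<integral>\<^sup>+xi. ennreal (cmod (fh xi) powr q) \<partial>lebesgue)"
   by (rule nn_integral_completion[symmetric])
  also have "... = (\<integral>\<^sup>+xi. ennreal (cmod (fhat xi) powr q) \<partial>lebesgue)"
   by (rule nn_integral_cong_AE) (use fheq in \<open>auto elim: eventually_mono\<close>)
  also have "... < \<infinity>" using i by (simp add: integrable_iff_bounded)
  finally show ?thesis .
 qed
 obtain c where "eventually (%xi. cmod (fhat xi) <= c * norm xi powr (- real N - 1 - real CARD('n) / q - \<epsilon>)) at_infinity"
  using decay by (auto elim!: landau_o.bigE)
 then obtain R where R: "\<And>xi. R <= norm xi ==> cmod (fhat xi) <= c * norm xi powr (- real N - 1 - real CARD('n) / q - \<epsilon>)"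
  by (auto simp: eventually_at_infinity)
 have dec: "AE xi in lborel. norm xi \<ge> R --> cmod (fh xi) <= c * norm xi powr (- real N - 1 - real CARD('n) / q - \<epsilon>)"
  using fheq' by (rule eventually_mono) (metis R)
 let ?W = "%xi :: real ^ 'n. (1 + norm xi) ^ (N + 1)"
 \<comment> \<open>The norm of the spectrum with the inhomogeneous weight. It dominates both the
   plain and the homogeneous norm, so a single number independent of j enters all estimates.\<close>
 define A where "A = enn2real (\<integral>\<^sup>+xi. ennreal ((cmod (fh xi) * ?W xi) powr q) \<partial>lborel) powr (1 / q)"
 have A0: "A \<ge> 0" by (simp add: A_def)
 have Aw: "(\<integral>\<^sup>+xi. ennreal ((cmod (fh xi) * ?W xi) powr q) \<partial>lborel) <= ennreal (A powr q)"
  using weighted_decay[OF fh q1 \<epsilon> fq dec] q1 by (simp add: A_def powr_powr)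
 have weight_le: "(\<integral>\<^sup>+xi. ennreal ((cmod (fh xi) * V xi) powr q) \<partial>lborel) <= ennreal (A powr q)"
  if V: "\<And>xi. 0 <= V xi" "\<And>xi. V xi <= ?W xi" for V
  by (rule order_trans[OF nn_integral_mono Aw])
    (use V q1 in \<open>auto intro!: ennreal_leI powr_mono2 mult_left_mono mult_nonneg_nonneg simp del: power_Suc\<close>)
 have fhi: "integrable lborel fh"
  using PN_le_weighted[OF dim, of N] fh A0 Aw by (auto simp: PN_le_def)
 have f_eq: "AE x in lebesgue. f x = ift fh x"
  by (rule has_fourier_ift[OF f(2) Lp_space_gauss_integrable[OF f(1)] fhi fheq])
 obtain C0 where C0: "C0 \<ge> 0" "\<And>n x. norm (transpose (mat_pow (matrix_inv M) n) *v x) <= C0 * (1 / \<theta>) ^ n * norm x"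
  using inv_pow_transpose_bound by blast
 obtain C where C: "C \<ge> 0" "\<And>(g :: real ^ 'n => complex) A A'. g \<in> borel_measurable borel ==> integrable lborel g ==> A \<ge> 0 ==> A' \<ge> 0 ==>
   (\<integral>\<^sup>+eta. ennreal (cmod (g eta) powr q) \<partial>lborel) <= ennreal (A' powr q) ==>
   (\<integral>\<^sup>+eta. ennreal ((cmod (g eta) * norm eta ^ (N + 1)) powr q) \<partial>lborel) <= ennreal (A powr q) ==>
   (AE x in lborel. integrable lat (%k. coef (%eta. g eta * mu eta) k * \<phi>0 (x + int_vec k))) \<and>
   Lp_le p (%x. ift g x - (LINT k|lat. coef (%eta. g eta * mu eta) k * \<phi>0 (x + int_vec k))) (C * A)"
  using error_level_zero by blast
 show ?thesis
 proof (intro exI[of _ "C * (C0 ^ (N + 1) * A)"] allI)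
  fix j
  define P where "P = mat_pow M j"
  define Q where "Q = mat_pow (matrix_inv M) j"
  define g where "g = (%eta. of_real \<bar>det P\<bar> * fh (transpose P *v eta))"
  interpret rescaled P Q fh g
   by standard (simp_all add: P_def Q_def mat_pow_inv fhi g_def)
  let ?c = "(C0 * (1 / \<theta>) ^ j) ^ (N + 1)"
  let ?d = "\<bar>det P\<bar> powr (1 - 1 / q)"
  have c0: "?c \<ge> 0" using C0(1) \<theta>(1) by simp
  have g1: "(\<integral>\<^sup>+eta. ennreal (cmod (g eta) powr q) \<partial>lborel) <= ennreal ((?d * (1 * A)) powr q)"
   using g_weighted[OF q1, of "%_. 1" 1 A] A0 weight_le[of "%_. 1"] by (simp add: one_le_power del: power_Suc)
  \<comment> \<open>The homogeneous weight grows at most by \<open>?c\<close> under the transposed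
    inverse power; the rate in j originates here.\<close>
  have gN: "(\<integral>\<^sup>+eta. ennreal ((cmod (g eta) * norm eta ^ (N + 1)) powr q) \<partial>lborel) <= ennreal ((?d * (?c * A)) powr q)"
  proof (rule g_weighted[OF q1])
   show "norm (transpose Q *v xi) ^ (N + 1) <= ?c * norm xi ^ (N + 1)" for xi
    unfolding power_mult_distrib[symmetric, where b = "norm xi"] by (rule power_mono) (use C0(2) in \<open>auto simp only: Q_def norm_ge_zero\<close>)
   show "(\<integral>\<^sup>+xi. ennreal ((cmod (fh xi) * norm xi ^ (N + 1)) powr q) \<partial>lborel) <= ennreal (A powr q)"
    by (rule weight_le) (auto intro!: power_mono simp del: power_Suc)
  qed (use c0 A0 in auto)
  let ?b = "%k. coef (%eta. g eta * mu eta) k"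
  have E: "AE x in lborel. integrable lat (%k. ?b k * \<phi>0 (x + int_vec k))"
   "Lp_le p (%x. ift g x - (LINT k|lat. ?b k * \<phi>0 (x + int_vec k))) (C * (?d * (?c * A)))"
   using C(2)[OF g_measurable g_int _ _ g1 gN] c0 A0 by simp_all
  \<comment> \<open>The determinant factor from passing to g and the one from the change of
    variables back are reciprocal.\<close>
  have "\<bar>det P\<bar> powr - (1 - 1 / q) * (C * (?d * (?c * A))) = C * (?c * A)"
  proof -
   have "\<bar>det P\<bar> powr - (1 - 1 / q) * ?d = 1" using det_P by (simp flip: powr_add)
   moreover have "\<bar>det P\<bar> powr - (1 - 1 / q) * (C * (?d * (?c * A))) = (\<bar>det P\<bar> powr - (1 - 1 / q) * ?d) * (C * (?c * A))"
    by (simp only: mult_ac)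
   ultimately show ?thesis by simp
  qed
  then have Ej: "Lp_le p (%x. ift g (P *v x) - (LINT k|lat. ?b k * \<phi>0 (P *v x + int_vec k))) (C * (?c * A))"
   using Lp_le_matrix[OF det_P E(2)] by (simp only:)
  have sample: "sample_avg M w h j f (- (mat_pow (matrix_inv M) j *v int_vec k)) = ?b k" for k
   by (rule sample_avg_eq_coef[OF expanding_axioms nu _ _ f_eq])
     (fact repr, use rescaled_axioms in \<open>simp add: P_def Q_def\<close>)
  \<comment> \<open>The lattice is countable, so for almost every x the generator and its
    representative agree on the whole coset at once.\<close>
  have \<phi>k: "AE x in lborel. \<forall>k. \<phi> (x + int_vec k) = \<phi>0 (x + int_vec k)"
   unfolding AE_all_countable using AE_lborel_translate[OF \<phi>0[unfolded AE_completion_iff]] by simp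
  have "AE x in lebesgue. integrable lat (%k. ?b k * \<phi>0 (P *v x + int_vec k))"
   "AE x in lebesgue. \<forall>k. \<phi> (P *v x + int_vec k) = \<phi>0 (P *v x + int_vec k)"
   using AE_lborel_matrix[OF det_P E(1)] AE_lborel_matrix[OF det_P \<phi>k] by (simp_all only: AE_completion_iff)
  with f_eq have main: "AE x in lebesgue. quasi_proj_term M w h f \<phi> j x summable_on UNIV \<and>
    f x - quasi_proj M w h f \<phi> j x = ift g (P *v x) - (LINT k|lat. ?b k * \<phi>0 (P *v x + int_vec k))"
  proof eventually_elim
   fix x assume i: "integrable lat (%k. ?b k * \<phi>0 (P *v x + int_vec k))"
    and e: "\<forall>k. \<phi> (P *v x + int_vec k) = \<phi>0 (P *v x + int_vec k)" and fx: "f x = ift fh x"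
   let ?s = "complex_of_real (\<bar>det M\<bar> powr (real j / 2))"
   have t: "quasi_proj_term M w h f \<phi> j x = (%k. ?s * (?b k * \<phi>0 (P *v x + int_vec k)))"
    using e by (simp add: fun_eq_iff quasi_proj_term_def scaled_shift_def sample P_def[symmetric] mult_ac)
   have it: "integrable lat (quasi_proj_term M w h f \<phi> j x)" unfolding t by (rule integrable_mult_right[OF i])
   \<comment> \<open>The normalization m^(-j/2) of the operator cancels the factor m^(j/2) in the
     dilated generator.\<close>
   have sc: "complex_of_real (\<bar>det M\<bar> powr (- (real j / 2))) * ?s = 1"
    using det_nz by (simp flip: powr_add of_real_mult)
   have "quasi_proj M w h f \<phi> j x = (LINT k|lat. ?b k * \<phi>0 (P *v x + int_vec k))"
    unfolding quasi_proj_def lat_summable(2)[OF it]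
    unfolding t integral_mult_right_zero mult.assoc[symmetric, of _ ?s] sc by simp
   moreover have "f x = ift g (P *v x)" unfolding fx ift_g[symmetric] by simp
   ultimately show "quasi_proj_term M w h f \<phi> j x summable_on UNIV \<and>
    f x - quasi_proj M w h f \<phi> j x = ift g (P *v x) - (LINT k|lat. ?b k * \<phi>0 (P *v x + int_vec k))"
    using lat_summable(1)[OF it] by simp
  qed
  then have eq: "AE x in lebesgue. f x - quasi_proj M w h f \<phi> j x = ift g (P *v x) - (LINT k|lat. ?b k * \<phi>0 (P *v x + int_vec k))"
   by (rule eventually_mono) simp
  have rate: "C * (?c * A) = C * (C0 ^ (N + 1) * A) * \<theta> powr (- (real j * (real N + 1)))"
  proof -
   have "\<theta> powr (- (real j * (real N + 1))) = ((1 / \<theta>) ^ j) ^ (N + 1)"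
   proof -
    have "\<theta> powr (- (real j * (real N + 1))) = \<theta> powr - real (j * (N + 1))" by (simp add: algebra_simps)
    also have "... = 1 / \<theta> ^ (j * (N + 1))" using \<theta>(1) by (simp only: powr_minus_divide powr_realpow)
    finally show ?thesis by (simp only: power_one_over power_mult)
   qed
   then show ?thesis by (simp only: power_mult_distrib mult_ac)
  qed
  show "(AE x in lebesgue. quasi_proj_term M w h f \<phi> j x summable_on UNIV) \<and>
      (%x. f x - quasi_proj M w h f \<phi> j x) \<in> Lp_space lebesgue p \<and>
      Lp_norm lebesgue p (%x. f x - quasi_proj M w h f \<phi> j x)
       <= C * (C0 ^ (N + 1) * A) * \<theta> powr (- (real j * (real N + 1)))"
   using main Lp_le_lebesgue[OF Ej eq p_pos] unfolding rate by (auto elim: eventually_mono)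
 qed
qed

end
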